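(* Let $h\in L^2[-1,0]$ be such that $\int_{-1}^0 h(y)\,\mathrm{d}y=0$. Then for every $u\in L^2_{\rm loc}[0,\infty)$, $\zeta_0\in H_{1/2}$ and $w_0\in H$, there exists a unique solution $(\phi,\zeta)$ of the water wave system (WW) (in the sense defined in the context) with $\zeta(0)=\zeta_0$ and $\dot\zeta(0)=w_0$. Moreover, there exists a well-posed linear control system $(\mathbb{T},\Phi)$ with state space $X=H_{1/2}\times H$ and input space $U=\mathbb{C}$ such that, for all such $u,\zeta_0,w_0$, setting $z_0=\begin{bmatrix}\zeta_0\\ w_0\end{bmatrix}$ and $z(t)=\begin{bmatrix}\zeta(t,\cdot)\\ \dot\zeta(t,\cdot)\end{bmatrix}$, where $(\phi,\zeta)$ is the corresponding solution, we have $$z(\tau)=\mathbb{T}_\tau z_0+\Phi_\tau u\qquad\text{for all }\tau\geq 0 .$$ Finally, the generator $A$ of $\mathbb{T}$ is skew-adjoint, with domain $\mathcal{D}(A)=H_1\times H_{1/2}$, and there exists a bounded linear operator $B\in\mathcal{L}(\mathbb{C},X)$ such that for any $\tau\geq0$, $$\Phi_\tau u=\int_0^\tau \mathbb{T}_{\tau-\sigma}Bu(\sigma)\,\mathrm{d}\sigma\qquad\text{for all }u\in L^2_{\rm loc}[0,\infty).$$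
   Context: All function spaces are complex-valued. $\Omega=(0,\pi)\times(-1,0)$, and $\mathcal{H}^1(\Omega)$ is the usual Sobolev space; boundary values of functions in $\mathcal{H}^1(\Omega)$ are Dirichlet traces. $H=\{\eta\in L^2[0,\pi] : \int_0^\pi\eta(x)\,\mathrm{d}x=0\}$ with the $L^2$ inner product; $\varphi_k(x)=\sqrt{2/\pi}\cos(kx)$, $k\in\mathbb{N}=\{1,2,\dots\}$, is an orthonormal basis of $H$. For $\eta\in H$ put $\eta_k=\langle\eta,\varphi_k\rangle$. For $\alpha\ge0$, $H_\alpha=\{\eta\in H:\sum_{k\geq1}k^{2\alpha}|\eta_k|^2<\infty\}$, with inner product $\langle\eta,\psi\rangle_\alpha=\sum_{k\ge1}k^{2\alpha}\eta_k\overline{\psi_k}$ (so $H_0=H$), except that $H_{1/2}$ is equipped with the equivalent inner product $\langle\eta,\psi\rangle_{1/2}=\sum_{k\geq1}k\tanh(k)\,\eta_k\overline{\psi_k}$. Water wave system (WW): for $t\ge0$, $$\Delta\phi(t,x,y)=0\ ((x,y)\in\Omega),\quad \phi(t,x,0)+\zeta(t,x)=0,\quad \tfrac{\partial\phi}{\partial y}(t,x,0)=\ddot\zeta(t,x)\ (x\in(0,\pi)),$$ $$\tfrac{\partial\phi}{\partial x}(t,0,y)=-h(y)u(t)\ (y\in(-1,0)),\quad \tfrac{\partial\phi}{\partial y}(t,x,-1)=0=\tfrac{\partial\phi}{\partial x}(t,\pi,y)\ ((x,y)\in\Omega).$$ Definition of solution: given $u\in L^2_{\rm loc}[0,\infty)$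 and $h\in L^2[-1,0]$ with $\int_{-1}^0h(y)\,\mathrm{d}y=0$, a couple $(\phi,\zeta)$ is a solution of (WW) if $\phi\in L^2_{\rm loc}([0,\infty);\mathcal{H}^1(\Omega))$, $\zeta\in C([0,\infty);H_{1/2})\cap C^1([0,\infty);H)$, $\phi(t,\cdot,0)+\zeta(t,\cdot)=0$ as an equality in $L^2_{\rm loc}([0,\infty);L^2[0,\pi])$, and for every $\Psi\in\mathcal{H}^1(\Omega)$ and every $t>0$, $$\int_0^\pi\dot\zeta(t,x)\overline{\Psi(x,0)}\,\mathrm{d}x-\int_0^\pi\dot\zeta(0,x)\overline{\Psi(x,0)}\,\mathrm{d}x=\int_0^t\!\!\int_\Omega\nabla\phi(\sigma,x,y)\cdot\overline{\nabla\Psi(x,y)}\,\mathrm{d}x\,\mathrm{d}y\,\mathrm{d}\sigma-\int_0^tu(\sigma)\int_{-1}^0h(y)\overline{\Psi(0,y)}\,\mathrm{d}y\,\mathrm{d}\sigma.$$ Well-posed linear control system: let $U,X$ be Hilbert spaces. For $u,v$ defined on $[0,\infty)$ and $\tau\ge0$, the $\tau$-concatenation $u\diamond_\tau v$ equals $u(t)$ for $t\in[0,\tau)$ and $v(t-\tau)$ for $t\ge\tau$. A well-posed linear control system with state space $X$ and input space $U$ is a couple $(\mathbb{T},\Phi)$ where $\mathbb{T}=(\mathbb{T}_t)_{t\ge0}$ is a $C_0$-semigroup on $X$ and $\Phi=(\Phi_t)_{t\ge0}$ is a family of bounded linear operators from $L^2([0,\infty);U)$ to $X$ such that $\Phi_{\tau+t}(u\diamond_\tau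 v)=\mathbb{T}_t\Phi_\tau u+\Phi_tv$ for all $u,v\in L^2([0,\infty);U)$ and $t,\tau\ge0$. It follows that $\Phi_\tau u$ depends only on the restriction of $u$ to $[0,\tau]$, so $\Phi_\tau$ extends naturally to $L^2_{\rm loc}([0,\infty);U)$. *)

theory Defs
  imports "HOL-Analysis.Analysis"
begin

section \<open>Complex Hilbert spaces and the space \<open>L\<^sup>2\<close>\<close>

text \<open>Complex Hilbert spaces. The complex inner product is linear in its first argument; the
  underlying real inner product (hence norm and topology) is its real part.\<close>

class complex_hilbert = real_inner + complete_space +
  fixes scaleC :: "complex \<Rightarrow> 'a \<Rightarrow> 'a" (infixr "*\<^sub>C" 75)
    and cinner :: "'a \<Rightarrow> 'a \<Rightarrow> complex"
  assumes scaleC_add_right: "c *\<^sub>C (x + y) = c *\<^sub>C x + c *\<^sub>C y"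
    and scaleC_add_left: "(c + d) *\<^sub>C x = c *\<^sub>C x + d *\<^sub>C x"
    and scaleC_scaleC: "c *\<^sub>C d *\<^sub>C x = (c * d) *\<^sub>C x"
    and scaleR_scaleC: "r *\<^sub>R x = complex_of_real r *\<^sub>C x"
    and cinner_commute: "cinner x y = cnj (cinner y x)"
    and cinner_add_left: "cinner (x + y) z = cinner x z + cinner y z"
    and cinner_scaleC_left: "cinner (c *\<^sub>C x) y = c * cinner x y"
    and inner_Re_cinner: "inner x y = Re (cinner x y)"

subclass (in complex_hilbert) banach ..

lemma cinner_scaleC_right: "cinner x (c *\<^sub>C y) = cnj c * cinner x (y::'a::complex_hilbert)"
  by (metis cinner_commute cinner_scaleC_left complex_cnj_cnj complex_cnj_mult)

lemma cinner_add_right: "cinner x (y + z) = cinner x y + cinner x (z::'a::complex_hilbert)"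
  by (metis cinner_commute cinner_add_left complex_cnj_add)

lemma cinner_self: "cinner x x = complex_of_real ((norm (x::'a::complex_hilbert))\<^sup>2)"
proof -
  have "Im (cinner x x) = 0" 
    using cinner_commute[of x x] by (metis Im_complex_of_real Reals_cases Reals_cnj_iff)
  moreover have "Re (cinner x x) = (norm x)\<^sup>2"
    by (simp add: inner_Re_cinner[symmetric] power2_norm_eq_inner)
  ultimately show ?thesis by (simp add: complex_eq_iff)
qed

instantiation complex :: complex_hilbert
begin
definition scaleC_complex :: "complex \<Rightarrow> complex \<Rightarrow> complex" where "scaleC_complex c x = c * x"
definition cinner_complex :: "complex \<Rightarrow> complex \<Rightarrow> complex" where "cinner_complex x y = x * cnj y"
instance
  by standard (auto simp: scaleC_complex_def cinner_complex_def algebra_simps scaleR_conv_of_real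
      inner_complex_def)
end

instantiation prod :: (complex_hilbert, complex_hilbert) complex_hilbert
begin
definition scaleC_prod :: "complex \<Rightarrow> 'a \<times> 'b \<Rightarrow> 'a \<times> 'b" where
  "scaleC_prod c x = (c *\<^sub>C fst x, c *\<^sub>C snd x)"
definition cinner_prod :: "'a \<times> 'b \<Rightarrow> 'a \<times> 'b \<Rightarrow> complex" where
  "cinner_prod x y = cinner (fst x) (fst y) + cinner (snd x) (snd y)"
instance
proof
  fix x y z :: "'a \<times> 'b" and c
  show "cinner x y = cnj (cinner y x)"
    unfolding cinner_prod_def complex_cnj_add by (metis cinner_commute)
qed (auto simp: scaleC_prod_def cinner_prod_def scaleC_add_left scaleC_add_right scaleC_scaleC
      scaleR_scaleC scaleR_prod_def cinner_add_left cinner_scaleC_left algebra_simps inner_prod_def inner_Re_cinner)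
end

text \<open>The square integrable functions on \<open>S\<close>, before identifying functions that agree almost
  everywhere. Strong and Borel measurability coincide here, since all value spaces used are separable.\<close>

definition sqint :: "'a::euclidean_space set \<Rightarrow> ('a \<Rightarrow> 'b::real_normed_vector) set" where
  "sqint S = {f. set_borel_measurable lborel S f \<and> set_integrable lborel S (\<lambda>x. (norm (f x))\<^sup>2)}"

lemma sqint_UNIV:
  "f \<in> sqint UNIV \<longleftrightarrow> f \<in> borel_measurable lborel \<and> integrable lborel (\<lambda>x. (norm (f x))\<^sup>2)"
  by (simp add: sqint_def set_borel_measurable_def set_integrable_def)

lemma indicator_in_sqint: 
  "(\<lambda>x. indicator S x *\<^sub>R f x) \<in> sqint UNIV \<longleftrightarrow> f \<in> sqint S"
proof -
  have "(norm (indicat_real S x *\<^sub>R f x))\<^sup>2 = indicat_real S x *\<^sub>R (norm (f x))\<^sup>2" for x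
    by (simp add: indicator_def)
  then show ?thesis by (simp add: sqint_UNIV sqint_def set_borel_measurable_def set_integrable_def)
qed

lemma sqint_mult:
  fixes f g :: "'a::euclidean_space \<Rightarrow> complex"
  assumes "f \<in> sqint UNIV" "g \<in> sqint UNIV"
  shows "integrable lborel (\<lambda>x. f x * cnj (g x))"
proof (rule Bochner_Integration.integrable_bound)
  show "integrable lborel (\<lambda>x. (norm (f x))\<^sup>2 + (norm (g x))\<^sup>2)"
    using assms by (simp add: sqint_UNIV)
  show "(\<lambda>x. f x * cnj (g x)) \<in> borel_measurable lborel"
  proof -
    have [measurable]: "f \<in> borel_measurable lborel" "g \<in> borel_measurable lborel"
      using assms by (auto simp: sqint_UNIV)
    have "cnj \<in> borel_measurable borel"
      by (intro borel_measurable_continuous_onI continuous_intros)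
    note [measurable] = this
    show ?thesis by measurable
  qed
  have "norm (f x * cnj (g x)) \<le> norm ((norm (f x))\<^sup>2 + (norm (g x))\<^sup>2)" for x
  proof -
    have "0 \<le> norm (f x) * norm (g x)" by simp
    then have "norm (f x) * norm (g x) \<le> (norm (f x))\<^sup>2 + (norm (g x))\<^sup>2"
      using sum_squares_bound[of "norm (f x)" "norm (g x)"] by linarith
    then show ?thesis by (simp add: norm_mult)
  qed
  then show "AE x in lborel. norm (f x * cnj (g x)) \<le> norm ((norm (f x))\<^sup>2 + (norm (g x))\<^sup>2)"
    by simp
qed

lemma sqint_add:
  fixes f g :: "'a::euclidean_space \<Rightarrow> complex"
  assumes "f \<in> sqint UNIV" "g \<in> sqint UNIV"
  shows "(\<lambda>x. f x + g x) \<in> sqint UNIV"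
proof -
  have [measurable]: "f \<in> borel_measurable lborel" "g \<in> borel_measurable lborel"
    using assms by (auto simp: sqint_UNIV)
  have "integrable lborel (\<lambda>x. (norm (f x + g x))\<^sup>2)"
  proof (rule Bochner_Integration.integrable_bound)
    show "integrable lborel (\<lambda>x. 2 * (norm (f x))\<^sup>2 + 2 * (norm (g x))\<^sup>2)"
      using assms by (simp add: sqint_UNIV)
    have "(norm (f x + g x))\<^sup>2 \<le> 2 * (norm (f x))\<^sup>2 + 2 * (norm (g x))\<^sup>2" for x
    proof -
      have "(norm (f x + g x))\<^sup>2 \<le> (norm (f x) + norm (g x))\<^sup>2"
        by (intro power_mono norm_triangle_ineq) auto
      also have "\<dots> \<le> 2 * (norm (f x))\<^sup>2 + 2 * (norm (g x))\<^sup>2"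
        using sum_squares_bound[of "norm (f x)" "norm (g x)"] by (simp add: power2_sum)
      finally show ?thesis .
    qed
    then show "AE x in lborel. norm ((norm (f x + g x))\<^sup>2) \<le> norm (2 * (norm (f x))\<^sup>2 + 2 * (norm (g x))\<^sup>2)"
      by auto
  qed measurable
  then show ?thesis by (simp add: sqint_UNIV)
qed

lemma sqint_scale:
  fixes f :: "'a::euclidean_space \<Rightarrow> complex"
  assumes "f \<in> sqint UNIV"
  shows "(\<lambda>x. c * f x) \<in> sqint UNIV"
  using assms by (auto simp: sqint_UNIV norm_mult power_mult_distrib)

text \<open>The Hilbert space \<open>L\<^sup>2\<close> over a Euclidean space, complex-valued, as a type of classes of
  functions modulo equality almost everywhere; \<open>rep_L2 f\<close> is an arbitrarily chosen representative.
  For a Borel set \<open>S\<close>, the space \<open>L\<^sup>2(S)\<close> is identified with the closed subspace \<open>L2_on S\<close> (below) of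
  the elements that vanish outside \<open>S\<close>, i.e. functions on \<open>S\<close> are extended by zero. Under this
  identification the inner product \<open>cinner\<close> is the integral over \<open>S\<close>.\<close>

definition L2_eq :: "('a::euclidean_space \<Rightarrow> complex) \<Rightarrow> ('a \<Rightarrow> complex) \<Rightarrow> bool" where
  "L2_eq f g \<longleftrightarrow> f \<in> sqint UNIV \<and> g \<in> sqint UNIV \<and> (AE x in lborel. f x = g x)"

quotient_type (overloaded) 'a L2 = "'a::euclidean_space \<Rightarrow> complex" / partial: L2_eq
proof (rule part_equivpI)
  show "\<exists>x. L2_eq x x"
    by (rule exI[of _ "\<lambda>_. 0"]) (auto simp: L2_eq_def sqint_UNIV)
  show "symp L2_eq" by (auto simp: symp_def L2_eq_def)
  show "transp L2_eq" by (rule transpI) (auto simp: L2_eq_def)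
qed

lemma rep_L2_sqint: "rep_L2 f \<in> sqint UNIV"
  using Quotient_rep_reflp[OF Quotient_L2, of f] by (simp add: L2_eq_def)

lemma rep_L2_measurable [measurable]: "rep_L2 f \<in> borel_measurable borel"
  using rep_L2_sqint[of f] by (simp add: sqint_UNIV)

lemma rep_L2_integrable: "integrable lborel (\<lambda>x. (norm (rep_L2 f x))\<^sup>2)"
  using rep_L2_sqint[of f] by (simp add: sqint_UNIV)

lemma rep_abs_L2: "f \<in> sqint UNIV \<Longrightarrow> AE x in lborel. rep_L2 (abs_L2 f) x = f x"
proof -
  assume "f \<in> sqint UNIV"
  then have "L2_eq f f" by (simp add: L2_eq_def)
  then have "L2_eq (rep_L2 (abs_L2 f)) f"
    by (rule Quotient_rep_abs[OF Quotient_L2])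
  then show ?thesis by (simp add: L2_eq_def)
qed

lemma L2_eqI: "AE x in lborel. rep_L2 f x = rep_L2 g x \<Longrightarrow> f = g"
  using Quotient_rel_rep[OF Quotient_L2, of f g] rep_L2_sqint[of f] rep_L2_sqint[of g]
  by (simp add: L2_eq_def)

lemma abs_L2_eqI: 
  "f \<in> sqint UNIV \<Longrightarrow> g \<in> sqint UNIV \<Longrightarrow> AE x in lborel. f x = g x \<Longrightarrow> abs_L2 f = abs_L2 g"
  using Quotient_rel[OF Quotient_L2, of f g] by (auto simp: L2_eq_def)

instantiation L2 :: (euclidean_space) real_vector
begin
definition zero_L2 :: "'a L2" where "zero_L2 = abs_L2 (\<lambda>_. 0)"
definition plus_L2 :: "'a L2 \<Rightarrow> 'a L2 \<Rightarrow> 'a L2" where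
  "plus_L2 f g = abs_L2 (\<lambda>x. rep_L2 f x + rep_L2 g x)"
definition uminus_L2 :: "'a L2 \<Rightarrow> 'a L2" where
  "uminus_L2 f = abs_L2 (\<lambda>x. - rep_L2 f x)"
definition minus_L2 :: "'a L2 \<Rightarrow> 'a L2 \<Rightarrow> 'a L2" where
  "minus_L2 f g = abs_L2 (\<lambda>x. rep_L2 f x - rep_L2 g x)"
definition scaleR_L2 :: "real \<Rightarrow> 'a L2 \<Rightarrow> 'a L2" where
  "scaleR_L2 r f = abs_L2 (\<lambda>x. of_real r * rep_L2 f x)"

lemma rep_zero_L2: "AE x in lborel. rep_L2 (0::'a L2) x = 0"
  unfolding zero_L2_def by (rule rep_abs_L2) (simp add: sqint_UNIV)
lemma rep_plus_L2: "AE x in lborel. rep_L2 (f + g :: 'a L2) x = rep_L2 f x + rep_L2 g x"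
  unfolding plus_L2_def by (rule rep_abs_L2) (intro sqint_add rep_L2_sqint)
lemma rep_uminus_L2: "AE x in lborel. rep_L2 (- f :: 'a L2) x = - rep_L2 f x"
  unfolding uminus_L2_def by (rule rep_abs_L2) (use sqint_scale[OF rep_L2_sqint, of "-1" f] in simp)
lemma rep_minus_L2: "AE x in lborel. rep_L2 (f - g :: 'a L2) x = rep_L2 f x - rep_L2 g x"
  unfolding minus_L2_def 
  by (rule rep_abs_L2) (use sqint_add[OF rep_L2_sqint sqint_scale[OF rep_L2_sqint, of "-1"], of f g] in simp)
lemma rep_scaleR_L2: "AE x in lborel. rep_L2 (r *\<^sub>R f :: 'a L2) x = of_real r * rep_L2 f x"
  unfolding scaleR_L2_def by (rule rep_abs_L2) (intro sqint_scale rep_L2_sqint)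

instance
proof
  fix f g h :: "'a L2" and r s :: real
  show "f + g + h = f + (g + h)"
    by (rule L2_eqI)
      (use rep_plus_L2[of f g] rep_plus_L2[of g h] rep_plus_L2[of "f+g" h] rep_plus_L2[of f "g+h"] in eventually_elim, simp)
  show "f + g = g + f"
    by (rule L2_eqI)
      (use rep_plus_L2[of f g] rep_plus_L2[of g f] in eventually_elim, simp)
  show "0 + f = f"
    by (rule L2_eqI) (use rep_plus_L2[of 0 f] rep_zero_L2 in eventually_elim, simp)
  show "- f + f = 0"
    by (rule L2_eqI) (use rep_plus_L2[of "-f" f] rep_uminus_L2[of f] rep_zero_L2 in eventually_elim, simp)
  show "f - g = f + - g"
    by (rule L2_eqI) (use rep_plus_L2[of f "-g"] rep_uminus_L2[of g] rep_minus_L2[of f g] in eventually_elim, simp)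
  show "r *\<^sub>R (f + g) = r *\<^sub>R f + r *\<^sub>R g"
    by (rule L2_eqI) (use rep_plus_L2[of "r *\<^sub>R f" "r *\<^sub>R g"] rep_plus_L2[of f g] rep_scaleR_L2[of r f]
      rep_scaleR_L2[of r g] rep_scaleR_L2[of r "f+g"] in eventually_elim, simp add: algebra_simps)
  show "(r + s) *\<^sub>R f = r *\<^sub>R f + s *\<^sub>R f"
    by (rule L2_eqI) (use rep_plus_L2[of "r *\<^sub>R f" "s *\<^sub>R f"] rep_scaleR_L2[of r f]
      rep_scaleR_L2[of s f] rep_scaleR_L2[of "r+s" f] in eventually_elim, simp add: algebra_simps)
  show "r *\<^sub>R s *\<^sub>R f = (r * s) *\<^sub>R f"
    by (rule L2_eqI) (use rep_scaleR_L2[of r "s *\<^sub>R f"] rep_scaleR_L2[of s f]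
      rep_scaleR_L2[of "r * s" f] in eventually_elim, simp add: algebra_simps)
  show "1 *\<^sub>R f = f"
    by (rule L2_eqI) (use rep_scaleR_L2[of 1 f] in eventually_elim, simp)
qed
end

lemma integral_norm_eq_0_L2:
  "(LINT x|lborel. (norm (rep_L2 f x))\<^sup>2) = 0 \<longleftrightarrow> f = 0"
proof
  assume "(LINT x|lborel. (norm (rep_L2 f x))\<^sup>2) = 0"
  then have "AE x in lborel. (norm (rep_L2 f x))\<^sup>2 = 0"
    by (subst (asm) integral_nonneg_eq_0_iff_AE) (auto simp: rep_L2_integrable)
  then show "f = 0" 
  proof (intro L2_eqI)
    show "AE x in lborel. rep_L2 f x = rep_L2 0 x"
      using rep_zero_L2 \<open>AE x in lborel. (norm (rep_L2 f x))\<^sup>2 = 0\<close> by eventually_elim simp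
  qed
next
  assume "f = 0"
  have "AE x in lborel. (norm (rep_L2 f x))\<^sup>2 = 0"
    unfolding \<open>f = 0\<close> using rep_zero_L2 by eventually_elim simp
  then show "(LINT x|lborel. (norm (rep_L2 f x))\<^sup>2) = 0"
    by (subst integral_nonneg_eq_0_iff_AE) (auto simp: rep_L2_integrable)
qed

definition L2_scaleC :: "complex \<Rightarrow> 'a::euclidean_space L2 \<Rightarrow> 'a L2" where
  "L2_scaleC c f = abs_L2 (\<lambda>x. c * rep_L2 f x)"

definition L2_cinner :: "'a::euclidean_space L2 \<Rightarrow> 'a L2 \<Rightarrow> complex" where
  "L2_cinner f g = (LINT x|lborel. rep_L2 f x * cnj (rep_L2 g x))"

lemma L2_rep_scaleC: "AE x in lborel. rep_L2 (L2_scaleC c f) x = c * rep_L2 f x"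
  unfolding L2_scaleC_def by (rule rep_abs_L2) (intro sqint_scale rep_L2_sqint)

lemma L2_cinner_AE:
  assumes "f' \<in> borel_measurable lborel" "g' \<in> borel_measurable lborel" 
    "AE x in lborel. rep_L2 f x = f' x" "AE x in lborel. rep_L2 g x = g' x"
  shows "L2_cinner f g = (LINT x|lborel. f' x * cnj (g' x))"
proof -
  have cnj[measurable]: "cnj \<in> borel_measurable borel"
    by (intro borel_measurable_continuous_onI continuous_intros)
  note [measurable] = assms(1,2)
  show ?thesis unfolding L2_cinner_def
    by (rule integral_cong_AE; measurable?) (use assms(3,4) in eventually_elim, simp)
qed

lemma L2_cinner_self: "L2_cinner f f = complex_of_real (LINT x|lborel. (norm (rep_L2 f x))\<^sup>2)"
  unfolding L2_cinner_def integral_complex_of_real[symmetric] complex_norm_square ..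

lemma L2_cinner_add: "L2_cinner (f + g) h = L2_cinner f h + L2_cinner g h"
proof -
  have "L2_cinner (f + g) h = (LINT x|lborel. (rep_L2 f x + rep_L2 g x) * cnj (rep_L2 h x))"
    by (rule L2_cinner_AE) (use rep_plus_L2 in auto)
  also have "\<dots> = L2_cinner f h + L2_cinner g h"
    unfolding L2_cinner_def distrib_right
    by (intro Bochner_Integration.integral_add sqint_mult rep_L2_sqint)
  finally show ?thesis .
qed

lemma L2_cinner_scaleC: "L2_cinner (L2_scaleC c f) h = c * L2_cinner f h"
proof -
  have "L2_cinner (L2_scaleC c f) h = (LINT x|lborel. (c * rep_L2 f x) * cnj (rep_L2 h x))"
    by (rule L2_cinner_AE) (use L2_rep_scaleC in auto)
  also have "\<dots> = c * L2_cinner f h"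
    unfolding L2_cinner_def by (simp add: mult.assoc)
  finally show ?thesis .
qed

lemma L2_cinner_commute: "L2_cinner f g = cnj (L2_cinner g f)"
  unfolding L2_cinner_def
  by (subst integral_bounded_linear'[OF bounded_linear_cnj bounded_linear_cnj, symmetric])
    (simp_all add: mult.commute)

lemma L2_scaleR_eq: "r *\<^sub>R f = L2_scaleC (of_real r) f"
  by (simp add: scaleR_L2_def L2_scaleC_def)

instantiation L2 :: (euclidean_space) real_inner
begin
definition inner_L2 :: "'a L2 \<Rightarrow> 'a L2 \<Rightarrow> real" where "inner_L2 f g = Re (L2_cinner f g)"
definition norm_L2 :: "'a L2 \<Rightarrow> real" where "norm_L2 f = sqrt (inner f f)"
definition sgn_L2 :: "'a L2 \<Rightarrow> 'a L2" where "sgn_L2 f = f /\<^sub>R norm f"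
definition dist_L2 :: "'a L2 \<Rightarrow> 'a L2 \<Rightarrow> real" where "dist_L2 f g = norm (f - g)"
definition uniformity_L2 :: "('a L2 \<times> 'a L2) filter" where
  "uniformity_L2 = (INF e\<in>{0<..}. principal {(x, y). dist x y < e})"
definition open_L2 :: "'a L2 set \<Rightarrow> bool" where
  "open_L2 U = (\<forall>x\<in>U. eventually (\<lambda>(x', y). x' = x \<longrightarrow> y \<in> U) uniformity)"
instance
proof
  fix x y z :: "'a L2" and r
  show "inner x y = inner y x" 
    unfolding inner_L2_def by (subst L2_cinner_commute) simp
  show "inner (x + y) z = inner x z + inner y z" by (simp add: inner_L2_def L2_cinner_add)
  show "inner (r *\<^sub>R x) y = r * inner x y" by (simp add: inner_L2_def L2_scaleR_eq L2_cinner_scaleC)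
  show "0 \<le> inner x x" by (simp add: inner_L2_def L2_cinner_self)
  show "inner x x = 0 \<longleftrightarrow> x = 0" by (simp add: inner_L2_def L2_cinner_self integral_norm_eq_0_L2)
qed (rule sgn_L2_def dist_L2_def uniformity_L2_def open_L2_def norm_L2_def)+
end

lemma norm_L2_sq: "(norm f)\<^sup>2 = (LINT x|lborel. (norm (rep_L2 f x))\<^sup>2)"
  by (simp add: norm_L2_def inner_L2_def L2_cinner_self)

lemma norm_L2_nn: "(\<integral>\<^sup>+x. ennreal ((norm (rep_L2 f x))\<^sup>2) \<partial>lborel) = ennreal ((norm f)\<^sup>2)"
  unfolding norm_L2_sq by (rule nn_integral_eq_integral) (auto simp: rep_L2_integrable)

lemma dist_L2_nn: 
  "(\<integral>\<^sup>+x. ennreal ((norm (rep_L2 f x - rep_L2 g x))\<^sup>2) \<partial>lborel) = ennreal ((dist f g)\<^sup>2)"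
  unfolding dist_norm norm_L2_nn[symmetric]
  by (rule nn_integral_cong_AE) (use rep_minus_L2[of f g] in eventually_elim, simp)

lemma dist_L2_abs_le:
  assumes "g \<in> sqint UNIV" "(\<integral>\<^sup>+x. ennreal ((norm (rep_L2 f x - g x))\<^sup>2) \<partial>lborel) \<le> ennreal (e\<^sup>2)" "e \<ge> 0"
  shows "dist f (abs_L2 g) \<le> e"
proof -
  have "ennreal ((dist f (abs_L2 g))\<^sup>2) = (\<integral>\<^sup>+x. ennreal ((norm (rep_L2 f x - g x))\<^sup>2) \<partial>lborel)"
    unfolding dist_L2_nn[symmetric]
    by (rule nn_integral_cong_AE) (use rep_abs_L2[OF assms(1)] in eventually_elim, simp)
  then have "ennreal ((dist f (abs_L2 g))\<^sup>2) \<le> ennreal (e\<^sup>2)" using assms(2) by simp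
  then have "(dist f (abs_L2 g))\<^sup>2 \<le> e\<^sup>2" by (simp add: ennreal_le_iff)
  then show ?thesis using assms(3) by (rule power2_le_imp_le)
qed

lemma Cauchy_fast_subseq:
  fixes X :: "nat \<Rightarrow> 'a::metric_space"
  assumes "Cauchy X" "\<And>n. e n > (0::real)"
  obtains r where "strict_mono r" "\<And>n::nat. dist (X (r n)) (X (r (Suc n))) < e n"
proof -
  have "\<exists>M. \<forall>m\<ge>M. \<forall>k\<ge>M. dist (X m) (X k) < e n" for n
    using assms by (auto simp: Cauchy_def)
  then obtain M where M: "\<And>n m k. m \<ge> M n \<Longrightarrow> k \<ge> M n \<Longrightarrow> dist (X m) (X k) < e n" by metis
  define r where "r n = (\<Sum>i\<le>n. M i) + n" for n
  have "strict_mono r" by (rule strict_mono_Suc_iff[THEN iffD2]) (simp add: r_def)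
  moreover have "r n \<ge> M n" for n
    unfolding r_def by (rule trans_le_add1, rule member_le_sum) auto
  then have "dist (X (r n)) (X (r (Suc n))) < e n" for n
    using M[where n=n] \<open>strict_mono r\<close> 
    by (meson le_trans less_imp_le lessI strict_mono_less)
  ultimately show ?thesis using that by blast
qed

lemma L2_Cauchy_convergent:
  fixes X :: "nat \<Rightarrow> 'a::euclidean_space L2"
  assumes "Cauchy X"
  shows "convergent X"
proof -
  obtain r where r: "strict_mono r" and d: "\<And>n. dist (X (r n)) (X (r (Suc n))) < (1/4)^n"
    using Cauchy_fast_subseq[OF assms, of "\<lambda>n. (1/4)^n"] by auto
  define f where "f n = rep_L2 (X (r n))" for n
  have [measurable]: "f n \<in> borel_measurable borel" for n by (simp add: f_def)
  define D where "D n x = (norm (f n x - f (Suc n) x))\<^sup>2" for n x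
  have [measurable]: "D n \<in> borel_measurable borel" for n unfolding D_def by measurable
  have "(\<integral>\<^sup>+x. (\<Sum>n. ennreal (4^n * D n x)) \<partial>lborel) = (\<Sum>n. \<integral>\<^sup>+x. ennreal (4^n * D n x) \<partial>lborel)"
    by (rule nn_integral_suminf) measurable
  also have "\<dots> \<le> (\<Sum>n. ennreal ((1/4)^n))"
  proof (rule suminf_le; simp?)
    fix n
    have "(\<integral>\<^sup>+x. ennreal (4^n * D n x) \<partial>lborel) = 4^n * (\<integral>\<^sup>+x. ennreal (D n x) \<partial>lborel)"
      by (simp add: ennreal_mult' nn_integral_cmult D_def power_mult_distrib
          flip: ennreal_power)
    also have "\<dots> = ennreal (4^n) * ennreal ((dist (X (r n)) (X (r (Suc n))))\<^sup>2)"
      unfolding D_def f_def dist_L2_nn by (simp flip: ennreal_power)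
    also have "\<dots> \<le> ennreal (4^n) * ennreal (((1/4)^n)\<^sup>2)"
      using d[of n] by (intro mult_left_mono ennreal_leI power_mono) auto
    also have "\<dots> = ennreal ((1/4)^n)"
      by (simp add: ennreal_mult[symmetric] power2_eq_square power_divide)
    finally show "(\<integral>\<^sup>+x. ennreal (4^n * D n x) \<partial>lborel) \<le> ennreal ((1/4)^n)" .
  qed
  also have "\<dots> < \<infinity>"
    by (subst suminf_ennreal2) (auto simp: summable_geometric)
  finally have "(\<integral>\<^sup>+x. (\<Sum>n. ennreal (4^n * D n x)) \<partial>lborel) \<noteq> \<infinity>" by simp
  then have "AE x in lborel. (\<Sum>n. ennreal (4^n * D n x)) \<noteq> \<infinity>"
    by (intro nn_integral_noteq_infinite) measurable
  then have conv: "AE x in lborel. convergent (\<lambda>n. f n x)"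
  proof eventually_elim
    case (elim x)
    obtain C where C: "(\<Sum>n. ennreal (4^n * D n x)) = ennreal C" "C \<ge> 0"
      using elim by (cases "\<Sum>n. ennreal (4^n * D n x)") auto
    have nb: "norm (f (Suc n) x - f n x) \<le> sqrt C * (1/2)^n" for n
    proof -
      have "ennreal (4^n * D n x) \<le> ennreal C"
        unfolding C(1)[symmetric] using sum_le_suminf[of "\<lambda>n. ennreal (4^n * D n x)" "{n}"] by simp
      then have "4^n * D n x \<le> C" using C(2) by simp
      then have "(norm (f n x - f (Suc n) x))\<^sup>2 \<le> C / 4^n"
        by (simp add: D_def field_simps)
      then have "norm (f n x - f (Suc n) x) \<le> sqrt (C / 4^n)"
        by (rule real_le_rsqrt)
      also have "\<dots> = sqrt C * (1/2)^n"
        using real_sqrt_power[of 4 n] by (simp add: real_sqrt_divide power_divide)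
      finally show ?thesis by (simp add: norm_minus_commute)
    qed
    have sm: "summable (\<lambda>n. sqrt C * (1/2)^n)"
      by (rule summable_mult) (simp add: summable_geometric)
    have "summable (\<lambda>n. f (Suc n) x - f n x)"
      by (rule summable_comparison_test'[OF sm]) (rule nb)
    then have "summable (\<lambda>n. f (Suc n) x - f n x)" .
    then have "convergent (\<lambda>n. \<Sum>i<n. f (Suc i) x - f i x)" by (simp add: summable_iff_convergent)
    then have "convergent (\<lambda>n. f n x - f 0 x)" unfolding sum_lessThan_telescope[of "\<lambda>n. f n x"] .
    from convergent_add[OF this convergent_const[of "f 0 x"]] show ?case by simp
  qed
  define g where "g x = lim (\<lambda>n. f n x)" for x
  have [measurable]: "g \<in> borel_measurable borel" unfolding g_def by measurable
  have lim: "AE x in lborel. (\<lambda>n. f n x) \<longlonglongrightarrow> g x"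
    using conv by eventually_elim (simp add: g_def convergent_LIMSEQ_iff)
  have bound: "(\<integral>\<^sup>+x. ennreal ((norm (f n x - g x))\<^sup>2) \<partial>lborel) \<le> ennreal (e\<^sup>2)"
    if "\<And>m. m \<ge> n \<Longrightarrow> dist (X (r n)) (X (r m)) \<le> e" for n e
  proof -
    have "(\<integral>\<^sup>+x. ennreal ((norm (f n x - g x))\<^sup>2) \<partial>lborel) 
        = (\<integral>\<^sup>+x. liminf (\<lambda>m. ennreal ((norm (f n x - f m x))\<^sup>2)) \<partial>lborel)"
    proof (rule nn_integral_cong_AE)
      show "AE x in lborel. ennreal ((norm (f n x - g x))\<^sup>2) = liminf (\<lambda>m. ennreal ((norm (f n x - f m x))\<^sup>2))"
        using lim
      proof eventually_elim
        case (elim x)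
        have "(\<lambda>m. ennreal ((norm (f n x - f m x))\<^sup>2)) \<longlonglongrightarrow> ennreal ((norm (f n x - g x))\<^sup>2)"
          by (intro tendsto_ennrealI tendsto_intros elim)
        from lim_imp_Liminf[OF _ this] show ?case by simp
      qed
    qed
    also have "\<dots> \<le> liminf (\<lambda>m. \<integral>\<^sup>+x. ennreal ((norm (f n x - f m x))\<^sup>2) \<partial>lborel)"
      by (rule nn_integral_liminf) measurable
    also have "\<dots> = liminf (\<lambda>m. ennreal ((dist (X (r n)) (X (r m)))\<^sup>2))"
      by (simp add: f_def dist_L2_nn)
    also have "\<dots> \<le> limsup (\<lambda>m. ennreal ((dist (X (r n)) (X (r m)))\<^sup>2))"
      by (rule Liminf_le_Limsup) simp
    also have "\<dots> \<le> ennreal (e\<^sup>2)"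
      by (intro Limsup_bounded eventually_sequentiallyI[of n] ennreal_leI power_mono that) auto
    finally show ?thesis .
  qed
  have Cr: "Cauchy (X \<circ> r)" using assms r by (rule Cauchy_subseq_Cauchy)
  have gs: "g \<in> sqint UNIV"
  proof -
    obtain n where n: "\<And>m. m \<ge> n \<Longrightarrow> dist (X (r n)) (X (r m)) \<le> 1"
      using Cr unfolding Cauchy_def o_def by (metis le_refl less_imp_le zero_less_one)
    have "(\<integral>\<^sup>+x. ennreal ((norm (f n x - g x))\<^sup>2) \<partial>lborel) \<le> ennreal (1\<^sup>2)"
      by (rule bound[OF n])
    then have "(\<lambda>x. f n x - g x) \<in> sqint UNIV"
      unfolding sqint_UNIV by (auto simp: integrable_iff_bounded le_less_trans)
    from sqint_add[OF rep_L2_sqint[of "X (r n)"] sqint_scale[OF this, of "-1"]]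
    show ?thesis by (simp add: f_def)
  qed
  have "(X \<circ> r) \<longlonglongrightarrow> abs_L2 g"
  proof (rule metric_LIMSEQ_I)
    fix e :: real assume "e > 0"
    then obtain N where N: "\<And>m n. m \<ge> N \<Longrightarrow> n \<ge> N \<Longrightarrow> dist (X (r m)) (X (r n)) < e/2"
      using Cr unfolding Cauchy_def o_def by (metis half_gt_zero)
    have "dist ((X \<circ> r) n) (abs_L2 g) < e" if "n \<ge> N" for n
    proof -
      have "dist (X (r n)) (abs_L2 g) \<le> e/2"
        by (rule dist_L2_abs_le[OF gs]) 
          (use N that \<open>e > 0\<close> bound[of n "e/2"] in \<open>auto simp: f_def less_imp_le\<close>)
      then show ?thesis using \<open>e > 0\<close> by simp
    qed
    then show "\<exists>N. \<forall>n\<ge>N. dist ((X \<circ> r) n) (abs_L2 g) < e" by blast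
  qed
  from Cauchy_converges_subseq[OF assms r this] show ?thesis by (auto simp: convergent_def)
qed

instantiation L2 :: (euclidean_space) complex_hilbert
begin
definition scaleC_L2 :: "complex \<Rightarrow> 'a L2 \<Rightarrow> 'a L2" where "scaleC_L2 = L2_scaleC"
definition cinner_L2 :: "'a L2 \<Rightarrow> 'a L2 \<Rightarrow> complex" where "cinner_L2 = L2_cinner"
instance
proof -
  show "OFCLASS('a L2, complex_hilbert_class)"
  proof (standard, unfold scaleC_L2_def cinner_L2_def)
    fix X :: "nat \<Rightarrow> 'a L2" assume "Cauchy X" then show "convergent X" by (rule L2_Cauchy_convergent)
  next
    fix x y z :: "'a L2" and a b :: complex and t :: real
    show "L2_scaleC a (x + y) = L2_scaleC a x + L2_scaleC a y"
      by (rule L2_eqI) (use L2_rep_scaleC[of a x] L2_rep_scaleC[of a y] L2_rep_scaleC[of a "x+y"]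
        rep_plus_L2[of x y] rep_plus_L2[of "L2_scaleC a x" "L2_scaleC a y"] in eventually_elim, simp add: algebra_simps)
    show "L2_scaleC (a + b) x = L2_scaleC a x + L2_scaleC b x"
      by (rule L2_eqI) (use L2_rep_scaleC[of a x] L2_rep_scaleC[of b x] L2_rep_scaleC[of "a+b" x]
        rep_plus_L2[of "L2_scaleC a x" "L2_scaleC b x"] in eventually_elim, simp add: algebra_simps)
    show "L2_scaleC a (L2_scaleC b x) = L2_scaleC (a * b) x"
      by (rule L2_eqI) (use L2_rep_scaleC[of a "L2_scaleC b x"] L2_rep_scaleC[of b x] L2_rep_scaleC[of "a * b" x]
        in eventually_elim, simp)
    show "t *\<^sub>R x = L2_scaleC (complex_of_real t) x" by (rule L2_scaleR_eq)
    show "L2_cinner x y = cnj (L2_cinner y x)" by (rule L2_cinner_commute)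
    show "L2_cinner (x + y) z = L2_cinner x z + L2_cinner y z" by (rule L2_cinner_add)
    show "L2_cinner (L2_scaleC a x) y = a * L2_cinner x y" by (rule L2_cinner_scaleC)
    show "inner x y = Re (L2_cinner x y)" by (rule inner_L2_def)
  qed
qed
end

lemma norm_scaleC: "norm (c *\<^sub>C x) = cmod c * norm (x::'a::complex_hilbert)"
proof -
  have "complex_of_real ((norm (c *\<^sub>C x))\<^sup>2) = complex_of_real ((cmod c * norm x)\<^sup>2)"
    unfolding cinner_self[symmetric] power_mult_distrib of_real_mult complex_norm_square[of c]
    by (simp add: cinner_scaleC_left cinner_scaleC_right cinner_complex_def mult.commute)
  then have "(norm (c *\<^sub>C x))\<^sup>2 = (cmod c * norm x)\<^sup>2"
    using of_real_eq_iff by blast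
  then show ?thesis by (simp add: power2_eq_iff_nonneg)
qed

lemma scaleC_scaleR: "c *\<^sub>C (r *\<^sub>R x) = r *\<^sub>R (c *\<^sub>C (x::'a::complex_hilbert))"
  by (simp add: scaleR_scaleC scaleC_scaleC mult.commute)

lemma bounded_bilinear_scaleC: "bounded_bilinear (scaleC :: complex \<Rightarrow> 'a::complex_hilbert \<Rightarrow> 'a)"
proof
  fix a b :: complex and x y :: 'a and r :: real
  show "(a + b) *\<^sub>C x = a *\<^sub>C x + b *\<^sub>C x" by (rule scaleC_add_left)
  show "a *\<^sub>C (x + y) = a *\<^sub>C x + a *\<^sub>C y" by (rule scaleC_add_right)
  show "(r *\<^sub>R a) *\<^sub>C x = r *\<^sub>R a *\<^sub>C x" by (simp add: scaleR_scaleC scaleC_scaleC scaleC_complex_def)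
  show "a *\<^sub>C r *\<^sub>R x = r *\<^sub>R a *\<^sub>C x" by (rule scaleC_scaleR)
  show "\<exists>K. \<forall>(a::complex) (b::'a). norm (a *\<^sub>C b) \<le> norm a * norm b * K"
    by (rule exI[of _ 1]) (simp add: norm_scaleC)
qed

lemma norm_cinner_le: "cmod (cinner x y) \<le> norm x * norm (y::'a::complex_hilbert)"
proof (cases "cinner x y = 0")
  case False
  define c where "c = cnj (cinner x y) / cmod (cinner x y)"
  have "cmod c = 1" using False by (simp add: c_def norm_divide)
  have "cinner (c *\<^sub>C x) y = cmod (cinner x y)"
    using False by (simp add: c_def cinner_scaleC_left complex_norm_square[symmetric] power2_eq_square mult.commute)
  then have "cmod (cinner x y) = inner (c *\<^sub>C x) y" by (simp add: inner_Re_cinner)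
  also have "\<dots> \<le> norm (c *\<^sub>C x) * norm y" by (rule norm_cauchy_schwarz)
  finally show ?thesis by (simp add: norm_scaleC \<open>cmod c = 1\<close>)
qed simp

lemma cinner_scaleR_left: "cinner (r *\<^sub>R x) y = r *\<^sub>R cinner x (y::'a::complex_hilbert)"
  by (simp add: scaleR_scaleC cinner_scaleC_left scaleC_complex_def)

lemma cinner_scaleR_right: "cinner x (r *\<^sub>R y) = r *\<^sub>R cinner x (y::'a::complex_hilbert)"
  by (simp add: scaleR_scaleC cinner_scaleC_right scaleC_complex_def)

lemma bounded_bilinear_cinner: "bounded_bilinear (cinner :: 'a::complex_hilbert \<Rightarrow> 'a \<Rightarrow> complex)"
proof
  show "\<exists>K. \<forall>(a::'a) b. norm (cinner a b) \<le> norm a * norm b * K"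
    by (rule exI[of _ 1]) (simp add: norm_cinner_le)
qed (simp_all add: cinner_add_left cinner_add_right cinner_scaleR_left cinner_scaleR_right)

interpretation scaleC: bounded_bilinear "scaleC :: complex \<Rightarrow> 'a::complex_hilbert \<Rightarrow> 'a"
  by (rule bounded_bilinear_scaleC)

interpretation cinner: bounded_bilinear "cinner :: 'a::complex_hilbert \<Rightarrow> 'a \<Rightarrow> complex"
  by (rule bounded_bilinear_cinner)

lemma scaleC_one [simp]: "1 *\<^sub>C x = (x::'a::complex_hilbert)"
  using scaleR_scaleC[of 1 x] by simp

lemma countable_dense_subbasis:
  fixes D :: "'a::metric_space set"
  assumes "countable D" "\<And>x e. e > 0 \<Longrightarrow> \<exists>d\<in>D. dist d x < e"
  shows "\<exists>B::'a set set. countable B \<and> open = generate_topology B"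
proof -
  define B where "B = (\<lambda>(d, q). ball d q) ` (D \<times> \<rat>)"
  have "countable B" unfolding B_def using assms(1) countable_rat by auto
  moreover have "topological_basis B"
  proof (rule topological_basisI)
    fix O' :: "'a set" and x assume "open O'" "x \<in> O'"
    then obtain e where e: "e > 0" "ball x e \<subseteq> O'" using openE by blast
    obtain q where q: "q \<in> \<rat>" "0 < q" "q < e/2"
      using Rats_dense_in_real[of 0 "e/2"] e(1) by auto
    obtain d where d: "d \<in> D" "dist d x < q" using assms(2) q(2) by blast
    have "ball d q \<subseteq> ball x e"
    proof
      fix y assume "y \<in> ball d q"
      then show "y \<in> ball x e" using d(2) q(3) dist_triangle[of x y d] by (simp add: dist_commute)
    qed
    then show "\<exists>B'\<in>B. x \<in> B' \<and> B' \<subseteq> O'"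
      using d q e by (intro bexI[of _ "ball d q"]) (auto simp: B_def)
  qed (auto simp: B_def)
  ultimately show ?thesis using topological_basis_imp_subbasis by blast
qed

lemma countable_subbasis_isometry:
  fixes f :: "'a::metric_space \<Rightarrow> 'b::{metric_space, second_countable_topology}"
  assumes iso: "\<And>x y. dist (f x) (f y) = dist x y"
  shows "\<exists>B::'a set set. countable B \<and> open = generate_topology B"
proof -
  obtain C :: "'b set set" where C: "countable C" "topological_basis C"
    using ex_countable_basis by blast
  define B where "B = (\<lambda>U. f -` U) ` C"
  have cf: "continuous_on UNIV f"
    unfolding continuous_on_iff using iso by metis
  have "topological_basis B"
  proof (rule topological_basisI)
    fix U assume "U \<in> B"
    then show "open U" unfolding B_def using topological_basis_open[OF C(2)] cf
      by (auto intro!: open_vimage)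
  next
    fix O' :: "'a set" and x assume "open O'" "x \<in> O'"
    then obtain e where e: "e > 0" "ball x e \<subseteq> O'" using openE by blast
    obtain U where U: "U \<in> C" "f x \<in> U" "U \<subseteq> ball (f x) e"
      using topological_basisE[OF C(2) open_ball, of "f x" "f x" e] e(1) by auto
    have "f -` U \<subseteq> O'"
      using U(3) e(2) iso by (auto simp: subset_eq)
    then show "\<exists>B'\<in>B. x \<in> B' \<and> B' \<subseteq> O'"
      using U by (auto simp: B_def)
  qed
  then show ?thesis using C(1) topological_basis_imp_subbasis unfolding B_def by blast
qed

lemma abs_L2_add: 
  assumes "f \<in> sqint UNIV" "g \<in> sqint UNIV"
  shows "abs_L2 (\<lambda>x. f x + g x) = abs_L2 f + abs_L2 g"
  unfolding plus_L2_def
  by (rule abs_L2_eqI[OF sqint_add[OF assms] sqint_add[OF rep_L2_sqint rep_L2_sqint]])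
    (use rep_abs_L2[OF assms(1)] rep_abs_L2[OF assms(2)] in eventually_elim, simp)

lemma abs_L2_scaleC: 
  assumes "f \<in> sqint UNIV"
  shows "abs_L2 (\<lambda>x. c * f x) = c *\<^sub>C abs_L2 f"
  unfolding scaleC_L2_def L2_scaleC_def
  by (rule abs_L2_eqI[OF sqint_scale[OF assms] sqint_scale[OF rep_L2_sqint]])
    (use rep_abs_L2[OF assms(1)] in eventually_elim, simp)

lemma abs_L2_diff: 
  assumes "f \<in> sqint UNIV" "g \<in> sqint UNIV"
  shows "abs_L2 (\<lambda>x. f x - g x) = abs_L2 f - abs_L2 g"
proof -
  have "abs_L2 (\<lambda>x. f x + (-1) * g x) = abs_L2 f + (-1) *\<^sub>C abs_L2 g"
    by (simp only: abs_L2_add[OF assms(1) sqint_scale[OF assms(2)]] abs_L2_scaleC[OF assms(2)])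
  also have "(-1) *\<^sub>C abs_L2 g = - abs_L2 g"
    using scaleR_scaleC[of "-1" "abs_L2 g"] by simp
  finally show ?thesis by simp
qed

lemma abs_L2_sum:
  assumes "finite I" "\<And>i. i \<in> I \<Longrightarrow> f i \<in> sqint UNIV"
  shows "(\<lambda>x. \<Sum>i\<in>I. f i x) \<in> sqint UNIV \<and> abs_L2 (\<lambda>x. \<Sum>i\<in>I. f i x) = (\<Sum>i\<in>I. abs_L2 (f i))"
  using assms
proof (induction I)
  case empty
  have "(\<lambda>_. 0) \<in> sqint UNIV" by (simp add: sqint_UNIV)
  then show ?case by (simp add: zero_L2_def)
next
  case (insert i I)
  then have IH: "(\<lambda>x. \<Sum>i\<in>I. f i x) \<in> sqint UNIV" "abs_L2 (\<lambda>x. \<Sum>i\<in>I. f i x) = (\<Sum>i\<in>I. abs_L2 (f i))"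
    and fi: "f i \<in> sqint UNIV" by auto
  show ?case using sqint_add[OF fi IH(1)] abs_L2_add[OF fi IH(1)] IH(2) insert.hyps by simp
qed

lemma norm_abs_L2:
  assumes "f \<in> sqint UNIV"
  shows "(norm (abs_L2 f))\<^sup>2 = (LINT x|lborel. (norm (f x))\<^sup>2)"
proof -
  have [measurable]: "f \<in> borel_measurable lborel" using assms by (simp add: sqint_UNIV)
  show ?thesis unfolding norm_L2_sq
    by (rule integral_cong_AE; measurable?) (use rep_abs_L2[OF assms] in eventually_elim, simp)
qed

lemma L2_dominated:
  assumes "\<And>n. f n \<in> sqint UNIV" "g \<in> sqint UNIV" "integrable lborel (\<lambda>x. (w x)\<^sup>2)"
    and lim: "\<And>x. (\<lambda>n. f n x) \<longlonglongrightarrow> g x" and bd: "\<And>n x. cmod (f n x) \<le> w x"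
  shows "(\<lambda>n. abs_L2 (f n)) \<longlonglongrightarrow> abs_L2 g"
proof -
  have [measurable]: "f n \<in> borel_measurable lborel" "g \<in> borel_measurable lborel" for n
    using assms by (auto simp: sqint_UNIV)
  have gw: "cmod (g x) \<le> w x" for x
    using tendsto_norm[OF lim[of x]] bd by (intro LIMSEQ_le_const2) auto
  have bd2: "(cmod (f n x - g x))\<^sup>2 \<le> 4 * (w x)\<^sup>2" for n x
  proof -
    have "cmod (f n x - g x) \<le> 2 * w x" 
      using norm_triangle_ineq4[of "f n x" "g x"] bd[of n x] gw[of x] by linarith
    then have "(cmod (f n x - g x))\<^sup>2 \<le> (2 * w x)\<^sup>2" by (rule power_mono) simp
    then show ?thesis by (simp add: power_mult_distrib)
  qed
  have "(\<lambda>n. LINT x|lborel. (cmod (f n x - g x))\<^sup>2) \<longlonglongrightarrow> (LINT x|(lborel::'a measure). 0)"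
  proof (rule integral_dominated_convergence)
    show "integrable lborel (\<lambda>x. 4 * (w x)\<^sup>2)" using assms(3) by simp
    show "AE x in lborel. (\<lambda>n. (cmod (f n x - g x))\<^sup>2) \<longlonglongrightarrow> 0"
    proof (intro always_eventually allI)
      fix x
      have "(\<lambda>n. (cmod (f n x - g x))\<^sup>2) \<longlonglongrightarrow> (cmod (g x - g x))\<^sup>2"
        by (intro tendsto_intros lim)
      then show "(\<lambda>n. (cmod (f n x - g x))\<^sup>2) \<longlonglongrightarrow> 0" by simp
    qed
    show "AE x in lborel. norm ((cmod (f n x - g x))\<^sup>2) \<le> 4 * (w x)\<^sup>2" for n
      using bd2 by simp
  qed measurable
  moreover have "(LINT x|lborel. (cmod (f n x - g x))\<^sup>2) = (norm (abs_L2 (f n) - abs_L2 g))\<^sup>2" for n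
  proof -
    have d: "(\<lambda>x. f n x - g x) \<in> sqint UNIV"
      using sqint_add[OF assms(1) sqint_scale[OF assms(2), of "-1"]] by simp
    show ?thesis unfolding abs_L2_diff[OF assms(1,2), symmetric] norm_abs_L2[OF d] ..
  qed
  ultimately have "(\<lambda>n. (norm (abs_L2 (f n) - abs_L2 g))\<^sup>2) \<longlonglongrightarrow> 0" by simp
  from tendsto_real_sqrt[OF this] have "(\<lambda>n. norm (abs_L2 (f n) - abs_L2 g)) \<longlonglongrightarrow> 0" by simp
  then show ?thesis by (rule Lim_null[THEN iffD2, OF tendsto_norm_zero_cancel])
qed

text \<open>The element of \<open>L\<^sup>2(S)\<close> given by the restriction of \<open>f\<close> to \<open>S\<close>; meaningful only if
  \<open>f \<in> sqint S\<close>.\<close>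

definition to_L2 :: "'a::euclidean_space set \<Rightarrow> ('a \<Rightarrow> complex) \<Rightarrow> 'a L2" where
  "to_L2 S f = abs_L2 (\<lambda>x. indicator S x *\<^sub>R f x)"

lemma sqint_indicator:
  assumes "A \<in> sets borel" "bounded (A::'a::euclidean_space set)"
  shows "(\<lambda>x. indicat_real A x *\<^sub>R (1::complex)) \<in> sqint UNIV"
proof -
  have "(norm (indicat_real A x *\<^sub>R (1::complex)))\<^sup>2 = indicator A x" for x
    by (simp add: indicator_def)
  moreover have "emeasure lborel A < \<infinity>" using assms(2) by (rule emeasure_bounded_finite)
  ultimately show ?thesis using assms by (simp add: sqint_UNIV)
qed

lemma L2_closed_subspace_UNIV:
  fixes V :: "'a::euclidean_space L2 set"
  assumes "closed V" "0 \<in> V" and add: "\<And>f g. f \<in> V \<Longrightarrow> g \<in> V \<Longrightarrow> f + g \<in> V"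
    and scale: "\<And>c f. f \<in> V \<Longrightarrow> c *\<^sub>C f \<in> V"
    and G: "Int_stable G" "sigma_sets UNIV G = sets borel" "UNIV \<in> G"
    and ind: "\<And>A n. A \<in> G \<Longrightarrow> to_L2 (A \<inter> cball 0 (real n)) (\<lambda>_. 1) \<in> V"
  shows "V = UNIV"
proof -
  have sum: "(\<Sum>i\<in>I. f i) \<in> V" if "finite I" "\<And>i. i \<in> I \<Longrightarrow> f i \<in> V" for f and I :: "'i set"
    using that by (induction I) (auto simp: assms(2) add)
  have diff: "f - g \<in> V" if "f \<in> V" "g \<in> V" for f g
  proof -
    have "(-1) *\<^sub>C g = - g" using scaleR_scaleC[of "-1" g] by simp
    then show ?thesis using add[OF that(1) scale[OF that(2), of "-1"]] by simp
  qed
  have sets: "to_L2 (A \<inter> cball 0 (real n)) (\<lambda>_. 1) \<in> V" if "A \<in> sets borel" for A n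
  proof -
    let ?B = "cball (0::'a) (real n)"
    have sq: "(\<lambda>x. indicat_real (A \<inter> ?B) x *\<^sub>R (1::complex)) \<in> sqint UNIV" if "A \<in> sets borel" for A
      using that by (intro sqint_indicator) (auto intro: bounded_subset[OF bounded_cball])
    have subset_Pow: "G \<subseteq> Pow UNIV" by simp
    show ?thesis
      using G(1) subset_Pow that[folded G(2)]
    proof (induction rule: sigma_sets_induct_disjoint)
      case (basic A) then show ?case by (rule ind)
    next
      case empty then show ?case using assms(2) by (simp add: to_L2_def zero_L2_def)
    next
      case (compl A)
      have A: "A \<in> sets borel" using compl G(2) by simp
      have "(\<lambda>x. indicat_real ((UNIV - A) \<inter> ?B) x *\<^sub>R (1::complex)) 
        = (\<lambda>x. indicat_real (UNIV \<inter> ?B) x *\<^sub>R 1 - indicat_real (A \<inter> ?B) x *\<^sub>R 1)"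
        by (auto simp: indicator_def)
      then have "to_L2 ((UNIV - A) \<inter> ?B) (\<lambda>_. 1) = to_L2 (UNIV \<inter> ?B) (\<lambda>_. 1) - to_L2 (A \<inter> ?B) (\<lambda>_. 1)"
        unfolding to_L2_def using abs_L2_diff[OF sq sq[OF A], of UNIV] by simp
      then show ?case using diff ind[OF G(3)] compl by simp
    next
      case (union A)
      have A: "A i \<in> sets borel" for i using union G(2) by auto
      let ?f = "\<lambda>N x. \<Sum>i<N. indicat_real (A i \<inter> ?B) x *\<^sub>R (1::complex)"
      have f: "?f N \<in> sqint UNIV" "abs_L2 (?f N) = (\<Sum>i<N. to_L2 (A i \<inter> ?B) (\<lambda>_. 1))" for N
        using abs_L2_sum[of "{..<N}" "\<lambda>i x. indicat_real (A i \<inter> ?B) x *\<^sub>R (1::complex)"] sq[OF A]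
        by (auto simp: to_L2_def)
      have feq: "?f N x = indicat_real ((\<Union>i<N. A i) \<inter> ?B) x *\<^sub>R 1" for N x
      proof (cases "x \<in> (\<Union>i<N. A i)")
        case True
        then obtain j where j: "j < N" "x \<in> A j" by auto
        have "x \<in> A i \<longleftrightarrow> i = j" for i
          using j(2) union(1) unfolding disjoint_family_on_def by blast
        then have "?f N x = (\<Sum>i<N. if i = j then indicat_real ?B x *\<^sub>R 1 else 0)"
          by (intro sum.cong) (auto simp: indicator_def)
        then show ?thesis using True j by (simp add: indicator_def)
      qed (auto simp: indicator_def intro!: sum.neutral)
      have "(\<lambda>N. abs_L2 (?f N)) \<longlonglongrightarrow> abs_L2 (\<lambda>x. indicat_real ((\<Union>i. A i) \<inter> ?B) x *\<^sub>R (1::complex))"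
      proof (rule L2_dominated[where w = "indicator ?B"])
        show "(\<lambda>x. indicat_real ((\<Union>i. A i) \<inter> ?B) x *\<^sub>R (1::complex)) \<in> sqint UNIV"
          using A by (intro sq) auto
        have "(indicat_real ?B x)\<^sup>2 = indicat_real ?B x" for x by (simp add: indicator_def)
        then show "integrable lborel (\<lambda>x. (indicat_real ?B x)\<^sup>2)"
          using emeasure_bounded_finite[of ?B] by (simp add: less_top)
        fix x
        show "(\<lambda>N. ?f N x) \<longlonglongrightarrow> indicat_real ((\<Union>i. A i) \<inter> ?B) x *\<^sub>R (1::complex)"
        proof -
          have U: "(\<Union>N. (\<Union>i<N. A i) \<inter> ?B) = (\<Union>i. A i) \<inter> ?B" by auto
          have "incseq (\<lambda>N. (\<Union>i<N. A i) \<inter> ?B)" by (force simp: incseq_def)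
          have "(\<lambda>N. indicat_real ((\<Union>i<N. A i) \<inter> ?B) x) \<longlonglongrightarrow> indicat_real ((\<Union>i. A i) \<inter> ?B) x"
            unfolding U[symmetric] by (rule LIMSEQ_indicator_incseq) fact
          then show ?thesis unfolding feq by (intro tendsto_intros)
        qed
        show "cmod (?f N x) \<le> indicator ?B x" for N
          unfolding feq by (auto simp: indicator_def)
      qed (rule f)
      then have "(\<lambda>N. \<Sum>i<N. to_L2 (A i \<inter> ?B) (\<lambda>_. 1)) \<longlonglongrightarrow> to_L2 ((\<Union>i. A i) \<inter> ?B) (\<lambda>_. 1)"
        unfolding f(2) to_L2_def[symmetric] .
      then show ?case
        by (rule closed_sequentially[OF assms(1), rotated]) (intro sum union, auto)
    qed
  qed
  have "f \<in> V" for f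
  proof -
    obtain F where F: "\<And>i. simple_function lborel (F i)" "\<And>x. (\<lambda>i. F i x) \<longlonglongrightarrow> rep_L2 f x"
      and Fb: "\<And>i x. cmod (F i x) \<le> 2 * cmod (rep_L2 f x)"
    proof -
      have "rep_L2 f \<in> borel_measurable lborel" by simp
      from borel_measurable_implies_sequence_metric[OF this, of 0] obtain F where
        "\<forall>i. simple_function lborel (F i)" "\<forall>x\<in>space lborel. (\<lambda>i. F i x) \<longlonglongrightarrow> rep_L2 f x"
        "\<forall>i. \<forall>x\<in>space lborel. dist (F i x) 0 \<le> 2 * dist (rep_L2 f x) 0" by blast
      then show ?thesis by (intro that[of F]) simp_all
    qed
    let ?B = "\<lambda>n. cball (0::'a) (real n)"
    let ?g = "\<lambda>n x. \<Sum>c\<in>range (F n). c * (indicat_real (F n -` {c} \<inter> ?B n) x *\<^sub>R (1::complex))"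
    have fin: "finite (range (F n))" for n using F(1)[of n] by (simp add: simple_function_def)
    have meas: "F n -` {c} \<in> sets borel" for n c
      using simple_functionD(2)[OF F(1), of n "{c}"] by simp
    have sq: "(\<lambda>x. indicat_real (F n -` {c} \<inter> ?B n) x *\<^sub>R (1::complex)) \<in> sqint UNIV" for n c
      using meas by (intro sqint_indicator) (auto intro: bounded_subset[OF bounded_cball])
    have g: "?g n \<in> sqint UNIV \<and> abs_L2 (?g n) = (\<Sum>c\<in>range (F n). c *\<^sub>C to_L2 (F n -` {c} \<inter> ?B n) (\<lambda>_. 1))" for n
      unfolding to_L2_def abs_L2_scaleC[OF sq, symmetric]
      by (rule abs_L2_sum[OF fin]) (rule sqint_scale[OF sq])
    have geq: "?g n x = indicat_real (?B n) x *\<^sub>R F n x" for n x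
    proof -
      have "?g n x = (\<Sum>c\<in>range (F n). if c = F n x then indicat_real (?B n) x *\<^sub>R c else 0)"
        by (intro sum.cong) (auto simp: indicator_def)
      then show ?thesis using fin[of n] by simp
    qed
    have "(\<lambda>n. abs_L2 (?g n)) \<longlonglongrightarrow> abs_L2 (rep_L2 f)"
    proof (rule L2_dominated[where w = "\<lambda>x. 2 * cmod (rep_L2 f x)"])
      show "integrable lborel (\<lambda>x. (2 * cmod (rep_L2 f x))\<^sup>2)"
        using rep_L2_integrable[of f] by (simp add: power_mult_distrib)
      fix x
      have "eventually (\<lambda>n. F n x = ?g n x) sequentially"
      proof (rule eventually_sequentiallyI[of "nat \<lceil>norm x\<rceil>"])
        fix n assume "nat \<lceil>norm x\<rceil> \<le> n"
        then have "x \<in> ?B n" by (simp add: nat_le_iff ceiling_le_iff)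
        then show "F n x = ?g n x" unfolding geq by simp
      qed
      from Lim_transform_eventually[OF F(2) this] show "(\<lambda>n. ?g n x) \<longlonglongrightarrow> rep_L2 f x" .
      show "cmod (?g n x) \<le> 2 * cmod (rep_L2 f x)" for n
        unfolding geq using Fb[of n x] by (auto simp: indicator_def)
    qed (rule g[THEN conjunct1] rep_L2_sqint)+
    moreover have "abs_L2 (?g n) \<in> V" for n
      unfolding g[THEN conjunct2] by (intro sum fin scale sets meas)
    ultimately have "abs_L2 (rep_L2 f) \<in> V" using closed_sequentially[OF assms(1), of "\<lambda>n. abs_L2 (?g n)"] by simp
    then show ?thesis using Quotient_abs_rep[OF Quotient_L2, of f] by simp
  qed
  then show ?thesis by auto
qed

instance L2 :: (euclidean_space) second_countable_topology
proof
  obtain B0 :: "'a set set" where B0: "countable B0" "topological_basis B0"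
    using ex_countable_basis by blast
  define G where "G = Inter ` {F. finite F \<and> F \<subseteq> B0}"
  have "countable G" unfolding G_def by (intro countable_image countable_Collect_finite_subset B0)
  have UG: "UNIV \<in> G" unfolding G_def by (rule image_eqI[of _ _ "{}"]) auto
  have IG: "Int_stable G"
  proof (rule Int_stableI)
    fix a b assume "a \<in> G" "b \<in> G"
    then obtain F1 F2 where "finite F1" "F1 \<subseteq> B0" "a = \<Inter>F1" "finite F2" "F2 \<subseteq> B0" "b = \<Inter>F2"
      by (auto simp: G_def)
    then show "a \<inter> b \<in> G" unfolding G_def by (intro image_eqI[of _ _ "F1 \<union> F2"]) auto
  qed
  have sG: "sigma_sets UNIV G = sets borel"
  proof
    have B0b: "b \<in> sets borel" if "b \<in> B0" for b using topological_basis_open[OF B0(2) that] by simp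
    have "G \<subseteq> sets borel"
    proof
      fix A assume "A \<in> G"
      then obtain F where F: "finite F" "F \<subseteq> B0" "A = \<Inter>F" by (auto simp: G_def)
      have "open A" unfolding F(3) using F(1,2) topological_basis_open[OF B0(2)] by (intro open_Inter) auto
      then show "A \<in> sets borel" by simp
    qed
    then show "sigma_sets UNIV G \<subseteq> sets borel" by (rule borel_sigma_sets_subset)
    have "B0 \<subseteq> G" unfolding G_def
    proof
      fix b assume "b \<in> B0" then show "b \<in> Inter ` {F. finite F \<and> F \<subseteq> B0}"
        by (intro image_eqI[of _ _ "{b}"]) auto
    qed
    then have "sigma_sets UNIV B0 \<subseteq> sigma_sets UNIV G" by (rule sigma_sets_mono')
    then show "sets borel \<subseteq> sigma_sets UNIV G"
      using arg_cong[OF borel_eq_countable_basis[OF B0], of sets] by (simp add: sets_measure_of)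
  qed
  define S where "S = {(c, f). Re c \<in> \<rat> \<and> Im c \<in> \<rat> \<and>
      f \<in> (\<lambda>(A, n). to_L2 (A \<inter> cball 0 (real n)) (\<lambda>_. 1)) ` (G \<times> (UNIV::nat set))}"
  define ev where "ev xs = (\<Sum>(c, f)\<leftarrow>xs. c *\<^sub>C f)" for xs :: "(complex \<times> 'a L2) list"
  define D where "D = ev ` lists S"
  have "countable S"
  proof -
    have "countable {c. Re c \<in> \<rat> \<and> Im c \<in> \<rat>}"
    proof (rule countable_subset)
      show "{c. Re c \<in> \<rat> \<and> Im c \<in> \<rat>} \<subseteq> (\<lambda>(a, b). Complex a b) ` (\<rat> \<times> \<rat>)"
        by (auto simp: image_iff complex_eq_iff intro!: bexI)
      show "countable ((\<lambda>(a, b). Complex a b) ` (\<rat> \<times> \<rat>))"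
        using countable_rat by auto
    qed
    moreover have "S = {c. Re c \<in> \<rat> \<and> Im c \<in> \<rat>} \<times> (\<lambda>(A, n). to_L2 (A \<inter> cball 0 (real n)) (\<lambda>_. 1)) ` (G \<times> (UNIV::nat set))"
      by (auto simp: S_def)
    ultimately show ?thesis using \<open>countable G\<close> by simp
  qed
  then have "countable D" unfolding D_def by auto
  have Dadd: "x + y \<in> D" if xy: "x \<in> D" "y \<in> D" for x y
  proof -
    obtain xs ys where "xs \<in> lists S" "ys \<in> lists S" "x = ev xs" "y = ev ys"
      using xy by (auto simp: D_def)
    then show ?thesis unfolding D_def by (intro image_eqI[of _ _ "xs @ ys"]) (auto simp: ev_def)
  qed
  have D0: "0 \<in> D" unfolding D_def by (rule image_eqI[of _ _ "[]"]) (auto simp: ev_def)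
  have cadd: "x + y \<in> closure D" if xy: "x \<in> closure D" "y \<in> closure D" for x y
  proof -
    obtain X Y where XY: "\<And>n. X n \<in> D" "X \<longlonglongrightarrow> x" "\<And>n. Y n \<in> D" "Y \<longlonglongrightarrow> y"
      using xy unfolding closure_sequential by metis
    show ?thesis unfolding closure_sequential
      using Dadd XY by (intro exI[of _ "\<lambda>n. X n + Y n"]) (auto intro: tendsto_add)
  qed
  have gen: "c *\<^sub>C f \<in> closure D" if f: "f \<in> (\<lambda>(A, n). to_L2 (A \<inter> cball 0 (real n)) (\<lambda>_. 1)) ` (G \<times> (UNIV::nat set))" for c f
  proof -
    have rat: "\<exists>q. (\<forall>n::nat. q n \<in> \<rat>) \<and> q \<longlonglongrightarrow> r" for r :: real
    proof -
      have "\<exists>x\<in>\<rat>. r < x \<and> x < r + 1 / real (Suc n)" for n by (rule Rats_dense_in_real) simp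
      then obtain q where q: "\<And>n. q n \<in> \<rat> \<and> r < q n \<and> q n < r + 1 / real (Suc n)" by metis
      have "q \<longlonglongrightarrow> r"
      proof (rule tendsto_sandwich[of "\<lambda>_. r" _ _ "\<lambda>n. r + 1 / real (Suc n)"])
        show "(\<lambda>n. r + 1 / real (Suc n)) \<longlonglongrightarrow> r"
          using tendsto_add[OF tendsto_const[of r] LIMSEQ_inverse_real_of_nat] by (simp add: inverse_eq_divide)
        show "(\<lambda>_::nat. r) \<longlonglongrightarrow> r" by simp
        show "\<forall>\<^sub>F n in sequentially. r \<le> q n" "\<forall>\<^sub>F n in sequentially. q n \<le> r + 1 / real (Suc n)"
          using q by (intro always_eventually allI less_imp_le; blast)+
      qed
      then show ?thesis using q by blast
    qed
    obtain p q where pq: "\<And>n::nat. p n \<in> \<rat>" "p \<longlonglongrightarrow> Re c" "\<And>n::nat. q n \<in> \<rat>" "q \<longlonglongrightarrow> Im c"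
      using rat by metis
    have "(\<lambda>n. Complex (p n) (q n)) \<longlonglongrightarrow> c"
      using pq by (simp add: tendsto_complex_iff)
    then have "(\<lambda>n. Complex (p n) (q n) *\<^sub>C f) \<longlonglongrightarrow> c *\<^sub>C f"
      by (rule scaleC.tendsto[OF _ tendsto_const])
    moreover have "Complex (p n) (q n) *\<^sub>C f \<in> D" for n
      unfolding D_def using pq f by (intro image_eqI[of _ _ "[(Complex (p n) (q n), f)]"]) (auto simp: ev_def S_def)
    ultimately show ?thesis
      unfolding closure_sequential by (intro exI[of _ "\<lambda>n. Complex (p n) (q n) *\<^sub>C f"]) simp
  qed
  have cscaleD: "c *\<^sub>C x \<in> closure D" if xD: "x \<in> D" for c x
  proof -
    obtain xs where "xs \<in> lists S" "x = ev xs" using xD by (auto simp: D_def)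
    have "c *\<^sub>C ev xs \<in> closure D" using \<open>xs \<in> lists S\<close>
    proof (induction xs)
      case Nil
      then show ?case using D0 closure_subset by (auto simp: ev_def scaleC.zero_right)
    next
      case (Cons a xs)
      obtain d f where a: "a = (d, f)" by (cases a)
      have "c *\<^sub>C ev (a # xs) = (c * d) *\<^sub>C f + c *\<^sub>C ev xs"
        by (simp add: ev_def a scaleC_add_right scaleC_scaleC)
      then show ?case using cadd[OF gen Cons.IH] Cons.hyps(1) by (auto simp: a S_def)
    qed
    then show ?thesis using \<open>x = ev xs\<close> by simp
  qed
  have cscale: "c *\<^sub>C x \<in> closure D" if xc: "x \<in> closure D" for c x
  proof -
    obtain X where X: "\<And>n. X n \<in> D" "X \<longlonglongrightarrow> x" using xc unfolding closure_sequential by metis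
    have "(\<lambda>n. c *\<^sub>C X n) \<longlonglongrightarrow> c *\<^sub>C x" by (rule scaleC.tendsto[OF tendsto_const X(2)])
    then show ?thesis by (rule closed_sequentially[OF closed_closure, rotated]) (rule cscaleD[OF X(1)])
  qed
  have "closure D = UNIV"
  proof (rule L2_closed_subspace_UNIV[OF closed_closure _ cadd cscale IG sG UG])
    show "0 \<in> closure D" using D0 closure_subset by auto
    fix A n assume "A \<in> G"
    then show "to_L2 (A \<inter> cball 0 (real n)) (\<lambda>_. 1) \<in> closure D"
      using gen[of _ 1] by auto
  qed
  then show "\<exists>B::'a L2 set set. countable B \<and> open = generate_topology B"
    using \<open>countable D\<close> by (intro countable_dense_subbasis[of D]) (metis UNIV_I closure_approachable)+
qed

section \<open>Orthonormal sequences and the cosine basis\<close>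

lemma cinner_zero_right_all: "(\<And>y. cinner x y = 0) \<Longrightarrow> x = (0::'a::complex_hilbert)"
  using cinner_self[of x] by simp

lemma cinner_sum_left: "cinner (\<Sum>i\<in>I. f i) y = (\<Sum>i\<in>I. cinner (f i) (y::'a::complex_hilbert))"
  by (rule cinner.sum_left)

lemma orthonormal_norm_sum:
  fixes e :: "nat \<Rightarrow> 'a::complex_hilbert"
  assumes on: "\<And>i j. cinner (e i) (e j) = (if i = j then 1 else 0)" and "finite I"
  shows "(norm (\<Sum>i\<in>I. c i *\<^sub>C e i))\<^sup>2 = (\<Sum>i\<in>I. (cmod (c i))\<^sup>2)"
proof -
  have "complex_of_real ((norm (\<Sum>i\<in>I. c i *\<^sub>C e i))\<^sup>2) = cinner (\<Sum>i\<in>I. c i *\<^sub>C e i) (\<Sum>i\<in>I. c i *\<^sub>C e i)"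
    by (simp only: cinner_self)
  also have "\<dots> = (\<Sum>i\<in>I. \<Sum>j\<in>I. c i * (cnj (c j) * cinner (e i) (e j)))"
    by (simp add: cinner.sum_left cinner.sum_right cinner_scaleC_left cinner_scaleC_right sum_distrib_left)
      (subst sum.swap, simp add: mult.left_commute)
  also have "\<dots> = (\<Sum>i\<in>I. \<Sum>j\<in>I. if i = j then c i * cnj (c i) else 0)"
    unfolding on by (intro sum.cong refl) auto
  also have "\<dots> = (\<Sum>i\<in>I. c i * cnj (c i))"
    using assms(2) by simp
  also have "\<dots> = complex_of_real (\<Sum>i\<in>I. (cmod (c i))\<^sup>2)"
    unfolding of_real_sum complex_norm_square ..
  finally show ?thesis using of_real_eq_iff by blast
qed

lemma orthonormal_summable:
  fixes e :: "nat \<Rightarrow> 'a::complex_hilbert"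
  assumes on: "\<And>i j. cinner (e i) (e j) = (if i = j then 1 else 0)"
    and s: "summable (\<lambda>i. (cmod (c i))\<^sup>2)"
  shows "summable (\<lambda>i. c i *\<^sub>C e i)"
  unfolding summable_Cauchy
proof (intro allI impI)
  fix \<epsilon> :: real assume "\<epsilon> > 0"
  then obtain N where N: "\<And>m n. m \<ge> N \<Longrightarrow> norm (\<Sum>i=m..<n. (cmod (c i))\<^sup>2) < \<epsilon>\<^sup>2"
    using s[unfolded summable_Cauchy] by (metis zero_less_power)
  have "norm (\<Sum>i=m..<n. c i *\<^sub>C e i) < \<epsilon>" if "m \<ge> N" for m n
  proof -
    have "(norm (\<Sum>i=m..<n. c i *\<^sub>C e i))\<^sup>2 < \<epsilon>\<^sup>2"
      using N[OF that, of n] orthonormal_norm_sum[OF on, of "{m..<n}" c] by simp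
    then show ?thesis using \<open>\<epsilon> > 0\<close> by (simp add: power_less_imp_less_base)
  qed
  then show "\<exists>N. \<forall>m\<ge>N. \<forall>n. norm (sum (\<lambda>i. c i *\<^sub>C e i) {m..<n}) < \<epsilon>" by blast
qed

lemma cinner_suminf_left:
  assumes "f sums (x::'a::complex_hilbert)"
  shows "(\<lambda>i. cinner (f i) y) sums cinner x y"
  by (rule bounded_linear.sums[OF cinner.bounded_linear_left assms])

lemma orthonormal_coefficient:
  fixes e :: "nat \<Rightarrow> 'a::complex_hilbert"
  assumes on: "\<And>i j. cinner (e i) (e j) = (if i = j then 1 else 0)"
    and s: "(\<lambda>i. c i *\<^sub>C e i) sums x"
  shows "cinner x (e k) = c k"
proof -
  have "(\<lambda>i. cinner (c i *\<^sub>C e i) (e k)) sums cinner x (e k)" by (rule cinner_suminf_left[OF s])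
  also have "(\<lambda>i. cinner (c i *\<^sub>C e i) (e k)) = (\<lambda>i. if i = k then c i else 0)"
    by (auto simp: cinner_scaleC_left on)
  finally have "(\<lambda>i. if i = k then c i else 0) sums cinner x (e k)" .
  then show ?thesis using sums_single[of k c] sums_unique2 by blast
qed

lemma orthonormal_Bessel:
  fixes e :: "nat \<Rightarrow> 'a::complex_hilbert"
  assumes on: "\<And>i j. cinner (e i) (e j) = (if i = j then 1 else 0)"
  shows "summable (\<lambda>i. (cmod (cinner x (e i)))\<^sup>2)"
proof (rule summableI_nonneg_bounded)
  fix n
  define y where "y = (\<Sum>i<n. cinner x (e i) *\<^sub>C e i)"
  define s where "s = (\<Sum>i<n. (cmod (cinner x (e i)))\<^sup>2)"
  have ny: "(norm y)\<^sup>2 = s" unfolding y_def s_def by (rule orthonormal_norm_sum[OF on]) simp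
  have "cinner x y = (\<Sum>i<n. complex_of_real ((cmod (cinner x (e i)))\<^sup>2))"
    unfolding y_def cinner.sum_right cinner_scaleC_right complex_norm_square by (simp add: mult.commute)
  then have "inner x y = s" by (simp add: inner_Re_cinner s_def)
  then have "s \<le> norm x * norm y" using norm_cauchy_schwarz[of x y] by simp
  then have "(norm y)\<^sup>2 \<le> norm x * norm y" using ny by simp
  then have "norm y \<le> norm x" by (cases "norm y = 0") (auto simp: power2_eq_square)
  then show "s \<le> (norm x)\<^sup>2" using ny by (metis norm_ge_zero power_mono)
qed simp

lemma orthonormal_total_sums:
  fixes e :: "nat \<Rightarrow> 'a::complex_hilbert"
  assumes on: "\<And>i j. cinner (e i) (e j) = (if i = j then 1 else 0)"
    and tot: "\<And>x. (\<And>k. cinner x (e k) = 0) \<Longrightarrow> x = 0"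
  shows "(\<lambda>i. cinner x (e i) *\<^sub>C e i) sums x"
proof -
  obtain y where y: "(\<lambda>i. cinner x (e i) *\<^sub>C e i) sums y"
    using orthonormal_summable[OF on orthonormal_Bessel[OF on]] by (auto simp: summable_def)
  have "cinner (x - y) (e k) = 0" for k
    using orthonormal_coefficient[OF on y] by (simp add: cinner.diff_left)
  then have "x - y = 0" by (rule tot)
  then show ?thesis using y by simp
qed

lemma orthonormal_Parseval:
  fixes e :: "nat \<Rightarrow> 'a::complex_hilbert"
  assumes on: "\<And>i j. cinner (e i) (e j) = (if i = j then 1 else 0)"
    and tot: "\<And>x. (\<And>k. cinner x (e k) = 0) \<Longrightarrow> x = 0"
  shows "(\<lambda>i. cinner x (e i) * cnj (cinner y (e i))) sums cinner x y"
proof -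
  have "cinner (cinner x (e i) *\<^sub>C e i) y = cinner x (e i) * cnj (cinner y (e i))" for i
    unfolding cinner_scaleC_left by (subst (2) cinner_commute) simp
  then show ?thesis using cinner_suminf_left[OF orthonormal_total_sums[OF on tot], of x y] by simp
qed

definition L2_on :: "'a::euclidean_space set \<Rightarrow> 'a L2 set" where
  "L2_on S = {f. AE x in lborel. x \<notin> S \<longrightarrow> rep_L2 f x = 0}"

lemma sqint_restrict:
  fixes f :: "'a::euclidean_space \<Rightarrow> complex"
  assumes "f \<in> sqint UNIV" "S \<in> sets borel" 
  shows "(\<lambda>x. indicator S x *\<^sub>R f x) \<in> sqint UNIV"
proof -
  have [measurable]: "f \<in> borel_measurable borel" "S \<in> sets borel" using assms by (auto simp: sqint_UNIV)
  have "integrable lborel (\<lambda>x. (norm (indicator S x *\<^sub>R f x))\<^sup>2)"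
    by (rule Bochner_Integration.integrable_bound[of lborel "\<lambda>x. (norm (f x))\<^sup>2"])
      (use assms in \<open>auto simp: sqint_UNIV indicator_def\<close>)
  then show ?thesis by (simp add: sqint_UNIV)
qed

lemma sqint_compact:
  fixes f :: "'a::euclidean_space \<Rightarrow> complex"
  assumes "continuous_on S f" "compact S"
  shows "f \<in> sqint S"
proof -
  have "set_integrable lborel S (\<lambda>x. (norm (f x))\<^sup>2)"
    unfolding set_integrable_def
    by (rule borel_integrable_compact) (use assms in \<open>auto intro!: continuous_intros\<close>)
  moreover have "set_borel_measurable lborel S f"
    using borel_integrable_compact[OF assms(2,1)] unfolding set_borel_measurable_def by simp
  ultimately show ?thesis by (simp add: sqint_def)
qed

lemma rep_to_L2: "f \<in> sqint S \<Longrightarrow> AE x in lborel. rep_L2 (to_L2 S f) x = indicator S x *\<^sub>R f x"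
  unfolding to_L2_def by (rule rep_abs_L2) (simp add: indicator_in_sqint)

lemma to_L2_in_L2_on: "f \<in> sqint S \<Longrightarrow> to_L2 S f \<in> L2_on S"
  unfolding L2_on_def using rep_to_L2[of f S] by auto

lemma cinner_to_L2: 
  assumes "g \<in> sqint S" 
  shows "cinner f (to_L2 S g) = (LINT x|lborel. rep_L2 f x * cnj (indicator S x *\<^sub>R g x))"
proof -
  have [measurable]: "cnj \<in> borel_measurable borel"
    by (intro borel_measurable_continuous_onI continuous_intros)
  define h where "h = (\<lambda>x. indicator S x *\<^sub>R g x)"
  have [measurable]: "h \<in> borel_measurable borel"
    using assms unfolding sqint_def set_borel_measurable_def h_def by simp
  show ?thesis unfolding cinner_L2_def L2_cinner_def fun_cong[OF h_def, symmetric]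
    by (rule integral_cong_AE; measurable?) (use rep_to_L2[OF assms] in eventually_elim, simp add: h_def)
qed

lemma sqint_rep: "S \<in> sets borel \<Longrightarrow> rep_L2 f \<in> sqint S"
  using sqint_restrict[OF rep_L2_sqint] by (simp add: indicator_in_sqint)

lemma L2_on_iff_cinner:
  assumes "S \<in> sets borel"
  shows "f \<in> L2_on S \<longleftrightarrow> (\<forall>g. cinner f (to_L2 (- S) (rep_L2 g)) = 0)"
proof
  assume f: "f \<in> L2_on S"
  have [measurable]: "cnj \<in> borel_measurable borel" "- S \<in> sets borel"
    using assms by (auto intro!: borel_measurable_continuous_onI continuous_intros)
  have "cinner f (to_L2 (- S) (rep_L2 g)) = 0" for g
    unfolding cinner_to_L2[OF sqint_rep[OF \<open>- S \<in> sets borel\<close>]]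
    by (rule integral_eq_zero_AE) 
      (use f in \<open>auto simp: L2_on_def indicator_def elim!: eventually_mono\<close>)
  then show "\<forall>g. cinner f (to_L2 (- S) (rep_L2 g)) = 0" by simp
next
  assume "\<forall>g. cinner f (to_L2 (- S) (rep_L2 g)) = 0"
  then have "cinner f (to_L2 (- S) (rep_L2 f)) = 0" by simp
  then have "(LINT x|lborel. rep_L2 f x * cnj (indicator (- S) x *\<^sub>R rep_L2 f x)) = 0"
    by (subst (asm) cinner_to_L2[OF sqint_rep]) (use assms in auto)
  also have "(LINT x|lborel. rep_L2 f x * cnj (indicator (- S) x *\<^sub>R rep_L2 f x)) = 
    (LINT x|lborel. complex_of_real ((norm (indicator (- S) x *\<^sub>R rep_L2 f x))\<^sup>2))"
    by (intro Bochner_Integration.integral_cong refl, unfold complex_norm_square) (auto simp: indicator_def)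
  finally have "(LINT x|lborel. (norm (indicator (- S) x *\<^sub>R rep_L2 f x))\<^sup>2) = 0"
    unfolding integral_complex_of_real by simp
  then have "AE x in lborel. (norm (indicator (- S) x *\<^sub>R rep_L2 f x))\<^sup>2 = 0"
    using sqint_restrict[OF rep_L2_sqint, of "- S" f] assms
    by (subst (asm) integral_nonneg_eq_0_iff_AE) (auto simp: sqint_UNIV)
  then show "f \<in> L2_on S" unfolding L2_on_def
    by (auto elim!: eventually_mono simp: indicator_def)
qed

lemma to_L2_add: "f \<in> sqint S \<Longrightarrow> g \<in> sqint S \<Longrightarrow> to_L2 S (\<lambda>x. f x + g x) = to_L2 S f + to_L2 S g"
  unfolding to_L2_def scaleR_add_right by (rule abs_L2_add) (auto simp: indicator_in_sqint)

lemma to_L2_diff: "f \<in> sqint S \<Longrightarrow> g \<in> sqint S \<Longrightarrow> to_L2 S (\<lambda>x. f x - g x) = to_L2 S f - to_L2 S g"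
  unfolding to_L2_def scaleR_diff_right by (rule abs_L2_diff) (auto simp: indicator_in_sqint)

lemma to_L2_scale: "f \<in> sqint S \<Longrightarrow> to_L2 S (\<lambda>x. c * f x) = c *\<^sub>C to_L2 S f"
  unfolding to_L2_def mult_scaleR_right[symmetric] by (rule abs_L2_scaleC) (auto simp: indicator_in_sqint)

definition cos_basis :: "nat \<Rightarrow> real L2" where
  "cos_basis k = to_L2 {0..pi} (\<lambda>x. complex_of_real (sqrt (2 / pi) * cos (real k * x)))"

lemma cos_int_integral:
  "(LINT x|lborel. indicator {0..pi} x *\<^sub>R complex_of_real (cos (of_int m * x))) = (if m = 0 then of_real pi else 0)"
proof (cases "m = 0")
  case True
  have "(LINT x|lborel. indicator {0..pi} x *\<^sub>R complex_of_real 1) = complex_of_real pi - complex_of_real 0"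
    by (rule integral_FTC_atLeastAtMost) (auto intro!: derivative_eq_intros continuous_intros)
  then show ?thesis using True by simp
next
  case False
  have "(LINT x|lborel. indicator {0..pi} x *\<^sub>R complex_of_real (cos (of_int m * x))) = 
     complex_of_real (sin (of_int m * pi) / of_int m) - complex_of_real (sin (of_int m * 0) / of_int m)"
    by (rule integral_FTC_atLeastAtMost)
      (use False in \<open>auto intro!: derivative_eq_intros continuous_intros has_vector_derivative_of_real simp: has_real_derivative_iff_has_vector_derivative[symmetric]\<close>)
  moreover have "sin (of_int m * pi) = 0" by (simp add: sin_int_times_real mult.commute sin_zero_iff_int2)
  ultimately show ?thesis using False by simp
qed

lemma cos_sqint: "(\<lambda>x. complex_of_real (c * cos (a * x))) \<in> sqint {0..pi}"
  by (rule sqint_compact) (auto intro!: continuous_intros)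

lemma cos_basis_cinner:
  "cinner (cos_basis j) (cos_basis k) = (if j = k then if j = 0 then 2 else 1 else 0)"
proof -
  have [measurable]: "cnj \<in> borel_measurable borel"
    by (intro borel_measurable_continuous_onI continuous_intros)
  let ?I = "\<lambda>m x. indicator {0..pi} x *\<^sub>R complex_of_real (cos (of_int m * x))"
  have int: "integrable lborel (?I m)" for m
    by (rule borel_integrable_compact) (auto intro!: continuous_intros)
  have "cinner (cos_basis j) (cos_basis k) = (LINT x|lborel. of_real (1/pi) * ?I (int j - int k) x + of_real (1/pi) * ?I (int j + int k) x)"
    unfolding cos_basis_def[of k] cinner_to_L2[OF cos_sqint]
  proof (rule integral_cong_AE; measurable?)
    show "AE x in lborel. rep_L2 (cos_basis j) x * cnj (indicator {0..pi} x *\<^sub>R complex_of_real (sqrt (2 / pi) * cos (real k * x))) =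
       of_real (1/pi) * ?I (int j - int k) x + of_real (1/pi) * ?I (int j + int k) x"
      using rep_to_L2[OF cos_sqint, of "sqrt (2/pi)" "real j"]
    proof eventually_elim
      case (elim x)
      have "sqrt (2/pi) * cos (real j * x) * (sqrt (2/pi) * cos (real k * x)) = 
        (2/pi) * (cos (real j * x) * cos (real k * x))"
        by (simp add: algebra_simps)
      also have "\<dots> = (1/pi) * cos (of_int (int j - int k) * x) + (1/pi) * cos (of_int (int j + int k) * x)"
        unfolding cos_times_cos by (simp add: algebra_simps add_divide_distrib)
      finally have *: "sqrt (2/pi) * cos (real j * x) * (sqrt (2/pi) * cos (real k * x)) = 
        (1/pi) * cos (of_int (int j - int k) * x) + (1/pi) * cos (of_int (int j + int k) * x)" .
      show ?case
      proof (cases "x \<in> {0..pi}")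
        case True
        then show ?thesis unfolding cos_basis_def elim using arg_cong[OF *, of complex_of_real] by simp
      next
        case False
        then have "indicator {0..pi} x = (0::real)" by (simp add: indicator_def)
        then show ?thesis by simp
      qed
    qed
  qed
  also have "\<dots> = of_real (1/pi) * (if int j - int k = 0 then of_real pi else 0) + of_real (1/pi) * (if int j + int k = 0 then of_real pi else 0)"
    by (subst Bochner_Integration.integral_add) (use int in \<open>simp_all only: integral_mult_right_zero cos_int_integral integrable_mult_right\<close>)
  also have "\<dots> = (if j = k then if j = 0 then 2 else 1 else 0)" by auto
  finally show ?thesis .
qed

inductive_set cos_alg :: "(real \<Rightarrow> real) set" where
  base: "(\<lambda>x. cos (real k * x)) \<in> cos_alg"
| add: "f \<in> cos_alg \<Longrightarrow> g \<in> cos_alg \<Longrightarrow> (\<lambda>x. f x + g x) \<in> cos_alg"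
| scale: "f \<in> cos_alg \<Longrightarrow> (\<lambda>x. c * f x) \<in> cos_alg"

lemma cos_alg_continuous: "f \<in> cos_alg \<Longrightarrow> continuous_on A f"
  by (induction rule: cos_alg.induct) (auto intro!: continuous_intros)

lemma cos_alg_mult:
  assumes "f \<in> cos_alg" "g \<in> cos_alg"
  shows "(\<lambda>x. f x * g x) \<in> cos_alg"
  using assms(1)
proof (induction rule: cos_alg.induct)
  case (base j)
  show ?case using assms(2)
  proof (induction rule: cos_alg.induct)
    case (base k)
    define m where "m = nat \<bar>int j - int k\<bar>"
    have m: "cos (real m * x) = cos (real j * x - real k * x)" for x
    proof (cases "j \<ge> k")
      case True
      then have "real m = real j - real k" by (simp add: m_def of_nat_diff)
      then have "real m * x = real j * x - real k * x" by (simp only: left_diff_distrib)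
      then show ?thesis by simp
    next
      case False
      then have "real m = real k - real j" by (simp add: m_def of_nat_diff)
      then have "real m * x = - (real j * x - real k * x)" by (simp only: left_diff_distrib minus_diff_eq)
      then show ?thesis by (metis cos_minus)
    qed
    have "(\<lambda>x. (1/2) * (cos (real m * x) + cos (real (j + k) * x))) \<in> cos_alg"
      by (intro cos_alg.intros)
    then show ?case by (simp add: m cos_times_cos distrib_right)
  next
    case (add f g)
    then show ?case using cos_alg.add[OF add.IH] by (simp add: distrib_left)
  next
    case (scale f c)
    then show ?case using cos_alg.scale[OF scale.IH, of c] by (simp add: algebra_simps)
  qed
next
  case (add f g)
  then show ?case using cos_alg.add[OF add.IH] by (simp add: distrib_right)
next
  case (scale f c)
  then show ?case using cos_alg.scale[OF scale.IH, of c] by (simp add: algebra_simps)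
qed

interpretation cos_ring: function_ring_on cos_alg "{0..pi}"
proof
  show "(\<lambda>_. c) \<in> cos_alg" for c
    using cos_alg.scale[OF cos_alg.base[of 0], of c] by simp
  fix x y :: real assume "x \<in> {0..pi}" "y \<in> {0..pi}" "x \<noteq> y"
  then show "\<exists>f\<in>cos_alg. f x \<noteq> f y"
    using cos_inj_pi[of x y] cos_alg.base[of 1] by (intro bexI[of _ "\<lambda>x. cos (real 1 * x)"]) auto
qed (auto intro: cos_alg_continuous cos_alg.add cos_alg_mult)

lemma norm_to_L2_le:
  assumes "continuous_on {0..pi} g" "\<And>x. x \<in> {0..pi} \<Longrightarrow> cmod (g x) \<le> b" "b \<ge> 0"
  shows "norm (to_L2 {0..pi} g) \<le> b * sqrt pi"
proof -
  have sq: "(\<lambda>x. indicator {0..pi} x *\<^sub>R g x) \<in> sqint UNIV"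
    using sqint_compact[OF assms(1)] by (simp add: indicator_in_sqint)
  have "(norm (to_L2 {0..pi} g))\<^sup>2 = (LINT x|lborel. (norm (indicator {0..pi} x *\<^sub>R g x))\<^sup>2)"
    unfolding to_L2_def by (rule norm_abs_L2[OF sq])
  also have "\<dots> \<le> (LINT x|lborel. b\<^sup>2 * indicator {0..pi} x)"
  proof (rule integral_mono)
    show "integrable lborel (\<lambda>x. (norm (indicator {0..pi} x *\<^sub>R g x))\<^sup>2)" using sq by (simp add: sqint_UNIV)
    show "integrable lborel (\<lambda>x. b\<^sup>2 * indicator {0..pi} x)" by simp
    show "(norm (indicator {0..pi} x *\<^sub>R g x))\<^sup>2 \<le> b\<^sup>2 * indicator {0..pi} x" for x
      using assms(2)[of x] assms(3) by (auto simp: indicator_def intro!: power_mono)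
  qed
  also have "\<dots> = (b * sqrt pi)\<^sup>2" by (simp add: power_mult_distrib)
  finally show ?thesis by (rule power2_le_imp_le) (use assms(3) in simp)
qed

lemma cos_basis_total:
  assumes f: "f \<in> L2_on {0..pi}" and orth: "\<And>k. cinner f (cos_basis k) = 0"
  shows "f = 0"
proof -
  have alg: "cinner f (to_L2 {0..pi} (\<lambda>x. complex_of_real (r x))) = 0" if "r \<in> cos_alg" for r
    using that
  proof (induction rule: cos_alg.induct)
    case (base k)
    have "to_L2 {0..pi} (\<lambda>x. complex_of_real (1 * cos (real k * x))) = of_real (1 / sqrt (2/pi)) *\<^sub>C cos_basis k"
      unfolding cos_basis_def to_L2_scale[OF cos_sqint, symmetric] by simp
    then show ?case by (simp add: cinner_scaleC_right orth)
  next
    case (add f g)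
    have "(\<lambda>x. complex_of_real (f x)) \<in> sqint {0..pi}" "(\<lambda>x. complex_of_real (g x)) \<in> sqint {0..pi}"
      using add.hyps by (auto intro!: sqint_compact continuous_intros cos_alg_continuous)
    then show ?case using add.IH by (simp add: to_L2_add cinner.add_right)
  next
    case (scale f c)
    have "(\<lambda>x. complex_of_real (f x)) \<in> sqint {0..pi}"
      using scale.hyps by (auto intro!: sqint_compact continuous_intros cos_alg_continuous)
    then show ?case using scale.IH by (simp add: to_L2_scale cinner_scaleC_right)
  qed
  have cont: "cinner f (to_L2 {0..pi} (\<lambda>x. complex_of_real (g x))) = 0" if g: "continuous_on {0..pi} g" for g
  proof -
    have "cmod (cinner f (to_L2 {0..pi} (\<lambda>x. complex_of_real (g x)))) \<le> e" if "e > 0" for e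
    proof -
      define d where "d = e / (norm f * sqrt pi + 1)"
      have pos: "norm f * sqrt pi + 1 > 0" by (smt (verit) mult_nonneg_nonneg norm_ge_zero real_sqrt_ge_zero pi_ge_zero)
      have "d > 0" using \<open>e > 0\<close> pos by (simp add: d_def)
      obtain r where r: "r \<in> cos_alg" "\<forall>x\<in>{0..pi}. \<bar>g x - r x\<bar> < d"
        using cos_ring.Stone_Weierstrass_basic[OF g \<open>d > 0\<close>] by blast
      have cr: "continuous_on {0..pi} r" by (rule cos_alg_continuous[OF r(1)])
      have "to_L2 {0..pi} (\<lambda>x. complex_of_real (g x)) = to_L2 {0..pi} (\<lambda>x. complex_of_real (g x) - complex_of_real (r x)) 
          + to_L2 {0..pi} (\<lambda>x. complex_of_real (r x))"
        by (subst to_L2_diff) (use g cr in \<open>auto intro!: sqint_compact continuous_intros\<close>)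
      then have "cmod (cinner f (to_L2 {0..pi} (\<lambda>x. complex_of_real (g x)))) = 
        cmod (cinner f (to_L2 {0..pi} (\<lambda>x. complex_of_real (g x) - complex_of_real (r x))))"
        by (simp add: cinner.add_right alg[OF r(1)])
      also have "\<dots> \<le> norm f * norm (to_L2 {0..pi} (\<lambda>x. complex_of_real (g x) - complex_of_real (r x)))"
        by (rule norm_cinner_le)
      also have "\<dots> \<le> norm f * (d * sqrt pi)"
        by (intro mult_left_mono norm_to_L2_le)
          (use g cr r(2) \<open>d > 0\<close> in \<open>auto intro!: continuous_intros simp flip: of_real_diff intro: less_imp_le\<close>)
      also have "\<dots> = d * (norm f * sqrt pi)" by simp
      also have "\<dots> \<le> d * (norm f * sqrt pi + 1)" using \<open>d > 0\<close> by (intro mult_left_mono) auto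
      also have "\<dots> = e" using pos by (simp add: d_def)
      finally show ?thesis .
    qed
    then have "cmod (cinner f (to_L2 {0..pi} (\<lambda>x. complex_of_real (g x)))) \<le> 0"
      by (meson dense_ge)
    then show ?thesis by simp
  qed
  define V where "V = {g. cinner f g = 0}"
  have "V = UNIV"
  proof (rule L2_closed_subspace_UNIV[where G = "Collect closed"])
    have "V = (\<lambda>g. cinner f g) -` {0}" by (auto simp: V_def)
    then show "closed V" 
      by (simp add: closed_vimage linear_continuous_on[OF cinner.bounded_linear_right])
    show "0 \<in> V" by (simp add: V_def cinner.zero_right)
    show "g + h \<in> V" if "g \<in> V" "h \<in> V" for g h using that by (simp add: V_def cinner.add_right)
    show "c *\<^sub>C g \<in> V" if "g \<in> V" for c g using that by (simp add: V_def cinner_scaleC_right)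
    show "Int_stable (Collect closed)" by (auto intro: Int_stableI)
    show "sigma_sets UNIV (Collect closed) = sets (borel :: real measure)"
      by (subst borel_eq_closed) (simp add: sets_measure_of)
    show "UNIV \<in> Collect closed" by simp
    fix A :: "real set" and n assume "A \<in> Collect closed"
    define B where "B = A \<inter> cball 0 (real n)"
    define K where "K = B \<inter> {0..pi}"
    have "closed B" using \<open>A \<in> Collect closed\<close> by (auto simp: B_def)
    have "closed K" using \<open>closed B\<close> by (auto simp: K_def)
    have sq: "(\<lambda>x. indicat_real S x *\<^sub>R (1::complex)) \<in> sqint UNIV" if "closed S" "bounded S" for S :: "real set"
      using that by (intro sqint_indicator) auto
    have bB: "bounded B" by (auto simp: B_def intro: bounded_subset[OF bounded_cball])
    have bK: "bounded K" using bB by (auto simp: K_def intro: bounded_subset)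
    have sB: "(\<lambda>_. 1::complex) \<in> sqint B" and sK: "(\<lambda>_. 1::complex) \<in> sqint K"
      by (rule iffD1[OF indicator_in_sqint sq[OF \<open>closed B\<close> bB]])
        (rule iffD1[OF indicator_in_sqint sq[OF \<open>closed K\<close> bK]])
    have [measurable]: "B \<in> sets borel" "K \<in> sets borel" using \<open>closed B\<close> \<open>closed K\<close> by auto
    have eq: "cinner f (to_L2 B (\<lambda>_. 1)) = cinner f (to_L2 K (\<lambda>_. 1))"
      unfolding cinner_to_L2[OF sB] cinner_to_L2[OF sK]
    proof (rule integral_cong_AE; measurable?)
      show "AE x in lborel. rep_L2 f x * cnj (indicat_real B x *\<^sub>R 1) = rep_L2 f x * cnj (indicat_real K x *\<^sub>R 1)"
        using f unfolding L2_on_def mem_Collect_eq by eventually_elim (auto simp: K_def indicator_def)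
    qed simp_all
    have "cinner f (to_L2 K (\<lambda>_. 1)) = 0"
    proof (cases "K = {}")
      case True
      then have "to_L2 K (\<lambda>_. 1) = 0" by (simp add: to_L2_def zero_L2_def)
      then show ?thesis by (simp add: cinner.zero_right)
    next
      case False
      define g where "g m x = max 0 (1 - real m * infdist x K)" for m x
      have gc: "continuous_on {0..pi} (g m)" for m unfolding g_def by (intro continuous_intros)
      have g01: "0 \<le> g m x" "g m x \<le> 1" for m x by (auto simp: g_def infdist_nonneg)
      have gs: "(\<lambda>x. complex_of_real (g m x)) \<in> sqint {0..pi}" for m
        using gc by (auto intro!: sqint_compact continuous_intros)
      have lim: "(\<lambda>m. g m x) \<longlonglongrightarrow> indicator K x" for x
      proof (cases "x \<in> K")
        case True then show ?thesis by (simp add: g_def)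
      next
        case nx: False
        then have d: "infdist x K > 0" using \<open>closed K\<close> False by (metis in_closed_iff_infdist_zero infdist_nonneg order_le_less)
        have "eventually (\<lambda>m. 0 = g m x) sequentially"
        proof (rule eventually_sequentiallyI[of "nat \<lceil>1 / infdist x K\<rceil>"])
          fix m assume "nat \<lceil>1 / infdist x K\<rceil> \<le> m"
          then have "1 / infdist x K \<le> real m" by (simp add: nat_le_iff ceiling_le_iff)
          then have "1 \<le> real m * infdist x K" using d by (simp add: field_simps)
          then show "0 = g m x" by (simp add: g_def)
        qed
        then show ?thesis using nx by (simp add: tendsto_eventually eventually_mono)
      qed
      have "(\<lambda>m. abs_L2 (\<lambda>x. indicat_real {0..pi} x *\<^sub>R complex_of_real (g m x))) \<longlonglongrightarrow> 
        abs_L2 (\<lambda>x. indicat_real K x *\<^sub>R (1::complex))"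
      proof (rule L2_dominated[where w = "indicator {0..pi}"])
        show "(\<lambda>x. indicat_real {0..pi} x *\<^sub>R complex_of_real (g m x)) \<in> sqint UNIV" for m
          using gs by (simp add: indicator_in_sqint)
        show "(\<lambda>x. indicat_real K x *\<^sub>R (1::complex)) \<in> sqint UNIV" by (rule sq[OF \<open>closed K\<close> bK])
        have "(indicat_real {0..pi} x)\<^sup>2 = indicat_real {0..pi} x" for x by (simp add: indicator_def)
        then show "integrable lborel (\<lambda>x. (indicat_real {0..pi} x)\<^sup>2)" by simp
        fix x
        have "(\<lambda>m. indicat_real {0..pi} x *\<^sub>R complex_of_real (g m x)) \<longlonglongrightarrow> 
          indicat_real {0..pi} x *\<^sub>R complex_of_real (indicator K x)"
          by (intro tendsto_intros lim)
        also have "indicat_real {0..pi} x *\<^sub>R complex_of_real (indicator K x) = indicat_real K x *\<^sub>R 1"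
          by (auto simp: K_def indicator_def)
        finally show "(\<lambda>m. indicat_real {0..pi} x *\<^sub>R complex_of_real (g m x)) \<longlonglongrightarrow> indicat_real K x *\<^sub>R (1::complex)" .
        show "cmod (indicat_real {0..pi} x *\<^sub>R complex_of_real (g m x)) \<le> indicat_real {0..pi} x" for m
          using g01[of m x] by (auto simp: indicator_def)
      qed
      then have "(\<lambda>m. cinner f (to_L2 {0..pi} (\<lambda>x. complex_of_real (g m x)))) \<longlonglongrightarrow> cinner f (to_L2 K (\<lambda>_. 1))"
        unfolding to_L2_def by (rule cinner.tendsto[OF tendsto_const])
      then have "(\<lambda>m. 0) \<longlonglongrightarrow> cinner f (to_L2 K (\<lambda>_. 1))" by (simp add: cont[OF gc])
      then show ?thesis by (simp add: LIMSEQ_const_iff)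
    qed
    then show "to_L2 (A \<inter> cball 0 (real n)) (\<lambda>_. 1) \<in> V" unfolding V_def B_def[symmetric] using eq by simp
  qed
  then have "cinner f f = 0" by (auto simp: V_def)
  then show ?thesis using cinner_self[of f] by simp
qed

section \<open>The spaces \<open>H\<close> and \<open>H\<^sub>\<alpha>\<close>\<close>

lemma closed_L2_on: "S \<in> sets borel \<Longrightarrow> closed (L2_on S :: 'a::euclidean_space L2 set)"
proof -
  assume S: "S \<in> sets borel"
  have "L2_on S = (\<Inter>g. (\<lambda>f. cinner f (to_L2 (- S) (rep_L2 g))) -` {0})"
    using L2_on_iff_cinner[OF S] by auto
  then show ?thesis
    by (simp add: closed_INT closed_vimage linear_continuous_on[OF cinner.bounded_linear_left])
qed

lemma L2_on_add: "S \<in> sets borel \<Longrightarrow> f \<in> L2_on S \<Longrightarrow> g \<in> L2_on S \<Longrightarrow> f + g \<in> L2_on S"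
  by (simp add: L2_on_iff_cinner cinner.add_left)

lemma L2_on_scaleC: "S \<in> sets borel \<Longrightarrow> f \<in> L2_on S \<Longrightarrow> c *\<^sub>C f \<in> L2_on S"
  by (simp add: L2_on_iff_cinner cinner_scaleC_left)

lemma L2_on_0: "S \<in> sets borel \<Longrightarrow> 0 \<in> L2_on S"
  by (simp add: L2_on_iff_cinner cinner.zero_left)

text \<open>The space \<open>H = H\<^sub>0\<close>.\<close>

definition H0_set :: "real L2 set" where
  "H0_set = {f \<in> L2_on {0..pi}. (LINT x:{0..pi}|lborel. rep_L2 f x) = 0}"

lemma one_sqint: "(\<lambda>_. 1 :: complex) \<in> sqint {0..pi}"
  by (rule sqint_compact) auto

lemma H0_set_iff: "f \<in> H0_set \<longleftrightarrow> f \<in> L2_on {0..pi} \<and> cinner f (to_L2 {0..pi} (\<lambda>_. 1)) = 0"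
proof -
  have "(LINT x:{0..pi}|lborel. rep_L2 f x) = cinner f (to_L2 {0..pi} (\<lambda>_. 1))"
    unfolding cinner_to_L2[OF one_sqint] set_lebesgue_integral_def
    by (intro Bochner_Integration.integral_cong refl) (auto simp: indicator_def)
  then show ?thesis by (simp add: H0_set_def)
qed

lemma closed_H0_set: "closed H0_set"
proof -
  have "H0_set = L2_on {0..pi} \<inter> (\<lambda>f. cinner f (to_L2 {0..pi} (\<lambda>_. 1))) -` {0}"
    by (auto simp: H0_set_iff)
  moreover have "closed ((\<lambda>f. cinner f (to_L2 {0..pi} (\<lambda>_. 1))) -` {0})"
    by (simp add: closed_vimage linear_continuous_on[OF cinner.bounded_linear_left])
  ultimately show ?thesis by (metis closed_Int closed_L2_on atLeastAtMost_borel)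
qed

lemma H0_set_add: "f \<in> H0_set \<Longrightarrow> g \<in> H0_set \<Longrightarrow> f + g \<in> H0_set"
  by (simp add: H0_set_iff L2_on_add cinner.add_left)
lemma H0_set_scaleC: "f \<in> H0_set \<Longrightarrow> c *\<^sub>C f \<in> H0_set"
  by (simp add: H0_set_iff L2_on_scaleC cinner_scaleC_left)
lemma H0_set_scaleR: "f \<in> H0_set \<Longrightarrow> r *\<^sub>R f \<in> H0_set"
  by (simp add: scaleR_scaleC H0_set_scaleC)
lemma H0_set_0: "0 \<in> H0_set"
  by (simp add: H0_set_iff L2_on_0 cinner.zero_left)
lemma H0_set_uminus: "f \<in> H0_set \<Longrightarrow> - f \<in> H0_set"
  using H0_set_scaleR[of f "-1"] by simp
lemma H0_set_diff: "f \<in> H0_set \<Longrightarrow> g \<in> H0_set \<Longrightarrow> f - g \<in> H0_set"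
  using H0_set_add[OF _ H0_set_uminus] by fastforce

typedef H0 = H0_set morphisms L2_of_H0 Abs_H0
  using H0_set_0 by blast

lemma Abs_H0_inv: "f \<in> H0_set \<Longrightarrow> L2_of_H0 (Abs_H0 f) = f"
  by (rule Abs_H0_inverse)

lemma L2_of_H0_in: "L2_of_H0 f \<in> H0_set"
  by (rule L2_of_H0)

instantiation H0 :: real_vector
begin
definition zero_H0 :: H0 where "zero_H0 = Abs_H0 0"
definition plus_H0 :: "H0 \<Rightarrow> H0 \<Rightarrow> H0" where "plus_H0 f g = Abs_H0 (L2_of_H0 f + L2_of_H0 g)"
definition uminus_H0 :: "H0 \<Rightarrow> H0" where "uminus_H0 f = Abs_H0 (- L2_of_H0 f)"
definition minus_H0 :: "H0 \<Rightarrow> H0 \<Rightarrow> H0" where "minus_H0 f g = Abs_H0 (L2_of_H0 f - L2_of_H0 g)"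
definition scaleR_H0 :: "real \<Rightarrow> H0 \<Rightarrow> H0" where "scaleR_H0 r f = Abs_H0 (r *\<^sub>R L2_of_H0 f)"

lemma L2_of_H0_simps:
  "L2_of_H0 0 = 0" "L2_of_H0 (f + g) = L2_of_H0 f + L2_of_H0 g" "L2_of_H0 (- f) = - L2_of_H0 f"
  "L2_of_H0 (f - g) = L2_of_H0 f - L2_of_H0 g" "L2_of_H0 (r *\<^sub>R f) = r *\<^sub>R L2_of_H0 f"
  by (simp_all add: zero_H0_def plus_H0_def uminus_H0_def minus_H0_def scaleR_H0_def Abs_H0_inv
      H0_set_0 H0_set_add H0_set_uminus H0_set_diff H0_set_scaleR L2_of_H0_in)

instance
  by standard (simp_all add: L2_of_H0_simps L2_of_H0_inject[symmetric] algebra_simps)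
end

instantiation H0 :: real_inner
begin
definition inner_H0 :: "H0 \<Rightarrow> H0 \<Rightarrow> real" where "inner_H0 f g = inner (L2_of_H0 f) (L2_of_H0 g)"
definition norm_H0 :: "H0 \<Rightarrow> real" where "norm_H0 f = norm (L2_of_H0 f)"
definition sgn_H0 :: "H0 \<Rightarrow> H0" where "sgn_H0 f = f /\<^sub>R norm f"
definition dist_H0 :: "H0 \<Rightarrow> H0 \<Rightarrow> real" where "dist_H0 f g = norm (f - g)"
definition uniformity_H0 :: "(H0 \<times> H0) filter" where
  "uniformity_H0 = (INF e\<in>{0<..}. principal {(x, y). dist x y < e})"
definition open_H0 :: "H0 set \<Rightarrow> bool" where
  "open_H0 U = (\<forall>x\<in>U. eventually (\<lambda>(x', y). x' = x \<longrightarrow> y \<in> U) uniformity)"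
instance
proof
  fix x y z :: H0 and r
  show "inner x y = inner y x" unfolding inner_H0_def by (rule inner_commute)
  show "inner (x + y) z = inner x z + inner y z" by (simp add: inner_H0_def L2_of_H0_simps inner_add_left)
  show "inner (r *\<^sub>R x) y = r * inner x y" by (simp add: inner_H0_def L2_of_H0_simps)
  show "0 \<le> inner x x" by (simp add: inner_H0_def)
  show "inner x x = 0 \<longleftrightarrow> x = 0" by (simp add: inner_H0_def L2_of_H0_inject[symmetric] L2_of_H0_simps)
  show "norm x = sqrt (inner x x)" unfolding norm_H0_def inner_H0_def by (rule norm_eq_sqrt_inner)
qed (rule sgn_H0_def dist_H0_def uniformity_H0_def open_H0_def)+
end

lemma dist_L2_of_H0: "dist (L2_of_H0 x) (L2_of_H0 y) = dist x y"
  by (simp add: dist_norm norm_H0_def L2_of_H0_simps)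

instance H0 :: second_countable_topology
  by standard (rule countable_subbasis_isometry[of L2_of_H0, OF dist_L2_of_H0])

instantiation H0 :: complex_hilbert
begin
definition scaleC_H0 :: "complex \<Rightarrow> H0 \<Rightarrow> H0" where "scaleC_H0 c f = Abs_H0 (c *\<^sub>C L2_of_H0 f)"
definition cinner_H0 :: "H0 \<Rightarrow> H0 \<Rightarrow> complex" where "cinner_H0 f g = cinner (L2_of_H0 f) (L2_of_H0 g)"

lemma L2_of_H0_scaleC: "L2_of_H0 (c *\<^sub>C f) = c *\<^sub>C L2_of_H0 f"
  by (simp add: scaleC_H0_def Abs_H0_inv H0_set_scaleC L2_of_H0_in)

instance
proof
  fix X :: "nat \<Rightarrow> H0" assume "Cauchy X"
  then have "Cauchy (\<lambda>n. L2_of_H0 (X n))" by (simp add: Cauchy_def dist_L2_of_H0)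
  then obtain l where l: "(\<lambda>n. L2_of_H0 (X n)) \<longlonglongrightarrow> l"
    using Cauchy_convergent convergent_def by blast
  then have "l \<in> H0_set"
    by (rule closed_sequentially[OF closed_H0_set, rotated]) (rule L2_of_H0_in)
  then have "X \<longlonglongrightarrow> Abs_H0 l"
    using l unfolding tendsto_iff dist_L2_of_H0[symmetric] by (simp add: Abs_H0_inv)
  then show "convergent X" by (auto simp: convergent_def)
next
  fix x y z :: H0 and a b :: complex and r :: real
  show "cinner x y = cnj (cinner y x)" unfolding cinner_H0_def by (rule cinner_commute)
qed (simp_all add: L2_of_H0_scaleC L2_of_H0_simps L2_of_H0_inject[symmetric] cinner_H0_def inner_H0_def
      inner_Re_cinner scaleC_add_right scaleC_add_left scaleC_scaleC scaleR_scaleC cinner.add_left cinner_scaleC_left)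
end

text \<open>The coefficients with respect to the orthonormal basis of \<open>H\<close>. Since the basis is indexed
  by the positive integers, sums over it are written as sums over all \<open>k\<close> with index \<open>Suc k\<close>.\<close>

definition coef :: "H0 \<Rightarrow> nat \<Rightarrow> complex" where
  "coef \<eta> k = cinner (L2_of_H0 \<eta>) (cos_basis k)"

definition H_alpha :: "real \<Rightarrow> H0 set" where
  "H_alpha \<alpha> = {\<eta>. summable (\<lambda>k. real (Suc k) powr (2 * \<alpha>) * (cmod (coef \<eta> (Suc k)))\<^sup>2)}"

definition e_H0 :: "nat \<Rightarrow> H0" where "e_H0 k = Abs_H0 (cos_basis (Suc k))"

lemma one_eq_cos_basis: "to_L2 {0..pi} (\<lambda>_. 1) = of_real (1 / sqrt (2/pi)) *\<^sub>C cos_basis 0"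
  unfolding cos_basis_def to_L2_scale[OF cos_sqint, symmetric] by simp

lemma L2_of_e_H0: "L2_of_H0 (e_H0 k) = cos_basis (Suc k)"
proof -
  have "cos_basis (Suc k) \<in> L2_on {0..pi}"
    unfolding cos_basis_def by (rule to_L2_in_L2_on[OF cos_sqint])
  then have "cos_basis (Suc k) \<in> H0_set"
    by (simp add: H0_set_iff one_eq_cos_basis cinner_scaleC_right cos_basis_cinner)
  then show ?thesis by (simp add: e_H0_def Abs_H0_inv)
qed

lemma coef_eq: "coef \<eta> (Suc k) = cinner \<eta> (e_H0 k)"
  by (simp add: coef_def cinner_H0_def L2_of_e_H0)

lemma e_H0_on: "cinner (e_H0 i) (e_H0 j) = (if i = j then 1 else 0)"
  by (simp add: cinner_H0_def L2_of_e_H0 cos_basis_cinner)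

lemma e_H0_total: 
  assumes "\<And>k. cinner \<eta> (e_H0 k) = 0"
  shows "\<eta> = 0"
proof -
  have H: "L2_of_H0 \<eta> \<in> L2_on {0..pi}" "cinner (L2_of_H0 \<eta>) (to_L2 {0..pi} (\<lambda>_. 1)) = 0"
    using L2_of_H0_in[of \<eta>] by (auto simp: H0_set_iff)
  have "cinner (L2_of_H0 \<eta>) (cos_basis k) = 0" for k
  proof (cases k)
    case 0
    show ?thesis using H(2) unfolding one_eq_cos_basis cinner_scaleC_right 0 by simp
  next
    case (Suc m)
    then show ?thesis using assms[of m] by (simp add: cinner_H0_def L2_of_e_H0)
  qed
  then have "L2_of_H0 \<eta> = 0" by (rule cos_basis_total[OF H(1)])
  then show ?thesis by (metis L2_of_H0_inject L2_of_H0_simps(1))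
qed

lemma e_H0_ext: "(\<And>k. cinner x (e_H0 k) = cinner y (e_H0 k)) \<Longrightarrow> x = y"
  using e_H0_total[of "x - y"] by (simp add: cinner.diff_left)

lemma H_half_iff: "\<eta> \<in> H_alpha (1/2) \<longleftrightarrow> summable (\<lambda>k. real (Suc k) * (cmod (cinner \<eta> (e_H0 k)))\<^sup>2)"
  unfolding H_alpha_def mem_Collect_eq coef_eq by simp

lemma H_half_scaleC: "\<eta> \<in> H_alpha (1/2) \<Longrightarrow> c *\<^sub>C \<eta> \<in> H_alpha (1/2)"
proof -
  assume "\<eta> \<in> H_alpha (1/2)"
  then have "summable (\<lambda>k. (cmod c)\<^sup>2 * (real (Suc k) * (cmod (cinner \<eta> (e_H0 k)))\<^sup>2))"
    unfolding H_half_iff by (rule summable_mult)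
  then show ?thesis unfolding H_half_iff
    by (simp add: cinner_scaleC_left norm_mult power_mult_distrib mult.left_commute)
qed

lemma H_half_add: "x \<in> H_alpha (1/2) \<Longrightarrow> y \<in> H_alpha (1/2) \<Longrightarrow> x + y \<in> H_alpha (1/2)"
proof -
  assume "x \<in> H_alpha (1/2)" "y \<in> H_alpha (1/2)"
  then have s: "summable (\<lambda>k. 2 * (real (Suc k) * (cmod (cinner x (e_H0 k)))\<^sup>2) + 2 * (real (Suc k) * (cmod (cinner y (e_H0 k)))\<^sup>2))"
    unfolding H_half_iff by (intro summable_add summable_mult)
  have "(cmod (a + b))\<^sup>2 \<le> 2 * (cmod a)\<^sup>2 + 2 * (cmod b)\<^sup>2" for a b
  proof -
    have "(cmod (a + b))\<^sup>2 \<le> (cmod a + cmod b)\<^sup>2" by (intro power_mono norm_triangle_ineq) auto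
    then show ?thesis using sum_squares_bound[of "cmod a" "cmod b"] by (simp add: power2_sum)
  qed
  from mult_left_mono[OF this, of "real (Suc _)"]
  have "real (Suc k) * (cmod (cinner (x + y) (e_H0 k)))\<^sup>2 \<le> 
     2 * (real (Suc k) * (cmod (cinner x (e_H0 k)))\<^sup>2) + 2 * (real (Suc k) * (cmod (cinner y (e_H0 k)))\<^sup>2)" for k
    by (simp add: cinner.add_left algebra_simps)
  then show ?thesis unfolding H_half_iff
    by (intro summable_comparison_test'[OF s]) simp
qed

lemma H_half_0: "0 \<in> H_alpha (1/2)"
  by (simp add: H_half_iff cinner.zero_left)
lemma H_half_scaleR: "x \<in> H_alpha (1/2) \<Longrightarrow> r *\<^sub>R x \<in> H_alpha (1/2)"
  by (simp only: scaleR_scaleC H_half_scaleC)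
lemma H_half_uminus: "x \<in> H_alpha (1/2) \<Longrightarrow> - x \<in> H_alpha (1/2)"
  using H_half_scaleR[of x "-1"] by simp
lemma H_half_diff: "x \<in> H_alpha (1/2) \<Longrightarrow> y \<in> H_alpha (1/2) \<Longrightarrow> x - y \<in> H_alpha (1/2)"
  using H_half_add[OF _ H_half_uminus] by fastforce

text \<open>The space \<open>H\<^sub>1\<^sub>/\<^sub>2\<close> is a type of its own because it carries its own inner product; the
  morphism \<open>H0_of_Hhalf\<close> is the inclusion into \<open>H\<close>.\<close>

typedef Hhalf = "H_alpha (1/2)" morphisms H0_of_Hhalf Abs_Hhalf
  using H_half_0 by blast

instantiation Hhalf :: real_vector
begin
definition zero_Hhalf :: Hhalf where "zero_Hhalf = Abs_Hhalf 0"
definition plus_Hhalf :: "Hhalf \<Rightarrow> Hhalf \<Rightarrow> Hhalf" where "plus_Hhalf f g = Abs_Hhalf (H0_of_Hhalf f + H0_of_Hhalf g)"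
definition uminus_Hhalf :: "Hhalf \<Rightarrow> Hhalf" where "uminus_Hhalf f = Abs_Hhalf (- H0_of_Hhalf f)"
definition minus_Hhalf :: "Hhalf \<Rightarrow> Hhalf \<Rightarrow> Hhalf" where "minus_Hhalf f g = Abs_Hhalf (H0_of_Hhalf f - H0_of_Hhalf g)"
definition scaleR_Hhalf :: "real \<Rightarrow> Hhalf \<Rightarrow> Hhalf" where "scaleR_Hhalf r f = Abs_Hhalf (r *\<^sub>R H0_of_Hhalf f)"

lemma H0_of_Hhalf_simps:
  "H0_of_Hhalf 0 = 0" "H0_of_Hhalf (f + g) = H0_of_Hhalf f + H0_of_Hhalf g" "H0_of_Hhalf (- f) = - H0_of_Hhalf f"
  "H0_of_Hhalf (f - g) = H0_of_Hhalf f - H0_of_Hhalf g" "H0_of_Hhalf (r *\<^sub>R f) = r *\<^sub>R H0_of_Hhalf f"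
  by (simp_all only: zero_Hhalf_def plus_Hhalf_def uminus_Hhalf_def minus_Hhalf_def scaleR_Hhalf_def Abs_Hhalf_inverse
      H_half_0 H_half_add H_half_uminus H_half_diff H_half_scaleR H0_of_Hhalf)

instance
  by standard (simp_all add: H0_of_Hhalf_simps H0_of_Hhalf_inject[symmetric] algebra_simps)
end

definition cinner_half :: "H0 \<Rightarrow> H0 \<Rightarrow> complex" where
  "cinner_half \<eta> \<psi> = (\<Sum>k. of_real (real (Suc k) * tanh (real (Suc k))) * coef \<eta> (Suc k) * cnj (coef \<psi> (Suc k)))"

definition w_half :: "nat \<Rightarrow> real" where "w_half k = real (Suc k) * tanh (real (Suc k))"

lemma w_half_bounds: "0 < w_half k" "w_half k \<le> real (Suc k)" "tanh 1 * real (Suc k) \<le> w_half k" 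
proof -
  show "0 < w_half k" by (simp add: w_half_def)
  have "real (Suc k) * tanh (real (Suc k)) \<le> real (Suc k) * 1"
    using tanh_real_lt_1[of "real (Suc k)"] by (intro mult_left_mono) auto
  then show "w_half k \<le> real (Suc k)" by (simp add: w_half_def)
  have "tanh (1::real) \<le> tanh (real (Suc k))" by simp
  then have "real (Suc k) * tanh 1 \<le> real (Suc k) * tanh (real (Suc k))"
    by (intro mult_left_mono) auto
  then show "tanh 1 * real (Suc k) \<le> w_half k" by (simp only: w_half_def mult.commute)
qed

text \<open>An isometry of \<open>H\<^sub>1\<^sub>/\<^sub>2\<close> onto \<open>H\<close>, from which completeness and separability are inherited.\<close>

definition J_half :: "H0 \<Rightarrow> H0" where
  "J_half \<eta> = (\<Sum>k. (of_real (sqrt (w_half k)) * cinner \<eta> (e_H0 k)) *\<^sub>C e_H0 k)"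

lemma coef_J_half:
  assumes "\<eta> \<in> H_alpha (1/2)"
  shows "cinner (J_half \<eta>) (e_H0 k) = of_real (sqrt (w_half k)) * cinner \<eta> (e_H0 k)"
proof -
  have "summable (\<lambda>k. (cmod (of_real (sqrt (w_half k)) * cinner \<eta> (e_H0 k)))\<^sup>2)"
  proof (rule summable_comparison_test'[OF assms[unfolded H_half_iff], of 0])
    fix k
    have "(cmod (of_real (sqrt (w_half k)) * cinner \<eta> (e_H0 k)))\<^sup>2 = w_half k * (cmod (cinner \<eta> (e_H0 k)))\<^sup>2"
      using w_half_bounds(1)[of k] by (simp add: norm_mult power_mult_distrib)
    also have "\<dots> \<le> real (Suc k) * (cmod (cinner \<eta> (e_H0 k)))\<^sup>2"
      by (intro mult_right_mono w_half_bounds) simp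
    finally show "norm ((cmod (of_real (sqrt (w_half k)) * cinner \<eta> (e_H0 k)))\<^sup>2) \<le> real (Suc k) * (cmod (cinner \<eta> (e_H0 k)))\<^sup>2"
      by simp
  qed
  from summable_sums[OF orthonormal_summable[OF e_H0_on this]]
  show ?thesis unfolding J_half_def[symmetric] by (rule orthonormal_coefficient[OF e_H0_on])
qed

lemma cinner_half_J:
  assumes "\<eta> \<in> H_alpha (1/2)" "\<psi> \<in> H_alpha (1/2)"
  shows "cinner_half \<eta> \<psi> = cinner (J_half \<eta>) (J_half \<psi>)"
proof -
  have w: "complex_of_real (sqrt (w_half k)) * complex_of_real (sqrt (w_half k)) = complex_of_real (w_half k)" for k
    using w_half_bounds(1)[of k] by (simp flip: of_real_mult)
  have "of_real (w_half k) * coef \<eta> (Suc k) * cnj (coef \<psi> (Suc k)) = 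
    cinner (J_half \<eta>) (e_H0 k) * cnj (cinner (J_half \<psi>) (e_H0 k))" for k
    unfolding coef_J_half[OF assms(1)] coef_J_half[OF assms(2)] coef_eq w[symmetric] by simp
  then show ?thesis
    using orthonormal_Parseval[OF e_H0_on e_H0_total, of "J_half \<eta>" "J_half \<psi>"]
    unfolding cinner_half_def w_half_def[symmetric] by (simp add: sums_iff)
qed

definition J_Hhalf :: "Hhalf \<Rightarrow> H0" where "J_Hhalf x = J_half (H0_of_Hhalf x)"

lemma coef_J_Hhalf: "cinner (J_Hhalf x) (e_H0 k) = of_real (sqrt (w_half k)) * cinner (H0_of_Hhalf x) (e_H0 k)"
  unfolding J_Hhalf_def by (rule coef_J_half[OF H0_of_Hhalf])

lemma J_Hhalf_add: "J_Hhalf (x + y) = J_Hhalf x + J_Hhalf y"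
  by (rule e_H0_ext) (simp add: coef_J_Hhalf cinner.add_left H0_of_Hhalf_simps distrib_left)

lemma J_Hhalf_scaleR: "J_Hhalf (r *\<^sub>R x) = r *\<^sub>R J_Hhalf x"
  by (rule e_H0_ext) (simp add: coef_J_Hhalf cinner.scaleR_left H0_of_Hhalf_simps)

lemma J_Hhalf_diff: "J_Hhalf (x - y) = J_Hhalf x - J_Hhalf y"
  by (rule e_H0_ext) (simp add: coef_J_Hhalf cinner.diff_left H0_of_Hhalf_simps right_diff_distrib)

lemma J_Hhalf_eq_0: "J_Hhalf x = 0 \<longleftrightarrow> x = 0"
proof
  assume "J_Hhalf x = 0"
  then have "of_real (sqrt (w_half k)) * cinner (H0_of_Hhalf x) (e_H0 k) = 0" for k
    using coef_J_Hhalf[of x k] by (simp add: cinner.zero_left)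
  then have "cinner (H0_of_Hhalf x) (e_H0 k) = 0" for k
    using w_half_bounds(1)[of k] by (metis mult_eq_0_iff of_real_eq_0_iff real_sqrt_eq_zero_cancel_iff less_irrefl)
  then have "H0_of_Hhalf x = 0" by (rule e_H0_total)
  then show "x = 0" by (metis H0_of_Hhalf_inject H0_of_Hhalf_simps(1))
next
  assume "x = 0"
  then show "J_Hhalf x = 0" using J_Hhalf_scaleR[of 0 0] by simp
qed

lemma J_Hhalf_surj: "\<exists>x. J_Hhalf x = y"
proof -
  define c where "c k = cinner y (e_H0 k) / of_real (sqrt (w_half k))" for k
  have t: "tanh (1::real) > 0" by simp
  have cb: "real (Suc k) * (cmod (c k))\<^sup>2 \<le> (1 / tanh 1) * (cmod (cinner y (e_H0 k)))\<^sup>2" for k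
  proof -
    have "(cmod (c k))\<^sup>2 = (cmod (cinner y (e_H0 k)))\<^sup>2 / w_half k"
      using w_half_bounds(1)[of k] by (simp add: c_def norm_divide power_divide)
    moreover have "real (Suc k) / w_half k \<le> 1 / tanh 1"
      using w_half_bounds(1,3)[of k] t by (simp add: field_simps)
    ultimately show ?thesis
      using mult_right_mono[of "real (Suc k) / w_half k" "1 / tanh 1" "(cmod (cinner y (e_H0 k)))\<^sup>2"]
      by simp
  qed
  have s1: "summable (\<lambda>k. (1 / tanh 1) * (cmod (cinner y (e_H0 k)))\<^sup>2)"
    by (rule summable_mult[OF orthonormal_Bessel[OF e_H0_on]])
  have s2: "summable (\<lambda>k. real (Suc k) * (cmod (c k))\<^sup>2)"
    by (rule summable_comparison_test'[OF s1, of 0]) (use cb in simp)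
  have s3: "summable (\<lambda>k. (cmod (c k))\<^sup>2)"
  proof (rule summable_comparison_test'[OF s2, of 0])
    show "norm ((cmod (c k))\<^sup>2) \<le> real (Suc k) * (cmod (c k))\<^sup>2" for k
      using mult_right_mono[of 1 "real (Suc k)" "(cmod (c k))\<^sup>2"] by simp
  qed
  define \<eta> where "\<eta> = (\<Sum>k. c k *\<^sub>C e_H0 k)"
  have "(\<lambda>k. c k *\<^sub>C e_H0 k) sums \<eta>"
    unfolding \<eta>_def by (rule summable_sums[OF orthonormal_summable[OF e_H0_on s3]])
  then have co: "cinner \<eta> (e_H0 k) = c k" for k by (rule orthonormal_coefficient[OF e_H0_on])
  then have "\<eta> \<in> H_alpha (1/2)" unfolding H_half_iff using s2 by simp
  then have "cinner (J_Hhalf (Abs_Hhalf \<eta>)) (e_H0 k) = cinner y (e_H0 k)" for k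
    unfolding coef_J_Hhalf using w_half_bounds(1)[of k] by (simp add: Abs_Hhalf_inverse co c_def)
  then have "J_Hhalf (Abs_Hhalf \<eta>) = y" by (rule e_H0_ext)
  then show ?thesis by blast
qed

instantiation Hhalf :: real_inner
begin
definition inner_Hhalf :: "Hhalf \<Rightarrow> Hhalf \<Rightarrow> real" where
  "inner_Hhalf f g = Re (cinner_half (H0_of_Hhalf f) (H0_of_Hhalf g))"
definition norm_Hhalf :: "Hhalf \<Rightarrow> real" where "norm_Hhalf f = sqrt (inner f f)"
definition sgn_Hhalf :: "Hhalf \<Rightarrow> Hhalf" where "sgn_Hhalf f = f /\<^sub>R norm f"
definition dist_Hhalf :: "Hhalf \<Rightarrow> Hhalf \<Rightarrow> real" where "dist_Hhalf f g = norm (f - g)"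
definition uniformity_Hhalf :: "(Hhalf \<times> Hhalf) filter" where
  "uniformity_Hhalf = (INF e\<in>{0<..}. principal {(x, y). dist x y < e})"
definition open_Hhalf :: "Hhalf set \<Rightarrow> bool" where
  "open_Hhalf U = (\<forall>x\<in>U. eventually (\<lambda>(x', y). x' = x \<longrightarrow> y \<in> U) uniformity)"

lemma inner_Hhalf_J: "inner x y = inner (J_Hhalf x) (J_Hhalf y)"
  by (simp add: inner_Hhalf_def cinner_half_J[OF H0_of_Hhalf H0_of_Hhalf] inner_Re_cinner J_Hhalf_def)

instance
proof
  fix x y z :: Hhalf and r
  show "inner x y = inner y x" unfolding inner_Hhalf_J by (rule inner_commute)
  show "inner (x + y) z = inner x z + inner y z" by (simp add: inner_Hhalf_J J_Hhalf_add inner_add_left)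
  show "inner (r *\<^sub>R x) y = r * inner x y" by (simp add: inner_Hhalf_J J_Hhalf_scaleR)
  show "0 \<le> inner x x" by (simp add: inner_Hhalf_J)
  show "inner x x = 0 \<longleftrightarrow> x = 0" by (simp add: inner_Hhalf_J J_Hhalf_eq_0)
qed (rule sgn_Hhalf_def dist_Hhalf_def uniformity_Hhalf_def open_Hhalf_def norm_Hhalf_def)+
end

lemma dist_J_Hhalf: "dist (J_Hhalf x) (J_Hhalf y) = dist x y"
  unfolding dist_norm J_Hhalf_diff[symmetric] norm_Hhalf_def inner_Hhalf_J by (rule norm_eq_sqrt_inner)

instance Hhalf :: second_countable_topology
  by standard (rule countable_subbasis_isometry[of J_Hhalf, OF dist_J_Hhalf])

instantiation Hhalf :: complex_hilbert
begin
definition scaleC_Hhalf :: "complex \<Rightarrow> Hhalf \<Rightarrow> Hhalf" where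
  "scaleC_Hhalf c f = Abs_Hhalf (c *\<^sub>C H0_of_Hhalf f)"
definition cinner_Hhalf :: "Hhalf \<Rightarrow> Hhalf \<Rightarrow> complex" where
  "cinner_Hhalf f g = cinner_half (H0_of_Hhalf f) (H0_of_Hhalf g)"

lemma H0_of_Hhalf_scaleC: "H0_of_Hhalf (c *\<^sub>C f) = c *\<^sub>C H0_of_Hhalf f"
  by (simp only: scaleC_Hhalf_def Abs_Hhalf_inverse H_half_scaleC H0_of_Hhalf)

lemma cinner_Hhalf_J: "cinner x y = cinner (J_Hhalf x) (J_Hhalf y)"
  by (simp add: cinner_Hhalf_def cinner_half_J[OF H0_of_Hhalf H0_of_Hhalf] J_Hhalf_def)

lemma J_Hhalf_scaleC: "J_Hhalf (c *\<^sub>C x) = c *\<^sub>C J_Hhalf x"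
  by (rule e_H0_ext) (simp add: coef_J_Hhalf cinner_scaleC_left H0_of_Hhalf_scaleC mult.left_commute)

instance
proof
  fix X :: "nat \<Rightarrow> Hhalf" assume "Cauchy X"
  then have "Cauchy (\<lambda>n. J_Hhalf (X n))" by (simp add: Cauchy_def dist_J_Hhalf)
  then obtain l where l: "(\<lambda>n. J_Hhalf (X n)) \<longlonglongrightarrow> l"
    using Cauchy_convergent convergent_def by blast
  obtain x where "J_Hhalf x = l" using J_Hhalf_surj by blast
  then have "X \<longlonglongrightarrow> x"
    using l unfolding tendsto_iff dist_J_Hhalf[symmetric] by simp
  then show "convergent X" by (auto simp: convergent_def)
next
  fix x y z :: Hhalf and a b :: complex and r :: real
  show "cinner x y = cnj (cinner y x)" unfolding cinner_Hhalf_J by (rule cinner_commute)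
  show "cinner (x + y) z = cinner x z + cinner y z" by (simp add: cinner_Hhalf_J J_Hhalf_add cinner.add_left)
  show "cinner (a *\<^sub>C x) y = a * cinner x y" by (simp add: cinner_Hhalf_J J_Hhalf_scaleC cinner_scaleC_left)
  show "inner x y = Re (cinner x y)" by (simp add: inner_Hhalf_def cinner_Hhalf_def)
qed (simp_all add: H0_of_Hhalf_scaleC H0_of_Hhalf_simps H0_of_Hhalf_inject[symmetric]
      scaleC_add_right scaleC_add_left scaleC_scaleC scaleR_scaleC)
end

section \<open>The Sobolev space of the rectangle and Dirichlet traces\<close>

definition Omega :: "(real \<times> real) set" where
  "Omega = {0<..<pi} \<times> {-1<..<0}"

definition pdx :: "(real \<times> real \<Rightarrow> complex) \<Rightarrow> real \<times> real \<Rightarrow> complex" where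
  "pdx f p = vector_derivative (\<lambda>s. f (s, snd p)) (at (fst p))"

definition pdy :: "(real \<times> real \<Rightarrow> complex) \<Rightarrow> real \<times> real \<Rightarrow> complex" where
  "pdy f p = vector_derivative (\<lambda>s. f (fst p, s)) (at (snd p))"

primrec Ck :: "nat \<Rightarrow> (real \<times> real \<Rightarrow> complex) \<Rightarrow> bool" where
  "Ck 0 f \<longleftrightarrow> continuous_on UNIV f"
| "Ck (Suc n) f \<longleftrightarrow> continuous_on UNIV f \<and>
     (\<forall>x y. (\<lambda>s. f (s, y)) differentiable (at x) \<and> (\<lambda>s. f (x, s)) differentiable (at y)) \<and>
     Ck n (pdx f) \<and> Ck n (pdy f)"

definition smooth :: "(real \<times> real \<Rightarrow> complex) \<Rightarrow> bool" where
  "smooth f \<longleftrightarrow> (\<forall>n. Ck n f)"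

definition test_functions :: "(real \<times> real) set \<Rightarrow> (real \<times> real \<Rightarrow> complex) set" where
  "test_functions S = {\<psi>. smooth \<psi> \<and> (\<exists>K. compact K \<and> K \<subseteq> S \<and> (\<forall>p. p \<notin> K \<longrightarrow> \<psi> p = 0))}"

text \<open>The parameter \<open>D\<close> is one of the operators \<^const>\<open>pdx\<close> and \<^const>\<open>pdy\<close>.\<close>

definition is_weak_deriv ::
  "((real \<times> real \<Rightarrow> complex) \<Rightarrow> real \<times> real \<Rightarrow> complex) \<Rightarrow> (real \<times> real) L2 \<Rightarrow> (real \<times> real) L2 \<Rightarrow> bool" where
  "is_weak_deriv D v g \<longleftrightarrow> g \<in> L2_on Omega \<and>
     (\<forall>\<psi>\<in>test_functions Omega.
        (LINT p:Omega|lborel. rep_L2 v p * D \<psi> p) = - (LINT p:Omega|lborel. rep_L2 g p * \<psi> p))"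

definition weak_dx :: "(real \<times> real) L2 \<Rightarrow> (real \<times> real) L2" where
  "weak_dx v = (THE g. is_weak_deriv pdx v g)"

definition weak_dy :: "(real \<times> real) L2 \<Rightarrow> (real \<times> real) L2" where
  "weak_dy v = (THE g. is_weak_deriv pdy v g)"

definition sobolev_H1 :: "(real \<times> real) L2 set" where
  "sobolev_H1 = {v \<in> L2_on Omega. (\<exists>g. is_weak_deriv pdx v g) \<and> (\<exists>g. is_weak_deriv pdy v g)}"

text \<open>The norm of \<open>H1_graph v\<close> in the product space is the Sobolev norm of \<open>v\<close>. Thus convergence,
  measurability and square integrability in \<^const>\<open>sobolev_H1\<close> are expressed through this isometric
  embedding.\<close>

definition H1_graph :: "(real \<times> real) L2 \<Rightarrow> (real \<times> real) L2 \<times> (real \<times> real) L2 \<times> (real \<times> real) L2" where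
  "H1_graph v = (v, weak_dx v, weak_dy v)"

text \<open>The Dirichlet trace on the side of the rectangle parametrised by \<open>\<gamma>\<close> on \<open>I\<close>: the continuous
  extension to \<^const>\<open>sobolev_H1\<close> of the pointwise restriction to this side of functions that are
  smooth up to the boundary.\<close>

definition has_trace :: "(real \<Rightarrow> real \<times> real) \<Rightarrow> real set \<Rightarrow> (real \<times> real) L2 \<Rightarrow> real L2 \<Rightarrow> bool" where
  "has_trace \<gamma> I v g \<longleftrightarrow> (\<exists>F. (\<forall>n::nat. smooth (F n)) \<and>
     (\<lambda>n. H1_graph (to_L2 Omega (F n))) \<longlonglongrightarrow> H1_graph v \<and>
     (\<lambda>n. to_L2 I (\<lambda>s. F n (\<gamma> s))) \<longlonglongrightarrow> g)"

definition trace_top :: "(real \<times> real) L2 \<Rightarrow> real L2" where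
  "trace_top v = (THE g. has_trace (\<lambda>x. (x, 0)) {0..pi} v g)"

definition trace_left :: "(real \<times> real) L2 \<Rightarrow> real L2" where
  "trace_left v = (THE g. has_trace (\<lambda>y. (0, y)) {-1..0} v g)"

section \<open>Solutions of the water wave system\<close>

definition L2_loc :: "(real \<Rightarrow> 'b::real_normed_vector) set" where
  "L2_loc = {u. \<forall>T. u \<in> sqint {0..T}}"

definition L2_loc_H1 :: "(real \<Rightarrow> (real \<times> real) L2) set" where
  "L2_loc_H1 = {\<phi>. (\<forall>t\<ge>0. \<phi> t \<in> sobolev_H1) \<and> (\<lambda>t. H1_graph (\<phi> t)) \<in> L2_loc}"

definition zeta_dot :: "(real \<Rightarrow> Hhalf) \<Rightarrow> real \<Rightarrow> H0" where
  "zeta_dot \<zeta> t = vector_derivative (\<lambda>s. H0_of_Hhalf (\<zeta> s)) (at t within {0..})"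

definition WW_solution ::
  "real L2 \<Rightarrow> (real \<Rightarrow> complex) \<Rightarrow> (real \<Rightarrow> (real \<times> real) L2) \<Rightarrow> (real \<Rightarrow> Hhalf) \<Rightarrow> bool" where
  "WW_solution h u \<phi> \<zeta> \<longleftrightarrow>
     \<phi> \<in> L2_loc_H1 \<and>
     continuous_on {0..} \<zeta> \<and>
     (\<lambda>s. H0_of_Hhalf (\<zeta> s)) differentiable_on {0..} \<and> continuous_on {0..} (zeta_dot \<zeta>) \<and>
     (AE t in lborel. t \<ge> 0 \<longrightarrow> trace_top (\<phi> t) + L2_of_H0 (H0_of_Hhalf (\<zeta> t)) = 0) \<and>
     (\<forall>\<Psi>\<in>sobolev_H1. \<forall>t>0.
        cinner (L2_of_H0 (zeta_dot \<zeta> t)) (trace_top \<Psi>) - cinner (L2_of_H0 (zeta_dot \<zeta> 0)) (trace_top \<Psi>) =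
        (LINT \<sigma>:{0..t}|lborel.
           cinner (weak_dx (\<phi> \<sigma>)) (weak_dx \<Psi>) + cinner (weak_dy (\<phi> \<sigma>)) (weak_dy \<Psi>)) -
        (LINT \<sigma>:{0..t}|lborel. u \<sigma> * cinner h (trace_left \<Psi>)))"

section \<open>Operator semigroups and well-posed linear control systems\<close>

definition bounded_clinear :: "('a::complex_hilbert \<Rightarrow> 'b::complex_hilbert) \<Rightarrow> bool" where
  "bounded_clinear f \<longleftrightarrow> bounded_linear f \<and> (\<forall>c x. f (c *\<^sub>C x) = c *\<^sub>C f x)"

definition C0_semigroup :: "(real \<Rightarrow> 'x \<Rightarrow> 'x::complex_hilbert) \<Rightarrow> bool" where
  "C0_semigroup T \<longleftrightarrow>
     (\<forall>t\<ge>0. bounded_clinear (T t)) \<and>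
     (\<forall>x. T 0 x = x) \<and>
     (\<forall>s\<ge>0. \<forall>t\<ge>0. \<forall>x. T (s + t) x = T s (T t x)) \<and>
     (\<forall>x. ((\<lambda>t. T t x) \<longlongrightarrow> x) (at_right 0))"

text \<open>Unbounded operators are represented by their graphs.\<close>

definition generator :: "(real \<Rightarrow> 'x \<Rightarrow> 'x::complex_hilbert) \<Rightarrow> ('x \<times> 'x) set" where
  "generator T = {(x, y). ((\<lambda>t. (T t x - x) /\<^sub>R t) \<longlongrightarrow> y) (at_right 0)}"

definition adjoint :: "('x::complex_hilbert \<times> 'x) set \<Rightarrow> ('x \<times> 'x) set" where
  "adjoint A = {(y, z). \<forall>(x, w)\<in>A. cinner w y = cinner x z}"

definition skew_adjoint :: "('x::complex_hilbert \<times> 'x) set \<Rightarrow> bool" where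
  "skew_adjoint A \<longleftrightarrow> closure (Domain A) = UNIV \<and> adjoint A = {(x, - y) | x y. (x, y) \<in> A}"

text \<open>As in \<^const>\<open>sqint\<close>, only the values on \<open>[0,\<infinity>)\<close> of input functions are relevant.\<close>

definition concatenation :: "real \<Rightarrow> (real \<Rightarrow> 'u) \<Rightarrow> (real \<Rightarrow> 'u) \<Rightarrow> real \<Rightarrow> 'u" where
  "concatenation \<tau> u v t = (if t < \<tau> then u t else v (t - \<tau>))"

text \<open>The input maps act on representatives: they are bounded linear maps from the seminormed space
  \<open>sqint {0..}\<close>. By the norm bound they identify functions that agree almost everywhere on
  \<open>[0,\<infinity>)\<close>, so that they are exactly the bounded linear operators on \<open>L\<^sup>2([0,\<infinity>);U)\<close>.\<close>

definition bounded_clinear_input ::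
  "((real \<Rightarrow> 'u::{complex_hilbert, second_countable_topology}) \<Rightarrow> 'x::complex_hilbert) \<Rightarrow> bool" where
  "bounded_clinear_input F \<longleftrightarrow>
     (\<forall>u\<in>sqint {0..}. \<forall>v\<in>sqint {0..}. F (\<lambda>t. u t + v t) = F u + F v) \<and>
     (\<forall>c. \<forall>u\<in>sqint {0..}. F (\<lambda>t. c *\<^sub>C u t) = c *\<^sub>C F u) \<and>
     (\<exists>K. \<forall>u\<in>sqint {0..}. norm (F u) \<le> K * sqrt (LINT t:{0..}|lborel. (norm (u t))\<^sup>2))"

definition well_posed_system ::
  "(real \<Rightarrow> 'x \<Rightarrow> 'x::complex_hilbert) \<Rightarrow>
   (real \<Rightarrow> (real \<Rightarrow> 'u::{complex_hilbert, second_countable_topology}) \<Rightarrow> 'x) \<Rightarrow> bool" where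
  "well_posed_system T \<Phi> \<longleftrightarrow>
     C0_semigroup T \<and>
     (\<forall>t\<ge>0. bounded_clinear_input (\<Phi> t)) \<and>
     (\<forall>\<tau>\<ge>0. \<forall>t\<ge>0. \<forall>u\<in>sqint {0..}. \<forall>v\<in>sqint {0..}.
        \<Phi> (\<tau> + t) (concatenation \<tau> u v) = T t (\<Phi> \<tau> u) + \<Phi> t v)"

text \<open>The natural extension of \<open>\<Phi> \<tau>\<close> to locally square integrable inputs.\<close>

definition input_ext ::
  "(real \<Rightarrow> (real \<Rightarrow> 'u::real_vector) \<Rightarrow> 'x) \<Rightarrow> real \<Rightarrow> (real \<Rightarrow> 'u) \<Rightarrow> 'x" where
  "input_ext \<Phi> \<tau> u = \<Phi> \<tau> (\<lambda>t. indicator {0..\<tau>} t *\<^sub>R u t)"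

end

theory Submission
  imports Defs
begin

text \<open>The potential splits as \<open>\<phi> = u n - D \<zeta>\<close>. Here \<open>D\<close> is the Dirichlet extension of surface data,
  harmonic with homogeneous Neumann conditions on the other three sides, and \<open>n\<close> is the weak solution
  with vanishing surface trace and flux \<open>h\<close> on the left side, which exists by the Poincare inequality
  and the Riesz representation theorem. Testing the weak formulation with the extensions
  \<open>cos (k x) cosh (k (y + 1)) / cosh k\<close> of the basis functions decouples the system into forced
  harmonic oscillators of frequency \<open>sqrt (k tanh k)\<close>. Hence the semigroup acts by plane rotations,
  the input maps are given by Duhamel's formula, and conservation of energy yields uniqueness.
  The control operator is bounded because the pairings of \<open>h\<close> with the left traces of these
  extensions are square summable, by Hilbert's inequality for \<open>1 / (j + k)\<close>.
  Traces exist since the smooth functions are dense in \<open>H\<^sup>1\<close> of the rectangle.\<close>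

section \<open>Closed subspaces of complex Hilbert spaces\<close>

text \<open>The inner product of \<open>Hhalf\<close> is the Dirichlet energy of the harmonic
  extension: the gradients of the extended basis functions are orthogonal with squared norm
  \<open>k tanh k\<close>. This makes the free motion unitary and, by Bessel's inequality, puts the
  surface trace of every Sobolev function into \<open>Hhalf\<close> up to its mean. That mean is
  invisible to \<open>H0\<close>; a constant test function leaves only the pairing with h, which
  vanishes because h has mean zero. The left traces of the extensions are not orthogonal, so
  Bessel's inequality does not bound the control operator, and h has no smoothness that would make
  its pairings decay; the decay comes from the concentration of the modes near the corner, measured
  by their Gram matrix. Inputs are only square integrable as well: velocity coordinates are merely
  absolutely continuous and obey their equations in integrated form, and the potential is determined
  for almost every time only. Since the free motion is a group, Duhamel's integral can be pulled
  back to time 0, where its integrand does not depend on the final time.\<close>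

definition csubspace :: "'a::complex_hilbert set \<Rightarrow> bool" where
  "csubspace W \<longleftrightarrow> 0 \<in> W \<and> (\<forall>x\<in>W. \<forall>y\<in>W. x + y \<in> W) \<and> (\<forall>c. \<forall>x\<in>W. c *\<^sub>C x \<in> W)"

lemma csubspaceD:
  assumes "csubspace W"
  shows "0 \<in> W" "x \<in> W \<Longrightarrow> y \<in> W \<Longrightarrow> x + y \<in> W" "x \<in> W \<Longrightarrow> c *\<^sub>C x \<in> W"
  using assms by (auto simp: csubspace_def)

lemma scaleC_minus1: "(-1) *\<^sub>C x = - (x::'a::complex_hilbert)"
  using scaleR_scaleC[of "-1" x] by simp

lemma csubspace_diff: "csubspace W \<Longrightarrow> x \<in> W \<Longrightarrow> y \<in> W \<Longrightarrow> x - y \<in> W"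
  using csubspaceD(2)[of W x "(-1) *\<^sub>C y"] csubspaceD(3)[of W y "-1"] by (simp add: scaleC_minus1)

lemma csubspace_closure:
  assumes "csubspace W" shows "csubspace (closure W)"
  unfolding csubspace_def
proof (intro conjI ballI allI)
  show "0 \<in> closure W" using csubspaceD(1)[OF assms] closure_subset by auto
next
  fix x y assume "x \<in> closure W" "y \<in> closure W"
  then obtain X Y where X: "\<And>n. X n \<in> W" "X \<longlonglongrightarrow> x" and Y: "\<And>n. Y n \<in> W" "Y \<longlonglongrightarrow> y"
    unfolding closure_sequential by metis
  show "x + y \<in> closure W" unfolding closure_sequential
    using X Y csubspaceD(2)[OF assms] by (intro exI[of _ "\<lambda>n. X n + Y n"]) (auto intro: tendsto_add)
next
  fix c x assume "x \<in> closure W"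
  then obtain X where X: "\<And>n. X n \<in> W" "X \<longlonglongrightarrow> x"
    unfolding closure_sequential by metis
  show "c *\<^sub>C x \<in> closure W" unfolding closure_sequential
    using X csubspaceD(3)[OF assms] scaleC.tendsto[OF tendsto_const X(2)]
    by (intro exI[of _ "\<lambda>n. c *\<^sub>C X n"]) auto
qed

text \<open>A minimising sequence for the distance to \<open>W\<close> is Cauchy by the
  parallelogram law, and comparing its limit p with the points \<open>p + c v\<close> of
  \<open>W\<close> forces orthogonality. It serves three times: for the Riesz representation, for
  the density of smooth functions, and for the density of the generator's domain.\<close>

lemma closed_projection:
  fixes x :: "'a::complex_hilbert"
  assumes W: "csubspace W" "closed W"
  obtains p where "p \<in> W" "\<And>w. w \<in> W \<Longrightarrow> cinner (x - p) w = 0"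
proof -
  have ne: "W \<noteq> {}" using csubspaceD(1)[OF W(1)] by auto
  define d where "d = infdist x W"
  have d0: "d \<ge> 0" by (simp add: d_def infdist_nonneg)
  have dle: "d \<le> norm (x - w)" if "w \<in> W" for w
    using infdist_le[OF that, of x] by (simp add: d_def dist_norm)
  have "\<exists>w\<in>W. norm (x - w) < d + 1 / real (Suc n)" for n
  proof -
    have "bdd_below (dist x ` W)" by (rule bdd_belowI2[of _ 0]) simp
    moreover have "(INF w\<in>W. dist x w) < d + 1 / real (Suc n)"
      using ne by (simp add: d_def infdist_notempty)
    ultimately show ?thesis using cINF_less_iff[OF ne] by (auto simp: dist_norm)
  qed
  then obtain w where w: "\<And>n. w n \<in> W" "\<And>n. norm (x - w n) < d + 1 / real (Suc n)" by metis
  \<comment> \<open>The midpoint of \<open>w m\<close> and \<open>w n\<close> lies in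
    \<open>W\<close>, so its distance from x is at least d. The parallelogram law then bounds the
    gap by the excess \<open>(d + 1/(k+1))^2 - d^2\<close>, which is at most
    \<open>(2d + 1)/(k+1)\<close>.\<close>
  have bd: "(norm (w m - w n))\<^sup>2 \<le> 4 * (2 * d + 1) / real (Suc k)" if "k \<le> m" "k \<le> n" for m n k
  proof -
    have nb: "(norm (x - w i))\<^sup>2 \<le> d\<^sup>2 + (2 * d + 1) / real (Suc k)" if "k \<le> i" for i
    proof -
      have le: "1 / real (Suc i) \<le> 1 / real (Suc k)" using that by (simp add: frac_le)
      have "(norm (x - w i))\<^sup>2 \<le> (d + 1 / real (Suc k))\<^sup>2"
        using w(2)[of i] le by (intro power_mono) auto
      also have "\<dots> = d\<^sup>2 + 2 * d / real (Suc k) + (1 / real (Suc k)) * (1 / real (Suc k))"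
        by (simp add: power2_eq_square algebra_simps)
      also have "(1 / real (Suc k)) * (1 / real (Suc k)) \<le> (1 / real (Suc k)) * 1"
        by (intro mult_left_mono) auto
      finally show ?thesis by (simp add: add_divide_distrib)
    qed
    have "(1/2) *\<^sub>C (w m + w n) \<in> W" using w(1) csubspaceD[OF W(1)] by blast
    from dle[OF this] have "d \<le> norm (x - (1/2) *\<^sub>R (w m + w n))"
      by (simp add: scaleR_scaleC)
    moreover have "2 *\<^sub>R (x - (1/2) *\<^sub>R (w m + w n)) = (x - w m) + (x - w n)"
      by (simp add: scaleR_diff_right scaleR_2)
    then have "norm ((x - w m) + (x - w n)) = 2 * norm (x - (1/2) *\<^sub>R (w m + w n))"
      by (metis norm_scaleR abs_numeral)
    ultimately have "2 * d \<le> norm ((x - w m) + (x - w n))" by simp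
    then have "4 * d\<^sup>2 \<le> (norm ((x - w m) + (x - w n)))\<^sup>2"
      using power_mono[of "2 * d" _ 2] d0 by (simp add: power_mult_distrib)
    moreover have "(norm (w m - w n))\<^sup>2 + (norm ((x - w m) + (x - w n)))\<^sup>2 
       = 2 * (norm (x - w m))\<^sup>2 + 2 * (norm (x - w n))\<^sup>2"
      by (simp add: power2_norm_eq_inner inner_diff inner_add inner_commute algebra_simps)
    ultimately have "(norm (w m - w n))\<^sup>2 \<le> 4 * ((2 * d + 1) / real (Suc k))"
      using nb[OF that(1)] nb[OF that(2)] by linarith
    then show ?thesis by simp
  qed
  have "Cauchy w"
  proof (rule CauchyI)
    fix e :: real assume "e > 0"
    obtain k where k: "4 * (2 * d + 1) / e\<^sup>2 < real (Suc k)"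
      by (meson reals_Archimedean2 less_trans of_nat_less_iff lessI)
    then have "4 * (2 * d + 1) / real (Suc k) < e\<^sup>2"
      using \<open>e > 0\<close> by (simp add: field_simps)
    then have "(norm (w m - w n))\<^sup>2 < e\<^sup>2" if "k \<le> m" "k \<le> n" for m n
      using bd[OF that] by simp
    then show "\<exists>M. \<forall>m\<ge>M. \<forall>n\<ge>M. norm (w m - w n) < e"
      using \<open>e > 0\<close> by (metis power_less_imp_less_base less_imp_le)
  qed
  then obtain p where p: "w \<longlonglongrightarrow> p" using Cauchy_convergent convergent_def by blast
  have pW: "p \<in> W" by (rule closed_sequentially[OF W(2) w(1) p])
  have "norm (x - p) \<le> d"
  proof (rule LIMSEQ_le)
    show "(\<lambda>n. norm (x - w n)) \<longlonglongrightarrow> norm (x - p)" by (intro tendsto_intros p)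
    show "(\<lambda>n. d + 1 / real (Suc n)) \<longlonglongrightarrow> d"
      using tendsto_add[OF tendsto_const[of d] LIMSEQ_inverse_real_of_nat] by (simp add: inverse_eq_divide)
    show "\<exists>N. \<forall>n\<ge>N. norm (x - w n) \<le> d + 1 / real (Suc n)" using w(2) less_imp_le by blast
  qed
  have "cinner (x - p) v = 0" if v: "v \<in> W" for v
  proof (cases "v = 0")
    case False
    \<comment> \<open>The coefficient of the component of \<open>x - p\<close> along v: moving p by
      \<open>c v\<close> lowers the squared distance by \<open>|<x - p, v>|^2 / |v|^2\<close>, which
      minimality permits only if it is 0.\<close>
    define c where "c = cinner (x - p) v / of_real ((norm v)\<^sup>2)"
    have "p + c *\<^sub>C v \<in> W" using pW v csubspaceD[OF W(1)] by blast
    then have "norm (x - p) \<le> norm (x - p - c *\<^sub>C v)"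
      using dle \<open>norm (x - p) \<le> d\<close> by (metis diff_diff_eq order_trans)
    then have 1: "(norm (x - p))\<^sup>2 \<le> (norm (x - p - c *\<^sub>C v))\<^sup>2" by (rule power_mono) simp
    define q where "q = x - p"
    let ?z = "cinner q v"
    have nv: "complex_of_real ((norm v)\<^sup>2) \<noteq> 0" using False by simp
    have "complex_of_real ((norm (q - c *\<^sub>C v))\<^sup>2) = cinner (q - c *\<^sub>C v) (q - c *\<^sub>C v)"
      by (simp only: cinner_self)
    also have "\<dots> = cinner q q - cnj c * ?z - c * cnj ?z + c * cnj c * cinner v v"
      using cinner_commute[of v q]
      by (simp add: cinner.diff_left cinner.diff_right cinner_scaleC_left cinner_scaleC_right algebra_simps)
    also have "c * cnj c * cinner v v = cnj c * ?z"
    proof -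
      have "c * cinner v v = ?z" unfolding cinner_self c_def q_def using nv by simp
      then show ?thesis by (metis mult.assoc mult.commute)
    qed
    also have "c * cnj ?z = complex_of_real ((cmod ?z)\<^sup>2 / (norm v)\<^sup>2)"
      unfolding c_def q_def by (simp only: of_real_divide complex_norm_square times_divide_eq_left)
    also have "cinner q q - cnj c * ?z - complex_of_real ((cmod ?z)\<^sup>2 / (norm v)\<^sup>2) + cnj c * ?z
      = complex_of_real ((norm q)\<^sup>2 - (cmod ?z)\<^sup>2 / (norm v)\<^sup>2)"
      by (simp add: cinner_self)
    finally have "(norm (x - p - c *\<^sub>C v))\<^sup>2 = (norm (x - p))\<^sup>2 - (cmod ?z)\<^sup>2 / (norm v)\<^sup>2"
      using of_real_eq_iff unfolding q_def by blast
    with 1 have "(cmod ?z)\<^sup>2 / (norm v)\<^sup>2 \<le> 0" by simp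
    then show ?thesis using False by (simp add: divide_le_0_iff q_def)
  qed (simp add: cinner.zero_right)
  with pW show ?thesis using that by blast
qed

text \<open>Stated for a closed subset because it will be applied to the gradients of Sobolev
  functions with vanishing surface trace, which do not form a type. The bound makes the kernel
  \<open>N\<close> closed, and every element of V differs from one of \<open>N\<close> by a multiple
  of the residual z of projecting a point with \<open>F x \<noteq> 0\<close> onto
  \<open>N\<close>.\<close>

lemma Riesz_closed:
  fixes F :: "'a::complex_hilbert \<Rightarrow> complex"
  assumes V: "csubspace V" "closed V"
    and add: "\<And>x y. x \<in> V \<Longrightarrow> y \<in> V \<Longrightarrow> F (x + y) = F x + F y"
    and scale: "\<And>c x. x \<in> V \<Longrightarrow> F (c *\<^sub>C x) = c * F x"
    and bound: "\<And>x. x \<in> V \<Longrightarrow> cmod (F x) \<le> K * norm x"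
  obtains y where "y \<in> V" "\<And>x. x \<in> V \<Longrightarrow> F x = cinner x y"
proof (cases "\<forall>x\<in>V. F x = 0")
  case True
  then show ?thesis using that[of 0] csubspaceD(1)[OF V(1)] by (auto simp: cinner.zero_right)
next
  case False
  then obtain x where x: "x \<in> V" "F x \<noteq> 0" by blast
  have diff: "F (a - b) = F a - F b" if "a \<in> V" "b \<in> V" for a b
    using add[OF that(1) csubspaceD(3)[OF V(1) that(2), of "-1"]] scale[OF that(2), of "-1"]
    by (simp add: scaleC_minus1)
  define N where "N = {v \<in> V. F v = 0}"
  have "csubspace N" unfolding csubspace_def N_def
    using csubspaceD[OF V(1)] add scale scale[of 0 0] by (auto simp: scaleC.zero_left)
  have "closed N"
  proof (subst closed_sequential_limits, intro allI impI)
    fix X l assume X: "(\<forall>n. X n \<in> N) \<and> X \<longlonglongrightarrow> l"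
    then have Xv: "X n \<in> V" "F (X n) = 0" for n by (auto simp: N_def)
    have l: "l \<in> V" using closed_sequentially[OF V(2), of X l] Xv X by blast
    have "(\<lambda>n. K * norm (l - X n)) \<longlonglongrightarrow> K * norm (l - l)"
      using X by (intro tendsto_intros) auto
    moreover have "cmod (F l) \<le> K * norm (l - X n)" for n
      using bound[OF csubspace_diff[OF V(1) l Xv(1)], of n] diff[OF l Xv(1)] Xv(2) by simp
    ultimately have "cmod (F l) \<le> 0" by (intro LIMSEQ_le_const[where X="\<lambda>n. K * norm (l - X n)"]) auto
    then show "l \<in> N" using l by (simp add: N_def)
  qed
  obtain p where p: "p \<in> N" "\<And>w. w \<in> N \<Longrightarrow> cinner (x - p) w = 0"
    using closed_projection[OF \<open>csubspace N\<close> \<open>closed N\<close>] by blast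
  define z where "z = x - p"
  have zV: "z \<in> V" using csubspace_diff[OF V(1) x(1)] p(1) by (simp add: z_def N_def)
  have Fz: "F z = F x" using diff[OF x(1)] p(1) by (simp add: z_def N_def)
  have z0: "z \<noteq> 0" using Fz x(2) scale[OF csubspaceD(1)[OF V(1)], of 0] by (auto simp: scaleC.zero_left)
  \<comment> \<open>Chosen so that both sides agree at z, that is,
    \<open>cnj a * |z|^2 = F z\<close>.\<close>
  define a where "a = cnj (F z) / of_real ((norm z)\<^sup>2)"
  have "F v = cinner v (a *\<^sub>C z)" if v: "v \<in> V" for v
  proof -
    define w where "w = v - (F v / F z) *\<^sub>C z"
    have "w \<in> N" unfolding N_def w_def
      using diff[OF v csubspaceD(3)[OF V(1) zV]] scale[OF zV] Fz x(2) 
        csubspace_diff[OF V(1) v csubspaceD(3)[OF V(1) zV]] by simp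
    then have "cinner w z = 0" using p(2)[of w] cinner_commute[of w z] by (simp add: z_def)
    then have "cinner v z = (F v / F z) * of_real ((norm z)\<^sup>2)"
      by (simp add: w_def cinner.diff_left cinner_scaleC_left cinner_self)
    then show ?thesis using z0 Fz x(2) by (simp add: cinner_scaleC_right a_def)
  qed
  then show ?thesis using that csubspaceD(3)[OF V(1) zV] by blast
qed

section \<open>Calculus of smooth functions of two variables\<close>

lemma Ck_cont: "Ck n f \<Longrightarrow> continuous_on UNIV f"
  by (cases n) auto

lemma Ck_Suc_D: "Ck (Suc n) f \<Longrightarrow> Ck n f"
proof (induction n arbitrary: f)
  case (Suc n)
  then show ?case using Ck.simps(2)[of "Suc n" f] Ck.simps(2)[of n f] by blast
qed simp

lemma Ck_pd:
  assumes "Ck (Suc n) f"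
  shows "((\<lambda>s. f (s, y)) has_vector_derivative pdx f (x, y)) (at x)"
    and "((\<lambda>s. f (x, s)) has_vector_derivative pdy f (x, y)) (at y)"
  using assms by (auto simp: pdx_def pdy_def vector_derivative_works)

lemma pdx_eqI: "(\<And>x y. ((\<lambda>s. f (s, y)) has_vector_derivative fx (x, y)) (at x)) \<Longrightarrow> pdx f = fx"
  by (auto simp: pdx_def fun_eq_iff vector_derivative_at)

lemma pdy_eqI: "(\<And>x y. ((\<lambda>s. f (x, s)) has_vector_derivative fy (x, y)) (at y)) \<Longrightarrow> pdy f = fy"
  by (auto simp: pdy_def fun_eq_iff vector_derivative_at)

lemma Ck_SucI:
  assumes "continuous_on UNIV f"
    and x: "\<And>x y. ((\<lambda>s. f (s, y)) has_vector_derivative fx (x, y)) (at x)"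
    and y: "\<And>x y. ((\<lambda>s. f (x, s)) has_vector_derivative fy (x, y)) (at y)"
    and "Ck n fx" "Ck n fy"
  shows "Ck (Suc n) f"
  using assms differentiableI_vector[OF x] differentiableI_vector[OF y] pdx_eqI[OF x] pdy_eqI[OF y] by auto

lemma Ck_add: "Ck n f \<Longrightarrow> Ck n g \<Longrightarrow> Ck n (\<lambda>p. f p + g p)"
proof (induction n arbitrary: f g)
  case (Suc n)
  show ?case
    by (rule Ck_SucI[of _ "\<lambda>p. pdx f p + pdx g p" "\<lambda>p. pdy f p + pdy g p"])
      (use Suc in \<open>auto intro!: continuous_on_add has_vector_derivative_add Ck_pd\<close>)
qed (auto intro: continuous_on_add)

lemma pd_mult:
  assumes "Ck (Suc n) f" "Ck (Suc m) g"
  shows "pdx (\<lambda>p. f p * g p) = (\<lambda>p. f p * pdx g p + pdx f p * g p)" 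
    and "pdy (\<lambda>p. f p * g p) = (\<lambda>p. f p * pdy g p + pdy f p * g p)"
  by (rule pdx_eqI pdy_eqI; intro has_vector_derivative_mult Ck_pd[OF assms(1)] Ck_pd[OF assms(2)])+

lemma Ck_mult: "Ck n f \<Longrightarrow> Ck n g \<Longrightarrow> Ck n (\<lambda>p. f p * g p)"
proof (induction n arbitrary: f g)
  case (Suc n)
  show ?case
    by (rule Ck_SucI[of _ "\<lambda>p. f p * pdx g p + pdx f p * g p" "\<lambda>p. f p * pdy g p + pdy f p * g p"])
      (use Suc Suc.prems[THEN Ck_Suc_D] in \<open>auto intro!: continuous_on_mult has_vector_derivative_mult Ck_pd Ck_add simp del: Ck.simps(2)\<close>, 
       use Suc in auto)
qed (auto intro: continuous_on_mult)

lemma Ck_const: "Ck n (\<lambda>p. c)"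
proof (induction n arbitrary: c)
  case (Suc n)
  show ?case by (rule Ck_SucI[of _ "\<lambda>p. 0" "\<lambda>p. 0"]) (auto intro: Suc)
qed auto

lemma pd_cnj:
  assumes "Ck (Suc n) f"
  shows "pdx (\<lambda>p. cnj (f p)) = (\<lambda>p. cnj (pdx f p))" "pdy (\<lambda>p. cnj (f p)) = (\<lambda>p. cnj (pdy f p))"
  by (rule pdx_eqI pdy_eqI; intro bounded_linear.has_vector_derivative[OF bounded_linear_cnj] Ck_pd[OF assms])+

lemma Ck_cnj: "Ck n f \<Longrightarrow> Ck n (\<lambda>p. cnj (f p))"
proof (induction n arbitrary: f)
  case (Suc n)
  show ?case
    by (rule Ck_SucI[of _ "\<lambda>p. cnj (pdx f p)" "\<lambda>p. cnj (pdy f p)"])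
      (use Suc in \<open>auto intro!: continuous_on_cnj bounded_linear.has_vector_derivative[OF bounded_linear_cnj] Ck_pd\<close>)
qed (auto intro: continuous_on_cnj)

text \<open>Since \<open>Ck\<close> recurses on partial derivatives, a function of one coordinate is
  supplied together with the whole sequence of its derivatives; the induction over the order of
  differentiability then only shifts the index j.\<close>

lemma Ck_fst_family:
  fixes F :: "nat \<Rightarrow> real \<Rightarrow> complex"
  assumes F: "\<And>n x. (F n has_vector_derivative F (Suc n) x) (at x)"
  shows "Ck m (\<lambda>p. F j (fst p))" "pdx (\<lambda>p. F j (fst p)) = (\<lambda>p. F (Suc j) (fst p))" "pdy (\<lambda>p. F j (fst p)) = (\<lambda>p. 0)"
proof -
  have c: "continuous_on UNIV (F n)" for n
    using F by (meson continuous_at_imp_continuous_on has_vector_derivative_continuous)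
  have c': "continuous_on UNIV (\<lambda>p::real\<times>real. F j (fst p))" for j
    by (rule continuous_on_compose2[OF c[of j]]) (auto intro!: continuous_intros)
  show "Ck m (\<lambda>p. F j (fst p))"
  proof (induction m arbitrary: j)
    case (Suc m)
    show ?case
      by (rule Ck_SucI[of _ "\<lambda>p. F (Suc j) (fst p)" "\<lambda>p. 0"]) (use F c' Suc Ck_const in auto)
  qed (simp add: c')
  show "pdx (\<lambda>p. F j (fst p)) = (\<lambda>p. F (Suc j) (fst p))" "pdy (\<lambda>p. F j (fst p)) = (\<lambda>p. 0)"
    by (rule pdx_eqI pdy_eqI; use F in auto)+
qed

lemma Ck_snd_family:
  fixes F :: "nat \<Rightarrow> real \<Rightarrow> complex"
  assumes F: "\<And>n x. (F n has_vector_derivative F (Suc n) x) (at x)"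
  shows "Ck m (\<lambda>p. F j (snd p))" "pdy (\<lambda>p. F j (snd p)) = (\<lambda>p. F (Suc j) (snd p))" "pdx (\<lambda>p. F j (snd p)) = (\<lambda>p. 0)"
proof -
  have c: "continuous_on UNIV (F n)" for n
    using F by (meson continuous_at_imp_continuous_on has_vector_derivative_continuous)
  have c': "continuous_on UNIV (\<lambda>p::real\<times>real. F j (snd p))" for j
    by (rule continuous_on_compose2[OF c[of j]]) (auto intro!: continuous_intros)
  show "Ck m (\<lambda>p. F j (snd p))"
  proof (induction m arbitrary: j)
    case (Suc m)
    show ?case
      by (rule Ck_SucI[of _ "\<lambda>p. 0" "\<lambda>p. F (Suc j) (snd p)"]) (use F c' Suc Ck_const in auto)
  qed (simp add: c')
  show "pdy (\<lambda>p. F j (snd p)) = (\<lambda>p. F (Suc j) (snd p))" "pdx (\<lambda>p. F j (snd p)) = (\<lambda>p. 0)"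
    by (rule pdx_eqI pdy_eqI; use F in auto)+
qed

lemma smooth_add: "smooth f \<Longrightarrow> smooth g \<Longrightarrow> smooth (\<lambda>p. f p + g p)"
  and smooth_mult: "smooth f \<Longrightarrow> smooth g \<Longrightarrow> smooth (\<lambda>p. f p * g p)"
  and smooth_cnj: "smooth f \<Longrightarrow> smooth (\<lambda>p. cnj (f p))"
  and smooth_const: "smooth (\<lambda>p. c)"
  by (auto simp: smooth_def intro: Ck_add Ck_mult Ck_cnj Ck_const)

lemma smooth_diff: "smooth f \<Longrightarrow> smooth g \<Longrightarrow> smooth (\<lambda>p. f p - g p)"
  using smooth_add[OF _ smooth_mult[OF smooth_const[of "-1"], of g], of f] by simp

lemma smooth_pd: "smooth f \<Longrightarrow> smooth (pdx f)" "smooth f \<Longrightarrow> smooth (pdy f)"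
  unfolding smooth_def by (meson Ck.simps(2))+

lemma smooth_C1: "smooth f \<Longrightarrow> Ck (Suc 0) f" by (simp only: smooth_def)

lemma smooth_continuous: "smooth f \<Longrightarrow> continuous_on S f"
  using Ck_cont[of 0 f] continuous_on_subset unfolding smooth_def by blast

subsection \<open>Elementary smooth functions\<close>

text \<open>The derivatives of an exponential are explicit in closed form, as
  \<open>Ck_fst_family\<close> demands; cos and cosh are reduced to this case as combinations of
  complex exponentials.\<close>

lemma vd_exp: "((\<lambda>x. c ^ n * exp (c * complex_of_real x + d)) has_vector_derivative 
    c ^ Suc n * exp (c * complex_of_real x + d)) (at x)"
  by (rule has_vector_derivative_real_field[of "\<lambda>z. c ^ n * exp (c * z + d)"])
    (auto intro!: derivative_eq_intros)

lemma smooth_exp_fst: "smooth (\<lambda>p. exp (c * complex_of_real (fst p) + d))"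
  and smooth_exp_snd: "smooth (\<lambda>p. exp (c * complex_of_real (snd p) + d))"
  unfolding smooth_def
  using Ck_fst_family(1)[where F = "\<lambda>n x. c ^ n * exp (c * complex_of_real x + d)", OF vd_exp, of _ 0] 
    Ck_snd_family(1)[where F = "\<lambda>n x. c ^ n * exp (c * complex_of_real x + d)", OF vd_exp, of _ 0] by simp_all

lemma cos_via_exp: "complex_of_real (cos (a * x + b)) 
    = (1/2) * exp ((\<i> * a) * of_real x + \<i> * b) + (1/2) * exp ((- \<i> * a) * of_real x + (- \<i> * b))"
  unfolding cos_of_real[symmetric] cos_exp_eq by (simp add: algebra_simps)

lemma smooth_cos_fst: "smooth (\<lambda>p. complex_of_real (cos (a * fst p + b)))"
  and smooth_cos_snd: "smooth (\<lambda>p. complex_of_real (cos (a * snd p + b)))"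
  unfolding cos_via_exp by (intro smooth_add smooth_mult smooth_const smooth_exp_fst smooth_exp_snd)+

lemma smooth_cosh_snd: "smooth (\<lambda>p. complex_of_real (cosh (a * snd p + b)))"
proof -
  have "complex_of_real (cosh t) = (1/2) * exp (of_real t) + (1/2) * exp (of_real (- t))" for t
    by (simp only: cosh_field_def exp_of_real) simp
  from this[of "a * _ + b"]
  have "complex_of_real (cosh (a * x + b)) = (1/2) * exp (of_real a * of_real x + of_real b) 
      + (1/2) * exp (of_real (- a) * of_real x + of_real (- b))" for x
    by simp
  then show ?thesis
    by (simp only:) (intro smooth_add smooth_mult smooth_const smooth_exp_snd)
qed

lemma vd_linear: "((\<lambda>x. if n = 0 then complex_of_real x else if n = Suc 0 then 1 else 0) has_vector_derivative 
    (if Suc n = 0 then complex_of_real x else if Suc n = Suc 0 then 1 else 0)) (at x)"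
  by (cases n) (auto intro!: derivative_eq_intros)

lemma smooth_fst: "smooth (\<lambda>p. complex_of_real (fst p))"
  and smooth_snd: "smooth (\<lambda>p. complex_of_real (snd p))"
  unfolding smooth_def
  using Ck_fst_family(1)[where F = "\<lambda>n x. if n = 0 then complex_of_real x else if n = Suc 0 then 1 else 0", OF vd_linear, of _ 0]
    Ck_snd_family(1)[where F = "\<lambda>n x. if n = 0 then complex_of_real x else if n = Suc 0 then 1 else 0", OF vd_linear, of _ 0] by simp_all

text \<open>Cutoff functions are built from \<open>exp (- 1 / x)\<close>, whose derivatives are of the form
  \<open>p (1 / x) * exp (- 1 / x)\<close> with polynomials \<open>p\<close>.\<close>

primrec cut_poly :: "nat \<Rightarrow> real poly" where
  "cut_poly 0 = 1"
| "cut_poly (Suc n) = [:0, 0, 1:] * (cut_poly n - pderiv (cut_poly n))"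

definition cut_exp :: "nat \<Rightarrow> real \<Rightarrow> real" where
  "cut_exp n x = (if x \<le> 0 then 0 else poly (cut_poly n) (1 / x) * exp (- (1 / x)))"

lemma poly_exp_tendsto_0: "((\<lambda>y. poly p y * exp (- y)) \<longlongrightarrow> (0::real)) at_top"
proof -
  have "((\<lambda>y. \<Sum>i\<le>degree p. coeff p i * (y ^ i / exp y)) \<longlongrightarrow> (\<Sum>i\<le>degree p. coeff p i * 0)) at_top"
    by (intro tendsto_sum tendsto_mult tendsto_const tendsto_power_div_exp_0)
  then show ?thesis by (simp add: poly_altdef sum_distrib_right exp_minus divide_inverse mult.assoc)
qed

lemma cut_exp_deriv: "(cut_exp n has_real_derivative cut_exp (Suc n) x) (at x)"
proof -
  consider "x < 0" | "x > 0" | "x = 0" by linarith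
  then show ?thesis
  proof cases
    case 1
    have "((\<lambda>_. 0) has_real_derivative cut_exp (Suc n) x) (at x)"
      using 1 by (auto simp: cut_exp_def intro!: derivative_eq_intros)
    then show ?thesis
      by (rule has_field_derivative_transform_within_open[where S="{..<0}"]) (use 1 in \<open>auto simp: cut_exp_def\<close>)
  next
    case 2
    have "((\<lambda>x. poly (cut_poly n) (1 / x) * exp (- (1 / x))) has_real_derivative cut_exp (Suc n) x) (at x)"
      using 2 by (auto simp: cut_exp_def power2_eq_square field_simps intro!: derivative_eq_intros DERIV_chain2[OF poly_DERIV])
    then show ?thesis
      by (rule has_field_derivative_transform_within_open[where S="{0<..}"]) (use 2 in \<open>auto simp: cut_exp_def\<close>)
  next
    case 3
    \<comment> \<open>Left of 0 the difference quotient vanishes. Right of 0 it is, in the variable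
      \<open>1 / y\<close>, a polynomial times a decaying exponential; the factor
      \<open>[:0, 1:]\<close> is the \<open>1 / y\<close> of the quotient.\<close>
    have "((\<lambda>y. (cut_exp n y - cut_exp n 0) / (y - 0)) \<longlongrightarrow> 0) (at 0)"
    proof (subst filterlim_at_split, intro conjI)
      have "eventually (\<lambda>y. (0::real) = (cut_exp n y - cut_exp n 0) / (y - 0)) (at_left 0)"
        by (auto simp: cut_exp_def eventually_at_filter)
      then show "((\<lambda>y. (cut_exp n y - cut_exp n 0) / (y - 0)) \<longlongrightarrow> 0) (at_left 0)"
        by (rule Lim_transform_eventually[OF tendsto_const])
      have "((\<lambda>y. poly ([:0, 1:] * cut_poly n) (inverse y) * exp (- inverse y)) \<longlongrightarrow> (0::real)) (at_right 0)"
        by (rule filterlim_compose[OF poly_exp_tendsto_0 filterlim_inverse_at_top_right])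
      moreover have "eventually (\<lambda>y::real. poly ([:0, 1:] * cut_poly n) (inverse y) * exp (- inverse y)
          = (cut_exp n y - cut_exp n 0) / (y - 0)) (at_right 0)"
        by (auto simp: cut_exp_def eventually_at_filter inverse_eq_divide)
      ultimately show "((\<lambda>y. (cut_exp n y - cut_exp n 0) / (y - 0)) \<longlongrightarrow> 0) (at_right 0)"
        by (rule Lim_transform_eventually)
    qed
    then show ?thesis using 3 by (simp add: has_field_derivative_iff cut_exp_def)
  qed
qed

lemma cut_exp_0: "0 \<le> cut_exp 0 x" "cut_exp 0 x \<le> 1" "x \<le> 0 \<Longrightarrow> cut_exp n x = 0"
  by (auto simp: cut_exp_def)

text \<open>With \<open>t = n * d\<close> the product is d times the derivative in d of
  \<open>cut_exp 0 (n * d - 1)\<close>. The bound 2 therefore says that the slope of the cutoff at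
  distance d from an endpoint is at most \<open>2 / d\<close> for all n, and the last bound makes it
  tend to 0 as n grows. In the variable \<open>y = 1 / (t - 1)\<close> the product is
  \<open>(y + y^2) exp (- y)\<close>.\<close>

lemma cut_exp_1:
  assumes "t > 1" 
  shows "0 \<le> t * cut_exp (Suc 0) (t - 1)" "t * cut_exp (Suc 0) (t - 1) \<le> 2"
    "t * cut_exp (Suc 0) (t - 1) \<le> 1 / (t - 1) + (1 / (t - 1))\<^sup>2"
proof -
  define y where "y = 1 / (t - 1)"
  have y: "y > 0" "t = 1 + 1 / y" using assms by (auto simp: y_def field_simps)
  have e: "t * cut_exp (Suc 0) (t - 1) = (y + y\<^sup>2) * exp (- y)"
  proof -
    have "t - 1 = 1 / y" using y by simp
    moreover have "cut_exp (Suc 0) (1 / y) = y * y * exp (- y)"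
      using y(1) by (simp add: cut_exp_def not_le)
    ultimately have "t * cut_exp (Suc 0) (t - 1) = (1 + 1 / y) * (y * y * exp (- y))" using y(2) by metis
    also have "\<dots> = (y + y\<^sup>2) * exp (- y)" using y(1) by (simp add: power2_eq_square distrib_right)
    finally show ?thesis .
  qed
  show "0 \<le> t * cut_exp (Suc 0) (t - 1)" unfolding e using y by simp
  show "t * cut_exp (Suc 0) (t - 1) \<le> 1 / (t - 1) + (1 / (t - 1))\<^sup>2"
    unfolding e y_def[symmetric] using y by (intro mult_left_le) auto
  have "1 + y + y\<^sup>2 / 2 \<le> exp y" by (rule exp_lower_Taylor_quadratic) (use y in simp)
  then have "y + y\<^sup>2 \<le> 2 * exp y" using y by linarith
  then show "t * cut_exp (Suc 0) (t - 1) \<le> 2" unfolding e by (simp add: exp_minus field_simps)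
qed

lemma cut_exp_1_bound:
  assumes "d > 0"
  shows "\<bar>real n * cut_exp (Suc 0) (real n * d - 1)\<bar> \<le> 2 / d"
proof (cases "real n * d > 1")
  case True
  from cut_exp_1(1,2)[OF this] show ?thesis using assms by (simp add: field_simps)
next
  case False
  then show ?thesis using assms by (simp add: cut_exp_0)
qed

lemma cut_limits:
  assumes "d > 0"
  shows "(\<lambda>n. cut_exp 0 (real n * d - 1)) \<longlonglongrightarrow> 1"
    and "(\<lambda>n. real n * cut_exp (Suc 0) (real n * d - 1)) \<longlonglongrightarrow> 0"
proof -
  have nd: "filterlim (\<lambda>n. real n * d - 1) at_top sequentially"
    using filterlim_tendsto_add_at_top[OF tendsto_const[of "-1"] 
      filterlim_tendsto_pos_mult_at_top[OF tendsto_const assms filterlim_real_sequentially]]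
    by (simp add: mult.commute)
  have y: "(\<lambda>n. 1 / (real n * d - 1)) \<longlonglongrightarrow> 0"
    using tendsto_inverse_0_at_top[OF nd] by (simp add: inverse_eq_divide)
  have ev: "eventually (\<lambda>n. real n * d - 1 > 0) sequentially"
    using nd[unfolded filterlim_at_top_dense, rule_format, of 0] .
  have "(\<lambda>n. exp (- (1 / (real n * d - 1)))) \<longlonglongrightarrow> exp (- 0)" by (intro tendsto_intros y)
  moreover have "eventually (\<lambda>n. exp (- (1 / (real n * d - 1))) = cut_exp 0 (real n * d - 1)) sequentially"
    using ev by eventually_elim (simp add: cut_exp_def)
  ultimately show "(\<lambda>n. cut_exp 0 (real n * d - 1)) \<longlonglongrightarrow> 1"
    using Lim_transform_eventually by fastforce
  show "(\<lambda>n. real n * cut_exp (Suc 0) (real n * d - 1)) \<longlonglongrightarrow> 0"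
  proof (rule tendsto_sandwich[of "\<lambda>_. 0"])
    have "(\<lambda>n. (1 / (real n * d - 1) + (1 / (real n * d - 1))\<^sup>2) / d) \<longlonglongrightarrow> (0 + 0\<^sup>2) / d"
      by (intro tendsto_intros y) (use assms in auto)
    then show "(\<lambda>n. (1 / (real n * d - 1) + (1 / (real n * d - 1))\<^sup>2) / d) \<longlonglongrightarrow> 0" by simp
    show "\<forall>\<^sub>F n in sequentially. 0 \<le> real n * cut_exp (Suc 0) (real n * d - 1)"
      using ev
    proof eventually_elim
      case (elim n)
      then have "0 \<le> real n * d * cut_exp (Suc 0) (real n * d - 1)" using cut_exp_1(1)[of "real n * d"] by simp
      then have "0 \<le> d * (real n * cut_exp (Suc 0) (real n * d - 1))" by (simp add: mult_ac)
      then show ?case using assms by (simp only: zero_le_mult_iff) auto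
    qed
    show "\<forall>\<^sub>F n in sequentially. real n * cut_exp (Suc 0) (real n * d - 1) \<le> (1 / (real n * d - 1) + (1 / (real n * d - 1))\<^sup>2) / d"
      using ev
    proof eventually_elim
      case (elim n)
      then show ?case using cut_exp_1(3)[of "real n * d"] assms by (simp add: field_simps)
    qed
  qed simp
qed

text \<open>The shift by 1 makes \<open>cut a b n\<close> vanish within distance
  \<open>1 / n\<close> of both endpoints, and identically for \<open>n = 0\<close>. Inside the
  interval it tends to 1.\<close>

definition cut :: "real \<Rightarrow> real \<Rightarrow> nat \<Rightarrow> real \<Rightarrow> real" where
  "cut a b n x = cut_exp 0 (real n * (x - a) - 1) * cut_exp 0 (real n * (b - x) - 1)"

definition cut_deriv :: "real \<Rightarrow> real \<Rightarrow> nat \<Rightarrow> real \<Rightarrow> real" where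
  "cut_deriv a b n x = real n * cut_exp (Suc 0) (real n * (x - a) - 1) * cut_exp 0 (real n * (b - x) - 1)
     - cut_exp 0 (real n * (x - a) - 1) * (real n * cut_exp (Suc 0) (real n * (b - x) - 1))"

lemma cut_has_deriv: "(cut a b n has_real_derivative cut_deriv a b n x) (at x)"
  unfolding cut_def[abs_def] cut_deriv_def
  by (auto intro!: derivative_eq_intros DERIV_chain2[OF cut_exp_deriv])

lemma cut_bounds: "0 \<le> cut a b n x" "cut a b n x \<le> 1"
  using cut_exp_0(1,2) by (auto simp: cut_def intro: mult_le_one)

lemma cut_support: 
  assumes "cut a b n x \<noteq> 0" shows "n > 0" "a + 1 / real n \<le> x" "x \<le> b - 1 / real n"
proof -
  have *: "real n * (x - a) - 1 > 0" "real n * (b - x) - 1 > 0"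
    using assms cut_exp_0(3)[of "real n * (x - a) - 1" 0] cut_exp_0(3)[of "real n * (b - x) - 1" 0]
    by (auto simp: cut_def not_le[symmetric])
  then show "n > 0" by (cases n) auto
  with * show "a + 1 / real n \<le> x" "x \<le> b - 1 / real n" by (auto simp: field_simps)
qed

lemma cut_tendsto: "a < x \<Longrightarrow> x < b \<Longrightarrow> (\<lambda>n. cut a b n x) \<longlonglongrightarrow> 1"
  unfolding cut_def using tendsto_mult[OF cut_limits(1)[of "x - a"] cut_limits(1)[of "b - x"]] by simp

lemma cut_deriv_tendsto:
  assumes "a < x" "x < b" shows "(\<lambda>n. cut_deriv a b n x) \<longlonglongrightarrow> 0"
proof -
  have "(\<lambda>n. cut_deriv a b n x) \<longlonglongrightarrow> 0 * 1 - 1 * 0"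
    unfolding cut_deriv_def using assms
    by (intro tendsto_diff tendsto_mult[OF cut_limits(2) cut_limits(1)] tendsto_mult[OF cut_limits(1) cut_limits(2)]) auto
  then show ?thesis by simp
qed

lemma cut_deriv_bound:
  assumes "a < x" "x < b" shows "\<bar>cut_deriv a b n x\<bar> \<le> 2 / (x - a) + 2 / (b - x)"
proof -
  have "\<bar>(real n * cut_exp (Suc 0) (real n * (x - a) - 1)) * cut_exp 0 (real n * (b - x) - 1)\<bar> \<le> 2 / (x - a) * 1"
    unfolding abs_mult using assms by (intro mult_mono) (use cut_exp_1_bound[of _ n, unfolded abs_mult] in \<open>auto simp: cut_exp_0\<close>)
  moreover have "\<bar>cut_exp 0 (real n * (x - a) - 1) * (real n * cut_exp (Suc 0) (real n * (b - x) - 1))\<bar> \<le> 1 * (2 / (b - x))"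
    unfolding abs_mult using assms by (intro mult_mono) (use cut_exp_1_bound[of _ n, unfolded abs_mult] in \<open>auto simp: cut_exp_0\<close>)
  ultimately show ?thesis unfolding cut_deriv_def by linarith
qed

lemma vd_cut_exp: "((\<lambda>x. complex_of_real (c ^ n * cut_exp n (c * x + d))) has_vector_derivative 
    complex_of_real (c ^ Suc n * cut_exp (Suc n) (c * x + d))) (at x)"
proof -
  have "((\<lambda>x. c ^ n * cut_exp n (c * x + d)) has_real_derivative c ^ Suc n * cut_exp (Suc n) (c * x + d)) (at x)"
    by (auto intro!: derivative_eq_intros DERIV_chain2[OF cut_exp_deriv])
  then show ?thesis by (intro has_vector_derivative_of_real) (simp add: has_real_derivative_iff_has_vector_derivative)
qed

lemma smooth_cut_exp: "smooth (\<lambda>p. complex_of_real (cut_exp 0 (c * fst p + d)))"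
    "smooth (\<lambda>p. complex_of_real (cut_exp 0 (c * snd p + d)))"
  unfolding smooth_def
  using Ck_fst_family(1)[where F = "\<lambda>n x. complex_of_real (c ^ n * cut_exp n (c * x + d))", OF vd_cut_exp, of _ 0]
    Ck_snd_family(1)[where F = "\<lambda>n x. complex_of_real (c ^ n * cut_exp n (c * x + d))", OF vd_cut_exp, of _ 0] by simp_all

lemma smooth_cut: "smooth (\<lambda>p. complex_of_real (cut a b n (fst p)))" 
    "smooth (\<lambda>p. complex_of_real (cut a b n (snd p)))"
proof -
  have e: "cut a b n x = cut_exp 0 (real n * x + (- real n * a - 1)) * cut_exp 0 ((- real n) * x + (real n * b - 1))" for x
    by (simp add: cut_def algebra_simps)
  show "smooth (\<lambda>p. complex_of_real (cut a b n (fst p)))" "smooth (\<lambda>p. complex_of_real (cut a b n (snd p)))"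
    unfolding e of_real_mult by (intro smooth_mult smooth_cut_exp)+
qed

definition cutoff :: "nat \<Rightarrow> real \<times> real \<Rightarrow> complex" where
  "cutoff n p = complex_of_real (cut 0 pi n (fst p)) * complex_of_real (cut (-1) 0 n (snd p))"

lemma smooth_cutoff: "smooth (cutoff n)"
  unfolding cutoff_def[abs_def] by (intro smooth_mult smooth_cut)

lemma pd_cutoff:
  "pdx (cutoff n) = (\<lambda>p. complex_of_real (cut_deriv 0 pi n (fst p) * cut (-1) 0 n (snd p)))"
  "pdy (cutoff n) = (\<lambda>p. complex_of_real (cut 0 pi n (fst p) * cut_deriv (-1) 0 n (snd p)))"
proof -
  show "pdx (cutoff n) = (\<lambda>p. complex_of_real (cut_deriv 0 pi n (fst p) * cut (-1) 0 n (snd p)))"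
    unfolding cutoff_def of_real_mult[symmetric]
    by (rule pdx_eqI, rule has_vector_derivative_of_real)
      (auto simp: has_real_derivative_iff_has_vector_derivative[symmetric] intro!: derivative_eq_intros cut_has_deriv)
  show "pdy (cutoff n) = (\<lambda>p. complex_of_real (cut 0 pi n (fst p) * cut_deriv (-1) 0 n (snd p)))"
    unfolding cutoff_def of_real_mult[symmetric]
    by (rule pdy_eqI, rule has_vector_derivative_of_real)
      (auto simp: has_real_derivative_iff_has_vector_derivative[symmetric] intro!: derivative_eq_intros cut_has_deriv)
qed

lemma cutoff_bound: "cmod (cutoff n p) \<le> 1"
  using cut_bounds by (auto simp: cutoff_def norm_mult intro!: mult_le_one)

lemma cutoff_tendsto: "p \<in> Omega \<Longrightarrow> (\<lambda>n. cutoff n p) \<longlonglongrightarrow> 1"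
proof -
  assume "p \<in> Omega"
  then have "(\<lambda>n. complex_of_real (cut 0 pi n (fst p)) * complex_of_real (cut (-1) 0 n (snd p))) \<longlonglongrightarrow> of_real 1 * of_real 1"
    by (intro tendsto_intros cut_tendsto) (auto simp: Omega_def)
  then show ?thesis by (simp add: cutoff_def)
qed

lemma test_cutoff:
  assumes "smooth \<psi>" shows "(\<lambda>p. \<psi> p * cutoff n p) \<in> test_functions Omega"
proof -
  \<comment> \<open>For \<open>n = 0\<close> the division convention \<open>1 / 0 = 0\<close> would
    give the closed rectangle, which is not inside \<open>Omega\<close>; as \<open>cutoff 0\<close>
    vanishes identically, the empty set serves.\<close>
  let ?K = "if n = 0 then {} else {1 / real n..pi - 1 / real n} \<times> {- 1 + 1 / real n..- (1 / real n)}"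
  have "compact ?K" by (auto intro!: compact_Times)
  moreover have "?K \<subseteq> Omega"
  proof (cases "n = 0")
    case False
    obtain r where r: "1 / real n = r" "r > 0" using False by auto
    show ?thesis unfolding r(1) using False r(2) by (auto simp: Omega_def)
  qed simp
  moreover have "\<psi> p * cutoff n p = 0" if "p \<notin> ?K" for p
    using that cut_support[of 0 pi n "fst p"] cut_support[of "-1" 0 n "snd p"] 
    by (cases p) (auto simp: cutoff_def split: if_splits)
  ultimately show ?thesis unfolding test_functions_def
    using smooth_mult[OF assms smooth_cutoff] by blast
qed

section \<open>Totality of the cosine products\<close>

lemma norm_to_L2_bound:
  fixes K :: "'a::euclidean_space set"
  assumes K: "bounded K" "K \<in> sets borel" and g: "g \<in> sqint K" 
    and bd: "\<And>x. x \<in> K \<Longrightarrow> cmod (g x) \<le> b" and b: "b \<ge> 0"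
  shows "norm (to_L2 K g) \<le> b * sqrt (measure lborel K)"
proof -
  have fin: "emeasure lborel K < \<infinity>" using K(1) by (rule emeasure_bounded_finite)
  have sq: "(\<lambda>x. indicator K x *\<^sub>R g x) \<in> sqint UNIV"
    using g by (simp add: indicator_in_sqint)
  have "(norm (to_L2 K g))\<^sup>2 = (LINT x|lborel. (norm (indicator K x *\<^sub>R g x))\<^sup>2)"
    unfolding to_L2_def by (rule norm_abs_L2[OF sq])
  also have "\<dots> \<le> (LINT x|lborel. b\<^sup>2 * indicator K x)"
  proof (rule integral_mono)
    show "integrable lborel (\<lambda>x. (norm (indicator K x *\<^sub>R g x))\<^sup>2)" using sq by (simp add: sqint_UNIV)
    show "integrable lborel (\<lambda>x. b\<^sup>2 * indicator K x)" using fin K(2) by (simp add: less_top)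
    show "(norm (indicator K x *\<^sub>R g x))\<^sup>2 \<le> b\<^sup>2 * indicator K x" for x
      using bd[of x] b by (auto simp: indicator_def intro!: power_mono)
  qed
  also have "\<dots> = (b * sqrt (measure lborel K))\<^sup>2" by (simp add: power_mult_distrib)
  finally show ?thesis by (rule power2_le_imp_le) (use b in simp)
qed

lemma borel_cnj: "cnj \<in> borel_measurable borel"
  by (intro borel_measurable_continuous_onI continuous_intros)

text \<open>Stone-Weierstrass extends orthogonality from the ring to all real continuous functions
  on K, and these approximate the indicators of compact subsets of K. Closed sets form an
  intersection-stable generator of the Borel sets, so f is orthogonal to everything, itself
  included. Real functions suffice because the annihilator of f is a complex subspace.\<close>

lemma L2_ring_total:
  fixes K :: "'a::euclidean_space set" and f :: "'a L2"
  assumes ring: "function_ring_on R K"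
    and f: "f \<in> L2_on K" and orth: "\<And>r. r \<in> R \<Longrightarrow> cinner f (to_L2 K (\<lambda>x. complex_of_real (r x))) = 0"
  shows "f = 0"
proof -
  interpret function_ring_on R K by (rule ring)
  have K: "bounded K" "K \<in> sets borel" using compact by (auto intro: compact_imp_bounded borel_compact)
  let ?M = "sqrt (measure lborel K)"
  have cont: "cinner f (to_L2 K (\<lambda>x. complex_of_real (g x))) = 0" if g: "continuous_on K g" for g
  proof -
    have "cmod (cinner f (to_L2 K (\<lambda>x. complex_of_real (g x)))) \<le> e" if "e > 0" for e
    proof -
      define d where "d = e / (norm f * ?M + 1)"
      have pos: "norm f * ?M + 1 > 0" by (smt (verit) mult_nonneg_nonneg norm_ge_zero real_sqrt_ge_zero measure_nonneg)
      have "d > 0" using \<open>e > 0\<close> pos by (simp add: d_def)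
      obtain r where r: "r \<in> R" "\<forall>x\<in>K. \<bar>g x - r x\<bar> < d"
        using Stone_Weierstrass_basic[OF g \<open>d > 0\<close>] by blast
      have cr: "continuous_on K r" by (rule continuous[OF r(1)])
      have sq: "(\<lambda>x. complex_of_real (g x)) \<in> sqint K" "(\<lambda>x. complex_of_real (r x)) \<in> sqint K"
        "(\<lambda>x. complex_of_real (g x) - complex_of_real (r x)) \<in> sqint K"
        using g cr compact by (auto intro!: sqint_compact continuous_intros)
      have "cinner f (to_L2 K (\<lambda>x. complex_of_real (g x))) = 
        cinner f (to_L2 K (\<lambda>x. complex_of_real (g x) - complex_of_real (r x)))"
        unfolding to_L2_diff[OF sq(1,2)] cinner.diff_right orth[OF r(1)] by simp
      then have "cmod (cinner f (to_L2 K (\<lambda>x. complex_of_real (g x)))) 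
          \<le> norm f * norm (to_L2 K (\<lambda>x. complex_of_real (g x) - complex_of_real (r x)))"
        by (simp add: norm_cinner_le)
      also have "\<dots> \<le> norm f * (d * ?M)"
        by (intro mult_left_mono norm_to_L2_bound K sq)
          (use r(2) \<open>d > 0\<close> in \<open>auto simp flip: of_real_diff intro: less_imp_le\<close>)
      also have "\<dots> \<le> d * (norm f * ?M + 1)" using \<open>d > 0\<close> by (simp add: algebra_simps)
      also have "\<dots> = e" using pos by (simp add: d_def)
      finally show ?thesis .
    qed
    then have "cmod (cinner f (to_L2 K (\<lambda>x. complex_of_real (g x)))) \<le> 0"
      by (meson dense_ge)
    then show ?thesis by simp
  qed
  define V where "V = {g. cinner f g = 0}"
  have "V = UNIV"
  proof (rule L2_closed_subspace_UNIV[where G = "Collect closed"])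
    have "V = (\<lambda>g. cinner f g) -` {0}" by (auto simp: V_def)
    then show "closed V" 
      by (simp add: closed_vimage linear_continuous_on[OF cinner.bounded_linear_right])
    show "0 \<in> V" by (simp add: V_def cinner.zero_right)
    show "g + h \<in> V" if "g \<in> V" "h \<in> V" for g h using that by (simp add: V_def cinner.add_right)
    show "c *\<^sub>C g \<in> V" if "g \<in> V" for c g using that by (simp add: V_def cinner_scaleC_right)
    show "Int_stable (Collect closed)" by (auto intro: Int_stableI)
    show "sigma_sets UNIV (Collect closed) = sets (borel :: 'a measure)"
      by (subst borel_eq_closed) (simp add: sets_measure_of)
    show "UNIV \<in> Collect closed" by simp
    fix A :: "'a set" and n assume "A \<in> Collect closed"
    define B where "B = A \<inter> cball 0 (real n)"
    define C where "C = B \<inter> K"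
    have B: "closed B" "bounded B" using \<open>A \<in> Collect closed\<close> by (auto simp: B_def intro: bounded_subset[OF bounded_cball])
    have C: "closed C" "bounded C" using B compact_imp_closed[OF compact] by (auto simp: C_def intro: bounded_subset)
    have sq: "(\<lambda>_. 1::complex) \<in> sqint S" if "closed S" "bounded S" for S :: "'a set"
      by (rule iffD1[OF indicator_in_sqint]) (use that in \<open>auto intro!: sqint_indicator\<close>)
    have [measurable]: "B \<in> sets borel" "C \<in> sets borel" using B C by auto
    note [measurable] = borel_cnj
    have eq: "cinner f (to_L2 B (\<lambda>_. 1)) = cinner f (to_L2 C (\<lambda>_. 1))"
      unfolding cinner_to_L2[OF sq[OF B]] cinner_to_L2[OF sq[OF C]]
    proof (rule integral_cong_AE; measurable?)
      show "AE x in lborel. rep_L2 f x * cnj (indicat_real B x *\<^sub>R 1) = rep_L2 f x * cnj (indicat_real C x *\<^sub>R 1)"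
        using f unfolding L2_on_def mem_Collect_eq by eventually_elim (auto simp: C_def indicator_def)
    qed
    have "cinner f (to_L2 C (\<lambda>_. 1)) = 0"
    proof (cases "C = {}")
      case True
      then have "to_L2 C (\<lambda>_. 1) = 0" by (simp add: to_L2_def zero_L2_def)
      then show ?thesis by (simp add: cinner.zero_right)
    next
      case False
      \<comment> \<open>Equal to 1 on C and dropping to 0 at distance \<open>1 / m\<close>, so the
        limit is the indicator of the closed set C. The empty set was split off because
        \<open>infdist\<close> from it is 0, which would make every \<open>g m\<close> constantly
        1.\<close>
      define g where "g m x = max 0 (1 - real m * infdist x C)" for m x
      have gc: "continuous_on K (g m)" for m unfolding g_def by (intro continuous_intros)
      have g01: "0 \<le> g m x" "g m x \<le> 1" for m x by (auto simp: g_def infdist_nonneg)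
      have gs: "(\<lambda>x. complex_of_real (g m x)) \<in> sqint K" for m
        using gc compact by (auto intro!: sqint_compact continuous_intros)
      have lim: "(\<lambda>m. g m x) \<longlonglongrightarrow> indicator C x" for x
      proof (cases "x \<in> C")
        case nx: False
        then have d: "infdist x C > 0" using \<open>closed C\<close> False by (metis in_closed_iff_infdist_zero infdist_nonneg order_le_less)
        have "eventually (\<lambda>m. 0 = g m x) sequentially"
        proof (rule eventually_sequentiallyI[of "nat \<lceil>1 / infdist x C\<rceil>"])
          fix m assume "nat \<lceil>1 / infdist x C\<rceil> \<le> m"
          then have "1 / infdist x C \<le> real m" by (simp add: nat_le_iff ceiling_le_iff)
          then have "1 \<le> real m * infdist x C" using d by (simp add: field_simps)
          then show "0 = g m x" by (simp add: g_def)
        qed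
        then show ?thesis using nx by (simp add: tendsto_eventually eventually_mono)
      qed (simp add: g_def)
      have "(\<lambda>m. abs_L2 (\<lambda>x. indicat_real K x *\<^sub>R complex_of_real (g m x))) \<longlonglongrightarrow> 
        abs_L2 (\<lambda>x. indicat_real C x *\<^sub>R (1::complex))"
      proof (rule L2_dominated[where w = "indicator K"])
        show "(\<lambda>x. indicat_real K x *\<^sub>R complex_of_real (g m x)) \<in> sqint UNIV" for m
          using gs by (simp add: indicator_in_sqint)
        show "(\<lambda>x. indicat_real C x *\<^sub>R (1::complex)) \<in> sqint UNIV" by (rule sqint_indicator) (use C in auto)
        have "(indicat_real K x)\<^sup>2 = indicat_real K x" for x by (simp add: indicator_def)
        then show "integrable lborel (\<lambda>x. (indicat_real K x)\<^sup>2)" 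
          using K emeasure_bounded_finite[OF K(1)] by (simp add: less_top)
        fix x
        have "(\<lambda>m. indicat_real K x *\<^sub>R complex_of_real (g m x)) \<longlonglongrightarrow> 
          indicat_real K x *\<^sub>R complex_of_real (indicator C x)"
          by (intro tendsto_intros lim)
        also have "indicat_real K x *\<^sub>R complex_of_real (indicator C x) = indicat_real C x *\<^sub>R 1"
          by (auto simp: C_def indicator_def)
        finally show "(\<lambda>m. indicat_real K x *\<^sub>R complex_of_real (g m x)) \<longlonglongrightarrow> indicat_real C x *\<^sub>R (1::complex)" .
        show "cmod (indicat_real K x *\<^sub>R complex_of_real (g m x)) \<le> indicat_real K x" for m
          using g01[of m x] by (auto simp: indicator_def)
      qed
      then have "(\<lambda>m. cinner f (to_L2 K (\<lambda>x. complex_of_real (g m x)))) \<longlonglongrightarrow> cinner f (to_L2 C (\<lambda>_. 1))"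
        unfolding to_L2_def by (rule cinner.tendsto[OF tendsto_const])
      then show ?thesis by (simp add: cont[OF gc] LIMSEQ_const_iff)
    qed
    then show "to_L2 (A \<inter> cball 0 (real n)) (\<lambda>_. 1) \<in> V" unfolding V_def B_def[symmetric] using eq by simp
  qed
  then have "cinner f f = 0" by (auto simp: V_def)
  then show ?thesis using cinner_self[of f] by simp
qed

section \<open>Cosine products on the rectangle\<close>

definition Omega_bar :: "(real \<times> real) set" where "Omega_bar = {0..pi} \<times> {-1..0}"

lemma Omega_bar: "compact Omega_bar" "Omega_bar \<in> sets borel" "bounded Omega_bar"
proof -
  show c: "compact Omega_bar" by (simp add: Omega_bar_def compact_Times)
  then show "Omega_bar \<in> sets borel" "bounded Omega_bar" by (auto intro: borel_compact compact_imp_bounded)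
qed

lemma Omega: "open Omega" "Omega \<in> sets borel" "bounded Omega" "Omega \<subseteq> Omega_bar"
proof -
  show o: "open Omega" by (simp add: Omega_def open_Times)
  then show "Omega \<in> sets borel" by simp
  show s: "Omega \<subseteq> Omega_bar" by (auto simp: Omega_def Omega_bar_def)
  show "bounded Omega" by (rule bounded_subset[OF Omega_bar(3) s])
qed

lemma sqint_subset:
  fixes f :: "'a::euclidean_space \<Rightarrow> complex"
  assumes "f \<in> sqint T" "S \<in> sets borel" "S \<subseteq> T"
  shows "f \<in> sqint S"
proof -
  have "(\<lambda>x. indicator S x *\<^sub>R (indicator T x *\<^sub>R f x)) \<in> sqint UNIV"
    by (rule sqint_restrict) (use assms in \<open>auto simp: indicator_in_sqint\<close>)
  also have "(\<lambda>x. indicator S x *\<^sub>R (indicator T x *\<^sub>R f x)) = (\<lambda>x. indicator S x *\<^sub>R f x)"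
    using assms(3) by (auto simp: indicator_def fun_eq_iff)
  finally show ?thesis by (simp add: indicator_in_sqint)
qed

lemma sqint_Omega_cont: 
  fixes f :: "real \<times> real \<Rightarrow> complex"
  shows "continuous_on Omega_bar f \<Longrightarrow> f \<in> sqint Omega"
  by (rule sqint_subset[OF sqint_compact]) (use Omega Omega_bar in auto)

lemma sqint_smooth: "smooth f \<Longrightarrow> f \<in> sqint Omega"
  by (rule sqint_Omega_cont) (rule smooth_continuous)

lemma cinner_to_L2_set: "g \<in> sqint S \<Longrightarrow> cinner f (to_L2 S g) = (LINT x:S|lborel. rep_L2 f x * cnj (g x))"
  unfolding cinner_to_L2 set_lebesgue_integral_def
  by (intro Bochner_Integration.integral_cong) (auto simp: indicator_def)

lemma cinner_to_L2_both:
  assumes f: "f \<in> sqint S" and g: "g \<in> sqint S"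
  shows "cinner (to_L2 S f) (to_L2 S g) = (LINT x:S|lborel. f x * cnj (g x))"
proof -
  have "cinner (to_L2 S f) (to_L2 S g) = (LINT x|lborel. (indicator S x *\<^sub>R f x) * cnj (indicator S x *\<^sub>R g x))"
    unfolding cinner_L2_def
    by (rule L2_cinner_AE[OF _ _ rep_to_L2[OF f] rep_to_L2[OF g]]) (use assms in \<open>simp_all add: sqint_def set_borel_measurable_def\<close>)
  then show ?thesis unfolding set_lebesgue_integral_def
    by (auto simp: indicator_def intro!: Bochner_Integration.integral_cong)
qed

text \<open>Finite sums of tensor products; scalars are absorbed into a. The map
  \<open>y \<mapsto> pi * (y + 1)\<close> takes \<open>{-1..0}\<close> onto \<open>{0..pi}\<close>,
  where cos is injective, so points are separated. A product of two tensors is again a tensor, which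
  yields closure under multiplication.\<close>

inductive_set cos2_alg :: "(real \<times> real \<Rightarrow> real) set" where
  base: "a \<in> cos_alg \<Longrightarrow> b \<in> cos_alg \<Longrightarrow> (\<lambda>p. a (fst p) * b (pi * (snd p + 1))) \<in> cos2_alg"
| add: "f \<in> cos2_alg \<Longrightarrow> g \<in> cos2_alg \<Longrightarrow> (\<lambda>x. f x + g x) \<in> cos2_alg"

lemma cos2_alg_continuous: "f \<in> cos2_alg \<Longrightarrow> continuous_on A f"
proof (induction rule: cos2_alg.induct)
  case (base a b)
  show ?case
    by (intro continuous_on_mult continuous_on_compose2[OF cos_alg_continuous[OF base(1), of UNIV]]
        continuous_on_compose2[OF cos_alg_continuous[OF base(2), of UNIV]] continuous_intros) auto
qed (intro continuous_on_add)

lemma cos2_alg_mult: "f \<in> cos2_alg \<Longrightarrow> g \<in> cos2_alg \<Longrightarrow> (\<lambda>x. f x * g x) \<in> cos2_alg"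
proof (induction arbitrary: g rule: cos2_alg.induct)
  case (base a b)
  show ?case using base(3)
  proof (induction rule: cos2_alg.induct)
    case (base a' b')
    show ?case using cos2_alg.base[OF cos_alg_mult[OF \<open>a \<in> cos_alg\<close> base(1)] cos_alg_mult[OF \<open>b \<in> cos_alg\<close> base(2)]]
      by (simp add: mult_ac)
  next
    case (add f g)
    then show ?case using cos2_alg.add[OF add.IH] by (simp add: distrib_left)
  qed
next
  case (add f f')
  then show ?case using cos2_alg.add[OF add.IH(1)[of g] add.IH(2)[of g]] by (simp add: distrib_right)
qed

lemma cos_alg_const: "(\<lambda>_. c) \<in> cos_alg"
  using cos_alg.scale[OF cos_alg.base[of 0], of c] by simp

lemma cos2_ring: "function_ring_on cos2_alg Omega_bar"
proof
  show "(\<lambda>_. c) \<in> cos2_alg" for c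
    using cos2_alg.base[OF cos_alg_const[of c] cos_alg_const[of 1]] by simp
  fix p q :: "real \<times> real" assume pq: "p \<in> Omega_bar" "q \<in> Omega_bar" "p \<noteq> q"
  show "\<exists>f\<in>cos2_alg. f p \<noteq> f q"
  proof (cases "fst p = fst q")
    case True
    then have "snd p \<noteq> snd q" using pq(3) by (simp add: prod_eq_iff)
    moreover have "pi * (snd p + 1) \<in> {0..pi}" "pi * (snd q + 1) \<in> {0..pi}"
      using pq by (auto simp: Omega_bar_def mem_Times_iff)
    ultimately have "cos (pi * (snd p + 1)) \<noteq> cos (pi * (snd q + 1))"
      using cos_inj_pi[of "pi * (snd p + 1)" "pi * (snd q + 1)"] by auto
    then show ?thesis using cos2_alg.base[OF cos_alg_const[of 1] cos_alg.base[of 1]]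
      by (intro bexI[of _ "\<lambda>p. 1 * cos (real 1 * (pi * (snd p + 1)))"]) auto
  next
    case False
    then have "cos (fst p) \<noteq> cos (fst q)"
      using cos_inj_pi[of "fst p" "fst q"] pq by (auto simp: Omega_bar_def mem_Times_iff)
    then show ?thesis using cos2_alg.base[OF cos_alg.base[of 1] cos_alg_const[of 1]]
      by (intro bexI[of _ "\<lambda>p. cos (real 1 * fst p) * 1"]) auto
  qed
qed (auto intro: cos2_alg_continuous cos2_alg.add cos2_alg_mult Omega_bar)

definition cosx :: "nat \<Rightarrow> nat \<Rightarrow> real \<times> real \<Rightarrow> complex" where
  "cosx j k p = complex_of_real (cos (real j * fst p)) * complex_of_real (cos (real k * (pi * (snd p + 1))))"

lemma smooth_cosx: "smooth (cosx j k)"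
proof -
  have "cosx j k = (\<lambda>p. complex_of_real (cos (real j * fst p + 0)) * complex_of_real (cos ((real k * pi) * snd p + real k * pi)))"
    by (auto simp: cosx_def algebra_simps)
  then show ?thesis by (simp only:) (intro smooth_mult smooth_cos_fst smooth_cos_snd)
qed

lemma L2_on_mono: "S \<subseteq> T \<Longrightarrow> f \<in> L2_on S \<Longrightarrow> f \<in> L2_on T"
  unfolding L2_on_def by (auto elim!: eventually_mono)

text \<open>Stone-Weierstrass needs the compact \<open>Omega_bar\<close>, whereas f lives on the
  open \<open>Omega\<close>. As f vanishes almost everywhere outside \<open>Omega\<close>, its
  pairings over both sets agree.\<close>

lemma cosx_total:
  assumes f: "f \<in> L2_on Omega" and orth: "\<And>j k. cinner f (to_L2 Omega (cosx j k)) = 0"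
  shows "f = 0"
proof (rule L2_ring_total[OF cos2_ring])
  show "f \<in> L2_on Omega_bar" by (rule L2_on_mono[OF Omega(4) f])
  note [measurable] = borel_cnj Omega(2) Omega_bar(2)
  have eq: "cinner f (to_L2 Omega_bar g) = cinner f (to_L2 Omega g)" if g: "continuous_on Omega_bar g" for g
  proof -
    have s: "g \<in> sqint Omega_bar" "g \<in> sqint Omega" using g by (auto intro: sqint_compact Omega_bar sqint_Omega_cont)
    have m: "(\<lambda>x. rep_L2 f x * cnj (k x)) \<in> borel_measurable lborel" if [measurable]: "k \<in> borel_measurable borel" for k
      by measurable
    show ?thesis unfolding cinner_to_L2[OF s(1)] cinner_to_L2[OF s(2)]
    proof (rule integral_cong_AE[OF m m])
      show "(\<lambda>x. indicator Omega_bar x *\<^sub>R g x) \<in> borel_measurable borel" "(\<lambda>x. indicator Omega x *\<^sub>R g x) \<in> borel_measurable borel"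
        using s by (simp_all add: sqint_def set_borel_measurable_def)
      show "AE x in lborel. rep_L2 f x * cnj (indicat_real Omega_bar x *\<^sub>R g x) = rep_L2 f x * cnj (indicat_real Omega x *\<^sub>R g x)"
        using f unfolding L2_on_def mem_Collect_eq by eventually_elim (use Omega(4) in \<open>auto simp: indicator_def\<close>)
    qed
  qed
  have ab: "cinner f (to_L2 Omega (\<lambda>p. complex_of_real (a (fst p) * b (pi * (snd p + 1))))) = 0"
    if "a \<in> cos_alg" "b \<in> cos_alg" for a b
  proof -
    have c: "continuous_on Omega_bar (\<lambda>p. complex_of_real (a (fst p) * b (pi * (snd p + 1))))" 
      if "a \<in> cos_alg" "b \<in> cos_alg" for a b
      by (intro continuous_on_of_real cos2_alg_continuous cos2_alg.base that)
    show ?thesis using that(1)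
    proof (induction rule: cos_alg.induct)
      case (base j)
      show ?case using that(2)
      proof (induction rule: cos_alg.induct)
        case (base k)
        show ?case using orth[of j k] by (simp add: cosx_def[abs_def])
      next
        case (add f g)
        show ?case
          using to_L2_add[OF c[OF cos_alg.base add.hyps(1), THEN sqint_Omega_cont] c[OF cos_alg.base add.hyps(2), THEN sqint_Omega_cont]] add.IH
          by (simp add: distrib_left cinner.add_right)
      next
        case (scale f r)
        show ?case
          using to_L2_scale[OF c[OF cos_alg.base scale.hyps(1), THEN sqint_Omega_cont], of "of_real r"] scale.IH
          by (simp add: mult.left_commute cinner_scaleC_right)
      qed
    next
      case (add f g)
      show ?case
        using to_L2_add[OF c[OF add.hyps(1) that(2), THEN sqint_Omega_cont] c[OF add.hyps(2) that(2), THEN sqint_Omega_cont]] add.IH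
        by (simp add: distrib_right cinner.add_right)
    next
      case (scale f r)
      show ?case
        using to_L2_scale[OF c[OF scale.hyps(1) that(2), THEN sqint_Omega_cont], of "of_real r"] scale.IH
        by (simp add: mult.assoc cinner_scaleC_right)
    qed
  qed
  have c2: "continuous_on Omega_bar (\<lambda>x. complex_of_real (r x))" if "r \<in> cos2_alg" for r
    using that by (intro continuous_on_of_real cos2_alg_continuous)
  fix r assume r: "r \<in> cos2_alg"
  then have "cinner f (to_L2 Omega (\<lambda>x. complex_of_real (r x))) = 0"
  proof (induction rule: cos2_alg.induct)
    case (base a b) then show ?case by (rule ab)
  next
    case (add f g)
    then show ?case
      using to_L2_add[OF c2[OF add.hyps(1), THEN sqint_Omega_cont] c2[OF add.hyps(2), THEN sqint_Omega_cont]]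
      by (simp add: cinner.add_right)
  qed
  then show "cinner f (to_L2 Omega_bar (\<lambda>x. complex_of_real (r x))) = 0" using eq[OF c2[OF r]] by simp
qed

section \<open>Green's formula and weak derivatives\<close>

lemma set_integrable_cont_Omega:
  fixes f :: "real \<times> real \<Rightarrow> complex"
  assumes "continuous_on Omega_bar f" shows "set_integrable lborel Omega f"
proof -
  have "set_integrable lborel Omega_bar f"
    unfolding set_integrable_def by (rule borel_integrable_compact[OF Omega_bar(1) assms])
  then show ?thesis by (rule set_integrable_subset) (use Omega in auto)
qed

lemma lborel_prod_integrals:
  fixes f :: "real \<times> real \<Rightarrow> complex"
  assumes "integrable lborel f"
  shows "(LINT p|lborel. f p) = (LINT y|lborel. LINT x|lborel. f (x, y))"
    "(LINT p|lborel. f p) = (LINT x|lborel. LINT y|lborel. f (x, y))"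
proof -
  have i: "integrable (lborel \<Otimes>\<^sub>M lborel) (case_prod (\<lambda>x y. f (x, y)))"
    using assms by (simp add: lborel_prod)
  show "(LINT p|lborel. f p) = (LINT y|lborel. LINT x|lborel. f (x, y))"
    using lborel_pair.integral_snd[OF i] by (simp add: lborel_prod)
  show "(LINT p|lborel. f p) = (LINT x|lborel. LINT y|lborel. f (x, y))"
    using lborel_pair.integral_fst[OF i] by (simp add: lborel_prod)
qed

lemma integral_open_interval:
  fixes f :: "real \<Rightarrow> complex"
  assumes "continuous_on UNIV f"
  shows "(LINT x|lborel. indicator {a<..<b} x *\<^sub>R f x) = (LINT x|lborel. indicator {a..b} x *\<^sub>R f x)"
proof (rule integral_cong_AE)
  have [measurable]: "f \<in> borel_measurable borel" using assms by (rule borel_measurable_continuous_onI)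
  show "(\<lambda>x. indicator {a<..<b} x *\<^sub>R f x) \<in> borel_measurable lborel" "(\<lambda>x. indicator {a..b} x *\<^sub>R f x) \<in> borel_measurable lborel"
    by measurable
  show "AE x in lborel. indicat_real {a<..<b} x *\<^sub>R f x = indicat_real {a..b} x *\<^sub>R f x"
    using AE_lborel_singleton[of a] AE_lborel_singleton[of b] by eventually_elim (auto simp: indicator_def)
qed

lemma green_x:
  assumes "Ck (Suc 0) H"
  shows "(LINT p:Omega|lborel. pdx H p) = (LINT y:{-1..0}|lborel. H (pi, y) - H (0, y))"
proof -
  have c: "continuous_on UNIV (pdx H)" using assms by simp
  have i: "integrable lborel (\<lambda>p. indicator Omega p *\<^sub>R pdx H p)"
    using set_integrable_cont_Omega[OF continuous_on_subset[OF c subset_UNIV]] by (simp add: set_integrable_def)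
  have "(LINT x|lborel. indicator Omega (x, y) *\<^sub>R pdx H (x, y)) = indicator {-1<..<0} y *\<^sub>R (H (pi, y) - H (0, y))" for y
  proof -
    have cx: "continuous_on UNIV (\<lambda>x. pdx H (x, y))"
      by (rule continuous_on_compose2[OF c]) (auto intro!: continuous_intros)
    have "(LINT x|lborel. indicator Omega (x, y) *\<^sub>R pdx H (x, y)) 
        = indicator {-1<..<0} y *\<^sub>R (LINT x|lborel. indicator {0<..<pi} x *\<^sub>R pdx H (x, y))"
      by (auto simp: Omega_def indicator_times indicator_def)
    also have "(LINT x|lborel. indicator {0<..<pi} x *\<^sub>R pdx H (x, y)) = H (pi, y) - H (0, y)"
      unfolding integral_open_interval[OF cx]
    proof (rule integral_FTC_atLeastAtMost)
      show "((\<lambda>x. H (x, y)) has_vector_derivative pdx H (x, y)) (at x within {0..pi})" for x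
        by (rule has_vector_derivative_at_within[OF Ck_pd(1)[OF assms]])
      show "continuous_on {0..pi} (\<lambda>x. pdx H (x, y))" by (rule continuous_on_subset[OF cx]) simp
    qed simp
    finally show ?thesis .
  qed
  moreover have c': "continuous_on UNIV (\<lambda>y. H (pi, y) - H (0, y))"
    by (rule continuous_on_diff; rule continuous_on_compose2[OF Ck_cont[OF assms]]; auto intro!: continuous_intros)
  ultimately show ?thesis unfolding set_lebesgue_integral_def lborel_prod_integrals(1)[OF i]
    by (simp only: integral_open_interval[OF c'])
qed

lemma green_y:
  assumes "Ck (Suc 0) H"
  shows "(LINT p:Omega|lborel. pdy H p) = (LINT x:{0..pi}|lborel. H (x, 0) - H (x, -1))"
proof -
  have c: "continuous_on UNIV (pdy H)" using assms by simp
  have i: "integrable lborel (\<lambda>p. indicator Omega p *\<^sub>R pdy H p)"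
    using set_integrable_cont_Omega[OF continuous_on_subset[OF c subset_UNIV]] by (simp add: set_integrable_def)
  have "(LINT y|lborel. indicator Omega (x, y) *\<^sub>R pdy H (x, y)) = indicator {0<..<pi} x *\<^sub>R (H (x, 0) - H (x, -1))" for x
  proof -
    have cy: "continuous_on UNIV (\<lambda>y. pdy H (x, y))"
      by (rule continuous_on_compose2[OF c]) (auto intro!: continuous_intros)
    have "(LINT y|lborel. indicator Omega (x, y) *\<^sub>R pdy H (x, y)) 
        = indicator {0<..<pi} x *\<^sub>R (LINT y|lborel. indicator {-1<..<0} y *\<^sub>R pdy H (x, y))"
      by (auto simp: Omega_def indicator_times indicator_def)
    also have "(LINT y|lborel. indicator {-1<..<0} y *\<^sub>R pdy H (x, y)) = H (x, 0) - H (x, -1)"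
      unfolding integral_open_interval[OF cy]
    proof (rule integral_FTC_atLeastAtMost)
      show "((\<lambda>y. H (x, y)) has_vector_derivative pdy H (x, y)) (at y within {-1..0})" for y
        by (rule has_vector_derivative_at_within[OF Ck_pd(2)[OF assms]])
      show "continuous_on {-1..0} (\<lambda>y. pdy H (x, y))" by (rule continuous_on_subset[OF cy]) simp
    qed simp
    finally show ?thesis .
  qed
  moreover have c': "continuous_on UNIV (\<lambda>x. H (x, 0) - H (x, -1))"
    by (rule continuous_on_diff; rule continuous_on_compose2[OF Ck_cont[OF assms]]; auto intro!: continuous_intros)
  ultimately show ?thesis unfolding set_lebesgue_integral_def lborel_prod_integrals(2)[OF i]
    by (simp only: integral_open_interval[OF c'])
qed

lemma sqint_Icc: "continuous_on {a..b} f \<Longrightarrow> f \<in> sqint {a..b::real}" for f :: "real \<Rightarrow> complex"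
  by (rule sqint_compact) auto

lemma smooth_side:
  assumes "smooth F" "continuous_on UNIV \<gamma>" shows "continuous_on S (\<lambda>s. F (\<gamma> s))"
  by (rule continuous_on_compose2[OF smooth_continuous[OF assms(1), of UNIV] continuous_on_subset[OF assms(2)]]) auto

lemma set_integrable_Icc: "continuous_on {a..b} f \<Longrightarrow> set_integrable lborel {a..b::real} (f :: real \<Rightarrow> complex)"
  unfolding set_integrable_def by (rule borel_integrable_compact) auto

lemma green_cinner_x:
  assumes F: "smooth F" and G: "smooth G"
  shows "cinner (to_L2 Omega (pdx F)) (to_L2 Omega G) + cinner (to_L2 Omega F) (to_L2 Omega (pdx G)) =
    cinner (to_L2 {-1..0} (\<lambda>y. F (pi, y))) (to_L2 {-1..0} (\<lambda>y. G (pi, y))) -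
    cinner (to_L2 {-1..0} (\<lambda>y. F (0, y))) (to_L2 {-1..0} (\<lambda>y. G (0, y)))"
proof -
  note c = F G smooth_pd(1)[OF F] smooth_pd(1)[OF G]
  let ?H = "\<lambda>p. F p * cnj (G p)"
  have C: "Ck (Suc 0) F" "Ck (Suc 0) (\<lambda>p. cnj (G p))" "Ck (Suc 0) ?H" 
    using F G by (auto simp only: smooth_def intro!: Ck_mult Ck_cnj)
  have "cinner (to_L2 Omega (pdx F)) (to_L2 Omega G) + cinner (to_L2 Omega F) (to_L2 Omega (pdx G)) 
    = (LINT p:Omega|lborel. pdx F p * cnj (G p) + F p * cnj (pdx G p))"
    unfolding cinner_to_L2_both[OF sqint_smooth[OF c(3)] sqint_smooth[OF G]] cinner_to_L2_both[OF sqint_smooth[OF F] sqint_smooth[OF c(4)]]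
    by (rule set_integral_add(2)[symmetric]; intro set_integrable_cont_Omega continuous_intros continuous_on_cnj smooth_continuous c)
  also have "(\<lambda>p. pdx F p * cnj (G p) + F p * cnj (pdx G p)) = pdx ?H"
    unfolding pd_mult(1)[OF C(1,2)] pd_cnj(1)[OF smooth_C1[OF G]] by (auto simp: fun_eq_iff)
  also have "(LINT p:Omega|lborel. pdx ?H p) = (LINT y:{-1..0}|lborel. ?H (pi, y) - ?H (0, y))"
    by (rule green_x[OF C(3)])
  also have "\<dots> = cinner (to_L2 {-1..0} (\<lambda>y. F (pi, y))) (to_L2 {-1..0} (\<lambda>y. G (pi, y))) -
    cinner (to_L2 {-1..0} (\<lambda>y. F (0, y))) (to_L2 {-1..0} (\<lambda>y. G (0, y)))"
    by (subst (1 2) cinner_to_L2_both)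
      (auto intro!: sqint_Icc set_integral_diff set_integrable_Icc smooth_side[OF F] smooth_side[OF G] continuous_intros)
  finally show ?thesis .
qed

lemma green_cinner_y:
  assumes F: "smooth F" and G: "smooth G"
  shows "cinner (to_L2 Omega (pdy F)) (to_L2 Omega G) + cinner (to_L2 Omega F) (to_L2 Omega (pdy G)) =
    cinner (to_L2 {0..pi} (\<lambda>x. F (x, 0))) (to_L2 {0..pi} (\<lambda>x. G (x, 0))) -
    cinner (to_L2 {0..pi} (\<lambda>x. F (x, -1))) (to_L2 {0..pi} (\<lambda>x. G (x, -1)))"
proof -
  note c = F G smooth_pd(2)[OF F] smooth_pd(2)[OF G]
  let ?H = "\<lambda>p. F p * cnj (G p)"
  have C: "Ck (Suc 0) F" "Ck (Suc 0) (\<lambda>p. cnj (G p))" "Ck (Suc 0) ?H" 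
    using F G by (auto simp only: smooth_def intro!: Ck_mult Ck_cnj)
  have "cinner (to_L2 Omega (pdy F)) (to_L2 Omega G) + cinner (to_L2 Omega F) (to_L2 Omega (pdy G)) 
    = (LINT p:Omega|lborel. pdy F p * cnj (G p) + F p * cnj (pdy G p))"
    unfolding cinner_to_L2_both[OF sqint_smooth[OF c(3)] sqint_smooth[OF G]] cinner_to_L2_both[OF sqint_smooth[OF F] sqint_smooth[OF c(4)]]
    by (rule set_integral_add(2)[symmetric]; intro set_integrable_cont_Omega continuous_intros continuous_on_cnj smooth_continuous c)
  also have "(\<lambda>p. pdy F p * cnj (G p) + F p * cnj (pdy G p)) = pdy ?H"
    unfolding pd_mult(2)[OF C(1,2)] pd_cnj(2)[OF smooth_C1[OF G]] by (auto simp: fun_eq_iff)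
  also have "(LINT p:Omega|lborel. pdy ?H p) = (LINT x:{0..pi}|lborel. ?H (x, 0) - ?H (x, -1))"
    by (rule green_y[OF C(3)])
  also have "\<dots> = cinner (to_L2 {0..pi} (\<lambda>x. F (x, 0))) (to_L2 {0..pi} (\<lambda>x. G (x, 0))) -
    cinner (to_L2 {0..pi} (\<lambda>x. F (x, -1))) (to_L2 {0..pi} (\<lambda>x. G (x, -1)))"
    by (subst (1 2) cinner_to_L2_both)
      (auto intro!: sqint_Icc set_integral_diff set_integrable_Icc smooth_side[OF F] smooth_side[OF G] continuous_intros)
  finally show ?thesis .
qed

section \<open>Weak derivatives and the Sobolev space\<close>

lemma to_L2_Omega_tendsto:
  assumes f: "\<And>n. f n \<in> sqint Omega" and g: "g \<in> sqint Omega"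
    and lim: "\<And>p. p \<in> Omega \<Longrightarrow> (\<lambda>n. f n p) \<longlonglongrightarrow> g p" and bd: "\<And>n p. p \<in> Omega \<Longrightarrow> cmod (f n p) \<le> M"
  shows "(\<lambda>n. to_L2 Omega (f n)) \<longlonglongrightarrow> to_L2 Omega g"
  unfolding to_L2_def
proof (rule L2_dominated[where w = "\<lambda>p. \<bar>M\<bar> * indicator Omega p"])
  have "(\<bar>M\<bar> * indicat_real Omega x)\<^sup>2 = \<bar>M\<bar>\<^sup>2 * indicat_real Omega x" for x by (simp add: indicator_def)
  moreover have "emeasure lborel Omega < \<infinity>" by (rule emeasure_bounded_finite[OF Omega(3)])
  ultimately show "integrable lborel (\<lambda>x. (\<bar>M\<bar> * indicat_real Omega x)\<^sup>2)"
    using Omega(2) by (simp add: less_top)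
  show "(\<lambda>n. indicat_real Omega x *\<^sub>R f n x) \<longlonglongrightarrow> indicat_real Omega x *\<^sub>R g x" for x
    using lim[of x] by (auto simp: indicator_def)
  show "cmod (indicat_real Omega x *\<^sub>R f n x) \<le> \<bar>M\<bar> * indicat_real Omega x" for n x
    using bd[of x n] by (auto simp: indicator_def)
qed (use f g in \<open>auto simp: indicator_in_sqint\<close>)

lemma smooth_bounded: 
  assumes "smooth \<psi>" obtains M where "M \<ge> 0" "\<And>p. p \<in> Omega \<Longrightarrow> cmod (\<psi> p) \<le> M"
proof -
  have "bounded (\<psi> ` Omega_bar)"
    by (intro compact_imp_bounded compact_continuous_image smooth_continuous assms Omega_bar)
  then obtain M where "\<And>p. p \<in> Omega_bar \<Longrightarrow> cmod (\<psi> p) \<le> M" by (auto simp: bounded_iff)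
  then show ?thesis using that[of "max M 0"] Omega(4) by (force simp: le_max_iff_disj)
qed

lemma cutoff_to_L2:
  assumes "smooth \<psi>"
  shows "(\<lambda>n. to_L2 Omega (\<lambda>p. \<psi> p * cutoff n p)) \<longlonglongrightarrow> to_L2 Omega \<psi>"
proof -
  obtain M where M: "M \<ge> 0" "\<And>p. p \<in> Omega \<Longrightarrow> cmod (\<psi> p) \<le> M" using smooth_bounded[OF assms] by blast
  show ?thesis
  proof (rule to_L2_Omega_tendsto)
    show "(\<lambda>p. \<psi> p * cutoff n p) \<in> sqint Omega" for n by (intro sqint_smooth smooth_mult assms smooth_cutoff)
    show "\<psi> \<in> sqint Omega" by (rule sqint_smooth[OF assms])
    show "(\<lambda>n. \<psi> p * cutoff n p) \<longlonglongrightarrow> \<psi> p" if "p \<in> Omega" for p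
      using tendsto_mult[OF tendsto_const cutoff_tendsto[OF that]] by simp
    show "cmod (\<psi> p * cutoff n p) \<le> M" if "p \<in> Omega" for n p
      using mult_mono[OF M(2)[OF that] cutoff_bound M(1)] by (simp add: norm_mult)
  qed
qed

lemma test_smooth: "\<psi> \<in> test_functions S \<Longrightarrow> smooth \<psi>"
  by (auto simp: test_functions_def)

lemma test_cnj: "\<psi> \<in> test_functions S \<Longrightarrow> (\<lambda>p. cnj (\<psi> p)) \<in> test_functions S"
  by (auto simp: test_functions_def smooth_cnj)

text \<open>A cosine product times a cutoff is a test function, and these converge in the mean to
  the cosine products, which are total. This is what makes weak derivatives unique.\<close>

lemma test_total:
  assumes "g \<in> L2_on Omega" "\<And>\<psi>. \<psi> \<in> test_functions Omega \<Longrightarrow> cinner g (to_L2 Omega \<psi>) = 0"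
  shows "g = 0"
proof (rule cosx_total[OF assms(1)])
  fix j k
  have "(\<lambda>n. cinner g (to_L2 Omega (\<lambda>p. cosx j k p * cutoff n p))) \<longlonglongrightarrow> cinner g (to_L2 Omega (cosx j k))"
    by (intro cinner.tendsto tendsto_const cutoff_to_L2 smooth_cosx)
  then show "cinner g (to_L2 Omega (cosx j k)) = 0"
    by (simp add: assms(2)[OF test_cutoff[OF smooth_cosx]] LIMSEQ_const_iff)
qed

lemma Omega_set_integral: 
  assumes "smooth \<psi>" shows "(LINT p:Omega|lborel. rep_L2 v p * \<psi> p) = cinner v (to_L2 Omega (\<lambda>p. cnj (\<psi> p)))"
  using cinner_to_L2_set[OF sqint_smooth[OF smooth_cnj[OF assms]], of v] by simp

text \<open>Weak derivatives are defined by a bilinear pairing, while \<open>cinner\<close>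
  conjugates its second argument. Conjugation permutes the test functions and commutes with both
  partial derivatives, so the two formulations agree, and the Hilbert space calculus becomes
  available.\<close>

lemma is_weak_deriv_iff:
  assumes D: "D = pdx \<or> D = pdy"
  shows "is_weak_deriv D v g \<longleftrightarrow> g \<in> L2_on Omega \<and>
    (\<forall>\<psi>\<in>test_functions Omega. cinner v (to_L2 Omega (D \<psi>)) = - cinner g (to_L2 Omega \<psi>))"
proof -
  have Ds: "smooth (D \<psi>)" "D (\<lambda>p. cnj (\<psi> p)) = (\<lambda>p. cnj (D \<psi> p))" if "\<psi> \<in> test_functions Omega" for \<psi>
    using D smooth_pd[OF test_smooth[OF that]] pd_cnj[OF smooth_C1[OF test_smooth[OF that]]] by auto
  have e: "((LINT p:Omega|lborel. rep_L2 v p * D \<psi> p) = - (LINT p:Omega|lborel. rep_L2 g p * \<psi> p)) \<longleftrightarrow>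
      cinner v (to_L2 Omega (D (\<lambda>p. cnj (\<psi> p)))) = - cinner g (to_L2 Omega (\<lambda>p. cnj (\<psi> p)))"
    if "\<psi> \<in> test_functions Omega" for \<psi>
    unfolding Omega_set_integral[OF Ds(1)[OF that]] Omega_set_integral[OF test_smooth[OF that]] Ds(2)[OF that] ..
  have "(\<forall>\<psi>\<in>test_functions Omega. P (\<lambda>p. cnj (\<psi> p))) \<longleftrightarrow> (\<forall>\<psi>\<in>test_functions Omega. P \<psi>)" for P
    using test_cnj by (metis (no_types, lifting) complex_cnj_cnj ext)
  from this[of "\<lambda>\<psi>. cinner v (to_L2 Omega (D \<psi>)) = - cinner g (to_L2 Omega \<psi>)"]
  show ?thesis unfolding is_weak_deriv_def using e by auto
qed

lemma weak_deriv_unique: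
  assumes "D = pdx \<or> D = pdy" "is_weak_deriv D v g" "is_weak_deriv D v g'" shows "g = g'"
proof -
  have "g - g' \<in> L2_on Omega"
    using assms(2,3) L2_on_add[OF Omega(2) _ L2_on_scaleC[OF Omega(2)], of g g' "-1"]
    by (simp add: is_weak_deriv_def scaleC_minus1)
  moreover have "cinner (g - g') (to_L2 Omega \<psi>) = 0" if "\<psi> \<in> test_functions Omega" for \<psi>
    using that assms(2,3)[unfolded is_weak_deriv_iff[OF assms(1)]] by (simp add: cinner.diff_left)
  ultimately have "g - g' = 0" by (rule test_total)
  then show ?thesis by simp
qed

lemma weak_deriv_eqI: "is_weak_deriv pdx v g \<Longrightarrow> weak_dx v = g" "is_weak_deriv pdy v g \<Longrightarrow> weak_dy v = g"
  unfolding weak_dx_def weak_dy_def using weak_deriv_unique by blast+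

lemma sobolev_H1_D:
  assumes "v \<in> sobolev_H1"
  shows "v \<in> L2_on Omega" "is_weak_deriv pdx v (weak_dx v)" "is_weak_deriv pdy v (weak_dy v)"
proof -
  show "v \<in> L2_on Omega" using assms by (simp add: sobolev_H1_def)
  obtain g g' where "is_weak_deriv pdx v g" "is_weak_deriv pdy v g'" using assms by (auto simp: sobolev_H1_def)
  then show "is_weak_deriv pdx v (weak_dx v)" "is_weak_deriv pdy v (weak_dy v)"
    using weak_deriv_eqI by metis+
qed

lemma weak_deriv_add: 
  "D = pdx \<or> D = pdy \<Longrightarrow> is_weak_deriv D v g \<Longrightarrow> is_weak_deriv D v' g' \<Longrightarrow> is_weak_deriv D (v + v') (g + g')"
  by (simp add: is_weak_deriv_iff L2_on_add Omega(2) cinner.add_left)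

lemma weak_deriv_scaleC: 
  "D = pdx \<or> D = pdy \<Longrightarrow> is_weak_deriv D v g \<Longrightarrow> is_weak_deriv D (c *\<^sub>C v) (c *\<^sub>C g)"
  by (simp add: is_weak_deriv_iff L2_on_scaleC Omega(2) cinner_scaleC_left)

lemma weak_deriv_limit:
  assumes D: "D = pdx \<or> D = pdy" and w: "\<And>n. is_weak_deriv D (v n) (g n)" and lim: "v \<longlonglongrightarrow> v'" "g \<longlonglongrightarrow> g'"
  shows "is_weak_deriv D v' g'"
  unfolding is_weak_deriv_iff[OF D]
proof (intro conjI ballI)
  note w' = w[unfolded is_weak_deriv_iff[OF D]]
  show "g' \<in> L2_on Omega" using closed_sequentially[OF closed_L2_on[OF Omega(2)] _ lim(2)] w' by blast
  fix \<psi> assume \<psi>: "\<psi> \<in> test_functions Omega"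
  have "(\<lambda>n. cinner (v n) (to_L2 Omega (D \<psi>))) \<longlonglongrightarrow> cinner v' (to_L2 Omega (D \<psi>))"
    "(\<lambda>n. - cinner (g n) (to_L2 Omega \<psi>)) \<longlonglongrightarrow> - cinner g' (to_L2 Omega \<psi>)"
    by (intro tendsto_minus cinner.tendsto lim tendsto_const)+
  moreover have "(\<lambda>n. cinner (v n) (to_L2 Omega (D \<psi>))) = (\<lambda>n. - cinner (g n) (to_L2 Omega \<psi>))"
    using w' \<psi> by auto
  ultimately show "cinner v' (to_L2 Omega (D \<psi>)) = - cinner g' (to_L2 Omega \<psi>)"
    using LIMSEQ_unique by metis
qed

lemma sobolev_H1_I:
  assumes "v \<in> L2_on Omega" "is_weak_deriv pdx v g" "is_weak_deriv pdy v g'"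
  shows "v \<in> sobolev_H1" "weak_dx v = g" "weak_dy v = g'" "H1_graph v = (v, g, g')"
  using assms weak_deriv_eqI by (auto simp: sobolev_H1_def H1_graph_def)

lemma H1_add:
  assumes "v \<in> sobolev_H1" "w \<in> sobolev_H1"
  shows "v + w \<in> sobolev_H1" "weak_dx (v + w) = weak_dx v + weak_dx w" "weak_dy (v + w) = weak_dy v + weak_dy w"
    "H1_graph (v + w) = H1_graph v + H1_graph w"
  using sobolev_H1_I[OF L2_on_add[OF Omega(2)] weak_deriv_add weak_deriv_add] sobolev_H1_D[OF assms(1)] sobolev_H1_D[OF assms(2)]
  by (auto simp: H1_graph_def)

lemma H1_scaleC:
  assumes "v \<in> sobolev_H1"
  shows "c *\<^sub>C v \<in> sobolev_H1" "weak_dx (c *\<^sub>C v) = c *\<^sub>C weak_dx v" "weak_dy (c *\<^sub>C v) = c *\<^sub>C weak_dy v"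
    "H1_graph (c *\<^sub>C v) = c *\<^sub>C H1_graph v"
  using sobolev_H1_I[OF L2_on_scaleC[OF Omega(2)] weak_deriv_scaleC weak_deriv_scaleC] sobolev_H1_D[OF assms]
  by (auto simp: H1_graph_def scaleC_prod_def)

lemma H1_0: "0 \<in> sobolev_H1" "H1_graph 0 = 0"
proof -
  have w: "is_weak_deriv pdx 0 0" "is_weak_deriv pdy 0 0"
    by (simp_all add: is_weak_deriv_iff cinner.zero_left L2_on_0 Omega(2))
  show "0 \<in> sobolev_H1" "H1_graph 0 = 0"
    using sobolev_H1_I[OF L2_on_0[OF Omega(2)] w] by (auto simp: zero_prod_def)
qed

lemma H1_diff:
  assumes "v \<in> sobolev_H1" "w \<in> sobolev_H1"
  shows "v - w \<in> sobolev_H1" "weak_dx (v - w) = weak_dx v - weak_dx w" "weak_dy (v - w) = weak_dy v - weak_dy w"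
    "H1_graph (v - w) = H1_graph v - H1_graph w"
  using H1_add[OF assms(1) H1_scaleC(1)[OF assms(2)], of "-1"] H1_scaleC[OF assms(2), of "-1"] 
  by (simp_all add: scaleC_minus1)

lemma H1_graph_csubspace: "csubspace (H1_graph ` sobolev_H1)"
  unfolding csubspace_def
proof (intro conjI ballI allI)
  show "0 \<in> H1_graph ` sobolev_H1" using H1_0 by force
next
  fix x y assume "x \<in> H1_graph ` sobolev_H1" "y \<in> H1_graph ` sobolev_H1"
  then show "x + y \<in> H1_graph ` sobolev_H1" using H1_add(1,4) by (auto simp: image_iff) metis
next
  fix c x assume "x \<in> H1_graph ` sobolev_H1"
  then show "c *\<^sub>C x \<in> H1_graph ` sobolev_H1" using H1_scaleC(1,4) by (auto simp: image_iff) metis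
qed

lemma H1_graph_limit:
  assumes "\<And>n. v n \<in> sobolev_H1" "(\<lambda>n. H1_graph (v n)) \<longlonglongrightarrow> l"
  shows "fst l \<in> sobolev_H1" "H1_graph (fst l) = l"
proof -
  obtain v' g g' where l: "l = (v', g, g')" by (metis surj_pair)
  have lim: "v \<longlonglongrightarrow> v'" "(\<lambda>n. weak_dx (v n)) \<longlonglongrightarrow> g" "(\<lambda>n. weak_dy (v n)) \<longlonglongrightarrow> g'"
    using tendsto_fst[OF assms(2)] tendsto_fst[OF tendsto_snd[OF assms(2)]] tendsto_snd[OF tendsto_snd[OF assms(2)]]
    by (simp_all add: l H1_graph_def)
  have "v' \<in> L2_on Omega"
    by (rule closed_sequentially[OF closed_L2_on[OF Omega(2)] _ lim(1)]) (use assms(1) sobolev_H1_D(1) in blast)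
  from sobolev_H1_I[OF this weak_deriv_limit[OF _ _ lim(1,2)] weak_deriv_limit[OF _ _ lim(1,3)]]
  show "fst l \<in> sobolev_H1" "H1_graph (fst l) = l"
    using sobolev_H1_D[OF assms(1)] by (auto simp: l)
qed

text \<open>Completeness of the Sobolev space, in the form that allows projections to be taken
  inside the surrounding product Hilbert space. It rests on the closedness of weak
  differentiation.\<close>

lemma closed_H1_graph: "closed (H1_graph ` sobolev_H1)"
proof (subst closed_sequential_limits, intro allI impI)
  fix X l assume "(\<forall>n. X n \<in> H1_graph ` sobolev_H1) \<and> X \<longlonglongrightarrow> l"
  then obtain v where v: "\<And>n. v n \<in> sobolev_H1" "\<And>n. X n = H1_graph (v n)" "X \<longlonglongrightarrow> l" 
    unfolding image_iff by metis
  then have "(\<lambda>n. H1_graph (v n)) \<longlonglongrightarrow> l" by (simp flip: v(2))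
  from H1_graph_limit[OF v(1) this] show "l \<in> H1_graph ` sobolev_H1" by (metis imageI)
qed

lemma test_boundary: 
  assumes "\<psi> \<in> test_functions Omega"
  shows "\<psi> (0, y) = 0" "\<psi> (pi, y) = 0" "\<psi> (x, 0) = 0" "\<psi> (x, -1) = 0"
  using assms by (auto simp: test_functions_def Omega_def subset_iff)

lemma smooth_H1:
  assumes F: "smooth F"
  shows "to_L2 Omega F \<in> sobolev_H1" "weak_dx (to_L2 Omega F) = to_L2 Omega (pdx F)"
    "weak_dy (to_L2 Omega F) = to_L2 Omega (pdy F)"
    "H1_graph (to_L2 Omega F) = (to_L2 Omega F, to_L2 Omega (pdx F), to_L2 Omega (pdy F))"
proof -
  note in_L2 = to_L2_in_L2_on[OF sqint_smooth]
  have to_L2_0: "to_L2 S (\<lambda>_. 0) = 0" for S :: "real set" by (simp add: to_L2_def zero_L2_def)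
  have x: "is_weak_deriv pdx (to_L2 Omega F) (to_L2 Omega (pdx F))"
    unfolding is_weak_deriv_iff[OF disjI1[OF refl]]
  proof (intro conjI ballI)
    show "to_L2 Omega (pdx F) \<in> L2_on Omega" by (rule in_L2[OF smooth_pd(1)[OF F]])
    fix \<psi> assume t: "\<psi> \<in> test_functions Omega"
    show "cinner (to_L2 Omega F) (to_L2 Omega (pdx \<psi>)) = - cinner (to_L2 Omega (pdx F)) (to_L2 Omega \<psi>)"
      using green_cinner_x[OF F test_smooth[OF t]] 
      by (simp add: test_boundary[OF t] to_L2_0 cinner.zero_right add_eq_0_iff)
  qed
  have y: "is_weak_deriv pdy (to_L2 Omega F) (to_L2 Omega (pdy F))"
    unfolding is_weak_deriv_iff[OF disjI2[OF refl]]
  proof (intro conjI ballI)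
    show "to_L2 Omega (pdy F) \<in> L2_on Omega" by (rule in_L2[OF smooth_pd(2)[OF F]])
    fix \<psi> assume t: "\<psi> \<in> test_functions Omega"
    show "cinner (to_L2 Omega F) (to_L2 Omega (pdy \<psi>)) = - cinner (to_L2 Omega (pdy F)) (to_L2 Omega \<psi>)"
      using green_cinner_y[OF F test_smooth[OF t]] 
      by (simp add: test_boundary[OF t] to_L2_0 cinner.zero_right add_eq_0_iff)
  qed
  show "to_L2 Omega F \<in> sobolev_H1" "weak_dx (to_L2 Omega F) = to_L2 Omega (pdx F)"
    "weak_dy (to_L2 Omega F) = to_L2 Omega (pdy F)"
    "H1_graph (to_L2 Omega F) = (to_L2 Omega F, to_L2 Omega (pdx F), to_L2 Omega (pdy F))"
    using sobolev_H1_I[OF in_L2[OF F] x y] by auto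
qed

text \<open>The derivatives of the cutoff functions blow up at the boundary, but only like the inverse
  distance to it, which is compensated by the decay of \<open>\<psi>\<close>.\<close>

lemma weak_by_parts:
  assumes D: "D = pdx \<or> D = pdy" and w: "is_weak_deriv D v g" and \<psi>: "smooth \<psi>"
    and bd: "\<And>n p. p \<in> Omega \<Longrightarrow> cmod (\<psi> p * D (cutoff n) p) \<le> C"
  shows "cinner v (to_L2 Omega (D \<psi>)) = - cinner g (to_L2 Omega \<psi>)"
proof -
  have Ds: "smooth (D f)" if "smooth f" for f using D smooth_pd[OF that] by auto
  have Dm: "D (\<lambda>p. \<psi> p * cutoff n p) = (\<lambda>p. \<psi> p * D (cutoff n) p + D \<psi> p * cutoff n p)" for n
    using D pd_mult[OF smooth_C1[OF \<psi>] smooth_C1[OF smooth_cutoff]] by auto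
  have D0: "(\<lambda>n. D (cutoff n) p) \<longlonglongrightarrow> 0" if p: "p \<in> Omega" for p
    using D
  proof
    assume "D = pdx"
    have "(\<lambda>n. complex_of_real (cut_deriv 0 pi n (fst p) * cut (-1) 0 n (snd p))) \<longlonglongrightarrow> of_real (0 * 1)"
      using p by (intro tendsto_of_real tendsto_mult cut_deriv_tendsto cut_tendsto) (auto simp: Omega_def)
    then show ?thesis by (simp add: \<open>D = pdx\<close> pd_cutoff)
  next
    assume "D = pdy"
    have "(\<lambda>n. complex_of_real (cut 0 pi n (fst p) * cut_deriv (-1) 0 n (snd p))) \<longlonglongrightarrow> of_real (1 * 0)"
      using p by (intro tendsto_of_real tendsto_mult cut_deriv_tendsto cut_tendsto) (auto simp: Omega_def)
    then show ?thesis by (simp add: \<open>D = pdy\<close> pd_cutoff)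
  qed
  obtain M where M: "M \<ge> 0" "\<And>p. p \<in> Omega \<Longrightarrow> cmod (D \<psi> p) \<le> M" using smooth_bounded[OF Ds[OF \<psi>]] by blast
  have "(\<lambda>n. to_L2 Omega (D (\<lambda>p. \<psi> p * cutoff n p))) \<longlonglongrightarrow> to_L2 Omega (D \<psi>)"
  proof (rule to_L2_Omega_tendsto)
    show "D (\<lambda>p. \<psi> p * cutoff n p) \<in> sqint Omega" for n by (intro sqint_smooth Ds smooth_mult \<psi> smooth_cutoff)
    show "D \<psi> \<in> sqint Omega" by (intro sqint_smooth Ds \<psi>)
    fix p assume p: "p \<in> Omega"
    have "(\<lambda>n. \<psi> p * D (cutoff n) p + D \<psi> p * cutoff n p) \<longlonglongrightarrow> \<psi> p * 0 + D \<psi> p * 1"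
      by (intro tendsto_intros D0 cutoff_tendsto p)
    then show "(\<lambda>n. D (\<lambda>p. \<psi> p * cutoff n p) p) \<longlonglongrightarrow> D \<psi> p" by (simp add: Dm)
    show "cmod (D (\<lambda>p. \<psi> p * cutoff n p) p) \<le> C + M" for n
    proof -
      have "cmod (D \<psi> p * cutoff n p) \<le> M"
        using mult_mono[OF M(2)[OF p] cutoff_bound M(1)] by (simp add: norm_mult)
      then show ?thesis unfolding Dm using bd[OF p, of n] norm_triangle_ineq[of "\<psi> p * D (cutoff n) p" "D \<psi> p * cutoff n p"] by linarith
    qed
  qed
  then have "(\<lambda>n. cinner v (to_L2 Omega (D (\<lambda>p. \<psi> p * cutoff n p)))) \<longlonglongrightarrow> cinner v (to_L2 Omega (D \<psi>))"
    by (intro cinner.tendsto tendsto_const)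
  moreover have "(\<lambda>n. - cinner g (to_L2 Omega (\<lambda>p. \<psi> p * cutoff n p))) \<longlonglongrightarrow> - cinner g (to_L2 Omega \<psi>)"
    by (intro tendsto_minus cinner.tendsto tendsto_const cutoff_to_L2 \<psi>)
  moreover have "cinner v (to_L2 Omega (D (\<lambda>p. \<psi> p * cutoff n p))) = - cinner g (to_L2 Omega (\<lambda>p. \<psi> p * cutoff n p))" for n
    using w[unfolded is_weak_deriv_iff[OF D]] test_cutoff[OF \<psi>] by blast
  ultimately show ?thesis using LIMSEQ_unique by simp
qed

text \<open>Differentiation in x hits only the x-factor of the cutoff. Hence \<psi> must decay only
  towards the two vertical sides and may have arbitrary values on the horizontal ones; linear decay
  absorbs the \<open>2 / distance\<close> slopes of the cutoffs at either end.\<close>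

lemma weak_by_parts_x:
  assumes w: "is_weak_deriv pdx v g" and \<psi>: "smooth \<psi>"
    and bd: "\<And>p. p \<in> Omega \<Longrightarrow> cmod (\<psi> p) \<le> L * fst p" "\<And>p. p \<in> Omega \<Longrightarrow> cmod (\<psi> p) \<le> L * (pi - fst p)"
  shows "cinner v (to_L2 Omega (pdx \<psi>)) = - cinner g (to_L2 Omega \<psi>)"
proof (rule weak_by_parts[OF _ w \<psi>])
  fix n p assume p: "p \<in> Omega"
  then have x: "0 < fst p" "fst p < pi" by (auto simp: Omega_def)
  have "cmod (\<psi> p) * \<bar>cut_deriv 0 pi n (fst p)\<bar> \<le> cmod (\<psi> p) * (2 / (fst p - 0) + 2 / (pi - fst p))"
    by (intro mult_left_mono cut_deriv_bound x) auto
  also have "\<dots> = cmod (\<psi> p) * 2 / fst p + cmod (\<psi> p) * 2 / (pi - fst p)" by (simp add: distrib_left)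
  also have "\<dots> \<le> 2 * L + 2 * L"
    using bd[OF p] x by (intro add_mono) (auto simp: field_simps)
  finally have 1: "cmod (\<psi> p) * \<bar>cut_deriv 0 pi n (fst p)\<bar> \<le> 4 * L" by simp
  have "cmod (\<psi> p * pdx (cutoff n) p) = (cmod (\<psi> p) * \<bar>cut_deriv 0 pi n (fst p)\<bar>) * cut (-1) 0 n (snd p)"
    using cut_bounds(1)[of "-1" 0 n "snd p"] by (simp add: pd_cutoff norm_mult abs_mult)
  also have "\<dots> \<le> (cmod (\<psi> p) * \<bar>cut_deriv 0 pi n (fst p)\<bar>) * 1"
    by (intro mult_left_mono cut_bounds) auto
  finally show "cmod (\<psi> p * pdx (cutoff n) p) \<le> 4 * L" using 1 by simp
qed simp

lemma weak_by_parts_y: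
  assumes w: "is_weak_deriv pdy v g" and \<psi>: "smooth \<psi>"
    and bd: "\<And>p. p \<in> Omega \<Longrightarrow> cmod (\<psi> p) \<le> L * (snd p + 1)" "\<And>p. p \<in> Omega \<Longrightarrow> cmod (\<psi> p) \<le> L * (- snd p)"
  shows "cinner v (to_L2 Omega (pdy \<psi>)) = - cinner g (to_L2 Omega \<psi>)"
proof (rule weak_by_parts[OF _ w \<psi>])
  fix n p assume p: "p \<in> Omega"
  then have x: "-1 < snd p" "snd p < 0" by (auto simp: Omega_def)
  have "cmod (\<psi> p) * \<bar>cut_deriv (-1) 0 n (snd p)\<bar> \<le> cmod (\<psi> p) * (2 / (snd p - (-1)) + 2 / (0 - snd p))"
    by (intro mult_left_mono cut_deriv_bound x) auto
  also have "\<dots> = cmod (\<psi> p) * 2 / (snd p + 1) + cmod (\<psi> p) * 2 / (- snd p)" 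
    by (simp add: right_diff_distrib)
  also have "\<dots> \<le> 2 * L + 2 * L"
  proof (intro add_mono)
    show "cmod (\<psi> p) * 2 / (snd p + 1) \<le> 2 * L" using bd(1)[OF p] x by (simp add: pos_divide_le_eq)
    have "- snd p > 0" using x by simp
    then show "cmod (\<psi> p) * 2 / (- snd p) \<le> 2 * L" using bd(2)[OF p] by (subst pos_divide_le_eq) auto
  qed
  finally have 1: "cmod (\<psi> p) * \<bar>cut_deriv (-1) 0 n (snd p)\<bar> \<le> 4 * L" by simp
  have "cmod (\<psi> p * pdy (cutoff n) p) = (cmod (\<psi> p) * \<bar>cut_deriv (-1) 0 n (snd p)\<bar>) * cut 0 pi n (fst p)"
    using cut_bounds(1)[of 0 pi n "fst p"] by (simp add: pd_cutoff norm_mult abs_mult mult_ac)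
  also have "\<dots> \<le> (cmod (\<psi> p) * \<bar>cut_deriv (-1) 0 n (snd p)\<bar>) * 1"
    by (intro mult_left_mono cut_bounds) auto
  finally show "cmod (\<psi> p * pdy (cutoff n) p) \<le> 4 * L" using 1 by simp
qed simp

section \<open>Density of smooth functions and Dirichlet traces\<close>

lemma pd_cosx:
  "pdx (cosx j k) = (\<lambda>p. complex_of_real (- real j * sin (real j * fst p) * cos (real k * (pi * (snd p + 1)))))"
  "pdx (pdx (cosx j k)) = (\<lambda>p. - complex_of_real ((real j)\<^sup>2) * cosx j k p)"
  "pdy (cosx j k) = (\<lambda>p. complex_of_real (- (real k * pi) * cos (real j * fst p) * sin (real k * (pi * (snd p + 1)))))"
  "pdy (pdy (cosx j k)) = (\<lambda>p. - complex_of_real ((real k * pi)\<^sup>2) * cosx j k p)"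
proof -
  show x: "pdx (cosx j k) = (\<lambda>p. complex_of_real (- real j * sin (real j * fst p) * cos (real k * (pi * (snd p + 1)))))"
    unfolding cosx_def of_real_mult[symmetric]
    by (rule pdx_eqI, rule has_vector_derivative_of_real)
      (auto simp: has_real_derivative_iff_has_vector_derivative[symmetric] intro!: derivative_eq_intros)
  show "pdx (pdx (cosx j k)) = (\<lambda>p. - complex_of_real ((real j)\<^sup>2) * cosx j k p)"
    unfolding x cosx_def of_real_mult[symmetric] of_real_minus[symmetric]
    by (rule pdx_eqI, rule has_vector_derivative_of_real)
      (auto simp: has_real_derivative_iff_has_vector_derivative[symmetric] power2_eq_square intro!: derivative_eq_intros)
  show y: "pdy (cosx j k) = (\<lambda>p. complex_of_real (- (real k * pi) * cos (real j * fst p) * sin (real k * (pi * (snd p + 1)))))"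
    unfolding cosx_def of_real_mult[symmetric]
    by (rule pdy_eqI, rule has_vector_derivative_of_real)
      (auto simp: has_real_derivative_iff_has_vector_derivative[symmetric] intro!: derivative_eq_intros)
  show "pdy (pdy (cosx j k)) = (\<lambda>p. - complex_of_real ((real k * pi)\<^sup>2) * cosx j k p)"
    unfolding y cosx_def of_real_mult[symmetric] of_real_minus[symmetric]
    by (rule pdy_eqI, rule has_vector_derivative_of_real)
      (auto simp: has_real_derivative_iff_has_vector_derivative[symmetric] power2_eq_square intro!: derivative_eq_intros)
qed

lemma abs_sin_nat_pi: "\<bar>sin (real j * (pi - x))\<bar> = \<bar>sin (real j * x)\<bar>"
  by (simp add: right_diff_distrib sin_diff abs_mult)

lemma sin_nat_bounds:
  assumes "0 \<le> x" "x \<le> pi"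
  shows "\<bar>sin (real j * x)\<bar> \<le> real j * x" "\<bar>sin (real j * x)\<bar> \<le> real j * (pi - x)"
  using abs_sin_x_le_abs_x[of "real j * x"] abs_sin_x_le_abs_x[of "real j * (pi - x)"] assms
  by (auto simp: abs_sin_nat_pi abs_mult)

text \<open>The bounds express a homogeneous Neumann condition on the vertical sides, so
  \<open>pdx G\<close> itself is an admissible test function for the weak x-derivative of v; the
  eigenvalue equation then returns G. It is applied to the cosine products and to the harmonic modes
  \<open>DE k\<close>.\<close>

lemma pdx_neumann:
  assumes v: "v \<in> sobolev_H1" and G: "smooth G" and c: "c \<ge> 0"
    and Gxx: "pdx (pdx G) = (\<lambda>p. - complex_of_real c * G p)"
    and bd: "\<And>p. p \<in> Omega \<Longrightarrow> cmod (pdx G p) \<le> L * fst p" "\<And>p. p \<in> Omega \<Longrightarrow> cmod (pdx G p) \<le> L * (pi - fst p)"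
  shows "cinner (weak_dx v) (to_L2 Omega (pdx G)) = of_real c * cinner v (to_L2 Omega G)"
  using weak_by_parts_x[OF sobolev_H1_D(2)[OF v] smooth_pd(1)[OF G] bd] to_L2_scale[OF sqint_smooth[OF G], of "- complex_of_real c"]
  by (simp add: Gxx cinner_scaleC_right)

lemma cosx_gradient:
  assumes v: "v \<in> sobolev_H1"
  shows "cinner (weak_dx v) (to_L2 Omega (pdx (cosx j k))) = of_real ((real j)\<^sup>2) * cinner v (to_L2 Omega (cosx j k))"
    "cinner (weak_dy v) (to_L2 Omega (pdy (cosx j k))) = of_real ((real k * pi)\<^sup>2) * cinner v (to_L2 Omega (cosx j k))"
proof -
  have b: "cmod (pdx (cosx j k) p) \<le> real j * \<bar>sin (real j * fst p)\<bar>" 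
    "cmod (pdy (cosx j k) p) \<le> (real k * pi) * \<bar>sin (real k * (pi * (snd p + 1)))\<bar>" for p
    unfolding pd_cosx norm_of_real abs_mult
    by (auto intro!: mult_left_le mult_right_mono simp: mult_left_le)
  show "cinner (weak_dx v) (to_L2 Omega (pdx (cosx j k))) = of_real ((real j)\<^sup>2) * cinner v (to_L2 Omega (cosx j k))"
  proof (rule pdx_neumann[OF v smooth_cosx _ pd_cosx(2)])
    fix p assume p: "p \<in> Omega"
    then have x: "0 \<le> fst p" "fst p \<le> pi" by (auto simp: Omega_def)
    have "cmod (pdx (cosx j k) p) \<le> real j * (real j * fst p)" 
      by (rule order_trans[OF b(1)]) (intro mult_left_mono sin_nat_bounds x, simp)
    then show "cmod (pdx (cosx j k) p) \<le> (real j)\<^sup>2 * fst p" by (simp add: power2_eq_square mult_ac)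
    have "cmod (pdx (cosx j k) p) \<le> real j * (real j * (pi - fst p))" 
      by (rule order_trans[OF b(1)]) (intro mult_left_mono sin_nat_bounds x, simp)
    then show "cmod (pdx (cosx j k) p) \<le> (real j)\<^sup>2 * (pi - fst p)" by (simp add: power2_eq_square mult_ac)
  qed simp
  have "cinner v (to_L2 Omega (pdy (pdy (cosx j k)))) = - cinner (weak_dy v) (to_L2 Omega (pdy (cosx j k)))"
  proof (rule weak_by_parts_y[OF sobolev_H1_D(3)[OF v] smooth_pd(2)[OF smooth_cosx]])
    fix p assume p: "p \<in> Omega"
    then have y: "0 \<le> pi * (snd p + 1)" "pi * (snd p + 1) \<le> pi" by (auto simp: Omega_def)
    have "cmod (pdy (cosx j k) p) \<le> (real k * pi) * (real k * (pi * (snd p + 1)))" 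
      by (rule order_trans[OF b(2)]) (intro mult_left_mono sin_nat_bounds y, simp)
    then show "cmod (pdy (cosx j k) p) \<le> (real k * pi)\<^sup>2 * (snd p + 1)" by (simp add: power2_eq_square mult_ac)
    have "cmod (pdy (cosx j k) p) \<le> (real k * pi) * (real k * (pi - pi * (snd p + 1)))" 
      by (rule order_trans[OF b(2)]) (intro mult_left_mono sin_nat_bounds y, simp)
    then show "cmod (pdy (cosx j k) p) \<le> (real k * pi)\<^sup>2 * (- snd p)" by (simp add: power2_eq_square algebra_simps)
  qed
  then show "cinner (weak_dy v) (to_L2 Omega (pdy (cosx j k))) = of_real ((real k * pi)\<^sup>2) * cinner v (to_L2 Omega (cosx j k))"
    using to_L2_scale[OF sqint_smooth[OF smooth_cosx], of "- complex_of_real ((real k * pi)\<^sup>2)" j k]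
    by (simp add: pd_cosx(4) cinner_scaleC_right)
qed

text \<open>The residual \<open>r\<close> of the orthogonal projection onto the closure of the smooth functions is
  orthogonal in \<open>H\<^sup>1\<close> to all cosine products, which are eigenfunctions of the Neumann Laplacian; so it
  is orthogonal to them in \<open>L\<^sup>2\<close>.\<close>

lemma H1_dense:
  assumes v: "v \<in> sobolev_H1"
  shows "\<exists>F. (\<forall>n::nat. smooth (F n)) \<and> (\<lambda>n. H1_graph (to_L2 Omega (F n))) \<longlonglongrightarrow> H1_graph v"
proof -
  define S where "S = (\<lambda>F. H1_graph (to_L2 Omega F)) ` {F. smooth F}"
  have "csubspace S" unfolding csubspace_def
  proof (intro conjI ballI allI)
    have "to_L2 Omega (\<lambda>_. 0) = 0" by (simp add: to_L2_def zero_L2_def)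
    then show "0 \<in> S" unfolding S_def using H1_0(2) smooth_const by (intro image_eqI[of _ _ "\<lambda>_. 0"]) auto
  next
    fix x y assume "x \<in> S" "y \<in> S"
    then obtain F G where FG: "smooth F" "smooth G" "x = H1_graph (to_L2 Omega F)" "y = H1_graph (to_L2 Omega G)"
      by (auto simp: S_def)
    have "x + y = H1_graph (to_L2 Omega (\<lambda>p. F p + G p))"
      by (simp add: FG to_L2_add[OF sqint_smooth sqint_smooth] H1_add(4)[OF smooth_H1(1) smooth_H1(1)])
    then show "x + y \<in> S" unfolding S_def using smooth_add[OF FG(1,2)] by blast
  next
    fix c x assume "x \<in> S"
    then obtain F where F: "smooth F" "x = H1_graph (to_L2 Omega F)"
      by (auto simp: S_def)
    have "c *\<^sub>C x = H1_graph (to_L2 Omega (\<lambda>p. c * F p))"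
      by (simp add: F to_L2_scale[OF sqint_smooth] H1_scaleC(4)[OF smooth_H1(1)])
    then show "c *\<^sub>C x \<in> S" unfolding S_def using smooth_mult[OF smooth_const F(1)] by blast
  qed
  obtain p where p: "p \<in> closure S" "\<And>w. w \<in> closure S \<Longrightarrow> cinner (H1_graph v - p) w = 0"
    using closed_projection[OF csubspace_closure[OF \<open>csubspace S\<close>] closed_closure] by blast
  \<comment> \<open>Because the graph of the Sobolev space is closed, the projection and hence the
    residual are graphs of Sobolev functions, so the residual can be integrated by parts.\<close>
  have "S \<subseteq> H1_graph ` sobolev_H1" unfolding S_def using smooth_H1(1) by blast
  then have "closure S \<subseteq> H1_graph ` sobolev_H1" by (rule closure_minimal[OF _ closed_H1_graph])
  then have "H1_graph v - p \<in> H1_graph ` sobolev_H1"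
    using csubspace_diff[OF H1_graph_csubspace] p(1) v by blast
  then obtain r where r: "r \<in> sobolev_H1" "H1_graph v - p = H1_graph r" by blast
  have "r = 0"
  proof (rule cosx_total[OF sobolev_H1_D(1)[OF r(1)]])
    fix j k
    have "H1_graph (to_L2 Omega (cosx j k)) \<in> S" unfolding S_def using smooth_cosx by blast
    then have "H1_graph (to_L2 Omega (cosx j k)) \<in> closure S" by (rule subsetD[OF closure_subset])
    from p(2)[OF this] have "cinner r (to_L2 Omega (cosx j k)) + (cinner (weak_dx r) (to_L2 Omega (pdx (cosx j k)))
        + cinner (weak_dy r) (to_L2 Omega (pdy (cosx j k)))) = 0"
      unfolding r(2) smooth_H1(4)[OF smooth_cosx] by (simp add: H1_graph_def cinner_prod_def)
    then have "complex_of_real (1 + (real j)\<^sup>2 + (real k * pi)\<^sup>2) * cinner r (to_L2 Omega (cosx j k)) = 0"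
      unfolding cosx_gradient[OF r(1)] by (simp add: algebra_simps)
    moreover have "1 + (real j)\<^sup>2 + (real k * pi)\<^sup>2 \<noteq> 0"
      by (metis add_nonneg_nonneg add_pos_nonneg less_irrefl zero_le_power2 zero_less_one)
    ultimately show "cinner r (to_L2 Omega (cosx j k)) = 0" by (metis mult_eq_0_iff of_real_eq_0_iff)
  qed
  then have "H1_graph v \<in> closure S" using r(2) p(1) H1_0(2) by simp
  then obtain X where X: "\<And>n. X n \<in> S" "X \<longlonglongrightarrow> H1_graph v" unfolding closure_sequential by metis
  then have "\<forall>n. \<exists>F. smooth F \<and> X n = H1_graph (to_L2 Omega F)" by (auto simp: S_def)
  then obtain F where F: "\<And>n. smooth (F n)" "\<And>n. X n = H1_graph (to_L2 Omega (F n))" by metis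
  then have "X = (\<lambda>n. H1_graph (to_L2 Omega (F n)))" by auto
  then show ?thesis using F(1) X(2) by metis
qed

section \<open>Dirichlet traces and the Poincare inequality\<close>

lemma norm_to_L2_mono:
  fixes f g :: "'a::euclidean_space \<Rightarrow> complex"
  assumes "f \<in> sqint S" "g \<in> sqint S" "\<And>x. x \<in> S \<Longrightarrow> cmod (f x) \<le> cmod (g x)"
  shows "norm (to_L2 S f) \<le> norm (to_L2 S g)"
proof -
  have s: "(\<lambda>x. indicator S x *\<^sub>R f x) \<in> sqint UNIV" "(\<lambda>x. indicator S x *\<^sub>R g x) \<in> sqint UNIV"
    using assms by (auto simp: indicator_in_sqint)
  have "(norm (to_L2 S f))\<^sup>2 \<le> (norm (to_L2 S g))\<^sup>2"
    unfolding to_L2_def norm_abs_L2[OF s(1)] norm_abs_L2[OF s(2)]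
    by (rule integral_mono) (use s assms(3) in \<open>auto simp: sqint_UNIV indicator_def intro!: power_mono\<close>)
  then show ?thesis by (rule power2_le_imp_le) simp
qed

lemma H1_graph_norms:
  "norm v \<le> norm (H1_graph v)" "norm (weak_dx v) \<le> norm (H1_graph v)" "norm (weak_dy v) \<le> norm (H1_graph v)"
  "(norm (H1_graph v))\<^sup>2 = (norm v)\<^sup>2 + ((norm (weak_dx v))\<^sup>2 + (norm (weak_dy v))\<^sup>2)"
proof -
  show e: "(norm (H1_graph v))\<^sup>2 = (norm v)\<^sup>2 + ((norm (weak_dx v))\<^sup>2 + (norm (weak_dy v))\<^sup>2)"
    by (simp add: H1_graph_def norm_Pair)
  show "norm v \<le> norm (H1_graph v)" "norm (weak_dx v) \<le> norm (H1_graph v)" "norm (weak_dy v) \<le> norm (H1_graph v)"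
    by (rule power2_le_imp_le; simp add: e)+
qed

text \<open>Green's formula for F and \<open>(y + 1) F\<close>: the weight is 1 on the top and 0 on
  the bottom, so only the top contributes, and the derivative of the weight returns the norm of F.
  It is kept as an identity with an error term since it is read in both directions: it bounds the
  trace by the function, and the function by the trace (the Poincare inequality).\<close>

lemma smooth_top_identity:
  assumes F: "smooth F"
  shows "\<exists>z. cmod z \<le> 2 * norm (to_L2 Omega F) * norm (to_L2 Omega (pdy F)) \<and>
    complex_of_real ((norm (to_L2 {0..pi} (\<lambda>x. F (x, 0))))\<^sup>2) = of_real ((norm (to_L2 Omega F))\<^sup>2) + z"
proof -
  define m where "m p = complex_of_real (snd p) + 1" for p :: "real \<times> real"
  have m: "smooth m" unfolding m_def[abs_def] by (intro smooth_add smooth_snd smooth_const)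
  have my: "pdy m = (\<lambda>p. 1)" unfolding m_def[abs_def]
    by (rule pdy_eqI) (auto intro!: derivative_eq_intros)
  have m1: "cmod (m p) \<le> 1" if "p \<in> Omega" for p
  proof -
    have "m p = complex_of_real (snd p + 1)" by (simp add: m_def)
    then show ?thesis using that by (auto simp: Omega_def simp del: of_real_add)
  qed
  have mle: "norm (to_L2 Omega (\<lambda>p. m p * f p)) \<le> norm (to_L2 Omega f)" if "smooth f" for f
    by (rule norm_to_L2_mono) (use that m m1 in \<open>auto intro!: sqint_smooth smooth_mult mult_left_le_one_le simp: norm_mult\<close>)
  let ?G = "\<lambda>p. m p * F p"
  note sF = F smooth_pd(2)[OF F]
  have G: "smooth ?G" by (rule smooth_mult[OF m F])
  have Gy: "pdy ?G = (\<lambda>p. m p * pdy F p + F p)"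
    using pd_mult(2)[OF smooth_C1[OF m] smooth_C1[OF F]] by (simp add: my)
  have "to_L2 Omega (pdy ?G) = to_L2 Omega (\<lambda>p. m p * pdy F p) + to_L2 Omega F"
    unfolding Gy by (rule to_L2_add) (intro sqint_smooth smooth_mult m sF)+
  moreover have "(\<lambda>x. ?G (x, 0)) = (\<lambda>x. F (x, 0))" "(\<lambda>x. ?G (x, -1)) = (\<lambda>x. 0)" by (auto simp: m_def)
  moreover have "to_L2 {0..pi} (\<lambda>x. 0) = 0" by (simp add: to_L2_def zero_L2_def)
  ultimately have "complex_of_real ((norm (to_L2 {0..pi} (\<lambda>x. F (x, 0))))\<^sup>2) = of_real ((norm (to_L2 Omega F))\<^sup>2) + 
     (cinner (to_L2 Omega (pdy F)) (to_L2 Omega ?G) + cinner (to_L2 Omega F) (to_L2 Omega (\<lambda>p. m p * pdy F p)))"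
    using green_cinner_y[OF F G] by (simp add: cinner.zero_right cinner.add_right cinner_self) (simp add: algebra_simps)
  moreover have "cmod (cinner (to_L2 Omega (pdy F)) (to_L2 Omega ?G) + cinner (to_L2 Omega F) (to_L2 Omega (\<lambda>p. m p * pdy F p)))
     \<le> norm (to_L2 Omega (pdy F)) * norm (to_L2 Omega F) + norm (to_L2 Omega F) * norm (to_L2 Omega (pdy F))"
    by (rule order_trans[OF norm_triangle_ineq], rule add_mono; rule order_trans[OF norm_cinner_le]; intro mult_left_mono mle sF norm_ge_zero)
  ultimately show ?thesis by (intro exI conjI) (auto simp: mult_ac)
qed

text \<open>The same device with the weight \<open>1 - x / pi\<close>, which is 1 on the left side
  and 0 on the right. Its slope contributes \<open>1 / pi\<close> times the squared norm of F,
  estimated by 1 here.\<close>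

lemma smooth_left_bound:
  assumes F: "smooth F"
  shows "(norm (to_L2 {-1..0} (\<lambda>y. F (0, y))))\<^sup>2 \<le> (norm (to_L2 Omega F))\<^sup>2 + 2 * norm (to_L2 Omega F) * norm (to_L2 Omega (pdx F))"
proof -
  define m where "m p = complex_of_real (- 1 / pi) * complex_of_real (fst p) + 1" for p :: "real \<times> real"
  have m: "smooth m" unfolding m_def[abs_def] by (intro smooth_add smooth_mult smooth_fst smooth_const)
  have mx: "pdx m = (\<lambda>p. complex_of_real (- 1 / pi))" unfolding m_def[abs_def]
    by (rule pdx_eqI) (auto intro!: derivative_eq_intros)
  have m1: "cmod (m p) \<le> 1" if "p \<in> Omega" for p
  proof -
    have "m p = complex_of_real (1 - fst p / pi)" by (simp add: m_def)
    moreover have "0 \<le> 1 - fst p / pi" "1 - fst p / pi \<le> 1" using that by (auto simp: Omega_def)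
    ultimately show ?thesis by (simp only: norm_of_real)
  qed
  have mle: "norm (to_L2 Omega (\<lambda>p. m p * f p)) \<le> norm (to_L2 Omega f)" if "smooth f" for f
    by (rule norm_to_L2_mono) (use that m m1 in \<open>auto intro!: sqint_smooth smooth_mult mult_left_le_one_le simp: norm_mult\<close>)
  let ?G = "\<lambda>p. m p * F p" and ?c = "complex_of_real (- 1 / pi)"
  note sF = F smooth_pd(1)[OF F]
  have G: "smooth ?G" by (rule smooth_mult[OF m F])
  have Gx: "pdx ?G = (\<lambda>p. m p * pdx F p + ?c * F p)"
    using pd_mult(1)[OF smooth_C1[OF m] smooth_C1[OF F]] by (simp add: mx)
  have "to_L2 Omega (pdx ?G) = to_L2 Omega (\<lambda>p. m p * pdx F p) + ?c *\<^sub>C to_L2 Omega F"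
    unfolding Gx to_L2_scale[OF sqint_smooth[OF F], symmetric]
    by (rule to_L2_add) (intro sqint_smooth smooth_mult smooth_const m sF)+
  moreover have "(\<lambda>y. ?G (0, y)) = (\<lambda>y. F (0, y))" "(\<lambda>y. ?G (pi, y)) = (\<lambda>y. 0)" by (auto simp: m_def)
  moreover have "to_L2 {-1..0::real} (\<lambda>y. 0) = 0" by (simp add: to_L2_def zero_L2_def)
  ultimately have e: "complex_of_real ((norm (to_L2 {-1..0} (\<lambda>y. F (0, y))))\<^sup>2) = 
     - (cnj ?c * cinner (to_L2 Omega F) (to_L2 Omega F) +
     (cinner (to_L2 Omega (pdx F)) (to_L2 Omega ?G) + cinner (to_L2 Omega F) (to_L2 Omega (\<lambda>p. m p * pdx F p))))"
    using green_cinner_x[OF F G] 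
    by (simp add: cinner.zero_right cinner.add_right cinner_scaleC_right cinner_self[of "to_L2 {- 1..0} (\<lambda>y. F (0, y))"] algebra_simps eq_neg_iff_add_eq_0)
  have "cmod (complex_of_real ((norm (to_L2 {-1..0} (\<lambda>y. F (0, y))))\<^sup>2)) \<le> 1 * (norm (to_L2 Omega F) * norm (to_L2 Omega F)) +
     (norm (to_L2 Omega (pdx F)) * norm (to_L2 Omega F) + norm (to_L2 Omega F) * norm (to_L2 Omega (pdx F)))"
    unfolding e norm_minus_cancel
  proof (intro order_trans[OF norm_triangle_ineq] add_mono)
    have "cmod (cnj ?c) \<le> 1" using pi_ge_two by (simp add: norm_divide)
    then show "cmod (cnj ?c * cinner (to_L2 Omega F) (to_L2 Omega F)) \<le> 1 * (norm (to_L2 Omega F) * norm (to_L2 Omega F))"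
      unfolding norm_mult by (intro mult_mono norm_cinner_le) auto
    show "cmod (cinner (to_L2 Omega (pdx F)) (to_L2 Omega ?G)) \<le> norm (to_L2 Omega (pdx F)) * norm (to_L2 Omega F)"
      "cmod (cinner (to_L2 Omega F) (to_L2 Omega (\<lambda>p. m p * pdx F p))) \<le> norm (to_L2 Omega F) * norm (to_L2 Omega (pdx F))"
      by (intro order_trans[OF norm_cinner_le] mult_left_mono mle sF; simp)+
  qed
  then show ?thesis unfolding norm_of_real abs_power2 by (simp add: power2_eq_square mult_ac)
qed

text \<open>One a priori bound on smooth functions yields existence, uniqueness, linearity and
  continuity of the trace by density. The constant 2 fits the top and the left side alike: with n
  the Sobolev norm, the squared trace norm is at most \<open>n^2 + 2 n^2\<close>, which is below
  \<open>(2 n)^2\<close>.\<close>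

locale trace_side =
  fixes \<gamma> :: "real \<Rightarrow> real \<times> real" and I :: "real set"
  assumes cont: "continuous_on UNIV \<gamma>" and I: "compact I"
    and bound: "\<And>F. smooth F \<Longrightarrow> norm (to_L2 I (\<lambda>s. F (\<gamma> s))) \<le> 2 * norm (H1_graph (to_L2 Omega F))"
begin

lemma side_sqint: "smooth F \<Longrightarrow> (\<lambda>s. F (\<gamma> s)) \<in> sqint I"
  by (rule sqint_compact[OF smooth_side[OF _ cont] I])

lemma has_trace_add:
  assumes "v \<in> sobolev_H1" "w \<in> sobolev_H1" "has_trace \<gamma> I v g" "has_trace \<gamma> I w k"
  shows "has_trace \<gamma> I (v + w) (g + k)"
proof -
  obtain F where F: "\<And>n::nat. smooth (F n)" "(\<lambda>n. H1_graph (to_L2 Omega (F n))) \<longlonglongrightarrow> H1_graph v"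
     "(\<lambda>n. to_L2 I (\<lambda>s. F n (\<gamma> s))) \<longlonglongrightarrow> g" using assms(3) by (auto simp: has_trace_def)
  obtain G where G: "\<And>n::nat. smooth (G n)" "(\<lambda>n. H1_graph (to_L2 Omega (G n))) \<longlonglongrightarrow> H1_graph w"
     "(\<lambda>n. to_L2 I (\<lambda>s. G n (\<gamma> s))) \<longlonglongrightarrow> k" using assms(4) by (auto simp: has_trace_def)
  show ?thesis unfolding has_trace_def
  proof (intro exI[of _ "\<lambda>n p. F n p + G n p"] conjI allI)
    show "smooth (\<lambda>p. F n p + G n p)" for n by (intro smooth_add F G)
    show "(\<lambda>n. H1_graph (to_L2 Omega (\<lambda>p. F n p + G n p))) \<longlonglongrightarrow> H1_graph (v + w)"
      using tendsto_add[OF F(2) G(2)]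
      by (simp add: to_L2_add sqint_smooth F(1) G(1) H1_add(4) smooth_H1(1) assms)
    show "(\<lambda>n. to_L2 I (\<lambda>s. F n (\<gamma> s) + G n (\<gamma> s))) \<longlonglongrightarrow> g + k"
      using tendsto_add[OF F(3) G(3)] by (simp add: to_L2_add side_sqint F(1) G(1))
  qed
qed

lemma has_trace_scaleC:
  assumes "v \<in> sobolev_H1" "has_trace \<gamma> I v g"
  shows "has_trace \<gamma> I (c *\<^sub>C v) (c *\<^sub>C g)"
proof -
  obtain F where F: "\<And>n::nat. smooth (F n)" "(\<lambda>n. H1_graph (to_L2 Omega (F n))) \<longlonglongrightarrow> H1_graph v"
     "(\<lambda>n. to_L2 I (\<lambda>s. F n (\<gamma> s))) \<longlonglongrightarrow> g" using assms(2) by (auto simp: has_trace_def)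
  show ?thesis unfolding has_trace_def
  proof (intro exI[of _ "\<lambda>n p. c * F n p"] conjI allI)
    show "smooth (\<lambda>p. c * F n p)" for n by (intro smooth_mult smooth_const F)
    show "(\<lambda>n. H1_graph (to_L2 Omega (\<lambda>p. c * F n p))) \<longlonglongrightarrow> H1_graph (c *\<^sub>C v)"
      using scaleC.tendsto[OF tendsto_const F(2)]
      by (simp add: to_L2_scale sqint_smooth F(1) H1_scaleC(4) smooth_H1(1) assms)
    show "(\<lambda>n. to_L2 I (\<lambda>s. c * F n (\<gamma> s))) \<longlonglongrightarrow> c *\<^sub>C g"
      using scaleC.tendsto[OF tendsto_const F(3)] by (simp add: to_L2_scale side_sqint F(1))
  qed
qed

lemma has_trace_bound: "has_trace \<gamma> I v g \<Longrightarrow> norm g \<le> 2 * norm (H1_graph v)"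
proof -
  assume "has_trace \<gamma> I v g"
  then obtain F where F: "\<And>n::nat. smooth (F n)" "(\<lambda>n. H1_graph (to_L2 Omega (F n))) \<longlonglongrightarrow> H1_graph v"
     "(\<lambda>n. to_L2 I (\<lambda>s. F n (\<gamma> s))) \<longlonglongrightarrow> g" by (auto simp: has_trace_def)
  show ?thesis
    by (rule LIMSEQ_le[OF tendsto_norm[OF F(3)] tendsto_mult[OF tendsto_const tendsto_norm[OF F(2)]]])
      (use bound[OF F(1)] in blast)
qed

lemma has_trace_unique:
  assumes "v \<in> sobolev_H1" "has_trace \<gamma> I v g" "has_trace \<gamma> I v k" shows "g = k"
proof -
  have "has_trace \<gamma> I (v + (-1) *\<^sub>C v) (g + (-1) *\<^sub>C k)"
    by (intro has_trace_add has_trace_scaleC H1_scaleC assms)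
  from has_trace_bound[OF this] show ?thesis by (simp add: scaleC_minus1 H1_0)
qed

lemma has_trace_exists:
  assumes v: "v \<in> sobolev_H1" shows "\<exists>g. has_trace \<gamma> I v g"
proof -
  obtain F where F: "\<And>n::nat. smooth (F n)" "(\<lambda>n. H1_graph (to_L2 Omega (F n))) \<longlonglongrightarrow> H1_graph v"
    using H1_dense[OF v] by blast
  have d: "norm (to_L2 I (\<lambda>s. F m (\<gamma> s)) - to_L2 I (\<lambda>s. F n (\<gamma> s))) \<le> 
      2 * norm (H1_graph (to_L2 Omega (F m)) - H1_graph (to_L2 Omega (F n)))" for m n
    using bound[OF smooth_diff[OF F(1) F(1)], of m n]
    by (simp add: to_L2_diff side_sqint F(1) sqint_smooth H1_diff(4) smooth_H1(1))
  have "Cauchy (\<lambda>n. to_L2 I (\<lambda>s. F n (\<gamma> s)))"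
  proof (rule CauchyI)
    fix e :: real assume "e > 0"
    then obtain M where M: "\<And>m n. m \<ge> M \<Longrightarrow> n \<ge> M \<Longrightarrow> norm (H1_graph (to_L2 Omega (F m)) - H1_graph (to_L2 Omega (F n))) < e / 2"
      using CauchyD[OF LIMSEQ_imp_Cauchy[OF F(2)], of "e/2"] by auto
    have "norm (to_L2 I (\<lambda>s. F m (\<gamma> s)) - to_L2 I (\<lambda>s. F n (\<gamma> s))) < e" if "m \<ge> M" "n \<ge> M" for m n
      using d[of m n] M[OF that] by linarith
    then show "\<exists>M. \<forall>m\<ge>M. \<forall>n\<ge>M. norm (to_L2 I (\<lambda>s. F m (\<gamma> s)) - to_L2 I (\<lambda>s. F n (\<gamma> s))) < e" by blast
  qed
  then obtain g where "(\<lambda>n. to_L2 I (\<lambda>s. F n (\<gamma> s))) \<longlonglongrightarrow> g" using Cauchy_convergent convergent_def by blast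
  then show ?thesis unfolding has_trace_def using F by blast
qed

definition tr :: "(real \<times> real) L2 \<Rightarrow> real L2" where "tr v = (THE g. has_trace \<gamma> I v g)"

lemma tr_eqI: "v \<in> sobolev_H1 \<Longrightarrow> has_trace \<gamma> I v g \<Longrightarrow> tr v = g"
  unfolding tr_def using has_trace_unique by blast

lemma has_trace_tr: "v \<in> sobolev_H1 \<Longrightarrow> has_trace \<gamma> I v (tr v)"
  using has_trace_exists tr_eqI by metis

lemma tr_add: "v \<in> sobolev_H1 \<Longrightarrow> w \<in> sobolev_H1 \<Longrightarrow> tr (v + w) = tr v + tr w"
  by (intro tr_eqI has_trace_add H1_add has_trace_tr)

lemma tr_scaleC: "v \<in> sobolev_H1 \<Longrightarrow> tr (c *\<^sub>C v) = c *\<^sub>C tr v"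
  by (intro tr_eqI has_trace_scaleC H1_scaleC has_trace_tr)

lemma tr_diff: "v \<in> sobolev_H1 \<Longrightarrow> w \<in> sobolev_H1 \<Longrightarrow> tr (v - w) = tr v - tr w"
  using tr_add[of v "(-1) *\<^sub>C w"] tr_scaleC[of w "-1"] H1_scaleC(1)[of w "-1"] unfolding scaleC_minus1 by simp

lemma tr_bound: "v \<in> sobolev_H1 \<Longrightarrow> norm (tr v) \<le> 2 * norm (H1_graph v)"
  by (rule has_trace_bound[OF has_trace_tr])

lemma tr_smooth: "smooth F \<Longrightarrow> tr (to_L2 Omega F) = to_L2 I (\<lambda>s. F (\<gamma> s))"
  by (intro tr_eqI smooth_H1) (auto simp: has_trace_def intro!: exI[of _ "\<lambda>n. F"])

lemma tr_tendsto:
  assumes "\<And>n. v n \<in> sobolev_H1" "w \<in> sobolev_H1" "(\<lambda>n. H1_graph (v n)) \<longlonglongrightarrow> H1_graph w"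
  shows "(\<lambda>n. tr (v n)) \<longlonglongrightarrow> tr w"
proof (rule Lim_null_comparison[THEN Lim_null[THEN iffD2]])
  have "(\<lambda>n. 2 * norm (H1_graph (v n) - H1_graph w)) \<longlonglongrightarrow> 2 * norm (H1_graph w - H1_graph w)"
    by (intro tendsto_intros assms)
  then show "(\<lambda>n. 2 * norm (H1_graph (v n) - H1_graph w)) \<longlonglongrightarrow> 0" by simp
  show "\<forall>\<^sub>F n in sequentially. norm (tr (v n) - tr w) \<le> 2 * norm (H1_graph (v n) - H1_graph w)"
    using tr_bound[OF H1_diff(1)[OF assms(1,2)]] assms(1,2) by (simp add: tr_diff H1_diff(4))
qed

lemma tr_L2_on: "v \<in> sobolev_H1 \<Longrightarrow> tr v \<in> L2_on I"
proof -
  assume v: "v \<in> sobolev_H1"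
  then obtain F where F: "\<And>n::nat. smooth (F n)" "(\<lambda>n. to_L2 I (\<lambda>s. F n (\<gamma> s))) \<longlonglongrightarrow> tr v" 
    using has_trace_tr[OF v] by (auto simp: has_trace_def)
  show ?thesis
    by (rule closed_sequentially[OF closed_L2_on[OF borel_compact[OF I]] _ F(2)]) (intro to_L2_in_L2_on side_sqint F(1))
qed

end

interpretation top: trace_side "\<lambda>x. (x, 0)" "{0..pi}"
  rewrites "trace_side.tr (\<lambda>x. (x, 0)) {0..pi} = trace_top"
proof -
  show t: "trace_side (\<lambda>x. (x, 0)) {0..pi}"
  proof
    fix F assume F: "smooth F"
    obtain z where z: "cmod z \<le> 2 * norm (to_L2 Omega F) * norm (to_L2 Omega (pdy F))"
      "complex_of_real ((norm (to_L2 {0..pi} (\<lambda>x. F (x, 0))))\<^sup>2) = of_real ((norm (to_L2 Omega F))\<^sup>2) + z"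
      using smooth_top_identity[OF F] by blast
    let ?n = "norm (H1_graph (to_L2 Omega F))"
    have n: "norm (to_L2 Omega F) \<le> ?n" "norm (to_L2 Omega (pdy F)) \<le> ?n"
      using H1_graph_norms[of "to_L2 Omega F"] smooth_H1[OF F] by auto
    have "(norm (to_L2 {0..pi} (\<lambda>x. F (x, 0))))\<^sup>2 = cmod (complex_of_real ((norm (to_L2 {0..pi} (\<lambda>x. F (x, 0))))\<^sup>2))"
      by (simp only: norm_of_real abs_power2)
    also have "\<dots> \<le> (norm (to_L2 Omega F))\<^sup>2 + cmod z" 
      unfolding z(2) by (rule order_trans[OF norm_triangle_ineq]) (simp only: norm_of_real abs_power2)
    also have "\<dots> \<le> ?n\<^sup>2 + 2 * ?n * ?n"
      by (intro add_mono power_mono order_trans[OF z(1)] mult_mono n) auto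
    also have "\<dots> \<le> (2 * ?n)\<^sup>2" by (simp add: power2_eq_square)
    finally show "norm (to_L2 {0..pi} (\<lambda>s. F (s, 0))) \<le> 2 * ?n" by (rule power2_le_imp_le) simp
  qed (auto intro!: continuous_intros)
  show "trace_side.tr (\<lambda>x. (x, 0)) {0..pi} = trace_top"
    by (auto simp: trace_side.tr_def[OF t] trace_top_def fun_eq_iff)
qed

interpretation left: trace_side "\<lambda>y. (0, y)" "{-1..0}"
  rewrites "trace_side.tr (\<lambda>y. (0, y)) {-1..0} = trace_left"
proof -
  show t: "trace_side (\<lambda>y. (0, y)) {-1..0}"
  proof
    fix F assume F: "smooth F"
    let ?n = "norm (H1_graph (to_L2 Omega F))"
    have n: "norm (to_L2 Omega F) \<le> ?n" "norm (to_L2 Omega (pdx F)) \<le> ?n"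
      using H1_graph_norms[of "to_L2 Omega F"] smooth_H1[OF F] by auto
    have "(norm (to_L2 {-1..0} (\<lambda>y. F (0, y))))\<^sup>2 \<le> ?n\<^sup>2 + 2 * ?n * ?n"
      by (rule order_trans[OF smooth_left_bound[OF F]]) (intro add_mono power_mono mult_mono n; simp)
    also have "\<dots> \<le> (2 * ?n)\<^sup>2" by (simp add: power2_eq_square)
    finally show "norm (to_L2 {-1..0} (\<lambda>s. F (0, s))) \<le> 2 * ?n" by (rule power2_le_imp_le) simp
  qed (auto intro!: continuous_intros)
  show "trace_side.tr (\<lambda>y. (0, y)) {-1..0} = trace_left"
    by (auto simp: trace_side.tr_def[OF t] trace_left_def fun_eq_iff)
qed

text \<open>The lower bound contained in \<open>smooth_top_identity\<close>, carried over to the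
  Sobolev space along an approximating sequence. Vanishing surface trace thus makes the gradient
  norm equivalent to the Sobolev norm, which settles the Neumann problem and the uniqueness of the
  potential.\<close>

lemma Poincare:
  assumes v: "v \<in> sobolev_H1"
  shows "(norm v)\<^sup>2 \<le> 2 * (norm (trace_top v))\<^sup>2 + 4 * (norm (weak_dy v))\<^sup>2"
proof -
  obtain F where F: "\<And>n::nat. smooth (F n)" "(\<lambda>n. H1_graph (to_L2 Omega (F n))) \<longlonglongrightarrow> H1_graph v"
     "(\<lambda>n. to_L2 {0..pi} (\<lambda>x. F n (x, 0))) \<longlonglongrightarrow> trace_top v" using top.has_trace_tr[OF v] by (auto simp: has_trace_def)
  have lim: "(\<lambda>n. to_L2 Omega (F n)) \<longlonglongrightarrow> v" "(\<lambda>n. to_L2 Omega (pdy (F n))) \<longlonglongrightarrow> weak_dy v"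
    using tendsto_fst[OF F(2)] tendsto_snd[OF tendsto_snd[OF F(2)]] by (simp_all add: smooth_H1(4) F(1)) (simp_all add: H1_graph_def)
  have "(norm v)\<^sup>2 \<le> (norm (trace_top v))\<^sup>2 + 2 * norm v * norm (weak_dy v)"
  proof (rule LIMSEQ_le)
    show "(\<lambda>n. (norm (to_L2 Omega (F n)))\<^sup>2) \<longlonglongrightarrow> (norm v)\<^sup>2" by (intro tendsto_intros lim)
    show "(\<lambda>n. (norm (to_L2 {0..pi} (\<lambda>x. F n (x, 0))))\<^sup>2 + 2 * norm (to_L2 Omega (F n)) * norm (to_L2 Omega (pdy (F n)))) 
      \<longlonglongrightarrow> (norm (trace_top v))\<^sup>2 + 2 * norm v * norm (weak_dy v)" by (intro tendsto_intros lim F(3))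
    have "(norm (to_L2 Omega (F n)))\<^sup>2 \<le> (norm (to_L2 {0..pi} (\<lambda>x. F n (x, 0))))\<^sup>2 + 2 * norm (to_L2 Omega (F n)) * norm (to_L2 Omega (pdy (F n)))" for n
    proof -
      obtain z where z: "cmod z \<le> 2 * norm (to_L2 Omega (F n)) * norm (to_L2 Omega (pdy (F n)))"
        "complex_of_real ((norm (to_L2 {0..pi} (\<lambda>x. F n (x, 0))))\<^sup>2) = of_real ((norm (to_L2 Omega (F n)))\<^sup>2) + z"
        using smooth_top_identity[OF F(1)] by blast
      have "(norm (to_L2 {0..pi} (\<lambda>x. F n (x, 0))))\<^sup>2 = (norm (to_L2 Omega (F n)))\<^sup>2 + Re z"
        using arg_cong[OF z(2), of Re] by (simp del: of_real_power)
      then show ?thesis using z(1) abs_Re_le_cmod[of z] by linarith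
    qed
    then show "\<exists>N. \<forall>n\<ge>N. (norm (to_L2 Omega (F n)))\<^sup>2 \<le> (norm (to_L2 {0..pi} (\<lambda>x. F n (x, 0))))\<^sup>2 + 2 * norm (to_L2 Omega (F n)) * norm (to_L2 Omega (pdy (F n)))"
      by blast
  qed
  \<comment> \<open>Young's inequality with the weight chosen so that half of
    \<open>(norm v)^2\<close> can be absorbed on the left.\<close>
  moreover have "2 * norm v * norm (weak_dy v) \<le> (norm v)\<^sup>2 / 2 + 2 * (norm (weak_dy v))\<^sup>2"
    using zero_le_power2[of "norm v - 2 * norm (weak_dy v)"] by (simp add: power2_eq_square algebra_simps)
  ultimately show ?thesis by simp
qed

lemma Poincare_graph:
  assumes "v \<in> sobolev_H1"
  shows "(norm (H1_graph v))\<^sup>2 \<le> 2 * (norm (trace_top v))\<^sup>2 + 5 * ((norm (weak_dx v))\<^sup>2 + (norm (weak_dy v))\<^sup>2)"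
  using Poincare[OF assms] zero_le_power2[of "norm (weak_dx v)"] unfolding H1_graph_norms(4) by argo

section \<open>The Dirichlet extension\<close>

definition DE :: "nat \<Rightarrow> real \<times> real \<Rightarrow> complex" where
  "DE k p = complex_of_real (sqrt (2 / pi) / cosh (real (Suc k))) * 
     (complex_of_real (cos (real (Suc k) * fst p)) * complex_of_real (cosh (real (Suc k) * (snd p + 1))))"

lemma smooth_DE: "smooth (DE k)"
proof -
  have "DE k = (\<lambda>p. complex_of_real (sqrt (2 / pi) / cosh (real (Suc k))) * 
     (complex_of_real (cos (real (Suc k) * fst p + 0)) * complex_of_real (cosh (real (Suc k) * snd p + real (Suc k)))))"
    by (auto simp: DE_def algebra_simps)
  then show ?thesis by (simp only:) (intro smooth_mult smooth_const smooth_cos_fst smooth_cosh_snd)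
qed

lemma pd_DE:
  "pdx (DE k) = (\<lambda>p. complex_of_real (sqrt (2 / pi) / cosh (real (Suc k)) * 
      (- real (Suc k) * sin (real (Suc k) * fst p) * cosh (real (Suc k) * (snd p + 1)))))"
  "pdx (pdx (DE k)) = (\<lambda>p. - complex_of_real ((real (Suc k))\<^sup>2) * DE k p)"
  "pdy (DE k) = (\<lambda>p. complex_of_real (sqrt (2 / pi) / cosh (real (Suc k)) * 
      (real (Suc k) * cos (real (Suc k) * fst p) * sinh (real (Suc k) * (snd p + 1)))))"
  "pdy (pdy (DE k)) = (\<lambda>p. complex_of_real ((real (Suc k))\<^sup>2) * DE k p)"
proof -
  define m where "m = real (Suc k)"
  show x: "pdx (DE k) = (\<lambda>p. complex_of_real (sqrt (2 / pi) / cosh (real (Suc k)) * 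
      (- real (Suc k) * sin (real (Suc k) * fst p) * cosh (real (Suc k) * (snd p + 1)))))"
    unfolding DE_def of_real_mult[symmetric] m_def[symmetric]
    by (rule pdx_eqI, rule has_vector_derivative_of_real)
      (auto simp: has_real_derivative_iff_has_vector_derivative[symmetric] intro!: derivative_eq_intros)
  show "pdx (pdx (DE k)) = (\<lambda>p. - complex_of_real ((real (Suc k))\<^sup>2) * DE k p)"
    unfolding x DE_def of_real_mult[symmetric] of_real_minus[symmetric] m_def[symmetric]
    by (rule pdx_eqI, rule has_vector_derivative_of_real)
      (auto simp: has_real_derivative_iff_has_vector_derivative[symmetric] power2_eq_square intro!: derivative_eq_intros)
  show y: "pdy (DE k) = (\<lambda>p. complex_of_real (sqrt (2 / pi) / cosh (real (Suc k)) * 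
      (real (Suc k) * cos (real (Suc k) * fst p) * sinh (real (Suc k) * (snd p + 1)))))"
    unfolding DE_def of_real_mult[symmetric] m_def[symmetric]
    by (rule pdy_eqI, rule has_vector_derivative_of_real)
      (auto simp: has_real_derivative_iff_has_vector_derivative[symmetric] intro!: derivative_eq_intros)
  show "pdy (pdy (DE k)) = (\<lambda>p. complex_of_real ((real (Suc k))\<^sup>2) * DE k p)"
    unfolding y DE_def of_real_mult[symmetric] m_def[symmetric]
    by (rule pdy_eqI, rule has_vector_derivative_of_real)
      (auto simp: has_real_derivative_iff_has_vector_derivative[symmetric] power2_eq_square intro!: derivative_eq_intros)
qed

definition grad :: "(real \<times> real) L2 \<Rightarrow> (real \<times> real) L2 \<times> (real \<times> real) L2" where
  "grad v = (weak_dx v, weak_dy v)"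

lemma cinner_grad: "cinner (grad v) (grad w) = cinner (weak_dx v) (weak_dx w) + cinner (weak_dy v) (weak_dy w)"
  by (simp add: grad_def cinner_prod_def)

lemma grad_graph: "grad v = snd (H1_graph v)"
  by (simp add: grad_def H1_graph_def)

lemma norm_grad: "(norm (grad v))\<^sup>2 = (norm (weak_dx v))\<^sup>2 + (norm (weak_dy v))\<^sup>2"
  by (simp add: grad_def norm_Pair)

lemma grad_linear:
  assumes "v \<in> sobolev_H1" 
  shows "w \<in> sobolev_H1 \<Longrightarrow> grad (v + w) = grad v + grad w" "w \<in> sobolev_H1 \<Longrightarrow> grad (v - w) = grad v - grad w" 
    "grad (c *\<^sub>C v) = c *\<^sub>C grad v"
  using H1_add[OF assms] H1_diff[OF assms] H1_scaleC[OF assms] by (auto simp: grad_def scaleC_prod_def)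

text \<open>Cutting off the test function would lose the boundary term on the top, so here v is
  approximated by smooth functions instead; Green's formula then passes to the limit together with
  the traces.\<close>

lemma trace_by_parts:
  assumes v: "v \<in> sobolev_H1" and G: "smooth G" "\<And>x. G (x, -1) = 0"
  shows "cinner (weak_dy v) (to_L2 Omega G) + cinner v (to_L2 Omega (pdy G)) = 
    cinner (trace_top v) (to_L2 {0..pi} (\<lambda>x. G (x, 0)))"
proof -
  obtain F where F: "\<And>n::nat. smooth (F n)" "(\<lambda>n. H1_graph (to_L2 Omega (F n))) \<longlonglongrightarrow> H1_graph v"
     "(\<lambda>n. to_L2 {0..pi} (\<lambda>x. F n (x, 0))) \<longlonglongrightarrow> trace_top v" using top.has_trace_tr[OF v] by (auto simp: has_trace_def)
  have lim: "(\<lambda>n. to_L2 Omega (F n)) \<longlonglongrightarrow> v" "(\<lambda>n. to_L2 Omega (pdy (F n))) \<longlonglongrightarrow> weak_dy v"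
    using tendsto_fst[OF F(2)] tendsto_snd[OF tendsto_snd[OF F(2)]] by (simp_all add: smooth_H1(4) F(1)) (simp_all add: H1_graph_def)
  have z: "to_L2 {0..pi} (\<lambda>x. 0) = 0" by (simp add: to_L2_def zero_L2_def)
  have "(\<lambda>n. cinner (to_L2 Omega (pdy (F n))) (to_L2 Omega G) + cinner (to_L2 Omega (F n)) (to_L2 Omega (pdy G)))
     \<longlonglongrightarrow> cinner (weak_dy v) (to_L2 Omega G) + cinner v (to_L2 Omega (pdy G))"
    by (intro tendsto_add cinner.tendsto tendsto_const lim)
  moreover have "cinner (to_L2 Omega (pdy (F n))) (to_L2 Omega G) + cinner (to_L2 Omega (F n)) (to_L2 Omega (pdy G))
     = cinner (to_L2 {0..pi} (\<lambda>x. F n (x, 0))) (to_L2 {0..pi} (\<lambda>x. G (x, 0)))" for n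
    using green_cinner_y[OF F(1) G(1)] by (simp add: G(2) z cinner.zero_right)
  moreover have "(\<lambda>n. cinner (to_L2 {0..pi} (\<lambda>x. F n (x, 0))) (to_L2 {0..pi} (\<lambda>x. G (x, 0)))) 
    \<longlonglongrightarrow> cinner (trace_top v) (to_L2 {0..pi} (\<lambda>x. G (x, 0)))"
    by (intro cinner.tendsto tendsto_const F(3))
  ultimately show ?thesis using LIMSEQ_unique by simp
qed

definition dirichlet :: "nat \<Rightarrow> (real \<times> real) L2" where "dirichlet k = to_L2 Omega (DE k)"

lemma dirichlet_H1: "dirichlet k \<in> sobolev_H1" 
  unfolding dirichlet_def by (rule smooth_H1(1)[OF smooth_DE])

text \<open>\<open>DE k\<close> is harmonic, so the two volume terms \<open>m^2 <v, DE k>\<close>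
  from the x- and y-integrations cancel. The Neumann conditions remove the sides and, since sinh
  vanishes at 0, the bottom. What remains is the top, where the normal derivative is
  \<open>w_half k\<close> times the boundary value: this number is the symbol of the
  Dirichlet-to-Neumann map.\<close>

lemma grad_dirichlet:
  assumes v: "v \<in> sobolev_H1"
  shows "cinner (grad v) (grad (dirichlet k)) = of_real (w_half k) * cinner (trace_top v) (cos_basis (Suc k))"
proof -
  define m where "m = real (Suc k)"
  have m: "m \<ge> 0" by (simp add: m_def)
  have x: "cinner (weak_dx v) (to_L2 Omega (pdx (DE k))) = of_real (m\<^sup>2) * cinner v (to_L2 Omega (DE k))"
  proof (rule pdx_neumann[OF v smooth_DE])
    show "pdx (pdx (DE k)) = (\<lambda>p. - complex_of_real (m\<^sup>2) * DE k p)" unfolding pd_DE(2) m_def ..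
    have b: "cmod (pdx (DE k) p) \<le> sqrt (2 / pi) * m * \<bar>sin (m * fst p)\<bar>" if "p \<in> Omega" for p
    proof -
      have y: "0 \<le> snd p + 1" "snd p + 1 \<le> 1" using that by (auto simp: Omega_def)
      have "m * (snd p + 1) \<le> m" using mult_left_mono[OF y(2) m] by simp
      then have "cosh (m * (snd p + 1)) \<le> cosh m"
        using y m by (subst cosh_real_nonneg_le_iff) auto
      then have "sqrt (2 / pi) * m * \<bar>sin (m * fst p)\<bar> * (cosh (m * (snd p + 1)) / cosh m) \<le> sqrt (2 / pi) * m * \<bar>sin (m * fst p)\<bar> * 1"
        using m by (intro mult_left_mono) auto
      moreover have "cmod (pdx (DE k) p) = sqrt (2 / pi) * m * \<bar>sin (m * fst p)\<bar> * (cosh (m * (snd p + 1)) / cosh m)"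
        unfolding pd_DE norm_of_real m_def[symmetric] using m by (simp add: abs_mult)
      ultimately show ?thesis by simp
    qed
    fix p assume p: "p \<in> Omega"
    then have xx: "0 \<le> fst p" "fst p \<le> pi" by (auto simp: Omega_def)
    have "cmod (pdx (DE k) p) \<le> sqrt (2 / pi) * m * (m * fst p)" 
      by (rule order_trans[OF b[OF p]]) (unfold m_def, intro mult_left_mono sin_nat_bounds xx, simp)
    then show "cmod (pdx (DE k) p) \<le> (sqrt (2 / pi) * m * m) * fst p" by (simp add: mult_ac)
    have "cmod (pdx (DE k) p) \<le> sqrt (2 / pi) * m * (m * (pi - fst p))" 
      by (rule order_trans[OF b[OF p]]) (unfold m_def, intro mult_left_mono sin_nat_bounds xx, simp)
    then show "cmod (pdx (DE k) p) \<le> (sqrt (2 / pi) * m * m) * (pi - fst p)" by (simp add: mult_ac)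
  qed simp
  have "(\<lambda>x. pdy (DE k) (x, 0)) = (\<lambda>x. of_real (w_half k) * complex_of_real (sqrt (2 / pi) * cos (real (Suc k) * x)))"
    unfolding pd_DE by (rule ext) (simp only: of_real_mult[symmetric] of_real_eq_iff w_half_def tanh_def, simp add: mult_ac)
  then have t: "to_L2 {0..pi} (\<lambda>x. pdy (DE k) (x, 0)) = of_real (w_half k) *\<^sub>C cos_basis (Suc k)"
    unfolding cos_basis_def to_L2_scale[OF cos_sqint, symmetric] by simp
  have "cinner (weak_dy v) (to_L2 Omega (pdy (DE k))) + cinner v (to_L2 Omega (pdy (pdy (DE k)))) =
      of_real (w_half k) * cinner (trace_top v) (cos_basis (Suc k))"
    using trace_by_parts[OF v smooth_pd(2)[OF smooth_DE], of k] unfolding t by (simp add: pd_DE(3) cinner_scaleC_right)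
  moreover have "to_L2 Omega (pdy (pdy (DE k))) = of_real (m\<^sup>2) *\<^sub>C to_L2 Omega (DE k)"
    unfolding pd_DE(4) m_def by (rule to_L2_scale[OF sqint_smooth[OF smooth_DE]])
  ultimately show ?thesis using x
    by (simp add: cinner_grad dirichlet_def smooth_H1(2,3) smooth_DE cinner_scaleC_right) (simp add: add.commute)
qed

lemma trace_dirichlet: "trace_top (dirichlet k) = cos_basis (Suc k)"
  unfolding dirichlet_def top.tr_smooth[OF smooth_DE] cos_basis_def by (simp add: DE_def del: of_nat_Suc)

definition grad_basis :: "nat \<Rightarrow> (real \<times> real) L2 \<times> (real \<times> real) L2" where
  "grad_basis k = of_real (1 / sqrt (w_half k)) *\<^sub>C grad (dirichlet k)"

lemma sqrt_w_half: "sqrt (w_half k) * sqrt (w_half k) = w_half k" "sqrt (w_half k) > 0" "sqrt (w_half k) \<noteq> 0"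
  using w_half_bounds(1)[of k] by auto

lemma cinner_grad_basis:
  "v \<in> sobolev_H1 \<Longrightarrow> cinner (grad v) (grad_basis k) = of_real (sqrt (w_half k)) * cinner (trace_top v) (cos_basis (Suc k))"
proof -
  assume v: "v \<in> sobolev_H1"
  have "1 / sqrt (w_half k) * w_half k = sqrt (w_half k)"
    using sqrt_w_half[of k] by (simp add: divide_eq_eq)
  then have "complex_of_real (1 / sqrt (w_half k)) * of_real (w_half k) = of_real (sqrt (w_half k))"
    by (metis of_real_mult)
  then show ?thesis
    unfolding grad_basis_def cinner_scaleC_right grad_dirichlet[OF v] by (simp only: complex_cnj_complex_of_real mult.assoc[symmetric])
qed

lemma grad_basis_on: "cinner (grad_basis j) (grad_basis k) = (if j = k then 1 else 0)"
proof -
  have "cinner (grad (dirichlet j)) (grad_basis k) = (if j = k then of_real (sqrt (w_half k)) else 0)"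
    by (simp add: cinner_grad_basis dirichlet_H1 trace_dirichlet cos_basis_cinner)
  then show ?thesis unfolding grad_basis_def[of j] cinner_scaleC_left using sqrt_w_half(3)[of k] by auto
qed

lemma w_half_ge: "tanh 1 \<le> w_half k"
proof -
  have "tanh (1::real) > 0" by simp
  then have "tanh 1 * 1 \<le> tanh 1 * real (Suc k)" by (intro mult_left_mono) auto
  with w_half_bounds(3)[of k] show ?thesis by linarith
qed

section \<open>Coefficients in H_1/2 and the trace theorem\<close>

definition hcoef :: "Hhalf \<Rightarrow> nat \<Rightarrow> complex" where "hcoef \<zeta> k = cinner (H0_of_Hhalf \<zeta>) (e_H0 k)"

lemma hcoef_linear: "hcoef (x + y) k = hcoef x k + hcoef y k" "hcoef (x - y) k = hcoef x k - hcoef y k"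
   "hcoef (c *\<^sub>C x) k = c * hcoef x k" "hcoef (r *\<^sub>R x) k = of_real r * hcoef x k" "hcoef 0 k = 0" "hcoef (- x) k = - hcoef x k"
  by (simp_all add: hcoef_def H0_of_Hhalf_simps H0_of_Hhalf_scaleC cinner.add_left cinner.diff_left 
      cinner.scaleR_left cinner_scaleC_left cinner.zero_left cinner.minus_left scaleR_conv_of_real)

lemma hcoef_ext: "(\<And>k. hcoef x k = hcoef y k) \<Longrightarrow> x = y"
  by (rule iffD1[OF H0_of_Hhalf_inject], rule e_H0_ext) (simp add: hcoef_def)

lemma hcoef_J: "cinner (J_Hhalf x) (e_H0 k) = of_real (sqrt (w_half k)) * hcoef x k"
  by (simp add: coef_J_Hhalf hcoef_def)

lemma H0_exists:
  assumes "summable (\<lambda>k. (cmod (c k))\<^sup>2)" shows "\<exists>x. \<forall>k. cinner x (e_H0 k) = c k"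
  using orthonormal_coefficient[OF e_H0_on summable_sums[OF orthonormal_summable[OF e_H0_on assms]]] by blast

lemma Hhalf_exists:
  assumes "summable (\<lambda>k. w_half k * (cmod (c k))\<^sup>2)" shows "\<exists>x. \<forall>k. hcoef x k = c k"
proof -
  have "(cmod (of_real (sqrt (w_half k)) * c k))\<^sup>2 = w_half k * (cmod (c k))\<^sup>2" for k
    using w_half_bounds(1)[of k] by (simp add: norm_mult power_mult_distrib)
  with assms obtain y where y: "\<And>k. cinner y (e_H0 k) = of_real (sqrt (w_half k)) * c k"
    using H0_exists[of "\<lambda>k. of_real (sqrt (w_half k)) * c k"] by auto
  obtain x where "J_Hhalf x = y" using J_Hhalf_surj by blast
  then have e: "of_real (sqrt (w_half k)) * hcoef x k = of_real (sqrt (w_half k)) * c k" for k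
    using y hcoef_J by metis
  have "hcoef x k = c k" for k using e[of k] sqrt_w_half(3)[of k] by simp
  then show ?thesis by blast
qed

lemma H0_sums: "(\<lambda>k. cinner x (e_H0 k) * cnj (cinner y (e_H0 k))) sums cinner x y"
  by (rule orthonormal_Parseval[OF e_H0_on e_H0_total])

lemma Hhalf_sums: "(\<lambda>k. of_real (w_half k) * hcoef x k * cnj (hcoef y k)) sums cinner x y"
proof -
  have "cinner (J_Hhalf x) (e_H0 k) * cnj (cinner (J_Hhalf y) (e_H0 k)) = of_real (w_half k) * hcoef x k * cnj (hcoef y k)" for k
  proof -
    have w: "complex_of_real (w_half k) = of_real (sqrt (w_half k)) * of_real (sqrt (w_half k))"
      by (metis of_real_mult sqrt_w_half(1))
    show ?thesis unfolding hcoef_J w complex_cnj_mult complex_cnj_complex_of_real by (simp only: mult_ac)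
  qed
  then show ?thesis using H0_sums[of "J_Hhalf x" "J_Hhalf y"] by (simp add: cinner_Hhalf_J)
qed

lemma Hhalf_norm_sums: "(\<lambda>k. w_half k * (cmod (hcoef x k))\<^sup>2) sums (norm x)\<^sup>2"
proof -
  have "complex_of_real (w_half k * (cmod (hcoef x k))\<^sup>2) = of_real (w_half k) * hcoef x k * cnj (hcoef x k)" for k
    by (simp only: of_real_mult complex_norm_square mult.assoc)
  then have "(\<lambda>k. complex_of_real (w_half k * (cmod (hcoef x k))\<^sup>2)) sums complex_of_real ((norm x)\<^sup>2)"
    using Hhalf_sums[of x x] by (simp only: cinner_self)
  then show ?thesis by (simp only: sums_of_real_iff)
qed

text \<open>By \<open>cinner_grad_basis\<close> the weighted trace coefficients are the coefficients
  of the gradient of v with respect to the orthonormal system \<open>grad_basis\<close>, so Bessel's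
  inequality in the space of gradients gives the half derivative of the trace.\<close>

lemma trace_half_exists:
  assumes v: "v \<in> sobolev_H1" shows "\<exists>t. \<forall>k. hcoef t k = cinner (trace_top v) (cos_basis (Suc k))"
proof (rule Hhalf_exists)
  have "(cmod (cinner (grad v) (grad_basis k)))\<^sup>2 = w_half k * (cmod (cinner (trace_top v) (cos_basis (Suc k))))\<^sup>2" for k
    unfolding cinner_grad_basis[OF v] using w_half_bounds(1)[of k] by (simp add: norm_mult power_mult_distrib)
  then show "summable (\<lambda>k. w_half k * (cmod (cinner (trace_top v) (cos_basis (Suc k))))\<^sup>2)"
    using orthonormal_Bessel[OF grad_basis_on, of "grad v"] by simp
qed

text \<open>The \<open>H\<^sub>1\<^sub>/\<^sub>2\<close>-part of the trace on the top, i.e. the trace up to an additive constant.\<close>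

definition trace_half :: "(real \<times> real) L2 \<Rightarrow> Hhalf" where
  "trace_half v = (SOME t. \<forall>k. hcoef t k = cinner (trace_top v) (cos_basis (Suc k)))"

lemma trace_half: "v \<in> sobolev_H1 \<Longrightarrow> hcoef (trace_half v) k = cinner (trace_top v) (cos_basis (Suc k))"
  unfolding trace_half_def using someI_ex[OF trace_half_exists] by blast

section \<open>The harmonic extension as a convergent series\<close>

lemma extension_finite:
  assumes "finite J"
  shows "(\<Sum>k\<in>J. c k *\<^sub>C dirichlet k) \<in> sobolev_H1 \<and> 
    H1_graph (\<Sum>k\<in>J. c k *\<^sub>C dirichlet k) = (\<Sum>k\<in>J. c k *\<^sub>C H1_graph (dirichlet k)) \<and>
    trace_top (\<Sum>k\<in>J. c k *\<^sub>C dirichlet k) = (\<Sum>k\<in>J. c k *\<^sub>C cos_basis (Suc k)) \<and>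
    grad (\<Sum>k\<in>J. c k *\<^sub>C dirichlet k) = (\<Sum>k\<in>J. c k *\<^sub>C grad (dirichlet k))"
  using assms
proof (induction J)
  case empty
  show ?case using H1_0 top.tr_scaleC[OF H1_0(1), of 0] by (simp add: scaleC.zero_left grad_graph)
next
  case (insert j J)
  have d: "c j *\<^sub>C dirichlet j \<in> sobolev_H1" by (rule H1_scaleC(1)[OF dirichlet_H1])
  show ?case using insert d
    by (simp add: H1_add top.tr_add grad_linear H1_scaleC(4) dirichlet_H1 top.tr_scaleC trace_dirichlet)
qed

text \<open>Both parts of \<open>Poincare_graph\<close> are orthogonal sums: the surface trace has
  squared norm \<open>\<Sum> |c k|^2\<close>, at most \<open>1 / tanh 1\<close> times the weighted
  sum because \<open>tanh 1\<close> is a lower bound of the weights, and the gradient contributes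
  the weighted sum itself. This explains \<open>2 / tanh 1 + 5\<close>.\<close>

lemma extension_bound:
  assumes "finite J"
  shows "(norm (\<Sum>k\<in>J. c k *\<^sub>C H1_graph (dirichlet k)))\<^sup>2 \<le> (2 / tanh 1 + 5) * (\<Sum>k\<in>J. w_half k * (cmod (c k))\<^sup>2)"
proof -
  let ?v = "\<Sum>k\<in>J. c k *\<^sub>C dirichlet k"
  note E = extension_finite[OF assms, of c]
  have on: "cinner (cos_basis (Suc i)) (cos_basis (Suc j)) = (if i = j then 1 else 0)" for i j
    by (simp add: cos_basis_cinner)
  have "(norm (trace_top ?v))\<^sup>2 = (\<Sum>k\<in>J. (cmod (c k))\<^sup>2)"
    using E orthonormal_norm_sum[OF on assms, of c] by simp
  also have "\<dots> \<le> (\<Sum>k\<in>J. (w_half k * (cmod (c k))\<^sup>2) / tanh 1)"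
  proof (rule sum_mono)
    fix k
    have t: "tanh (1::real) > 0" by simp
    have "tanh 1 * (cmod (c k))\<^sup>2 \<le> w_half k * (cmod (c k))\<^sup>2" by (intro mult_right_mono w_half_ge) simp
    then show "(cmod (c k))\<^sup>2 \<le> (w_half k * (cmod (c k))\<^sup>2) / tanh 1" using t by (simp add: field_simps)
  qed
  finally have 1: "(norm (trace_top ?v))\<^sup>2 \<le> (\<Sum>k\<in>J. w_half k * (cmod (c k))\<^sup>2) / tanh 1"
    by (simp add: sum_divide_distrib)
  have "c k *\<^sub>C grad (dirichlet k) = (c k * of_real (sqrt (w_half k))) *\<^sub>C grad_basis k" for k
    unfolding grad_basis_def scaleC_scaleC using sqrt_w_half(3)[of k] by (simp flip: of_real_mult)
  then have "(norm (grad ?v))\<^sup>2 = (\<Sum>k\<in>J. (cmod (c k * of_real (sqrt (w_half k))))\<^sup>2)"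
    using E orthonormal_norm_sum[OF grad_basis_on assms, of "\<lambda>k. c k * of_real (sqrt (w_half k))"] by simp
  also have "\<dots> = (\<Sum>k\<in>J. w_half k * (cmod (c k))\<^sup>2)"
    using w_half_bounds(1) by (intro sum.cong) (auto simp: norm_mult power_mult_distrib less_imp_le)
  finally have 2: "(norm (grad ?v))\<^sup>2 = (\<Sum>k\<in>J. w_half k * (cmod (c k))\<^sup>2)" .
  have "(norm (H1_graph ?v))\<^sup>2 \<le> 2 * (norm (trace_top ?v))\<^sup>2 + 5 * (norm (grad ?v))\<^sup>2"
    unfolding norm_grad using Poincare_graph E by blast
  then show ?thesis using 1 2 E by (simp add: algebra_simps)
qed

lemma extension_summable: "summable (\<lambda>k. hcoef \<zeta> k *\<^sub>C H1_graph (dirichlet k))"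
  unfolding summable_Cauchy
proof (intro allI impI)
  fix e :: real assume "e > 0"
  define C where "C = 2 / tanh 1 + (5::real)"
  have C: "C > 0" unfolding C_def by (intro add_nonneg_pos) auto
  obtain N where N: "\<And>m n. m \<ge> N \<Longrightarrow> norm (\<Sum>k=m..<n. w_half k * (cmod (hcoef \<zeta> k))\<^sup>2) < e\<^sup>2 / C"
    using sums_summable[OF Hhalf_norm_sums[of \<zeta>], unfolded summable_Cauchy] \<open>e > 0\<close> C by (metis divide_pos_pos zero_less_power)
  have "norm (\<Sum>k=m..<n. hcoef \<zeta> k *\<^sub>C H1_graph (dirichlet k)) < e" if "m \<ge> N" for m n
  proof -
    have "(\<Sum>k=m..<n. w_half k * (cmod (hcoef \<zeta> k))\<^sup>2) < e\<^sup>2 / C" using N[OF that, of n] by simp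
    then have "C * (\<Sum>k=m..<n. w_half k * (cmod (hcoef \<zeta> k))\<^sup>2) < e\<^sup>2" using C by (simp add: field_simps)
    then have "(norm (\<Sum>k=m..<n. hcoef \<zeta> k *\<^sub>C H1_graph (dirichlet k)))\<^sup>2 < e\<^sup>2"
      using extension_bound[of "{m..<n}" "hcoef \<zeta>"] unfolding C_def by simp
    then show ?thesis using \<open>e > 0\<close> by (simp add: power_less_imp_less_base)
  qed
  then show "\<exists>N. \<forall>m\<ge>N. \<forall>n. norm (\<Sum>k=m..<n. hcoef \<zeta> k *\<^sub>C H1_graph (dirichlet k)) < e" by blast
qed

text \<open>The series is summed in the graph space, where it converges; as the graph is closed, its
  limit is the graph of the first component.\<close>

definition extension :: "Hhalf \<Rightarrow> (real \<times> real) L2" where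
  "extension \<zeta> = fst (\<Sum>k. hcoef \<zeta> k *\<^sub>C H1_graph (dirichlet k))"

lemma extension_H1: "extension \<zeta> \<in> sobolev_H1" 
  and extension_sums: "(\<lambda>k. hcoef \<zeta> k *\<^sub>C H1_graph (dirichlet k)) sums H1_graph (extension \<zeta>)"
proof -
  let ?v = "\<lambda>n. \<Sum>k<n. hcoef \<zeta> k *\<^sub>C dirichlet k"
  have "(\<lambda>n. \<Sum>k<n. hcoef \<zeta> k *\<^sub>C H1_graph (dirichlet k)) \<longlonglongrightarrow> (\<Sum>k. hcoef \<zeta> k *\<^sub>C H1_graph (dirichlet k))"
    using summable_LIMSEQ[OF extension_summable] .
  then have "(\<lambda>n. H1_graph (?v n)) \<longlonglongrightarrow> (\<Sum>k. hcoef \<zeta> k *\<^sub>C H1_graph (dirichlet k))"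
    using extension_finite by simp
  from H1_graph_limit[OF _ this] 
  show "extension \<zeta> \<in> sobolev_H1" "(\<lambda>k. hcoef \<zeta> k *\<^sub>C H1_graph (dirichlet k)) sums H1_graph (extension \<zeta>)"
    using extension_finite extension_summable[of \<zeta>] by (auto simp: extension_def summable_sums)
qed

lemma extension_tendsto: "(\<lambda>n. H1_graph (\<Sum>k<n. hcoef \<zeta> k *\<^sub>C dirichlet k)) \<longlonglongrightarrow> H1_graph (extension \<zeta>)"
  using extension_sums[of \<zeta>] extension_finite by (simp add: sums_def)

lemma trace_extension: "trace_top (extension \<zeta>) = L2_of_H0 (H0_of_Hhalf \<zeta>)"
proof -
  have "(\<lambda>n. trace_top (\<Sum>k<n. hcoef \<zeta> k *\<^sub>C dirichlet k)) \<longlonglongrightarrow> trace_top (extension \<zeta>)"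
    by (rule top.tr_tendsto[OF _ extension_H1 extension_tendsto]) (use extension_finite in auto)
  moreover have "trace_top (\<Sum>k<n. hcoef \<zeta> k *\<^sub>C dirichlet k) = L2_of_H0 (\<Sum>k<n. hcoef \<zeta> k *\<^sub>C e_H0 k)" for n
  proof -
    have "L2_of_H0 (\<Sum>k<n. hcoef \<zeta> k *\<^sub>C e_H0 k) = (\<Sum>k<n. hcoef \<zeta> k *\<^sub>C cos_basis (Suc k))"
      by (induction n) (auto simp: L2_of_H0_simps L2_of_H0_scaleC L2_of_e_H0)
    then show ?thesis using extension_finite by simp
  qed
  moreover have "(\<lambda>n. L2_of_H0 (\<Sum>k<n. hcoef \<zeta> k *\<^sub>C e_H0 k)) \<longlonglongrightarrow> L2_of_H0 (H0_of_Hhalf \<zeta>)"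
  proof -
    have "(\<lambda>n. \<Sum>k<n. hcoef \<zeta> k *\<^sub>C e_H0 k) \<longlonglongrightarrow> H0_of_Hhalf \<zeta>"
      using orthonormal_total_sums[OF e_H0_on e_H0_total, of "H0_of_Hhalf \<zeta>"] by (simp add: sums_def hcoef_def)
    then show ?thesis by (simp add: tendsto_iff dist_L2_of_H0)
  qed
  ultimately show ?thesis using LIMSEQ_unique by simp
qed

text \<open>The reason for the weight \<open>k tanh k\<close> in the inner product of
  \<open>Hhalf\<close>: the gradient of an extension, paired with any gradient, reproduces that
  inner product with the trace. In particular it is orthogonal to gradients of functions with
  vanishing surface trace.\<close>

lemma grad_extension:
  assumes "\<Psi> \<in> sobolev_H1"
  shows "cinner (grad (extension \<zeta>)) (grad \<Psi>) = cinner \<zeta> (trace_half \<Psi>)"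
proof -
  have "(\<lambda>k. hcoef \<zeta> k *\<^sub>C grad (dirichlet k)) sums grad (extension \<zeta>)"
    using bounded_linear.sums[OF bounded_linear_snd extension_sums[of \<zeta>]] by (simp add: grad_graph scaleC_prod_def)
  then have "(\<lambda>k. cinner (hcoef \<zeta> k *\<^sub>C grad (dirichlet k)) (grad \<Psi>)) sums cinner (grad (extension \<zeta>)) (grad \<Psi>)"
    by (rule cinner_suminf_left)
  moreover have "cinner (hcoef \<zeta> k *\<^sub>C grad (dirichlet k)) (grad \<Psi>) = of_real (w_half k) * hcoef \<zeta> k * cnj (hcoef (trace_half \<Psi>) k)" for k
    unfolding trace_half[OF assms] cinner_scaleC_left 
    by (subst cinner_commute) (simp add: grad_dirichlet[OF assms] mult_ac)
  ultimately have "(\<lambda>k. of_real (w_half k) * hcoef \<zeta> k * cnj (hcoef (trace_half \<Psi>) k)) sums cinner (grad (extension \<zeta>)) (grad \<Psi>)"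
    by simp
  from sums_unique2[OF this Hhalf_sums] show ?thesis .
qed

lemma norm_H0_of_Hhalf: "norm (H0_of_Hhalf \<zeta>) \<le> norm \<zeta> / sqrt (tanh 1)"
proof -
  have t: "tanh (1::real) > 0" by simp
  have "(\<lambda>k. cinner (H0_of_Hhalf \<zeta>) (e_H0 k) * cnj (cinner (H0_of_Hhalf \<zeta>) (e_H0 k))) sums complex_of_real ((norm (H0_of_Hhalf \<zeta>))\<^sup>2)"
    using H0_sums[of "H0_of_Hhalf \<zeta>" "H0_of_Hhalf \<zeta>"] unfolding cinner_self .
  then have "(\<lambda>k. (cmod (hcoef \<zeta> k))\<^sup>2) sums (norm (H0_of_Hhalf \<zeta>))\<^sup>2"
    unfolding hcoef_def complex_norm_square[symmetric] sums_of_real_iff .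
  moreover have "(\<lambda>k. w_half k * (cmod (hcoef \<zeta> k))\<^sup>2 / tanh 1) sums ((norm \<zeta>)\<^sup>2 / tanh 1)"
    by (intro sums_divide Hhalf_norm_sums)
  moreover have "(cmod (hcoef \<zeta> k))\<^sup>2 \<le> w_half k * (cmod (hcoef \<zeta> k))\<^sup>2 / tanh 1" for k
  proof -
    have "tanh 1 * (cmod (hcoef \<zeta> k))\<^sup>2 \<le> w_half k * (cmod (hcoef \<zeta> k))\<^sup>2" by (intro mult_right_mono w_half_ge) simp
    then show ?thesis using t by (simp add: field_simps)
  qed
  ultimately have "(norm (H0_of_Hhalf \<zeta>))\<^sup>2 \<le> (norm \<zeta>)\<^sup>2 / tanh 1" by (rule sums_le[rotated])
  also have "\<dots> = (norm \<zeta> / sqrt (tanh 1))\<^sup>2" using t by (simp add: power_divide)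
  finally show ?thesis by (rule power2_le_imp_le) (use t in simp)
qed

lemma bounded_linear_H0_of_Hhalf: "bounded_linear H0_of_Hhalf"
  by (rule bounded_linear_intro[where K = "1 / sqrt (tanh 1)"])
    (use norm_H0_of_Hhalf in \<open>auto simp: H0_of_Hhalf_simps\<close>)

text \<open>Boundedness in the graph norm turns a continuous surface elevation into a potential that
  depends continuously on time with values in the Sobolev space, which gives measurability and local
  square integrability.\<close>

lemma bounded_linear_extension: "bounded_linear (\<lambda>\<zeta>. H1_graph (extension \<zeta>))"
proof (rule bounded_linear_intro[where K = "sqrt (2 / tanh 1 + 5)"])
  fix x y and r :: real
  have "(\<lambda>k. hcoef (x + y) k *\<^sub>C H1_graph (dirichlet k)) sums (H1_graph (extension x) + H1_graph (extension y))"
    using sums_add[OF extension_sums[of x] extension_sums[of y]] by (simp add: hcoef_linear scaleC_add_left)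
  then show "H1_graph (extension (x + y)) = H1_graph (extension x) + H1_graph (extension y)"
    using extension_sums[of "x + y"] sums_unique2 by blast
  have "(\<lambda>k. hcoef (r *\<^sub>R x) k *\<^sub>C H1_graph (dirichlet k)) sums (r *\<^sub>R H1_graph (extension x))"
    using sums_scaleR_right[OF extension_sums[of x], of r] by (simp add: hcoef_linear scaleR_scaleC scaleC_scaleC)
  then show "H1_graph (extension (r *\<^sub>R x)) = r *\<^sub>R H1_graph (extension x)"
    using extension_sums[of "r *\<^sub>R x"] sums_unique2 by blast
  let ?C = "2 / tanh 1 + (5::real)"
  have C: "?C \<ge> 0" by (intro add_nonneg_nonneg) auto
  have "(norm (H1_graph (extension x)))\<^sup>2 \<le> ?C * (norm x)\<^sup>2"
  proof (rule LIMSEQ_le)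
    show "(\<lambda>n. (norm (\<Sum>k<n. hcoef x k *\<^sub>C H1_graph (dirichlet k)))\<^sup>2) \<longlonglongrightarrow> (norm (H1_graph (extension x)))\<^sup>2"
      by (intro tendsto_intros) (use extension_sums in \<open>simp add: sums_def\<close>)
    show "(\<lambda>n. ?C * (\<Sum>k<n. w_half k * (cmod (hcoef x k))\<^sup>2)) \<longlonglongrightarrow> ?C * (norm x)\<^sup>2"
      by (intro tendsto_mult tendsto_const) (use Hhalf_norm_sums in \<open>simp add: sums_def\<close>)
  qed (use extension_bound in blast)
  also have "\<dots> = (norm x * sqrt ?C)\<^sup>2" using C by (simp add: power_mult_distrib)
  finally show "norm (H1_graph (extension x)) \<le> norm x * sqrt ?C" by (rule power2_le_imp_le) (use C in simp)
qed

section \<open>The control vector and the Neumann map\<close>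

text \<open>Comparison with the integral of \<open>1 / (sqrt x * (m + x))\<close> over the
  half-line, whose value is \<open>pi / sqrt m\<close>.\<close>

lemma sum_inverse_sqrt_le:
  assumes m: "m > 0"
  shows "(\<Sum>k<N. 1 / (sqrt (real (Suc k)) * (m + real (Suc k)))) \<le> pi / sqrt m"
proof -
  define c where "c = 1 / sqrt m"
  have c: "c > 0" "c * c = 1 / m" using m by (auto simp: c_def)
  \<comment> \<open>An antiderivative of \<open>1 / (sqrt x * (m + x))\<close>; the factor
    \<open>pi / 2\<close> bounding arctan produces the final constant.\<close>
  define F where "F x = 2 * c * arctan (sqrt x * c)" for x
  have DF: "(F has_real_derivative (2 * c * (inverse (1 + (sqrt x * c)\<^sup>2) * (inverse (sqrt x) / 2 * c)))) (at x)" if "x > 0" for x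
    unfolding F_def using that by (auto intro!: derivative_eq_intros)
  have "1 / (sqrt (real (Suc k)) * (m + real (Suc k))) \<le> F (real (Suc k)) - F (real k)" for k
  proof -
    \<comment> \<open>The mean value theorem needs differentiability only in the open interval, so
      the singular endpoint 0 for \<open>k = 0\<close> does no harm. The integrand decreases, so its
      value at z dominates the one at \<open>k + 1\<close>.\<close>
    have "\<exists>l z. real k < z \<and> z < real (Suc k) \<and> (F has_real_derivative l) (at z) \<and> F (real (Suc k)) - F (real k) = (real (Suc k) - real k) * l"
    proof (rule MVT)
      show "continuous_on {real k..real (Suc k)} F" unfolding F_def by (intro continuous_intros)
      fix x assume "real k < x" "x < real (Suc k)"
      then have "x > 0" by linarith
      from DF[OF this] show "F differentiable (at x)" by (auto simp: real_differentiable_def)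
    qed simp
    then obtain l z where z: "real k < z" "z < real (Suc k)" "(F has_real_derivative l) (at z)" "F (real (Suc k)) - F (real k) = l"
      by auto
    then have z0: "z > 0" by linarith
    have "l = 2 * c * (inverse (1 + (sqrt z * c)\<^sup>2) * (inverse (sqrt z) / 2 * c))"
      using z(3) DF[OF z0] DERIV_unique by blast
    also have "\<dots> = (c * c) * inverse (1 + z * (c * c)) * inverse (sqrt z)"
      using z0 by (simp add: power2_eq_square mult_ac)
    also have "\<dots> = 1 / (sqrt z * (m * (1 + z / m)))"
      unfolding c(2) by (simp add: inverse_eq_divide mult_ac)
    also have "m * (1 + z / m) = m + z" using m by (simp add: distrib_left)
    finally have l: "l = 1 / (sqrt z * (m + z))" .
    have "sqrt z * (m + z) \<le> sqrt (real (Suc k)) * (m + real (Suc k))"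
      using m z z0 by (intro mult_mono) auto
    moreover have "sqrt z * (m + z) > 0" using m z0 by simp
    ultimately show ?thesis unfolding z(4) l by (intro divide_left_mono) (auto intro: mult_pos_pos)
  qed
  then have "(\<Sum>k<N. 1 / (sqrt (real (Suc k)) * (m + real (Suc k)))) \<le> (\<Sum>k<N. F (real (Suc k)) - F (real k))"
    by (intro sum_mono)
  also have "\<dots> = F (real N) - F 0" using sum_lessThan_telescope[of "\<lambda>k. F (real k)" N] by simp
  also have "\<dots> = 2 * c * arctan (sqrt (real N) * c)" by (simp add: F_def)
  also have "\<dots> \<le> 2 * c * (pi / 2)" using c(1) arctan_ubound[of "sqrt (real N) * c"] by (intro mult_left_mono) auto
  finally show ?thesis by (simp add: c_def)
qed

text \<open>Schur test with weights \<open>1 / sqrt k\<close>.\<close>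

lemma Hilbert_inequality:
  fixes a :: "nat \<Rightarrow> real"
  assumes a: "\<And>k. a k \<ge> 0"
  shows "(\<Sum>j<N. \<Sum>k<N. a j * a k / (real (Suc j) + real (Suc k))) \<le> pi * (\<Sum>k<N. (a k)\<^sup>2)"
proof -
  define s where "s k = sqrt (real (Suc k))" for k
  have s: "s k > 0" "s k * s k = real (Suc k)" for k by (auto simp: s_def)
  define g where "g j k = (a j)\<^sup>2 * s j * (1 / (s k * (real (Suc j) + real (Suc k))))" for j k
  \<comment> \<open>The inequality of means after splitting \<open>a j * a k\<close> with the ratio
    \<open>s j / s k\<close>. The two halves are transposes of each other, so after symmetrisation
    only the row sums of g remain, and \<open>sum_inverse_sqrt_le\<close> with
    \<open>m = j + 1\<close> controls these.\<close>
  have le: "a j * a k / (real (Suc j) + real (Suc k)) \<le> g j k / 2 + g k j / 2" for j k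
  proof -
    let ?d = "real (Suc j) + real (Suc k)"
    have "0 \<le> (a j * s j - a k * s k)\<^sup>2" by simp
    then have "2 * (a j * a k) * (s j * s k) \<le> (a j)\<^sup>2 * (s j * s j) + (a k)\<^sup>2 * (s k * s k)"
      by (simp add: power2_eq_square algebra_simps)
    then have "a j * a k \<le> ((a j)\<^sup>2 * (s j * s j) + (a k)\<^sup>2 * (s k * s k)) / (2 * (s j * s k))"
      using s[of j] s[of k] by (simp add: field_simps)
    also have "\<dots> = ((a j)\<^sup>2 * s j / s k + (a k)\<^sup>2 * s k / s j) / 2"
      using s(1)[of j] s(1)[of k] by (simp add: field_simps)
    finally have "a j * a k / ?d \<le> ((a j)\<^sup>2 * s j / s k + (a k)\<^sup>2 * s k / s j) / 2 / ?d"
      by (rule divide_right_mono) simp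
    also have "\<dots> = g j k / 2 + g k j / 2"
      by (simp add: g_def add_divide_distrib add.commute mult_ac)
    finally show ?thesis .
  qed
  have row: "(\<Sum>k<N. g j k) \<le> pi * (a j)\<^sup>2" for j
  proof -
    have "(\<Sum>k<N. g j k) = (a j)\<^sup>2 * s j * (\<Sum>k<N. 1 / (s k * (real (Suc j) + real (Suc k))))"
      by (simp add: g_def sum_distrib_left)
    also have "\<dots> \<le> (a j)\<^sup>2 * s j * (pi / s j)"
      using sum_inverse_sqrt_le[of "real (Suc j)" N] s(1)[of j] unfolding s_def by (intro mult_left_mono) auto
    also have "\<dots> = pi * (a j)\<^sup>2" using s(1)[of j] by simp
    finally show ?thesis .
  qed
  have "(\<Sum>j<N. \<Sum>k<N. a j * a k / (real (Suc j) + real (Suc k))) \<le> (\<Sum>j<N. \<Sum>k<N. g j k / 2 + g k j / 2)"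
    by (intro sum_mono le)
  also have "\<dots> = (\<Sum>j<N. \<Sum>k<N. g j k)"
    using sum.swap[of "\<lambda>j k. g k j" "{..<N}" "{..<N}"] by (simp add: sum.distrib flip: sum_divide_distrib)
  also have "\<dots> \<le> (\<Sum>j<N. pi * (a j)\<^sup>2)" by (intro sum_mono row)
  finally show ?thesis by (simp add: sum_distrib_left)
qed

section \<open>Left traces of the harmonic modes and the control vector\<close>

definition side_mode :: "nat \<Rightarrow> real \<Rightarrow> real" where
  "side_mode k y = cosh (real (Suc k) * (y + 1)) / cosh (real (Suc k))"

lemma side_mode_cont: "continuous_on S (side_mode k)"
  unfolding side_mode_def by (intro continuous_intros) simp

lemma side_mode_bounds:
  assumes "-1 \<le> y" "y \<le> 0" shows "0 \<le> side_mode k y" "side_mode k y \<le> 2 * exp (real (Suc k) * y)"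
proof -
  define m where "m = real (Suc k)"
  have m: "m \<ge> 0" by (simp add: m_def)
  show "0 \<le> side_mode k y" by (simp add: side_mode_def)
  have "- (m * (y + 1)) \<le> m * (y + 1)" using assms m by simp
  then have "cosh (m * (y + 1)) \<le> exp (m * (y + 1))"
    by (simp add: cosh_field_def del: mult_le_cancel_left)
  also have "\<dots> = exp m * exp (m * y)" by (simp add: distrib_left exp_add)
  also have "\<dots> \<le> (2 * cosh m) * exp (m * y)" by (intro mult_right_mono) (auto simp: cosh_field_def)
  finally have "cosh (m * (y + 1)) / cosh m \<le> 2 * exp (m * y)" by (simp add: divide_le_eq mult_ac)
  then show "side_mode k y \<le> 2 * exp (real (Suc k) * y)" by (simp add: side_mode_def m_def)
qed

definition side_vec :: "nat \<Rightarrow> real L2" where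
  "side_vec k = to_L2 {-1..0} (\<lambda>y. complex_of_real (side_mode k y))"

lemma side_sqint: "(\<lambda>y. complex_of_real (side_mode k y)) \<in> sqint {-1..0}"
  by (intro sqint_Icc continuous_on_of_real side_mode_cont)

lemma trace_left_dirichlet: "trace_left (dirichlet k) = of_real (sqrt (2 / pi)) *\<^sub>C side_vec k"
proof -
  have "(\<lambda>y. DE k (0, y)) = (\<lambda>y. of_real (sqrt (2 / pi)) * complex_of_real (side_mode k y))"
    unfolding DE_def side_mode_def fst_conv snd_conv by (auto simp del: of_nat_Suc)
  then show ?thesis
    unfolding dirichlet_def left.tr_smooth[OF smooth_DE] side_vec_def to_L2_scale[OF side_sqint, symmetric] by simp
qed

text \<open>The modes on the left side are not orthogonal, but each is dominated by
  \<open>2 exp (m y)\<close> with its own frequency m. A product of two modes is therefore at most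
  \<open>4 exp (c y)\<close>, with c the sum of the frequencies, and integration gives four times an
  entry of the Hilbert matrix.\<close>

lemma cinner_side_vec: "cmod (cinner (side_vec j) (side_vec k)) \<le> 4 / (real (Suc j) + real (Suc k))"
proof -
  define c where "c = real (Suc j) + real (Suc k)"
  have c: "c > 0" by (simp add: c_def)
  have "cinner (side_vec j) (side_vec k) = (LINT y|lborel. complex_of_real (indicator {-1..0} y *\<^sub>R (side_mode j y * side_mode k y)))"
    unfolding side_vec_def cinner_to_L2_both[OF side_sqint side_sqint] set_lebesgue_integral_def
    by (intro Bochner_Integration.integral_cong) (auto simp: indicator_def)
  also have "\<dots> = of_real (LINT y|lborel. indicator {-1..0} y *\<^sub>R (side_mode j y * side_mode k y))"
    by (rule integral_complex_of_real)
  finally have "cmod (cinner (side_vec j) (side_vec k)) = \<bar>LINT y|lborel. indicator {-1..0} y *\<^sub>R (side_mode j y * side_mode k y)\<bar>"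
    by (simp only: norm_of_real)
  also have "\<dots> = (LINT y|lborel. indicator {-1..0} y *\<^sub>R (side_mode j y * side_mode k y))"
    by (rule abs_of_nonneg, rule integral_nonneg_AE) (auto simp: indicator_def side_mode_bounds)
  also have "\<dots> \<le> (LINT y|lborel. indicator {-1..0} y *\<^sub>R (4 * exp (c * y)))"
  proof (rule integral_mono)
    show "integrable lborel (\<lambda>y. indicator {-1..0} y *\<^sub>R (side_mode j y * side_mode k y))"
      by (rule borel_integrable_compact) (auto intro!: continuous_intros side_mode_cont)
    show "integrable lborel (\<lambda>y. indicator {-1..0} y *\<^sub>R (4 * exp (c * y)))"
      by (rule borel_integrable_compact) (auto intro!: continuous_intros)
    fix y
    show "indicator {-1..0} y *\<^sub>R (side_mode j y * side_mode k y) \<le> indicator {-1..0} y *\<^sub>R (4 * exp (c * y))"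
    proof (cases "y \<in> {-1..0}")
      case True
      then have "side_mode j y * side_mode k y \<le> (2 * exp (real (Suc j) * y)) * (2 * exp (real (Suc k) * y))"
        by (intro mult_mono side_mode_bounds) auto
      also have "\<dots> = 4 * (exp (real (Suc j) * y) * exp (real (Suc k) * y))" by simp
      also have "\<dots> = 4 * exp (c * y)" by (simp only: c_def exp_add distrib_right)
      finally show ?thesis by (simp add: indicator_def)
    qed simp
  qed
  also have "\<dots> = 4 * exp (c * 0) / c - 4 * exp (c * (-1)) / c"
    by (rule integral_FTC_atLeastAtMost)
      (use c in \<open>auto intro!: derivative_eq_intros continuous_intros simp: has_real_derivative_iff_has_vector_derivative[symmetric]\<close>)
  also have "\<dots> \<le> 4 / c" using c by simp
  finally show ?thesis by (simp add: c_def)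
qed

lemma norm_side_sum:
  "(norm (\<Sum>k<N. a k *\<^sub>C side_vec k))\<^sup>2 \<le> 4 * pi * (\<Sum>k<N. (cmod (a k))\<^sup>2)"
proof -
  let ?x = "\<Sum>k<N. a k *\<^sub>C side_vec k"
  have e: "cinner ?x ?x = (\<Sum>j<N. \<Sum>k<N. a j * (cnj (a k) * cinner (side_vec j) (side_vec k)))"
    by (simp only: cinner.sum_left) (simp add: cinner.sum_right cinner_scaleC_left cinner_scaleC_right sum_distrib_left mult.left_commute)
  have "(norm ?x)\<^sup>2 = cmod (cinner ?x ?x)" unfolding cinner_self norm_of_real by simp
  also have "\<dots> \<le> (\<Sum>j<N. \<Sum>k<N. 4 * (cmod (a j) * cmod (a k) / (real (Suc j) + real (Suc k))))"
    unfolding e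
  proof (intro order_trans[OF norm_sum] sum_mono)
    fix j k
    have "cmod (a j) * cmod (a k) * cmod (cinner (side_vec j) (side_vec k)) \<le> cmod (a j) * cmod (a k) * (4 / (real (Suc j) + real (Suc k)))"
      by (intro mult_left_mono cinner_side_vec) simp
    then show "cmod (a j * (cnj (a k) * cinner (side_vec j) (side_vec k))) \<le> 4 * (cmod (a j) * cmod (a k) / (real (Suc j) + real (Suc k)))"
      by (simp add: norm_mult mult_ac)
  qed
  also have "\<dots> = 4 * (\<Sum>j<N. \<Sum>k<N. cmod (a j) * cmod (a k) / (real (Suc j) + real (Suc k)))"
    by (simp add: sum_distrib_left)
  also have "\<dots> \<le> 4 * (pi * (\<Sum>k<N. (cmod (a k))\<^sup>2))"
    by (intro mult_left_mono Hilbert_inequality) auto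
  finally show ?thesis by simp
qed

text \<open>Duality: pairing h with the combination of the modes whose coefficients are
  \<open><h, side_vec k>\<close> gives the partial sum s itself, while Cauchy-Schwarz and
  \<open>norm_side_sum\<close> bound its square by \<open>|h|^2 * 4 pi s\<close>. Dividing by s
  leaves a bound independent of N.\<close>

lemma side_coef_summable: "summable (\<lambda>k. (cmod (cinner h (side_vec k)))\<^sup>2)"
proof (rule summableI_nonneg_bounded)
  fix N
  define s where "s = (\<Sum>k<N. (cmod (cinner h (side_vec k)))\<^sup>2)"
  let ?x = "\<Sum>k<N. cinner h (side_vec k) *\<^sub>C side_vec k"
  have s0: "s \<ge> 0" by (simp add: s_def sum_nonneg)
  have "cinner h ?x = (\<Sum>k<N. cnj (cinner h (side_vec k)) * cinner h (side_vec k))"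
    by (simp add: cinner.sum_right cinner_scaleC_right)
  also have "\<dots> = of_real s" unfolding s_def of_real_sum complex_norm_square by (simp add: mult.commute)
  finally have "s \<le> norm h * norm ?x" using norm_cinner_le[of h ?x] s0 by simp
  then have "s\<^sup>2 \<le> (norm h * norm ?x)\<^sup>2" using s0 by (rule power_mono)
  also have "\<dots> = (norm h)\<^sup>2 * (norm ?x)\<^sup>2" by (simp add: power_mult_distrib)
  also have "\<dots> \<le> (norm h)\<^sup>2 * (4 * pi * s)"
    unfolding s_def by (intro mult_left_mono norm_side_sum) simp
  finally have "s * s \<le> ((norm h)\<^sup>2 * (4 * pi)) * s" by (simp add: power2_eq_square mult_ac)
  then show "s \<le> (norm h)\<^sup>2 * (4 * pi)"
    using s0 by (cases "s = 0") (auto simp: mult_le_cancel_right)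
qed simp

text \<open>The forcing of mode k in the weak formulation tested with \<open>dirichlet k\<close>;
  the sign is that of the input term there. The vector is unique because \<open>e_H0\<close> is
  total, so the choice is harmless.\<close>

definition control_vec :: "real L2 \<Rightarrow> H0" where
  "control_vec h = (SOME b. \<forall>k. cinner b (e_H0 k) = - cinner h (trace_left (dirichlet k)))"

lemma control_vec: "cinner (control_vec h) (e_H0 k) = - cinner h (trace_left (dirichlet k))"
proof -
  have "(cmod (- cinner h (trace_left (dirichlet k))))\<^sup>2 = (sqrt (2 / pi))\<^sup>2 * (cmod (cinner h (side_vec k)))\<^sup>2" for k
    unfolding trace_left_dirichlet cinner_scaleC_right norm_minus_cancel norm_mult power_mult_distrib by simp
  then have "summable (\<lambda>k. (cmod (- cinner h (trace_left (dirichlet k))))\<^sup>2)"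
    using summable_mult[OF side_coef_summable[of h], of "(sqrt (2 / pi))\<^sup>2"] by simp
  from H0_exists[OF this] have "\<exists>b. \<forall>k. cinner b (e_H0 k) = - cinner h (trace_left (dirichlet k))" .
  from someI_ex[OF this] show ?thesis unfolding control_vec_def by blast
qed

text \<open>Carries the mean of the surface trace of a test function, the part that no element of
  \<open>Hhalf\<close> can represent. Its value is chosen to make its surface trace
  \<open>cos_basis 0\<close>.\<close>

definition constant_fn :: "(real \<times> real) L2" where
  "constant_fn = to_L2 Omega (\<lambda>_. of_real (sqrt (2 / pi)))"

lemma constant_fn:
  "constant_fn \<in> sobolev_H1" "grad constant_fn = 0" "trace_top constant_fn = cos_basis 0"
  "trace_left constant_fn = to_L2 {-1..0} (\<lambda>_. of_real (sqrt (2 / pi)))"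
proof -
  have pd: "pdx (\<lambda>_. c) = (\<lambda>_. 0)" "pdy (\<lambda>_. c) = (\<lambda>_. 0)" for c
    by (rule pdx_eqI pdy_eqI; simp)+
  have z: "to_L2 Omega (\<lambda>_. 0) = 0" by (simp add: to_L2_def zero_L2_def)
  show "constant_fn \<in> sobolev_H1" "grad constant_fn = 0"
    using smooth_H1[OF smooth_const[of "of_real (sqrt (2 / pi))"]]
    by (auto simp: constant_fn_def grad_def pd z zero_prod_def)
  show "trace_top constant_fn = cos_basis 0"
    "trace_left constant_fn = to_L2 {-1..0} (\<lambda>_. of_real (sqrt (2 / pi)))"
    unfolding constant_fn_def top.tr_smooth[OF smooth_const] left.tr_smooth[OF smooth_const] cos_basis_def by simp_all
qed

text \<open>The half is there because \<open>cos_basis 0\<close> has squared norm 2: the factor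
  \<open>sqrt (2 / pi)\<close> normalises only the nonconstant cosines. Both sides have the same
  cosine coefficients, and the cosines are total.\<close>

lemma trace_top_decomp:
  assumes v: "v \<in> sobolev_H1"
  shows "trace_top v = L2_of_H0 (H0_of_Hhalf (trace_half v)) + (cinner (trace_top v) (cos_basis 0) / 2) *\<^sub>C cos_basis 0"
    (is "_ = ?t + ?c *\<^sub>C _")
proof -
  have t: "?t \<in> L2_on {0..pi}" "cinner ?t (cos_basis 0) = 0"
    using L2_of_H0_in[of "H0_of_Hhalf (trace_half v)"]
    by (auto simp: H0_set_iff one_eq_cos_basis cinner_scaleC_right)
  have c0: "cos_basis 0 \<in> L2_on {0..pi}" unfolding cos_basis_def by (rule to_L2_in_L2_on[OF cos_sqint])
  define d where "d = trace_top v - (?t + ?c *\<^sub>C cos_basis 0)"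
  have "d \<in> L2_on {0..pi}"
  proof -
    have "trace_top v + (-1) *\<^sub>C (?t + ?c *\<^sub>C cos_basis 0) \<in> L2_on {0..pi}"
      by (intro L2_on_add L2_on_scaleC top.tr_L2_on v t(1) c0 atLeastAtMost_borel)
    then show ?thesis unfolding d_def scaleC_minus1 by (simp only: diff_conv_add_uminus)
  qed
  moreover have "cinner d (cos_basis k) = 0" for k
  proof (cases k)
    case 0
    then show ?thesis by (simp add: d_def cinner.diff_left cinner.add_left t(2) cinner_scaleC_left cos_basis_cinner)
  next
    case (Suc m)
    have "cinner ?t (cos_basis (Suc m)) = cinner (trace_top v) (cos_basis (Suc m))"
      using trace_half[OF v, of m] by (simp add: hcoef_def cinner_H0_def L2_of_e_H0)
    then show ?thesis unfolding Suc by (simp add: d_def cinner.diff_left cinner.add_left cinner_scaleC_left cos_basis_cinner)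
  qed
  ultimately have "d = 0" by (rule cos_basis_total)
  then show ?thesis by (simp add: d_def)
qed

lemma cinner_H0_trace:
  assumes v: "v \<in> sobolev_H1"
  shows "cinner (L2_of_H0 w) (trace_top v) = cinner w (H0_of_Hhalf (trace_half v))"
proof -
  have "cinner (L2_of_H0 w) (cos_basis 0) = 0"
    using L2_of_H0_in[of w] by (auto simp: H0_set_iff one_eq_cos_basis cinner_scaleC_right)
  then show ?thesis
    by (subst trace_top_decomp[OF v]) (simp add: cinner.add_right cinner_scaleC_right cinner_H0_def)
qed

text \<open>The defining relation of \<open>control_vec\<close> on the basis, extended to all
  surface data by continuity of the left trace along the partial sums of the extension.\<close>

lemma left_trace_extension:
  "cinner h (trace_left (extension \<zeta>)) = - cinner (control_vec h) (H0_of_Hhalf \<zeta>)"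
proof -
  have "(\<lambda>n. trace_left (\<Sum>k<n. hcoef \<zeta> k *\<^sub>C dirichlet k)) \<longlonglongrightarrow> trace_left (extension \<zeta>)"
    by (rule left.tr_tendsto[OF _ extension_H1 extension_tendsto]) (use extension_finite in auto)
  moreover have "trace_left (\<Sum>k<n. hcoef \<zeta> k *\<^sub>C dirichlet k) = (\<Sum>k<n. hcoef \<zeta> k *\<^sub>C trace_left (dirichlet k))" for n
  proof (induction n)
    case 0
    show ?case using left.tr_scaleC[OF H1_0(1), of 0] by (simp add: scaleC.zero_left)
  next
    case (Suc n)
    then show ?case using extension_finite[of "{..<n}" "hcoef \<zeta>"]
      by (simp add: left.tr_add left.tr_scaleC H1_scaleC(1) dirichlet_H1)
  qed
  ultimately have "(\<lambda>n. cinner h (\<Sum>k<n. hcoef \<zeta> k *\<^sub>C trace_left (dirichlet k))) \<longlonglongrightarrow> cinner h (trace_left (extension \<zeta>))"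
    by (intro cinner.tendsto tendsto_const) simp
  moreover have "cinner h (\<Sum>k<n. hcoef \<zeta> k *\<^sub>C trace_left (dirichlet k)) = - (\<Sum>k<n. cinner (control_vec h) (e_H0 k) * cnj (hcoef \<zeta> k))" for n
    by (simp add: cinner.sum_right cinner_scaleC_right control_vec sum_negf mult.commute)
  ultimately have "(\<lambda>n. - (\<Sum>k<n. cinner (control_vec h) (e_H0 k) * cnj (hcoef \<zeta> k))) \<longlonglongrightarrow> cinner h (trace_left (extension \<zeta>))"
    by simp
  moreover have "(\<lambda>n. - (\<Sum>k<n. cinner (control_vec h) (e_H0 k) * cnj (hcoef \<zeta> k))) \<longlonglongrightarrow> - cinner (control_vec h) (H0_of_Hhalf \<zeta>)"
    using H0_sums[of "control_vec h" "H0_of_Hhalf \<zeta>"] by (intro tendsto_minus) (simp add: sums_def hcoef_def)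
  ultimately show ?thesis using LIMSEQ_unique by blast
qed

section \<open>The weak Neumann problem\<close>

lemma zero_trace_bound:
  assumes "v \<in> sobolev_H1" "trace_top v = 0"
  shows "norm (H1_graph v) \<le> sqrt 5 * norm (grad v)"
proof -
  have "(norm (H1_graph v))\<^sup>2 \<le> (sqrt 5 * norm (grad v))\<^sup>2"
    using Poincare_graph[OF assms(1)] assms(2) by (simp add: power_mult_distrib norm_grad)
  then show ?thesis by (rule power2_le_imp_le) simp
qed

text \<open>Riesz representation among the gradients of functions with vanishing surface trace, a
  closed subspace by the Poincare inequality, produces n and the equation for test functions with
  vanishing trace. A general test function differs from such a one by a harmonic extension and a
  constant: the extension contributes only through its left trace, which is the
  \<open>control_vec\<close> term, and the constant contributes nothing because h has mean
  zero.\<close>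

lemma neumann_exists:
  assumes mean: "(LINT y:{-1..0}|lborel. rep_L2 h y) = 0"
  shows "\<exists>n\<in>sobolev_H1. trace_top n = 0 \<and> (\<forall>\<Psi>\<in>sobolev_H1.
     cinner (grad n) (grad \<Psi>) = cinner h (trace_left \<Psi>) + cinner (L2_of_H0 (control_vec h)) (trace_top \<Psi>))"
proof -
  define V where "V = {v \<in> sobolev_H1. trace_top v = 0}"
  have V: "v \<in> sobolev_H1" "trace_top v = 0" if "v \<in> V" for v using that by (auto simp: V_def)
  have V0: "0 \<in> V" using top.tr_scaleC[OF H1_0(1), of 0] by (simp add: V_def H1_0 scaleC.zero_left)
  have Va: "x + y \<in> V" "x - y \<in> V" "c *\<^sub>C x \<in> V" if "x \<in> V" "y \<in> V" for x y c
    using that by (auto simp: V_def H1_add H1_diff H1_scaleC top.tr_add top.tr_diff top.tr_scaleC scaleC.zero_right)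
  have sub: "csubspace (grad ` V)" unfolding csubspace_def
  proof (intro conjI ballI allI)
    show "0 \<in> grad ` V" using V0 H1_0 by (intro image_eqI[of _ _ 0]) (auto simp: grad_graph)
    show "x + y \<in> grad ` V" if xy: "x \<in> grad ` V" "y \<in> grad ` V" for x y
    proof -
      obtain a b where "a \<in> V" "b \<in> V" "x = grad a" "y = grad b" using xy by blast
      then show ?thesis using Va(1) V(1) grad_linear(1) by (intro image_eqI[of _ _ "a + b"]) auto
    qed
    show "c *\<^sub>C x \<in> grad ` V" if x: "x \<in> grad ` V" for c x
    proof -
      obtain a where "a \<in> V" "x = grad a" using x by blast
      then show ?thesis using Va(3) V(1) grad_linear(3) by (intro image_eqI[of _ _ "c *\<^sub>C a"]) auto
    qed
  qed
  have bd: "norm (H1_graph v) \<le> sqrt 5 * norm (grad v)" if "v \<in> V" for v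
    by (rule zero_trace_bound) (use V that in auto)
  have inj: "inj_on grad V"
  proof (rule inj_onI)
    fix x y assume xy: "x \<in> V" "y \<in> V" "grad x = grad y"
    then have "grad (x - y) = 0" using grad_linear(2)[OF V(1) V(1)] by simp
    then have "H1_graph (x - y) = 0" using bd[OF Va(2)[OF xy(1,2)]] by simp
    then show "x = y" by (simp add: H1_graph_def zero_prod_def)
  qed
  have clo: "closed (grad ` V)"
  proof (subst closed_sequential_limits, intro allI impI)
    fix X l assume "(\<forall>n. X n \<in> grad ` V) \<and> X \<longlonglongrightarrow> l"
    then obtain v where v: "\<And>n. v n \<in> V" "\<And>n. X n = grad (v n)" and X: "X \<longlonglongrightarrow> l" unfolding image_iff by metis
    have d: "norm (H1_graph (v m) - H1_graph (v n)) \<le> sqrt 5 * norm (X m - X n)" for m n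
      using bd[OF Va(2)[OF v(1) v(1)], of m n] V(1)[OF v(1)] by (simp add: H1_diff(4) grad_linear(2) v(2))
    have "Cauchy (\<lambda>n. H1_graph (v n))"
    proof (rule CauchyI)
      fix e :: real assume "e > 0"
      then obtain M where M: "\<And>m n. m \<ge> M \<Longrightarrow> n \<ge> M \<Longrightarrow> norm (X m - X n) < e / sqrt 5"
        using CauchyD[OF LIMSEQ_imp_Cauchy[OF X], of "e / sqrt 5"] by auto
      have "norm (H1_graph (v m) - H1_graph (v n)) < e" if "m \<ge> M" "n \<ge> M" for m n
        using d[of m n] M[OF that] by (simp add: pos_less_divide_eq mult.commute)
      then show "\<exists>M. \<forall>m\<ge>M. \<forall>n\<ge>M. norm (H1_graph (v m) - H1_graph (v n)) < e" by blast
    qed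
    then obtain g where g: "(\<lambda>n. H1_graph (v n)) \<longlonglongrightarrow> g" using Cauchy_convergent convergent_def by blast
    note G = H1_graph_limit[OF V(1)[OF v(1)] g]
    have "(\<lambda>n. trace_top (v n)) \<longlonglongrightarrow> trace_top (fst g)"
      by (rule top.tr_tendsto[OF V(1)[OF v(1)] G(1)]) (simp add: g G(2))
    then have "trace_top (fst g) = 0" using V(2)[OF v(1)] by (simp add: LIMSEQ_const_iff)
    moreover have "X = (\<lambda>n. grad (v n))" using v(2) by auto
    then have "X \<longlonglongrightarrow> snd g" using tendsto_snd[OF g] by (simp add: grad_graph)
    then have "l = grad (fst g)" using X LIMSEQ_unique by (metis G(2) grad_graph)
    ultimately show "l \<in> grad ` V" using G(1) by (auto simp: V_def)
  qed
  \<comment> \<open>The functional lives on functions but is represented in the space of gradients,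
    where \<open>grad\<close> is invertible on V. h stands in the second argument so that F is
    linear; the desired equation is its conjugate.\<close>
  define F where "F g = cinner (trace_left (inv_into V grad g)) h" for g
  have F: "F (grad v) = cinner (trace_left v) h" if "v \<in> V" for v
    by (simp add: F_def inv_into_f_f[OF inj that])
  have Fa: "F (x + y) = F x + F y" if xy: "x \<in> grad ` V" "y \<in> grad ` V" for x y
  proof -
    obtain a b where ab: "a \<in> V" "b \<in> V" "x = grad a" "y = grad b" using xy by blast
    have "F (grad (a + b)) = F (grad a) + F (grad b)"
      unfolding F[OF Va(1)[OF ab(1,2)]] F[OF ab(1)] F[OF ab(2)] using ab V(1) by (simp add: left.tr_add cinner.add_left)
    then show ?thesis using ab V(1) by (simp add: grad_linear)
  qed
  have Fc: "F (c *\<^sub>C x) = c * F x" if x: "x \<in> grad ` V" for c x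
  proof -
    obtain a where a: "a \<in> V" "x = grad a" using x by blast
    have "F (grad (c *\<^sub>C a)) = c * F (grad a)"
      unfolding F[OF Va(3)[OF a(1) a(1)]] F[OF a(1)] using a V(1) by (simp add: left.tr_scaleC cinner_scaleC_left)
    then show ?thesis using a V(1) by (simp add: grad_linear)
  qed
  have Fb: "cmod (F x) \<le> (2 * sqrt 5 * norm h) * norm x" if x: "x \<in> grad ` V" for x
  proof -
    obtain a where a: "a \<in> V" "x = grad a" using x by blast
    have "cmod (F x) \<le> norm (trace_left a) * norm h" unfolding a(2) F[OF a(1)] by (rule norm_cinner_le)
    also have "\<dots> \<le> (2 * norm (H1_graph a)) * norm h" using left.tr_bound V(1)[OF a(1)] by (intro mult_right_mono) auto
    also have "\<dots> \<le> (2 * (sqrt 5 * norm x)) * norm h" unfolding a(2) by (intro mult_right_mono mult_left_mono bd a) auto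
    finally show ?thesis by (simp add: mult_ac)
  qed
  obtain y where y: "y \<in> grad ` V" "\<And>x. x \<in> grad ` V \<Longrightarrow> F x = cinner x y"
    using Riesz_closed[OF sub clo Fa Fc Fb] by blast
  then obtain n where n: "n \<in> V" "y = grad n" by blast
  have nV: "cinner (grad n) (grad v) = cinner h (trace_left v)" if "v \<in> V" for v
    using y(2)[of "grad v"] F[OF that] that unfolding n(2) by (metis cinner_commute imageI)
  have "cinner (grad n) (grad \<Psi>) = cinner h (trace_left \<Psi>) + cinner (L2_of_H0 (control_vec h)) (trace_top \<Psi>)" 
    if P: "\<Psi> \<in> sobolev_H1" for \<Psi>
  proof -
    define t where "t = trace_half \<Psi>"
    define c where "c = cinner (trace_top \<Psi>) (cos_basis 0) / 2"
    have cH: "c *\<^sub>C constant_fn \<in> sobolev_H1" by (rule H1_scaleC(1)[OF constant_fn(1)])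
    \<comment> \<open>Subtracting the extension of the trace and the constant carrying its mean
      leaves a function with vanishing surface trace, to which the Riesz equation applies.\<close>
    define P0 where "P0 = \<Psi> - extension t - c *\<^sub>C constant_fn"
    have P1: "\<Psi> - extension t \<in> sobolev_H1" by (rule H1_diff(1)[OF P extension_H1])
    have D: "trace_top \<Psi> = L2_of_H0 (H0_of_Hhalf t) + c *\<^sub>C cos_basis 0"
      unfolding t_def c_def by (rule trace_top_decomp[OF P])
    have "trace_top P0 = trace_top \<Psi> - L2_of_H0 (H0_of_Hhalf t) - c *\<^sub>C cos_basis 0"
      unfolding P0_def top.tr_diff[OF P1 cH] top.tr_diff[OF P extension_H1] 
        top.tr_scaleC[OF constant_fn(1)] constant_fn(3) trace_extension ..
    also have "\<dots> = 0" using D by simp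
    finally have "trace_top P0 = 0" .
    then have P0: "P0 \<in> V" unfolding V_def P0_def using H1_diff(1)[OF P1 cH] by simp
    \<comment> \<open>The gradient of n is orthogonal to those of all harmonic extensions, since n
      vanishes on the surface.\<close>
    have tn: "trace_half n = 0"
      by (rule hcoef_ext) (simp add: trace_half V[OF n(1)] hcoef_linear cinner.zero_left)
    have "cinner (grad n) (grad (extension t)) = cnj (cinner (grad (extension t)) (grad n))"
      by (rule cinner_commute)
    also have "\<dots> = 0" unfolding grad_extension[OF V(1)[OF n(1)]] tn by (simp add: cinner.zero_right)
    finally have z: "cinner (grad n) (grad (extension t)) = 0" .
    have sq: "(\<lambda>_. complex_of_real (sqrt (2 / pi))) \<in> sqint {-1..0::real}" by (rule sqint_Icc) simp
    have h0: "cinner h (trace_left constant_fn) = 0"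
      unfolding constant_fn(4) cinner_to_L2_set[OF sq] using mean by simp
    have "grad P0 = grad \<Psi> - grad (extension t)"
      unfolding P0_def grad_linear(2)[OF P1 cH] grad_linear(2)[OF P extension_H1] grad_linear(3)[OF constant_fn(1)] constant_fn(2)
      by (simp add: scaleC.zero_right)
    then have "cinner (grad n) (grad \<Psi>) = cinner (grad n) (grad P0)" using z by (simp add: cinner.diff_right)
    also have "\<dots> = cinner h (trace_left \<Psi>) - cinner h (trace_left (extension t))"
      unfolding nV[OF P0] unfolding P0_def left.tr_diff[OF P1 cH] left.tr_diff[OF P extension_H1] left.tr_scaleC[OF constant_fn(1)]
      by (simp add: cinner.diff_right cinner_scaleC_right h0)
    also have "\<dots> = cinner h (trace_left \<Psi>) + cinner (L2_of_H0 (control_vec h)) (trace_top \<Psi>)"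
      unfolding left_trace_extension cinner_H0_trace[OF P] t_def by simp
    finally show ?thesis .
  qed
  then show ?thesis using n(1) by (auto simp: V_def)
qed

section \<open>The unitary group\<close>

definition omega :: "nat \<Rightarrow> real" where "omega k = sqrt (w_half k)"

lemma omega: "omega k > 0" "omega k \<noteq> 0" "omega k * omega k = w_half k" "(omega k)\<^sup>2 = w_half k"
  using w_half_bounds(1)[of k] by (auto simp: omega_def)

text \<open>Coordinates in which the norm of the state space is the \<open>\<ell>\<^sup>2\<close>-norm and the group consists of
  rotations of the planes \<open>(zp z k, zq z k)\<close>.\<close>

definition zp :: "Hhalf \<times> H0 \<Rightarrow> nat \<Rightarrow> complex" where "zp z k = cinner (J_Hhalf (fst z)) (e_H0 k)"
definition zq :: "Hhalf \<times> H0 \<Rightarrow> nat \<Rightarrow> complex" where "zq z k = cinner (snd z) (e_H0 k)"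

lemma zp_hcoef: "zp z k = of_real (omega k) * hcoef (fst z) k"
  by (simp add: zp_def hcoef_J omega_def)

lemma z_linear:
  "zp (x + y) k = zp x k + zp y k" "zq (x + y) k = zq x k + zq y k"
  "zp (x - y) k = zp x k - zp y k" "zq (x - y) k = zq x k - zq y k"
  "zp (c *\<^sub>C x) k = c * zp x k" "zq (c *\<^sub>C x) k = c * zq x k"
  "zp (r *\<^sub>R x) k = of_real r * zp x k" "zq (r *\<^sub>R x) k = of_real r * zq x k"
  "zp 0 k = 0" "zq 0 k = 0" "zp (- x) k = - zp x k" "zq (- x) k = - zq x k"
  by (simp_all add: zp_hcoef zq_def hcoef_linear scaleC_prod_def cinner.add_left cinner.diff_left cinner_scaleC_left
      cinner.scaleR_left cinner.zero_left cinner.minus_left scaleR_conv_of_real algebra_simps)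

lemma z_cinner: "(\<lambda>k. zp x k * cnj (zp y k) + zq x k * cnj (zq y k)) sums cinner x y"
  unfolding zp_def zq_def cinner_prod_def cinner_Hhalf_J by (intro sums_add H0_sums)

lemma z_norm: "(\<lambda>k. (cmod (zp x k))\<^sup>2 + (cmod (zq x k))\<^sup>2) sums (norm x)\<^sup>2"
proof -
  have "(\<lambda>k. complex_of_real ((cmod (zp x k))\<^sup>2 + (cmod (zq x k))\<^sup>2)) sums complex_of_real ((norm x)\<^sup>2)"
    using z_cinner[of x x] unfolding cinner_self of_real_add complex_norm_square .
  then show ?thesis by (simp only: sums_of_real_iff)
qed

lemma z_ext: "(\<And>k. zp x k = zp y k) \<Longrightarrow> (\<And>k. zq x k = zq y k) \<Longrightarrow> x = y"
proof -
  assume "\<And>k. zp x k = zp y k" "\<And>k. zq x k = zq y k"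
  then have "(\<lambda>k. 0) sums (norm (x - y))\<^sup>2" using z_norm[of "x - y"] by (simp add: z_linear)
  then have "(norm (x - y))\<^sup>2 = 0" using sums_unique2 sums_zero by blast
  then show "x = y" by simp
qed

lemma z_exists:
  assumes p: "summable (\<lambda>k. (cmod (p k))\<^sup>2)" and q: "summable (\<lambda>k. (cmod (q k))\<^sup>2)"
  shows "\<exists>z. \<forall>k. zp z k = p k \<and> zq z k = q k"
proof -
  obtain y w where "\<And>k. cinner y (e_H0 k) = p k" "\<And>k. cinner w (e_H0 k) = q k"
    using H0_exists[OF p] H0_exists[OF q] by blast
  moreover obtain x where "J_Hhalf x = y" using J_Hhalf_surj by blast
  ultimately show ?thesis by (intro exI[of _ "(x, w)"]) (simp add: zp_def zq_def)
qed

lemma z_summable: "summable (\<lambda>k. (cmod (zp x k))\<^sup>2)" "summable (\<lambda>k. (cmod (zq x k))\<^sup>2)"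
  unfolding zp_def zq_def by (rule orthonormal_Bessel[OF e_H0_on])+

lemma cmod_add_sq_le: "(cmod (a + b))\<^sup>2 \<le> 2 * (cmod a)\<^sup>2 + 2 * (cmod b)\<^sup>2"
proof -
  have "(cmod (a + b))\<^sup>2 \<le> (cmod a + cmod b)\<^sup>2" by (intro power_mono norm_triangle_ineq) auto
  also have "\<dots> \<le> 2 * (cmod a)\<^sup>2 + 2 * (cmod b)\<^sup>2"
    using sum_squares_bound[of "cmod a" "cmod b"] by (simp add: power2_sum)
  finally show ?thesis .
qed

lemma summable_comb:
  fixes p q :: "nat \<Rightarrow> complex"
  assumes p: "summable (\<lambda>k. (cmod (p k))\<^sup>2)" and q: "summable (\<lambda>k. (cmod (q k))\<^sup>2)"
    and ab: "\<And>k. \<bar>a k\<bar> \<le> 1" "\<And>k. \<bar>b k\<bar> \<le> 1"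
  shows "summable (\<lambda>k. (cmod (of_real (a k) * p k + of_real (b k) * q k))\<^sup>2)"
proof (rule summable_comparison_test'[of "\<lambda>k. 2 * (cmod (p k))\<^sup>2 + 2 * (cmod (q k))\<^sup>2" 0])
  show "summable (\<lambda>k. 2 * (cmod (p k))\<^sup>2 + 2 * (cmod (q k))\<^sup>2)" by (intro summable_add summable_mult p q)
  fix k
  have "cmod (of_real (a k) * p k) \<le> cmod (p k)" "cmod (of_real (b k) * q k) \<le> cmod (q k)"
    using ab[of k] by (auto simp: norm_mult mult_left_le_one_le)
  then have "2 * (cmod (of_real (a k) * p k))\<^sup>2 + 2 * (cmod (of_real (b k) * q k))\<^sup>2 \<le> 2 * (cmod (p k))\<^sup>2 + 2 * (cmod (q k))\<^sup>2"
    by (intro add_mono mult_left_mono power_mono) auto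
  then show "norm ((cmod (of_real (a k) * p k + of_real (b k) * q k))\<^sup>2) \<le> 2 * (cmod (p k))\<^sup>2 + 2 * (cmod (q k))\<^sup>2"
    using cmod_add_sq_le[of "of_real (a k) * p k" "of_real (b k) * q k"] by simp
qed

text \<open>The flow of \<open>p' = omega q\<close>, \<open>q' = - omega p\<close>. With
  \<open>p = omega * \<zeta>\<close> and \<open>q\<close> the velocity, this is the oscillator
  equation with squared frequency \<open>w_half k\<close> for each coefficient. It is defined for
  negative times as well, which later allows inputs to be pulled back to time 0.\<close>

definition grp :: "real \<Rightarrow> Hhalf \<times> H0 \<Rightarrow> Hhalf \<times> H0" where
  "grp t z = (SOME z'. \<forall>k. zp z' k = of_real (cos (omega k * t)) * zp z k + of_real (sin (omega k * t)) * zq z k \<and>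
     zq z' k = of_real (- sin (omega k * t)) * zp z k + of_real (cos (omega k * t)) * zq z k)"

lemma grp: "zp (grp t z) k = of_real (cos (omega k * t)) * zp z k + of_real (sin (omega k * t)) * zq z k"
   "zq (grp t z) k = of_real (- sin (omega k * t)) * zp z k + of_real (cos (omega k * t)) * zq z k"
proof -
  have "\<exists>z'. \<forall>k. zp z' k = of_real (cos (omega k * t)) * zp z k + of_real (sin (omega k * t)) * zq z k \<and>
     zq z' k = of_real (- sin (omega k * t)) * zp z k + of_real (cos (omega k * t)) * zq z k"
    by (intro z_exists summable_comb z_summable) auto
  from someI_ex[OF this] 
  show "zp (grp t z) k = of_real (cos (omega k * t)) * zp z k + of_real (sin (omega k * t)) * zq z k"
   "zq (grp t z) k = of_real (- sin (omega k * t)) * zp z k + of_real (cos (omega k * t)) * zq z k"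
    unfolding grp_def by blast+
qed

lemma grp_norm: "norm (grp t z) = norm z"
proof -
  have rot: "(cmod (of_real c * p + of_real s * q))\<^sup>2 + (cmod (of_real (- s) * p + of_real c * q))\<^sup>2 = (cmod p)\<^sup>2 + (cmod q)\<^sup>2"
    if "s\<^sup>2 + c\<^sup>2 = 1" for c s :: real and p q
  proof -
    have "(cmod (of_real c * p + of_real s * q))\<^sup>2 + (cmod (of_real (- s) * p + of_real c * q))\<^sup>2 = (s\<^sup>2 + c\<^sup>2) * ((cmod p)\<^sup>2 + (cmod q)\<^sup>2)"
      unfolding cmod_power2 by (simp add: power2_eq_square algebra_simps)
    then show ?thesis using that by simp
  qed
  have "(\<lambda>k. (cmod (zp z k))\<^sup>2 + (cmod (zq z k))\<^sup>2) sums (norm (grp t z))\<^sup>2"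
    using z_norm[of "grp t z"] unfolding grp by (subst (asm) rot) auto
  then have "(norm (grp t z))\<^sup>2 = (norm z)\<^sup>2" using z_norm[of z] sums_unique2 by blast
  then show ?thesis by (simp add: power2_eq_iff_nonneg)
qed

lemma grp_add: "grp t (x + y) = grp t x + grp t y"
  by (rule z_ext) (simp_all add: grp z_linear algebra_simps)

lemma grp_scaleC: "grp t (c *\<^sub>C x) = c *\<^sub>C grp t x"
  by (rule z_ext) (simp_all add: grp z_linear algebra_simps)

lemma grp_scaleR: "grp t (r *\<^sub>R x) = r *\<^sub>R grp t x"
  by (simp only: scaleR_scaleC grp_scaleC)

lemma grp_bounded_linear: "bounded_linear (grp t)"
  by (rule bounded_linear_intro[where K = 1]) (simp_all add: grp_add grp_scaleR grp_norm)

lemma grp_diff: "grp t (x - y) = grp t x - grp t y"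
  by (rule linear_diff[OF bounded_linear.linear[OF grp_bounded_linear]])

lemma grp_bounded_clinear: "bounded_clinear (grp t)"
  unfolding bounded_clinear_def using grp_bounded_linear grp_scaleC by blast

lemma grp_0: "grp 0 x = x"
  by (rule z_ext) (simp_all add: grp)

lemma grp_grp: "grp s (grp t x) = grp (s + t) x"
  by (rule z_ext) (simp_all add: grp distrib_left sin_add cos_add algebra_simps)

text \<open>Tannery's theorem reduces limits in the state space to limits of the coordinates.\<close>

lemma z_tendsto_0:
  assumes p: "\<And>k. ((\<lambda>t. zp (f t) k) \<longlongrightarrow> 0) F" and q: "\<And>k. ((\<lambda>t. zq (f t) k) \<longlongrightarrow> 0) F"
    and b: "\<And>t k. (cmod (zp (f t) k))\<^sup>2 + (cmod (zq (f t) k))\<^sup>2 \<le> M k" and M: "summable M" and F: "F \<noteq> bot"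
  shows "(f \<longlongrightarrow> 0) F"
proof -
  have "((\<lambda>t. \<Sum>k. (cmod (zp (f t) k))\<^sup>2 + (cmod (zq (f t) k))\<^sup>2) \<longlongrightarrow> (\<Sum>k. 0)) F"
  proof (rule tannerys_theorem[THEN conjunct2, THEN conjunct2, OF _ _ M F])
    show "((\<lambda>t. (cmod (zp (f t) k))\<^sup>2 + (cmod (zq (f t) k))\<^sup>2) \<longlongrightarrow> 0) F" for k
    proof -
      have "((\<lambda>t. (cmod (zp (f t) k))\<^sup>2 + (cmod (zq (f t) k))\<^sup>2) \<longlongrightarrow> (cmod 0)\<^sup>2 + (cmod 0)\<^sup>2) F"
        by (intro tendsto_intros p q)
      then show ?thesis by simp
    qed
    show "\<forall>\<^sub>F (k, t) in at_top \<times>\<^sub>F F. norm ((cmod (zp (f t) k))\<^sup>2 + (cmod (zq (f t) k))\<^sup>2) \<le> M k"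
      using b by (intro always_eventually) auto
  qed
  moreover have "(\<Sum>k. (cmod (zp (f t) k))\<^sup>2 + (cmod (zq (f t) k))\<^sup>2) = (norm (f t))\<^sup>2" for t
    using z_norm[of "f t"] by (simp add: sums_iff)
  ultimately have "((\<lambda>t. (norm (f t))\<^sup>2) \<longlongrightarrow> 0) F" by simp
  from tendsto_real_sqrt[OF this] have "((\<lambda>t. norm (f t)) \<longlongrightarrow> 0) F" by simp
  then show ?thesis by (rule tendsto_norm_zero_cancel)
qed

lemma grp_tendsto_0: "((\<lambda>t. grp t x - x) \<longlongrightarrow> 0) (at 0)"
\<comment> \<open>The two coordinate estimates below add up to 10 times the bracket; 16 leaves
  room.\<close>
proof (rule z_tendsto_0[where M = "\<lambda>k. 16 * ((cmod (zp x k))\<^sup>2 + (cmod (zq x k))\<^sup>2)"])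
  fix k
  have "((\<lambda>t. of_real (cos (omega k * t)) * zp x k + of_real (sin (omega k * t)) * zq x k - zp x k) 
      \<longlongrightarrow> of_real (cos (omega k * 0)) * zp x k + of_real (sin (omega k * 0)) * zq x k - zp x k) (at 0)"
    by (intro tendsto_intros)
  then show "((\<lambda>t. zp (grp t x - x) k) \<longlongrightarrow> 0) (at 0)" by (simp add: z_linear grp)
  have "((\<lambda>t. of_real (- sin (omega k * t)) * zp x k + of_real (cos (omega k * t)) * zq x k - zq x k) 
      \<longlongrightarrow> of_real (- sin (omega k * 0)) * zp x k + of_real (cos (omega k * 0)) * zq x k - zq x k) (at 0)"
    by (intro tendsto_intros)
  then show "((\<lambda>t. zq (grp t x - x) k) \<longlongrightarrow> 0) (at 0)" by (simp add: z_linear grp)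
  fix t
  have b: "(cmod (of_real a * p + of_real b * q - r))\<^sup>2 \<le> 4 * (cmod p)\<^sup>2 + 4 * (cmod q)\<^sup>2 + 2 * (cmod r)\<^sup>2"
    if "\<bar>a\<bar> \<le> 1" "\<bar>b\<bar> \<le> 1" for a b p q r
  proof -
    have "cmod (of_real a * p) \<le> cmod p" "cmod (of_real b * q) \<le> cmod q"
      using that by (auto simp: norm_mult mult_left_le_one_le)
    then have "(cmod (of_real a * p))\<^sup>2 \<le> (cmod p)\<^sup>2" "(cmod (of_real b * q))\<^sup>2 \<le> (cmod q)\<^sup>2"
      by (auto intro!: power_mono)
    then show ?thesis
      using cmod_add_sq_le[of "of_real a * p + of_real b * q" "- r"] cmod_add_sq_le[of "of_real a * p" "of_real b * q"]
      unfolding norm_minus_cancel add_uminus_conv_diff by linarith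
  qed
  have c: "\<bar>cos y\<bar> \<le> 1" "\<bar>sin y\<bar> \<le> 1" "\<bar>- sin y\<bar> \<le> 1" for y :: real by auto
  show "(cmod (zp (grp t x - x) k))\<^sup>2 + (cmod (zq (grp t x - x) k))\<^sup>2 \<le> 16 * ((cmod (zp x k))\<^sup>2 + (cmod (zq x k))\<^sup>2)"
    using b[OF c(1,2), of "omega k * t" "zp x k" "omega k * t" "zq x k" "zp x k"]
      b[OF c(3,1), of "omega k * t" "zp x k" "omega k * t" "zq x k" "zq x k"] 
    using zero_le_power2[of "cmod (zp x k)"] zero_le_power2[of "cmod (zq x k)"]
    unfolding z_linear grp by argo
qed (auto intro!: summable_mult summable_add z_summable)

lemma grp_continuous: "continuous_on S (\<lambda>t. grp t x)"
  unfolding continuous_on_def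
proof
  fix s
  have "((\<lambda>t. grp s (grp (t - s) x - x)) \<longlongrightarrow> grp s 0) (at s)"
  proof (rule bounded_linear.tendsto[OF grp_bounded_linear])
    have "((\<lambda>t. t - s) \<longlongrightarrow> s - s) (at s)" by (intro tendsto_intros)
    then have "filterlim (\<lambda>t. t - s) (at 0) (at s)" by (auto simp: filterlim_at eventually_at_filter)
    from filterlim_compose[OF grp_tendsto_0 this] show "((\<lambda>t. grp (t - s) x - x) \<longlongrightarrow> 0) (at s)" .
  qed
  moreover have "grp s (grp (t - s) x - x) = grp t x - grp s x" for t by (simp add: grp_diff grp_grp)
  moreover have "grp s 0 = 0" using grp_scaleR[of s 0 0] by simp
  ultimately have "((\<lambda>t. grp t x - grp s x) \<longlongrightarrow> 0) (at s)" by simp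
  then have "((\<lambda>t. grp t x) \<longlongrightarrow> grp s x) (at s)" by (rule LIM_zero_cancel)
  then show "((\<lambda>t. grp t x) \<longlongrightarrow> grp s x) (at s within S)" by (rule tendsto_within_subset) simp
qed

lemma grp_C0_semigroup: "C0_semigroup grp"
  unfolding C0_semigroup_def
proof (intro conjI allI impI)
  show "((\<lambda>t. grp t x) \<longlongrightarrow> x) (at_right 0)" for x
    using tendsto_within_subset[OF LIM_zero_cancel[OF grp_tendsto_0[of x]]] by simp
qed (simp_all add: grp_bounded_clinear grp_0 grp_grp)

section \<open>The generator, its skew-adjointness and its domain\<close>

definition gen_rel :: "((Hhalf \<times> H0) \<times> (Hhalf \<times> H0)) set" where
  "gen_rel = {(x, y). \<forall>k. zp y k = of_real (omega k) * zq x k \<and> zq y k = - of_real (omega k) * zp x k}"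

lemma z_bounded_linear: "bounded_linear (\<lambda>z. zp z k)" "bounded_linear (\<lambda>z. zq z k)"
proof -
  have "cmod (zp z k) \<le> norm z * 1" "cmod (zq z k) \<le> norm z * 1" for z
  proof -
    have "(cmod (zp z k))\<^sup>2 + (cmod (zq z k))\<^sup>2 \<le> (norm z)\<^sup>2"
      using sum_le_suminf[OF sums_summable[OF z_norm[of z]], of "{k}"] sums_unique[OF z_norm[of z]] by simp
    moreover have "0 \<le> (cmod (zp z k))\<^sup>2" "0 \<le> (cmod (zq z k))\<^sup>2" by auto
    ultimately have "(cmod (zp z k))\<^sup>2 \<le> (norm z)\<^sup>2" "(cmod (zq z k))\<^sup>2 \<le> (norm z)\<^sup>2" by linarith+
    from this[THEN power2_le_imp_le[OF _ norm_ge_zero]]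
    show "cmod (zp z k) \<le> norm z * 1" "cmod (zq z k) \<le> norm z * 1" by simp_all
  qed
  then show "bounded_linear (\<lambda>z. zp z k)" "bounded_linear (\<lambda>z. zq z k)"
    by - (rule bounded_linear_intro[where K = 1]; simp only: z_linear scaleR_conv_of_real)+
qed

lemma cos_minus_1_bound: "\<bar>cos x - 1\<bar> \<le> \<bar>x::real\<bar>"
proof -
  have "\<bar>cos x - 1\<bar> = 2 * (sin (x / 2))\<^sup>2" using cos_double_sin[of "x / 2"] by (simp add: abs_if)
  also have "\<dots> = 2 * (\<bar>sin (x / 2)\<bar> * \<bar>sin (x / 2)\<bar>)" by (simp add: power2_eq_square abs_mult[symmetric])
  also have "\<dots> \<le> 2 * (\<bar>x / 2\<bar> * 1)" by (intro mult_left_mono mult_mono abs_sin_x_le_abs_x) auto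
  finally show ?thesis by simp
qed

lemma trig_quotients:
  "((\<lambda>t. (cos (w * t) - 1) / t) \<longlongrightarrow> 0) (at_right (0::real))" "((\<lambda>t. sin (w * t) / t) \<longlongrightarrow> w) (at_right 0)"
proof -
  have "((\<lambda>t. cos (w * t)) has_real_derivative 0) (at 0)" "((\<lambda>t. sin (w * t)) has_real_derivative w) (at 0)"
    by (auto intro!: derivative_eq_intros)
  then show "((\<lambda>t. (cos (w * t) - 1) / t) \<longlongrightarrow> 0) (at_right (0::real))" "((\<lambda>t. sin (w * t) / t) \<longlongrightarrow> w) (at_right 0)"
    by (auto simp: has_field_derivative_iff intro: tendsto_within_subset)
qed

lemma grp_quotient:
  "zp ((grp t x - x) /\<^sub>R t) k = of_real ((cos (omega k * t) - 1) / t) * zp x k + of_real (sin (omega k * t) / t) * zq x k"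
  "zq ((grp t x - x) /\<^sub>R t) k = of_real (- (sin (omega k * t) / t)) * zp x k + of_real ((cos (omega k * t) - 1) / t) * zq x k"
  by (simp_all add: z_linear grp divide_inverse algebra_simps)

text \<open>In these coordinates \<open>gen_rel\<close> is the graph of
  \<open>(\<zeta>, w) \<mapsto> (w, - A \<zeta>)\<close>, where A multiplies coefficient k by
  \<open>w_half k\<close>. One inclusion is uniqueness of limits in each coordinate. For the other,
  the difference quotients of cos and sin are bounded by \<open>omega k\<close>, so the coordinates
  of y, which are square summable, dominate uniformly in t.\<close>

lemma generator_grp: "generator grp = gen_rel"
proof (intro set_eqI iffI)
  fix z assume "z \<in> generator grp"
  then obtain x y where z: "z = (x, y)" and lim: "((\<lambda>t. (grp t x - x) /\<^sub>R t) \<longlongrightarrow> y) (at_right 0)"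
    by (auto simp: generator_def)
  have nb: "at_right (0::real) \<noteq> bot" by simp
  have "zp y k = of_real (omega k) * zq x k \<and> zq y k = - of_real (omega k) * zp x k" for k
  proof
    have "((\<lambda>t. zp ((grp t x - x) /\<^sub>R t) k) \<longlongrightarrow> of_real 0 * zp x k + of_real (omega k) * zq x k) (at_right 0)"
      unfolding grp_quotient by (intro tendsto_intros trig_quotients)
    from tendsto_unique[OF nb bounded_linear.tendsto[OF z_bounded_linear(1) lim] this]
    show "zp y k = of_real (omega k) * zq x k" by simp
    have "((\<lambda>t. zq ((grp t x - x) /\<^sub>R t) k) \<longlongrightarrow> of_real (- omega k) * zp x k + of_real 0 * zq x k) (at_right 0)"
      unfolding grp_quotient by (intro tendsto_intros trig_quotients)
    from tendsto_unique[OF nb bounded_linear.tendsto[OF z_bounded_linear(2) lim] this]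
    show "zq y k = - of_real (omega k) * zp x k" by simp
  qed
  then show "z \<in> gen_rel" by (simp add: gen_rel_def z)
next
  fix z assume "z \<in> gen_rel"
  then obtain x y where z: "z = (x, y)" and y: "\<And>k. zp y k = of_real (omega k) * zq x k" "\<And>k. zq y k = - of_real (omega k) * zp x k"
    by (auto simp: gen_rel_def)
  have "((\<lambda>t. (grp t x - x) /\<^sub>R t - y) \<longlongrightarrow> 0) (at_right 0)"
  proof (rule z_tendsto_0[where M = "\<lambda>k. 16 * ((cmod (zp y k))\<^sup>2 + (cmod (zq y k))\<^sup>2)"])
    fix k
    have "((\<lambda>t. zp ((grp t x - x) /\<^sub>R t) k - zp y k) \<longlongrightarrow> of_real 0 * zp x k + of_real (omega k) * zq x k - zp y k) (at_right 0)"
      unfolding grp_quotient by (intro tendsto_intros trig_quotients)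
    then show "((\<lambda>t. zp ((grp t x - x) /\<^sub>R t - y) k) \<longlongrightarrow> 0) (at_right 0)" by (simp add: z_linear(3) y)
    have "((\<lambda>t. zq ((grp t x - x) /\<^sub>R t) k - zq y k) \<longlongrightarrow> of_real (- omega k) * zp x k + of_real 0 * zq x k - zq y k) (at_right 0)"
      unfolding grp_quotient by (intro tendsto_intros trig_quotients)
    then show "((\<lambda>t. zq ((grp t x - x) /\<^sub>R t - y) k) \<longlongrightarrow> 0) (at_right 0)" by (simp add: z_linear(4) y)
    fix t :: real
    let ?w = "omega k"
    \<comment> \<open>Domination is required for every real t, including 0, where the quotients are
      0 by convention.\<close>
    have c: "\<bar>(cos (?w * t) - 1) / t\<bar> \<le> ?w" "\<bar>sin (?w * t) / t\<bar> \<le> ?w" "\<bar>- (sin (?w * t) / t)\<bar> \<le> ?w"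
      using cos_minus_1_bound[of "?w * t"] abs_sin_x_le_abs_x[of "?w * t"] omega(1)[of k]
      by (cases "t = 0"; simp add: abs_mult divide_le_eq)+
    have n: "cmod (zp y k) = ?w * cmod (zq x k)" "cmod (zq y k) = ?w * cmod (zp x k)"
      using omega(1)[of k] by (simp_all add: y norm_mult)
    have b: "(cmod (of_real a * zp x k + of_real b * zq x k - r))\<^sup>2 \<le> 4 * (cmod (zq y k))\<^sup>2 + 4 * (cmod (zp y k))\<^sup>2 + 2 * (cmod r)\<^sup>2"
      if "\<bar>a\<bar> \<le> ?w" "\<bar>b\<bar> \<le> ?w" for a b r
    proof -
      have "cmod (of_real a * zp x k) \<le> cmod (zq y k)" "cmod (of_real b * zq x k) \<le> cmod (zp y k)"
        using that unfolding n by (auto simp: norm_mult intro: mult_right_mono)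
      then have "(cmod (of_real a * zp x k))\<^sup>2 \<le> (cmod (zq y k))\<^sup>2" "(cmod (of_real b * zq x k))\<^sup>2 \<le> (cmod (zp y k))\<^sup>2"
        by (auto intro!: power_mono)
      then show ?thesis
        using cmod_add_sq_le[of "of_real a * zp x k + of_real b * zq x k" "- r"] cmod_add_sq_le[of "of_real a * zp x k" "of_real b * zq x k"]
        unfolding norm_minus_cancel add_uminus_conv_diff by linarith
    qed
    show "(cmod (zp ((grp t x - x) /\<^sub>R t - y) k))\<^sup>2 + (cmod (zq ((grp t x - x) /\<^sub>R t - y) k))\<^sup>2 \<le> 16 * ((cmod (zp y k))\<^sup>2 + (cmod (zq y k))\<^sup>2)"
      using b[OF c(1,2), of "zp y k"] b[OF c(3,1), of "zq y k"]
        zero_le_power2[of "cmod (zp y k)"] zero_le_power2[of "cmod (zq y k)"]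
      unfolding z_linear(3)[of "(grp t x - x) /\<^sub>R t"] z_linear(4)[of "(grp t x - x) /\<^sub>R t"] grp_quotient by argo
  qed (auto intro!: summable_mult summable_add z_summable)
  then have "((\<lambda>t. (grp t x - x) /\<^sub>R t) \<longlongrightarrow> y) (at_right 0)" by (rule LIM_zero_cancel)
  then show "z \<in> generator grp" by (simp add: generator_def z)
qed

definition basis_p :: "nat \<Rightarrow> Hhalf \<times> H0" where
  "basis_p j = (SOME z. \<forall>k. zp z k = (if k = j then 1 else 0) \<and> zq z k = 0)"
definition basis_q :: "nat \<Rightarrow> Hhalf \<times> H0" where
  "basis_q j = (SOME z. \<forall>k. zp z k = 0 \<and> zq z k = (if k = j then 1 else 0))"

lemma basis_pq:
  "zp (basis_p j) k = (if k = j then 1 else 0)" "zq (basis_p j) k = 0"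
  "zp (basis_q j) k = 0" "zq (basis_q j) k = (if k = j then 1 else 0)"
proof -
  have s: "summable (\<lambda>k. (cmod (if k = j then 1 else 0))\<^sup>2)"
    by (rule summable_finite[of "{j}"]) auto
  show "zp (basis_p j) k = (if k = j then 1 else 0)" "zq (basis_p j) k = 0"
    unfolding basis_p_def using someI_ex[OF z_exists[OF s, of "\<lambda>_. 0"]] by auto
  show "zp (basis_q j) k = 0" "zq (basis_q j) k = (if k = j then 1 else 0)"
    unfolding basis_q_def using someI_ex[OF z_exists[OF _ s, of "\<lambda>_. 0"]] by auto
qed

lemma cinner_basis: "cinner (basis_p j) z = cnj (zp z j)" "cinner (basis_q j) z = cnj (zq z j)"
proof -
  have "(\<lambda>k. if k = j then cnj (zp z k) else 0) sums cinner (basis_p j) z"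
    using z_cinner[of "basis_p j" z] by (simp add: basis_pq if_distrib[where f="\<lambda>x. x * _"] cong: if_cong)
  then show "cinner (basis_p j) z = cnj (zp z j)" using sums_single[of j "\<lambda>k. cnj (zp z k)"] sums_unique2 by blast
  have "(\<lambda>k. if k = j then cnj (zq z k) else 0) sums cinner (basis_q j) z"
    using z_cinner[of "basis_q j" z] by (simp add: basis_pq if_distrib[where f="\<lambda>x. x * _"] cong: if_cong)
  then show "cinner (basis_q j) z = cnj (zq z j)" using sums_single[of j "\<lambda>k. cnj (zq z k)"] sums_unique2 by blast
qed

lemma gen_rel_basis: 
  "(basis_p j, (- complex_of_real (omega j)) *\<^sub>C basis_q j) \<in> gen_rel" "(basis_q j, complex_of_real (omega j) *\<^sub>C basis_p j) \<in> gen_rel"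
  by (auto simp: gen_rel_def basis_pq z_linear(5,6))

text \<open>The coordinate vectors lie in the domain and have total span, which gives density.
  Testing the adjoint relation with them reads off every coordinate of z, and this alone places
  \<open>(y, - z)\<close> in \<open>gen_rel\<close>: membership in the domain means just that some
  vector has the required coordinates. The converse is cancellation in each plane.\<close>

lemma gen_rel_skew_adjoint: "skew_adjoint gen_rel"
  unfolding skew_adjoint_def
proof
  show "closure (Domain gen_rel) = UNIV"
  proof -
    have sub: "csubspace (Domain gen_rel)" unfolding csubspace_def
    proof (intro conjI ballI allI)
      have "(0, 0) \<in> gen_rel" by (simp add: gen_rel_def z_linear)
      then show "0 \<in> Domain gen_rel" by blast
    next
      fix x y assume "x \<in> Domain gen_rel" "y \<in> Domain gen_rel"
      then obtain x' y' where "(x, x') \<in> gen_rel" "(y, y') \<in> gen_rel" by blast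
      then have "(x + y, x' + y') \<in> gen_rel" by (simp add: gen_rel_def z_linear algebra_simps)
      then show "x + y \<in> Domain gen_rel" by blast
    next
      fix c x assume "x \<in> Domain gen_rel"
      then obtain x' where "(x, x') \<in> gen_rel" by blast
      then have "(c *\<^sub>C x, c *\<^sub>C x') \<in> gen_rel" by (simp add: gen_rel_def z_linear algebra_simps)
      then show "c *\<^sub>C x \<in> Domain gen_rel" by blast
    qed
    have "x \<in> closure (Domain gen_rel)" for x
    proof -
      obtain p where p: "p \<in> closure (Domain gen_rel)" "\<And>w. w \<in> closure (Domain gen_rel) \<Longrightarrow> cinner (x - p) w = 0"
        using closed_projection[OF csubspace_closure[OF sub] closed_closure] by blast
      have "basis_p k \<in> closure (Domain gen_rel)" "basis_q k \<in> closure (Domain gen_rel)" for k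
        using gen_rel_basis[of k] closure_subset[of "Domain gen_rel"] by blast+
      then have "cinner (basis_p k) (x - p) = 0" "cinner (basis_q k) (x - p) = 0" for k
        using p(2) by (subst cinner_commute, simp)+
      then have "x = p" by (intro z_ext) (simp_all add: cinner_basis z_linear)
      then show ?thesis using p(1) by simp
    qed
    then show ?thesis by blast
  qed
  show "adjoint gen_rel = {(x, - y) |x y. (x, y) \<in> gen_rel}"
  proof (intro set_eqI iffI)
    fix a assume "a \<in> adjoint gen_rel"
    moreover obtain y z where a: "a = (y, z)" by (cases a)
    ultimately have adj: "cinner w y = cinner x z" if "(x, w) \<in> gen_rel" for x w
      using that by (auto simp: adjoint_def)
    have "zp (- z) k = of_real (omega k) * zq y k \<and> zq (- z) k = - of_real (omega k) * zp y k" for k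
    proof -
      have "cnj (zp z k) = - of_real (omega k) * cnj (zq y k)" 
        using adj[OF gen_rel_basis(1)[of k]] by (simp only: cinner_scaleC_left cinner_basis)
      then have 1: "zp z k = - of_real (omega k) * zq y k"
        by (metis complex_cnj_cnj complex_cnj_complex_of_real complex_cnj_minus complex_cnj_mult)
      have "cnj (zq z k) = of_real (omega k) * cnj (zp y k)" 
        using adj[OF gen_rel_basis(2)[of k]] by (simp only: cinner_scaleC_left cinner_basis)
      then have 2: "zq z k = of_real (omega k) * zp y k"
        by (metis complex_cnj_cnj complex_cnj_complex_of_real complex_cnj_mult)
      show ?thesis using 1 2 by (simp add: z_linear)
    qed
    then have "(y, - z) \<in> gen_rel" by (simp add: gen_rel_def)
    then show "a \<in> {(x, - y) |x y. (x, y) \<in> gen_rel}" unfolding a by (intro CollectI exI[of _ y] exI[of _ "- z"]) simp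
  next
    fix a assume "a \<in> {(x, - y) |x y. (x, y) \<in> gen_rel}"
    then obtain x0 y0 where a: "a = (x0, - y0)" "(x0, y0) \<in> gen_rel" by blast
    have "cinner w x0 = cinner x (- y0)" if xw: "(x, w) \<in> gen_rel" for x w
    proof -
      have "zp w k * cnj (zp x0 k) + zq w k * cnj (zq x0 k) = zp x k * cnj (zp (- y0) k) + zq x k * cnj (zq (- y0) k)" for k
        using xw a(2) by (simp add: gen_rel_def z_linear algebra_simps)
      then show ?thesis using z_cinner[of w x0] z_cinner[of x "- y0"] sums_unique2 by (metis (no_types, lifting) sums_cong)
    qed
    then show "a \<in> adjoint gen_rel" by (auto simp: adjoint_def a(1))
  qed
qed

text \<open>The image must have square summable coordinates. These are \<open>omega k\<close> times
  the velocity coefficient, a condition of order 1/2, and \<open>w_half k\<close> times the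
  elevation coefficient, a condition of order 1. \<open>H_alpha\<close> uses powers of the frequency
  itself, which is comparable to \<open>w_half\<close> with constants \<open>tanh 1\<close> and
  1.\<close>

lemma gen_rel_domain: "Domain gen_rel = {(\<zeta>, w). H0_of_Hhalf \<zeta> \<in> H_alpha 1 \<and> w \<in> H_alpha (1/2)}"
proof (intro set_eqI)
  fix x :: "Hhalf \<times> H0"
  obtain \<zeta> w where x: "x = (\<zeta>, w)" by (cases x)
  have t: "tanh (1::real) > 0" by simp
  have bounds: "tanh 1 * real (Suc k) \<le> w_half k" "w_half k \<le> real (Suc k)" "0 \<le> w_half k" for k
    using w_half_bounds[of k] by auto
  \<comment> \<open>Applied with \<open>n = 2\<close> to the elevation and with \<open>n = 1\<close>
    to the velocity.\<close>
  have sum_iff: "summable (\<lambda>k. (w_half k)^n * c k) \<longleftrightarrow> summable (\<lambda>k. (real (Suc k))^n * c k)" 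
    if c: "\<And>k. c k \<ge> 0" for c and n :: nat
  proof
    assume s: "summable (\<lambda>k. (w_half k)^n * c k)"
    have "(real (Suc k))^n * c k \<le> (1 / tanh 1)^n * ((w_half k)^n * c k)" for k
    proof -
      have "real (Suc k) \<le> (1 / tanh 1) * w_half k" using bounds(1)[of k] t by (simp add: field_simps)
      then have "(real (Suc k))^n \<le> ((1 / tanh 1) * w_half k)^n" by (rule power_mono) simp
      then have "(real (Suc k))^n * c k \<le> ((1 / tanh 1) * w_half k)^n * c k" by (rule mult_right_mono[OF _ c])
      then show ?thesis by (simp only: power_mult_distrib mult.assoc)
    qed
    then show "summable (\<lambda>k. (real (Suc k))^n * c k)"
      by (intro summable_comparison_test'[OF summable_mult[OF s, of "(1 / tanh 1)^n"], of 0]) (simp add: c)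
  next
    assume s: "summable (\<lambda>k. (real (Suc k))^n * c k)"
    have "(w_half k)^n * c k \<le> (real (Suc k))^n * c k" for k
      by (intro mult_right_mono power_mono bounds c)
    then show "summable (\<lambda>k. (w_half k)^n * c k)"
      by (intro summable_comparison_test'[OF s, of 0]) (use c bounds(3) in simp)
  qed
  have 1: "H0_of_Hhalf \<zeta> \<in> H_alpha 1 \<longleftrightarrow> summable (\<lambda>k. (w_half k)\<^sup>2 * (cmod (hcoef \<zeta> k))\<^sup>2)"
  proof -
    have "real (Suc k) powr (2 * 1) = (real (Suc k))\<^sup>2" for k
      using powr_realpow[of "real (Suc k)" 2] by simp
    then show ?thesis unfolding H_alpha_def mem_Collect_eq coef_eq hcoef_def[symmetric]
      by (subst sum_iff) simp_all
  qed
  have 2: "w \<in> H_alpha (1/2) \<longleftrightarrow> summable (\<lambda>k. w_half k * (cmod (cinner w (e_H0 k)))\<^sup>2)"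
    unfolding H_half_iff using sum_iff[of "\<lambda>k. (cmod (cinner w (e_H0 k)))\<^sup>2" 1] by simp
  have np: "(cmod (- of_real (omega k) * zp x k))\<^sup>2 = (w_half k)\<^sup>2 * (cmod (hcoef \<zeta> k))\<^sup>2" for k
  proof -
    have "cmod (- of_real (omega k) * zp x k) = w_half k * cmod (hcoef \<zeta> k)"
      using omega(1)[of k] by (simp add: zp_hcoef x norm_mult omega(3)[symmetric])
    then show ?thesis by (simp only: power_mult_distrib)
  qed
  have nq: "(cmod (of_real (omega k) * zq x k))\<^sup>2 = w_half k * (cmod (cinner w (e_H0 k)))\<^sup>2" for k
    by (simp add: zq_def x norm_mult power_mult_distrib omega(4))
  show "x \<in> Domain gen_rel \<longleftrightarrow> x \<in> {(\<zeta>, w). H0_of_Hhalf \<zeta> \<in> H_alpha 1 \<and> w \<in> H_alpha (1/2)}"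
  proof
    assume "x \<in> Domain gen_rel"
    then obtain y where "\<And>k. zp y k = of_real (omega k) * zq x k" "\<And>k. zq y k = - of_real (omega k) * zp x k"
      by (auto simp: gen_rel_def)
    then show "x \<in> {(\<zeta>, w). H0_of_Hhalf \<zeta> \<in> H_alpha 1 \<and> w \<in> H_alpha (1/2)}"
      using z_summable[of y] unfolding x mem_Collect_eq prod.case 1 2 np[symmetric] nq[symmetric] by (simp only: x)
  next
    assume "x \<in> {(\<zeta>, w). H0_of_Hhalf \<zeta> \<in> H_alpha 1 \<and> w \<in> H_alpha (1/2)}"
    then have "summable (\<lambda>k. (cmod (of_real (omega k) * zq x k))\<^sup>2)" "summable (\<lambda>k. (cmod (- of_real (omega k) * zp x k))\<^sup>2)"
      unfolding np nq using 1 2 by (simp_all add: x)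
    from z_exists[OF this] show "x \<in> Domain gen_rel" by (auto simp: gen_rel_def)
  qed
qed

section \<open>The input maps\<close>

lemma sqint_Icc_one: "(\<lambda>_. 1 :: complex) \<in> sqint {a..b::real}"
  by (rule sqint_Icc) simp

lemma sqint_set_integrable:
  fixes u :: "real \<Rightarrow> complex"
  assumes "u \<in> sqint {a..b}" shows "integrable lborel (\<lambda>x. indicator {a..b} x *\<^sub>R u x)"
proof -
  have "integrable lborel (\<lambda>x. (indicator {a..b} x *\<^sub>R u x) * cnj (indicator {a..b} x *\<^sub>R 1))"
    by (rule sqint_mult) (use assms sqint_Icc_one in \<open>auto simp: indicator_in_sqint\<close>)
  then show ?thesis by (rule Bochner_Integration.integrable_cong[THEN iffD1, rotated 2]) (auto simp: indicator_def)
qed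

lemma L1_le_L2:
  fixes u :: "real \<Rightarrow> complex"
  assumes u: "u \<in> sqint {a..b}" and ab: "a \<le> b"
  shows "(LINT x|lborel. indicator {a..b} x *\<^sub>R cmod (u x)) \<le> sqrt (b - a) * sqrt (LINT x:{a..b}|lborel. (cmod (u x))\<^sup>2)"
proof -
  let ?v = "\<lambda>x. complex_of_real (cmod (u x))"
  have [measurable]: "(\<lambda>x. indicator {a..b} x *\<^sub>R u x) \<in> borel_measurable borel"
    using u by (simp add: sqint_def set_borel_measurable_def)
  have "(\<lambda>x. complex_of_real (cmod (indicator {a..b} x *\<^sub>R u x))) \<in> borel_measurable borel" by measurable
  also have "(\<lambda>x. complex_of_real (cmod (indicator {a..b} x *\<^sub>R u x))) = (\<lambda>x. indicator {a..b} x *\<^sub>R ?v x)"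
    by (auto simp: indicator_def)
  finally have v: "?v \<in> sqint {a..b}"
    using u by (auto simp: sqint_def set_borel_measurable_def)
  have e: "cinner (to_L2 {a..b} ?v) (to_L2 {a..b} (\<lambda>_. 1)) = of_real (LINT x|lborel. indicator {a..b} x *\<^sub>R cmod (u x))"
    unfolding cinner_to_L2_both[OF v sqint_Icc_one] set_lebesgue_integral_def integral_complex_of_real[symmetric]
    by (intro Bochner_Integration.integral_cong) (auto simp: indicator_def)
  have n: "norm (to_L2 {a..b} f) = sqrt (LINT x:{a..b}|lborel. (cmod (f x))\<^sup>2)" if "f \<in> sqint {a..b}" for f
  proof -
    have "(norm (to_L2 {a..b} f))\<^sup>2 = (LINT x:{a..b}|lborel. (cmod (f x))\<^sup>2)"
      unfolding to_L2_def set_lebesgue_integral_def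
      by (subst norm_abs_L2[OF iffD2[OF indicator_in_sqint that]])
        (auto simp: indicator_def intro!: Bochner_Integration.integral_cong)
    then show ?thesis by (metis norm_ge_zero real_sqrt_abs abs_of_nonneg)
  qed
  have "(LINT x:{a..b}|lborel. (cmod (1::complex))\<^sup>2) = b - a"
    using ab by (simp add: set_lebesgue_integral_def)
  then have n1: "norm (to_L2 {a..b} (\<lambda>_. 1)) = sqrt (b - a)" using n[OF sqint_Icc_one] by simp
  have "(LINT x|lborel. indicator {a..b} x *\<^sub>R cmod (u x)) \<le> cmod (cinner (to_L2 {a..b} ?v) (to_L2 {a..b} (\<lambda>_. 1)))"
    unfolding e norm_of_real by (rule abs_ge_self)
  also have "\<dots> \<le> norm (to_L2 {a..b} ?v) * norm (to_L2 {a..b} (\<lambda>_. 1))" by (rule norm_cinner_le)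
  also have "\<dots> = sqrt (b - a) * sqrt (LINT x:{a..b}|lborel. (cmod (u x))\<^sup>2)"
    unfolding n1 n[OF v] by simp
  finally show ?thesis .
qed

text \<open>The control direction transported back to time 0. With the factor \<open>grp t\<close>
  taken out of Duhamel's integral, \<open>pulled_input\<close> depends on t only through the
  interval of integration; continuity and the norm bounds then reduce to estimates of u, since
  \<open>orbit\<close> has constant norm.\<close>

definition orbit :: "real L2 \<Rightarrow> real \<Rightarrow> Hhalf \<times> H0" where
  "orbit h \<sigma> = grp (- \<sigma>) (0, control_vec h)"

definition pulled_input :: "real L2 \<Rightarrow> real \<Rightarrow> (real \<Rightarrow> complex) \<Rightarrow> Hhalf \<times> H0" where
  "pulled_input h t u = (LINT \<sigma>|lborel. indicator {0..t} \<sigma> *\<^sub>R (u \<sigma> *\<^sub>C orbit h \<sigma>))"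

lemma norm_orbit: "norm (orbit h \<sigma>) = norm (control_vec h)"
  by (simp add: orbit_def grp_norm norm_Pair)

lemma orbit_measurable: "orbit h \<in> borel_measurable borel"
proof -
  have "continuous_on UNIV (\<lambda>\<sigma>. grp (- \<sigma>) (0, control_vec h))"
    by (rule continuous_on_compose2[OF grp_continuous[of UNIV]]) (auto intro!: continuous_intros)
  then show ?thesis unfolding orbit_def[abs_def] by (rule borel_measurable_continuous_onI)
qed

lemma scaleC_measurable:
  fixes f :: "real \<Rightarrow> complex" and g :: "real \<Rightarrow> 'b::{complex_hilbert, second_countable_topology}"
  assumes "f \<in> borel_measurable lborel" "g \<in> borel_measurable lborel"
  shows "(\<lambda>x. f x *\<^sub>C g x) \<in> borel_measurable lborel"
  by (rule borel_measurable_continuous_Pair[OF assms]) (intro scaleC.continuous_on continuous_intros)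

lemma orbit_integrable:
  assumes u: "u \<in> sqint {a..b}"
  shows "integrable lborel (\<lambda>\<sigma>. indicator {a..b} \<sigma> *\<^sub>R (u \<sigma> *\<^sub>C orbit h \<sigma>))"
proof (rule Bochner_Integration.integrable_bound)
  show "integrable lborel (\<lambda>\<sigma>. (indicator {a..b} \<sigma> *\<^sub>R u \<sigma>) * of_real (norm (control_vec h)))"
    by (intro integrable_mult_left sqint_set_integrable u)
  have "(\<lambda>\<sigma>. (indicator {a..b} \<sigma> *\<^sub>R u \<sigma>) *\<^sub>C orbit h \<sigma>) \<in> borel_measurable lborel"
    by (rule scaleC_measurable) (use u orbit_measurable in \<open>simp_all add: sqint_def set_borel_measurable_def\<close>)
  then show "(\<lambda>\<sigma>. indicator {a..b} \<sigma> *\<^sub>R (u \<sigma> *\<^sub>C orbit h \<sigma>)) \<in> borel_measurable lborel"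
    by (simp only: scaleC.scaleR_left)
qed (auto simp: norm_scaleC norm_orbit indicator_def norm_mult)

lemma pulled_input_add:
  assumes "u \<in> sqint {0..t}" "v \<in> sqint {0..t}"
  shows "pulled_input h t (\<lambda>x. u x + v x) = pulled_input h t u + pulled_input h t v"
  unfolding pulled_input_def scaleC_add_left scaleR_add_right
  by (rule Bochner_Integration.integral_add) (intro orbit_integrable assms)+

lemma pulled_input_scaleC:
  assumes "u \<in> sqint {0..t}"
  shows "pulled_input h t (\<lambda>x. c *\<^sub>C u x) = c *\<^sub>C pulled_input h t u"
proof -
  have "pulled_input h t (\<lambda>x. c *\<^sub>C u x) = (LINT \<sigma>|lborel. c *\<^sub>C (indicator {0..t} \<sigma> *\<^sub>R (u \<sigma> *\<^sub>C orbit h \<sigma>)))"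
    unfolding pulled_input_def scaleC_scaleR by (simp add: scaleC_scaleC scaleC_complex_def)
  also have "\<dots> = c *\<^sub>C pulled_input h t u"
    unfolding pulled_input_def by (rule integral_bounded_linear[OF scaleC.bounded_linear_right orbit_integrable[OF assms]])
  finally show ?thesis .
qed

text \<open>Cauchy-Schwarz on \<open>{s..t}\<close> gives Hoelder continuity of order 1/2 in time;
  for \<open>s = 0\<close> the same estimate is the boundedness of the input maps.\<close>

lemma pulled_input_diff_bound:
  assumes u: "u \<in> sqint {0..t}" and st: "0 \<le> s" "s \<le> t"
  shows "norm (pulled_input h t u - pulled_input h s u) \<le> norm (control_vec h) * (sqrt (t - s) * sqrt (LINT x:{0..t}|lborel. (cmod (u x))\<^sup>2))"
proof -
  have us: "u \<in> sqint {0..s}" "u \<in> sqint {s..t}" by (rule sqint_subset[OF u]; use st in auto)+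
  let ?f = "\<lambda>\<sigma>. indicator {0..t} \<sigma> *\<^sub>R (u \<sigma> *\<^sub>C orbit h \<sigma>) - indicator {0..s} \<sigma> *\<^sub>R (u \<sigma> *\<^sub>C orbit h \<sigma>)"
  have i: "integrable lborel ?f" by (intro Bochner_Integration.integrable_diff orbit_integrable u us)
  have i2: "integrable lborel (\<lambda>\<sigma>. norm (control_vec h) * (indicator {s..t} \<sigma> *\<^sub>R cmod (u \<sigma>)))"
  proof -
    have "integrable lborel (\<lambda>\<sigma>. norm (indicator {s..t} \<sigma> *\<^sub>R u \<sigma>))"
      by (rule integrable_norm[OF sqint_set_integrable[OF us(2)]])
    then have "integrable lborel (\<lambda>\<sigma>. norm (control_vec h) * norm (indicator {s..t} \<sigma> *\<^sub>R u \<sigma>))"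
      by (rule integrable_mult_right)
    then show ?thesis by simp
  qed
  have "pulled_input h t u - pulled_input h s u = (LINT \<sigma>|lborel. ?f \<sigma>)"
    unfolding pulled_input_def by (rule Bochner_Integration.integral_diff[symmetric]) (intro orbit_integrable u us)+
  then have "norm (pulled_input h t u - pulled_input h s u) \<le> (LINT \<sigma>|lborel. norm (?f \<sigma>))"
    by (simp only: integral_norm_bound)
  also have "\<dots> \<le> (LINT \<sigma>|lborel. norm (control_vec h) * (indicator {s..t} \<sigma> *\<^sub>R cmod (u \<sigma>)))"
    by (rule integral_mono[OF integrable_norm[OF i] i2])
      (use st in \<open>auto simp: indicator_def norm_scaleC norm_orbit\<close>)
  also have "\<dots> = norm (control_vec h) * (LINT \<sigma>|lborel. indicator {s..t} \<sigma> *\<^sub>R cmod (u \<sigma>))"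
    by (rule integral_mult_right_zero)
  also have "\<dots> \<le> norm (control_vec h) * (sqrt (t - s) * sqrt (LINT x:{s..t}|lborel. (cmod (u x))\<^sup>2))"
    by (intro mult_left_mono L1_le_L2 us st) simp
  also have "\<dots> \<le> norm (control_vec h) * (sqrt (t - s) * sqrt (LINT x:{0..t}|lborel. (cmod (u x))\<^sup>2))"
  proof (intro mult_left_mono real_sqrt_le_mono)
    show "(LINT x:{s..t}|lborel. (cmod (u x))\<^sup>2) \<le> (LINT x:{0..t}|lborel. (cmod (u x))\<^sup>2)"
      unfolding set_lebesgue_integral_def
      by (rule integral_mono) (use u us st in \<open>auto simp: sqint_def set_integrable_def indicator_def\<close>)
  qed (use st in auto)
  finally show ?thesis .
qed

lemma pulled_input_0: "pulled_input h 0 u = 0"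
proof -
  have "AE \<sigma> in lborel. indicator {0..0} \<sigma> *\<^sub>R (u \<sigma> *\<^sub>C orbit h \<sigma>) = 0"
    using AE_lborel_singleton[of "0::real"] by eventually_elim (auto simp: indicator_def)
  then show ?thesis unfolding pulled_input_def by (rule integral_eq_zero_AE)
qed

lemma pulled_input_continuous:
  assumes u: "u \<in> L2_loc" shows "continuous_on {0..} (\<lambda>t. pulled_input h t u)"
  unfolding continuous_on_def
proof
  fix s :: real assume s: "s \<in> {0..}"
  have uT: "u \<in> sqint {0..T}" for T using u by (auto simp: L2_loc_def)
  define C where "C = norm (control_vec h) * sqrt (LINT x:{0..s + 1}|lborel. (cmod (u x))\<^sup>2)"
  have mono: "(LINT x:{0..t}|lborel. (cmod (u x))\<^sup>2) \<le> (LINT x:{0..s + 1}|lborel. (cmod (u x))\<^sup>2)" if "t \<le> s + 1" for t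
    unfolding set_lebesgue_integral_def
    by (rule integral_mono) (use uT[of t] uT[of "s + 1"] that in \<open>auto simp: sqint_def set_integrable_def indicator_def\<close>)
  have bd: "norm (pulled_input h t u - pulled_input h s u) \<le> C * sqrt \<bar>t - s\<bar>" if t: "t \<ge> 0" "t \<le> s + 1" for t
  proof (cases "s \<le> t")
    case True
    have "norm (pulled_input h t u - pulled_input h s u) \<le> norm (control_vec h) * (sqrt (t - s) * sqrt (LINT x:{0..t}|lborel. (cmod (u x))\<^sup>2))"
      by (rule pulled_input_diff_bound[OF uT]) (use s True in auto)
    also have "\<dots> \<le> norm (control_vec h) * (sqrt (t - s) * sqrt (LINT x:{0..s + 1}|lborel. (cmod (u x))\<^sup>2))"
      using True by (intro mult_left_mono real_sqrt_le_mono mono t) auto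
    finally show ?thesis using True by (simp add: C_def mult_ac)
  next
    case False
    have "norm (pulled_input h s u - pulled_input h t u) \<le> norm (control_vec h) * (sqrt (s - t) * sqrt (LINT x:{0..s}|lborel. (cmod (u x))\<^sup>2))"
      by (rule pulled_input_diff_bound[OF uT]) (use t False in auto)
    also have "\<dots> \<le> norm (control_vec h) * (sqrt (s - t) * sqrt (LINT x:{0..s + 1}|lborel. (cmod (u x))\<^sup>2))"
      using False by (intro mult_left_mono real_sqrt_le_mono mono) auto
    finally show ?thesis using False by (simp add: C_def mult_ac norm_minus_commute)
  qed
  have "((\<lambda>t. pulled_input h t u - pulled_input h s u) \<longlongrightarrow> 0) (at s within {0..})"
  proof (rule Lim_null_comparison)
    have "((\<lambda>t. C * sqrt \<bar>t - s\<bar>) \<longlongrightarrow> C * sqrt \<bar>s - s\<bar>) (at s within {0..})" by (intro tendsto_intros)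
    then show "((\<lambda>t. C * sqrt \<bar>t - s\<bar>) \<longlongrightarrow> 0) (at s within {0..})" by simp
    have "eventually (\<lambda>t. t \<in> {..<s + 1}) (nhds s)" by (rule eventually_nhds_in_open) auto
    then show "\<forall>\<^sub>F t in at s within {0..}. norm (pulled_input h t u - pulled_input h s u) \<le> C * sqrt \<bar>t - s\<bar>"
      unfolding eventually_at_filter by eventually_elim (use bd in auto)
  qed
  then show "((\<lambda>t. pulled_input h t u) \<longlongrightarrow> pulled_input h s u) (at s within {0..})" by (rule LIM_zero_cancel)
qed

lemma orbit_shift: "orbit h (\<tau> + \<sigma>) = grp (- \<tau>) (orbit h \<sigma>)"
  by (simp add: orbit_def grp_grp)

lemma pulled_input_concatenation:
  assumes u: "u \<in> sqint {0..}" and v: "v \<in> sqint {0..}" and t: "\<tau> \<ge> 0" "t \<ge> 0"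
  shows "pulled_input h (\<tau> + t) (concatenation \<tau> u v) = pulled_input h \<tau> u + grp (- \<tau>) (pulled_input h t v)"
proof -
  have us: "u \<in> sqint {0..\<tau>}" by (rule sqint_subset[OF u]) auto
  have vs: "v \<in> sqint {0..t}" by (rule sqint_subset[OF v]) auto
  \<comment> \<open>The first interval is half-open because the concatenation already takes the
    value of v at \<tau>; the integrals do not notice the missing point. Shifting the second piece
    by \<tau> turns the transport over \<open>\<tau> + x\<close> into one over x followed by
    \<open>grp (- \<tau>)\<close>.\<close>
  define f1 where "f1 \<sigma> = indicator {0..<\<tau>} \<sigma> *\<^sub>R (u \<sigma> *\<^sub>C orbit h \<sigma>)" for \<sigma>
  define f2 where "f2 \<sigma> = indicator {\<tau>..\<tau> + t} \<sigma> *\<^sub>R (v (\<sigma> - \<tau>) *\<^sub>C orbit h \<sigma>)" for \<sigma>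
  have "integrable lborel (\<lambda>\<sigma>. indicator {0..<\<tau>} \<sigma> *\<^sub>R (indicator {0..\<tau>} \<sigma> *\<^sub>R (u \<sigma> *\<^sub>C orbit h \<sigma>)))"
    by (rule integrable_mult_indicator[OF _ orbit_integrable[OF us]]) simp
  moreover have "(\<lambda>\<sigma>. indicator {0..<\<tau>} \<sigma> *\<^sub>R (indicator {0..\<tau>} \<sigma> *\<^sub>R (u \<sigma> *\<^sub>C orbit h \<sigma>))) = f1"
    by (auto simp: f1_def indicator_def fun_eq_iff)
  ultimately have i1: "integrable lborel f1" by simp
  have e1: "(LINT \<sigma>|lborel. f1 \<sigma>) = pulled_input h \<tau> u"
    unfolding pulled_input_def
  proof (rule integral_cong_AE)
    show "f1 \<in> borel_measurable lborel" using i1 by simp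
    show "(\<lambda>\<sigma>. indicator {0..\<tau>} \<sigma> *\<^sub>R (u \<sigma> *\<^sub>C orbit h \<sigma>)) \<in> borel_measurable lborel"
      using orbit_integrable[OF us] by simp
    show "AE \<sigma> in lborel. f1 \<sigma> = indicator {0..\<tau>} \<sigma> *\<^sub>R (u \<sigma> *\<^sub>C orbit h \<sigma>)"
      using AE_lborel_singleton[of \<tau>] by eventually_elim (auto simp: f1_def indicator_def)
  qed
  have sh: "f2 (\<tau> + 1 * x) = grp (- \<tau>) (indicator {0..t} x *\<^sub>R (v x *\<^sub>C orbit h x))" for x
    by (simp add: f2_def orbit_shift grp_scaleR grp_scaleC indicator_def)
  have iv: "integrable lborel (\<lambda>x. f2 (\<tau> + 1 * x))"
    unfolding sh by (rule integrable_bounded_linear[OF grp_bounded_linear orbit_integrable[OF vs]])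
  then have i2: "integrable lborel f2" by (subst (asm) lborel_integrable_real_affine_iff) auto
  have "(LINT \<sigma>|lborel. f2 \<sigma>) = (LINT x|lborel. f2 (\<tau> + 1 * x))"
    by (subst lborel_integral_real_affine[of 1 _ \<tau>]) simp_all
  also have "\<dots> = grp (- \<tau>) (pulled_input h t v)"
    unfolding sh pulled_input_def by (rule integral_bounded_linear[OF grp_bounded_linear orbit_integrable[OF vs]])
  finally have e2: "(LINT \<sigma>|lborel. f2 \<sigma>) = grp (- \<tau>) (pulled_input h t v)" .
  have "indicator {0..\<tau> + t} \<sigma> *\<^sub>R (concatenation \<tau> u v \<sigma> *\<^sub>C orbit h \<sigma>) = f1 \<sigma> + f2 \<sigma>" for \<sigma>
    using t by (auto simp: f1_def f2_def concatenation_def indicator_def)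
  then have "pulled_input h (\<tau> + t) (concatenation \<tau> u v) = (LINT \<sigma>|lborel. f1 \<sigma> + f2 \<sigma>)"
    by (simp add: pulled_input_def)
  also have "\<dots> = (LINT \<sigma>|lborel. f1 \<sigma>) + (LINT \<sigma>|lborel. f2 \<sigma>)" by (rule Bochner_Integration.integral_add[OF i1 i2])
  finally show ?thesis unfolding e1 e2 .
qed

definition input_map :: "real L2 \<Rightarrow> real \<Rightarrow> (real \<Rightarrow> complex) \<Rightarrow> Hhalf \<times> H0" where
  "input_map h t u = grp t (pulled_input h t u)"

lemma input_map_well_posed: "well_posed_system grp (input_map h)"
  unfolding well_posed_system_def
proof (intro conjI allI impI ballI)
  show "C0_semigroup grp" by (rule grp_C0_semigroup)
next
  fix t :: real assume t: "t \<ge> 0"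
  have sub: "u \<in> sqint {0..t}" if "u \<in> sqint {0..}" for u :: "real \<Rightarrow> complex" by (rule sqint_subset[OF that]) auto
  show "bounded_clinear_input (input_map h t)"
    unfolding bounded_clinear_input_def
  proof (intro conjI allI ballI exI)
    show "input_map h t (\<lambda>t. u t + v t) = input_map h t u + input_map h t v" if "u \<in> sqint {0..}" "v \<in> sqint {0..}" for u v
      by (simp add: input_map_def pulled_input_add sub that grp_add)
    show "input_map h t (\<lambda>t. c *\<^sub>C u t) = c *\<^sub>C input_map h t u" if "u \<in> sqint {0..}" for c u
      by (simp add: input_map_def pulled_input_scaleC sub that grp_scaleC)
    fix u :: "real \<Rightarrow> complex" assume u: "u \<in> sqint {0..}"
    have "norm (input_map h t u) = norm (pulled_input h t u - pulled_input h 0 u)"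
      by (simp add: input_map_def grp_norm pulled_input_0)
    also have "\<dots> \<le> norm (control_vec h) * (sqrt (t - 0) * sqrt (LINT x:{0..t}|lborel. (cmod (u x))\<^sup>2))"
      by (rule pulled_input_diff_bound[OF sub[OF u]]) (use t in auto)
    also have "\<dots> \<le> norm (control_vec h) * (sqrt (t - 0) * sqrt (LINT x:{0..}|lborel. (cmod (u x))\<^sup>2))"
    proof (intro mult_left_mono real_sqrt_le_mono)
      show "(LINT x:{0..t}|lborel. (cmod (u x))\<^sup>2) \<le> (LINT x:{0..}|lborel. (cmod (u x))\<^sup>2)"
        unfolding set_lebesgue_integral_def
        by (rule integral_mono) (use u sub[OF u] in \<open>auto simp: sqint_def set_integrable_def indicator_def\<close>)
    qed (use t in auto)
    finally show "norm (input_map h t u) \<le> (norm (control_vec h) * sqrt t) * sqrt (LINT t:{0..}|lborel. (norm (u t))\<^sup>2)"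
      by (simp add: mult.assoc)
  qed
next
  fix \<tau> t :: real and u v :: "real \<Rightarrow> complex"
  assume "0 \<le> \<tau>" "0 \<le> t" "u \<in> sqint {0..}" "v \<in> sqint {0..}"
  then show "input_map h (\<tau> + t) (concatenation \<tau> u v) = grp t (input_map h \<tau> u) + input_map h t v"
    by (simp add: input_map_def pulled_input_concatenation grp_add grp_grp add.commute)
qed

lemma input_ext_input_map: "input_ext (input_map h) t u = input_map h t u"
  unfolding input_ext_def input_map_def pulled_input_def
  by (intro arg_cong[of _ _ "grp t"] Bochner_Integration.integral_cong) (auto simp: indicator_def)

lemma input_map_integral:
  assumes "u \<in> sqint {0..\<tau>}"
  shows "has_bochner_integral lborel (\<lambda>\<sigma>. indicator {0..\<tau>} \<sigma> *\<^sub>R grp (\<tau> - \<sigma>) (u \<sigma> *\<^sub>C (0, control_vec h))) (input_map h \<tau> u)"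
proof -
  have "has_bochner_integral lborel (\<lambda>\<sigma>. grp \<tau> (indicator {0..\<tau>} \<sigma> *\<^sub>R (u \<sigma> *\<^sub>C orbit h \<sigma>))) (input_map h \<tau> u)"
    unfolding input_map_def pulled_input_def
    by (intro has_bochner_integral_bounded_linear[OF grp_bounded_linear] has_bochner_integral_integrable orbit_integrable assms)
  then show ?thesis by (simp add: orbit_def grp_scaleR grp_scaleC grp_grp)
qed

section \<open>The trajectories in coordinates\<close>

definition trajectory :: "real L2 \<Rightarrow> (real \<Rightarrow> complex) \<Rightarrow> Hhalf \<times> H0 \<Rightarrow> real \<Rightarrow> Hhalf \<times> H0" where
  "trajectory h u z t = grp t (z + pulled_input h t u)"

lemma trajectory_eq: "trajectory h u z t = grp t z + input_map h t u"
  by (simp add: trajectory_def input_map_def grp_add)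

lemma trajectory_0: "trajectory h u z 0 = z"
  by (simp add: trajectory_def pulled_input_0 grp_0)

text \<open>Since \<open>grp\<close> is isometric, the change of the pulled-back state passes
  through it undistorted, and what remains is the strong continuity of the group at one fixed
  vector.\<close>

lemma trajectory_continuous:
  assumes u: "u \<in> L2_loc" shows "continuous_on {0..} (trajectory h u z)"
  unfolding continuous_on_def
proof
  fix s :: real assume s: "s \<in> {0..}"
  let ?y = "\<lambda>t. z + pulled_input h t u"
  have y: "(?y \<longlongrightarrow> ?y s) (at s within {0..})"
    using pulled_input_continuous[OF u] s unfolding continuous_on_def by (intro tendsto_intros) auto
  have g: "((\<lambda>t. grp t (?y s)) \<longlongrightarrow> grp s (?y s)) (at s within {0..})"
    using grp_continuous[of "{0..}"] s unfolding continuous_on_def by auto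
  have "((\<lambda>t. norm (?y t - ?y s) + norm (grp t (?y s) - grp s (?y s))) \<longlongrightarrow> norm (?y s - ?y s) + norm (grp s (?y s) - grp s (?y s))) (at s within {0..})"
    by (intro tendsto_add tendsto_norm tendsto_diff tendsto_const y g)
  then have l: "((\<lambda>t. norm (?y t - ?y s) + norm (grp t (?y s) - grp s (?y s))) \<longlongrightarrow> 0) (at s within {0..})" by simp
  have "norm (trajectory h u z t - trajectory h u z s) \<le> norm (?y t - ?y s) + norm (grp t (?y s) - grp s (?y s))" for t
  proof -
    have "trajectory h u z t - trajectory h u z s = grp t (?y t - ?y s) + (grp t (?y s) - grp s (?y s))"
      unfolding trajectory_def by (simp only: grp_diff) simp
    then show ?thesis using norm_triangle_ineq[of "grp t (?y t - ?y s)"] by (metis grp_norm)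
  qed
  then have "((\<lambda>t. trajectory h u z t - trajectory h u z s) \<longlongrightarrow> 0) (at s within {0..})"
    by (intro Lim_null_comparison[OF _ l] always_eventually) blast
  then show "(trajectory h u z \<longlongrightarrow> trajectory h u z s) (at s within {0..})" by (rule LIM_zero_cancel)
qed

section \<open>Variation of constants in coordinates\<close>

lemma integrable_product:
  fixes f g :: "real \<Rightarrow> complex"
  assumes f: "integrable lborel f" and g: "integrable lborel g"
  shows "integrable (lborel \<Otimes>\<^sub>M lborel) (\<lambda>(x, y). f x * g y)"
proof (rule lborel_pair.Fubini_integrable)
  have [measurable]: "f \<in> borel_measurable borel" "g \<in> borel_measurable borel" using f g by auto
  show "(\<lambda>(x, y). f x * g y) \<in> borel_measurable (lborel \<Otimes>\<^sub>M lborel)" by measurable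
  show "integrable lborel (\<lambda>x. LINT y|lborel. norm (case (x, y) of (x, y) \<Rightarrow> f x * g y))"
    using integrable_norm[OF f] by (simp add: norm_mult)
  show "AE x in lborel. integrable lborel (\<lambda>y. case (x, y) of (x, y) \<Rightarrow> f x * g y)"
    using g by simp
qed

lemma integral_by_parts_AC:
  fixes a :: "real \<Rightarrow> complex" and c c' :: "real \<Rightarrow> real"
  assumes a: "integrable lborel (\<lambda>\<sigma>. indicator {0..t} \<sigma> *\<^sub>R a \<sigma>)" and t: "t \<ge> 0"
    and c: "\<And>s. (c has_real_derivative c' s) (at s)" and cc: "continuous_on UNIV c'"
  shows "(LINT s:{0..t}|lborel. of_real (c' s) * (LINT \<sigma>:{0..s}|lborel. a \<sigma>)) 
    = of_real (c t) * (LINT \<sigma>:{0..t}|lborel. a \<sigma>) - (LINT \<sigma>:{0..t}|lborel. of_real (c \<sigma>) * a \<sigma>)"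
proof -
  define b where "b \<sigma> = indicator {0..t} \<sigma> *\<^sub>R a \<sigma>" for \<sigma>
  \<comment> \<open>The variable x is the inner time \<sigma>, and y is the outer time s:
    integrating out x first gives the left-hand side, integrating out y first gives
    \<open>c t - c x\<close> by the fundamental theorem.\<close>
  define F where "F x y = b x * (if x \<le> y \<and> y \<le> t then complex_of_real (c' y) else 0)" for x y
  have [measurable]: "b \<in> borel_measurable borel" using a by (auto simp: b_def[abs_def])
  have [measurable]: "c' \<in> borel_measurable borel" using cc by (rule borel_measurable_continuous_onI)
  have contc: "continuous_on S c" for S
    using c by (meson DERIV_continuous continuous_at_imp_continuous_on)
  have ic: "integrable lborel (\<lambda>y. indicator {0..t} y *\<^sub>R complex_of_real (c' y))"
    by (rule borel_integrable_compact) (auto intro!: continuous_on_of_real continuous_on_subset[OF cc])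
  have "integrable (lborel \<Otimes>\<^sub>M lborel) (case_prod F)"
  proof (rule Bochner_Integration.integrable_bound)
    show "integrable (lborel \<Otimes>\<^sub>M lborel) (\<lambda>(x, y). b x * (indicator {0..t} y *\<^sub>R complex_of_real (c' y)))"
      by (rule integrable_product[OF _ ic]) (use a in \<open>simp add: b_def[abs_def]\<close>)
    show "case_prod F \<in> borel_measurable (lborel \<Otimes>\<^sub>M lborel)" unfolding F_def by measurable
    show "AE p in lborel \<Otimes>\<^sub>M lborel. norm (case_prod F p) \<le> norm (case p of (x, y) \<Rightarrow> b x * (indicator {0..t} y *\<^sub>R complex_of_real (c' y)))"
      by (intro always_eventually) (auto simp: F_def b_def indicator_def)
  qed
  from lborel_pair.Fubini_integral[OF this]
  have fub: "(LINT y|lborel. LINT x|lborel. F x y) = (LINT x|lborel. LINT y|lborel. F x y)" .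
  have l: "(LINT x|lborel. F x y) = indicator {0..t} y *\<^sub>R (of_real (c' y) * (LINT \<sigma>:{0..y}|lborel. a \<sigma>))" for y
  proof (cases "y \<in> {0..t}")
    case True
    then have "F x y = of_real (c' y) * (indicator {0..y} x *\<^sub>R a x)" for x by (auto simp: F_def b_def indicator_def)
    then have "(LINT x|lborel. F x y) = (LINT x|lborel. of_real (c' y) * (indicator {0..y} x *\<^sub>R a x))" by (simp only:)
    also have "\<dots> = of_real (c' y) * (LINT \<sigma>:{0..y}|lborel. a \<sigma>)"
      unfolding set_lebesgue_integral_def by (rule integral_mult_right_zero)
    finally show ?thesis using True by simp
  next
    case False
    then have "F x y = 0" for x by (auto simp: F_def b_def indicator_def)
    then show ?thesis using False by simp
  qed
  have r: "(LINT y|lborel. F x y) = indicator {0..t} x *\<^sub>R (of_real (c t) * a x - of_real (c x) * a x)" for x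
  proof (cases "x \<in> {0..t}")
    case True
    have "F x y = b x * (indicator {x..t} y *\<^sub>R complex_of_real (c' y))" for y by (auto simp: F_def indicator_def)
    then have "(LINT y|lborel. F x y) = (LINT y|lborel. b x * (indicator {x..t} y *\<^sub>R complex_of_real (c' y)))" by (simp only:)
    also have "\<dots> = b x * (LINT y|lborel. indicator {x..t} y *\<^sub>R complex_of_real (c' y))" by (rule integral_mult_right_zero)
    also have "(LINT y|lborel. indicator {x..t} y *\<^sub>R complex_of_real (c' y)) = of_real (c t) - of_real (c x)"
    proof (rule integral_FTC_atLeastAtMost)
      show "((\<lambda>x. complex_of_real (c x)) has_vector_derivative complex_of_real (c' y)) (at y within {x..t})" for y
        using c[of y] by (intro has_vector_derivative_of_real) (simp add: has_real_derivative_iff_has_vector_derivative has_vector_derivative_at_within)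
      show "continuous_on {x..t} (\<lambda>x. complex_of_real (c' x))" by (intro continuous_on_of_real continuous_on_subset[OF cc]) simp
    qed (use True in auto)
    finally show ?thesis using True by (simp add: b_def algebra_simps)
  qed (simp add: F_def b_def)
  have ica: "integrable lborel (\<lambda>\<sigma>. indicator {0..t} \<sigma> *\<^sub>R (of_real (c \<sigma>) * a \<sigma>))"
  proof -
    have "bounded (c ` {0..t})" by (intro compact_imp_bounded compact_continuous_image contc) simp
    then obtain M where "\<forall>x\<in>c ` {0..t}. norm x \<le> M" unfolding bounded_iff by blast
    then have M: "\<And>s. s \<in> {0..t} \<Longrightarrow> \<bar>c s\<bar> \<le> M" by simp
    have [measurable]: "c \<in> borel_measurable borel" using contc by (rule borel_measurable_continuous_onI)
    show ?thesis
    proof (rule Bochner_Integration.integrable_bound)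
      show "integrable lborel (\<lambda>\<sigma>. of_real M * b \<sigma>)" unfolding b_def by (rule integrable_mult_right[OF a])
      have "(\<lambda>\<sigma>. of_real (c \<sigma>) * b \<sigma>) \<in> borel_measurable lborel" by measurable
      then show "(\<lambda>\<sigma>. indicator {0..t} \<sigma> *\<^sub>R (of_real (c \<sigma>) * a \<sigma>)) \<in> borel_measurable lborel" by (simp add: b_def)
      show "AE \<sigma> in lborel. norm (indicator {0..t} \<sigma> *\<^sub>R (of_real (c \<sigma>) * a \<sigma>)) \<le> norm (of_real M * b \<sigma>)"
      proof (intro always_eventually allI)
        fix \<sigma>
        show "norm (indicator {0..t} \<sigma> *\<^sub>R (of_real (c \<sigma>) * a \<sigma>)) \<le> norm (of_real M * b \<sigma>)"
          using M[of \<sigma>] by (auto simp: b_def indicator_def norm_mult intro!: mult_right_mono)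
      qed
    qed
  qed
  have "(LINT s:{0..t}|lborel. of_real (c' s) * (LINT \<sigma>:{0..s}|lborel. a \<sigma>)) = (LINT x|lborel. indicator {0..t} x *\<^sub>R (of_real (c t) * a x - of_real (c x) * a x))"
    using fub unfolding l r by (simp add: set_lebesgue_integral_def)
  also have "\<dots> = (LINT x|lborel. of_real (c t) * (indicator {0..t} x *\<^sub>R a x) - indicator {0..t} x *\<^sub>R (of_real (c x) * a x))"
    by (intro Bochner_Integration.integral_cong) (auto simp: algebra_simps)
  also have "\<dots> = of_real (c t) * (LINT \<sigma>:{0..t}|lborel. a \<sigma>) - (LINT \<sigma>:{0..t}|lborel. of_real (c \<sigma>) * a \<sigma>)"
    unfolding set_lebesgue_integral_def
    by (simp only: Bochner_Integration.integral_diff[OF integrable_mult_right[OF a] ica] integral_mult_right_zero)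
  finally show ?thesis .
qed

lemma integral_by_parts_AC':
  fixes a A :: "real \<Rightarrow> complex" and c c' :: "real \<Rightarrow> real"
  assumes a: "integrable lborel (\<lambda>\<sigma>. indicator {0..t} \<sigma> *\<^sub>R a \<sigma>)" and t: "t \<ge> 0"
    and c: "\<And>s. (c has_real_derivative c' s) (at s)" and cc: "continuous_on UNIV c'"
    and A: "\<And>s. s \<in> {0..t} \<Longrightarrow> A s = A0 + (LINT \<sigma>:{0..s}|lborel. a \<sigma>)" and Ac: "continuous_on {0..t} A"
  shows "(LINT s:{0..t}|lborel. of_real (c' s) * A s) = of_real (c t) * A t - of_real (c 0) * A0 - (LINT \<sigma>:{0..t}|lborel. of_real (c \<sigma>) * a \<sigma>)"
proof -
  have cR: "continuous_on {0..t} (\<lambda>s. complex_of_real (c' s))" by (intro continuous_on_of_real continuous_on_subset[OF cc]) simp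
  have "(LINT s:{0..t}|lborel. of_real (c' s) * A s) - (LINT s:{0..t}|lborel. of_real (c' s) * A0) 
      = (LINT s:{0..t}|lborel. of_real (c' s) * A s - of_real (c' s) * A0)"
    by (rule set_integral_diff(2)[symmetric]; intro set_integrable_Icc continuous_intros cR Ac)
  also have "\<dots> = (LINT s:{0..t}|lborel. of_real (c' s) * (LINT \<sigma>:{0..s}|lborel. a \<sigma>))"
    by (rule set_lebesgue_integral_cong) (auto simp: A algebra_simps)
  also have "\<dots> = of_real (c t) * (LINT \<sigma>:{0..t}|lborel. a \<sigma>) - (LINT \<sigma>:{0..t}|lborel. of_real (c \<sigma>) * a \<sigma>)"
    by (rule integral_by_parts_AC[OF a t c cc])
  also have "(LINT \<sigma>:{0..t}|lborel. a \<sigma>) = A t - A0" using A[of t] t by simp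
  finally have 1: "(LINT s:{0..t}|lborel. of_real (c' s) * A s) - (LINT s:{0..t}|lborel. of_real (c' s) * A0) = 
     of_real (c t) * (A t - A0) - (LINT \<sigma>:{0..t}|lborel. of_real (c \<sigma>) * a \<sigma>)" .
  have 2: "(LINT s:{0..t}|lborel. of_real (c' s) * A0) = of_real (c t) * A0 - of_real (c 0) * A0"
    unfolding set_lebesgue_integral_def
  proof (rule integral_FTC_atLeastAtMost[OF t])
    show "((\<lambda>x. complex_of_real (c x) * A0) has_vector_derivative complex_of_real (c' y) * A0) (at y within {0..t})" for y
      using c[of y] by (intro has_vector_derivative_mult_left has_vector_derivative_of_real) 
        (simp add: has_real_derivative_iff_has_vector_derivative has_vector_derivative_at_within)
    show "continuous_on {0..t} (\<lambda>x. complex_of_real (c' x) * A0)" by (intro continuous_intros cR)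
  qed
  show ?thesis using 1 unfolding 2 by (simp add: algebra_simps)
qed

lemma z_pulled_input:
  assumes "u \<in> sqint {0..t}"
  shows "zp (pulled_input h t u) k = (LINT \<sigma>:{0..t}|lborel. u \<sigma> * zp (orbit h \<sigma>) k)"
    "zq (pulled_input h t u) k = (LINT \<sigma>:{0..t}|lborel. u \<sigma> * zq (orbit h \<sigma>) k)"
    "integrable lborel (\<lambda>\<sigma>. indicator {0..t} \<sigma> *\<^sub>R (u \<sigma> * zp (orbit h \<sigma>) k))"
    "integrable lborel (\<lambda>\<sigma>. indicator {0..t} \<sigma> *\<^sub>R (u \<sigma> * zq (orbit h \<sigma>) k))"
  unfolding pulled_input_def set_lebesgue_integral_def
  using integral_bounded_linear[OF z_bounded_linear(1) orbit_integrable[OF assms, of h], of k]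
    integral_bounded_linear[OF z_bounded_linear(2) orbit_integrable[OF assms, of h], of k]
    integrable_bounded_linear[OF z_bounded_linear(1) orbit_integrable[OF assms, of h], of k]
    integrable_bounded_linear[OF z_bounded_linear(2) orbit_integrable[OF assms, of h], of k]
  by (simp_all add: z_linear(5-8) scaleR_conv_of_real)

lemma z_orbit: 
  "zp (orbit h \<sigma>) k = of_real (- sin (omega k * \<sigma>)) * cinner (control_vec h) (e_H0 k)"
  "zq (orbit h \<sigma>) k = of_real (cos (omega k * \<sigma>)) * cinner (control_vec h) (e_H0 k)"
  unfolding orbit_def grp by (simp_all add: zp_hcoef zq_def hcoef_linear)

text \<open>The oscillator equations, in integrated form because u is only square integrable. A and
  B are the coordinates in the frame that rotates with the free motion and change only through the
  input. Integrating the rotated sums by parts leaves the input terms, whose trigonometric factors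
  collapse.\<close>

lemma trajectory_ode:
  assumes u: "u \<in> L2_loc" and t: "t \<ge> 0"
  shows "zp (trajectory h u z t) k - zp z k = (LINT s:{0..t}|lborel. of_real (omega k) * zq (trajectory h u z s) k)"
    "zq (trajectory h u z t) k - zq z k = - (LINT s:{0..t}|lborel. of_real (omega k) * zp (trajectory h u z s) k)
       + cinner (control_vec h) (e_H0 k) * (LINT s:{0..t}|lborel. u s)"
proof -
  let ?w = "omega k" and ?b = "cinner (control_vec h) (e_H0 k)"
  have us: "u \<in> sqint {0..T}" for T using u by (auto simp: L2_loc_def)
  define A where "A s = zp z k + zp (pulled_input h s u) k" for s
  define B where "B s = zq z k + zq (pulled_input h s u) k" for s
  define a where "a \<sigma> = u \<sigma> * zp (orbit h \<sigma>) k" for \<sigma>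
  define b where "b \<sigma> = u \<sigma> * zq (orbit h \<sigma>) k" for \<sigma>
  have A: "A s = zp z k + (LINT \<sigma>:{0..s}|lborel. a \<sigma>)" and B: "B s = zq z k + (LINT \<sigma>:{0..s}|lborel. b \<sigma>)" for s
    by (simp_all add: A_def B_def a_def b_def z_pulled_input[OF us])
  have ia: "integrable lborel (\<lambda>\<sigma>. indicator {0..t} \<sigma> *\<^sub>R a \<sigma>)" and ib: "integrable lborel (\<lambda>\<sigma>. indicator {0..t} \<sigma> *\<^sub>R b \<sigma>)"
    unfolding a_def b_def by (rule z_pulled_input[OF us])+
  have cp: "continuous_on {0..t} (\<lambda>s. pulled_input h s u)"
    by (rule continuous_on_subset[OF pulled_input_continuous[OF u]]) auto
  have cA: "continuous_on {0..t} A" and cB: "continuous_on {0..t} B" unfolding A_def B_def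
    by (intro continuous_intros bounded_linear.continuous_on[OF z_bounded_linear(1)] bounded_linear.continuous_on[OF z_bounded_linear(2)] cp)+
  have zt: "zp (trajectory h u z s) k = of_real (cos (?w * s)) * A s + of_real (sin (?w * s)) * B s"
    "zq (trajectory h u z s) k = of_real (- sin (?w * s)) * A s + of_real (cos (?w * s)) * B s" for s
    by (simp_all add: trajectory_def grp z_linear A_def B_def)
  have dc: "((\<lambda>s. cos (?w * s)) has_real_derivative (- ?w * sin (?w * s))) (at s)"
    and ds: "((\<lambda>s. sin (?w * s)) has_real_derivative (?w * cos (?w * s))) (at s)" for s
    by (auto intro!: derivative_eq_intros)
  have cc: "continuous_on UNIV (\<lambda>s. - ?w * sin (?w * s))" "continuous_on UNIV (\<lambda>s. ?w * cos (?w * s))"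
    by (intro continuous_intros)+
  note I1 = integral_by_parts_AC'[OF ia t dc cc(1) A cA]
  note I2 = integral_by_parts_AC'[OF ib t ds cc(2) B cB]
  note I3 = integral_by_parts_AC'[OF ia t ds cc(2) A cA]
  note I4 = integral_by_parts_AC'[OF ib t dc cc(1) B cB]
  have isum: "(LINT s:{0..t}|lborel. of_real (c s) * X s + of_real (d s) * Y s) = (LINT s:{0..t}|lborel. of_real (c s) * X s) + (LINT s:{0..t}|lborel. of_real (d s) * Y s)"
    if "continuous_on UNIV c" "continuous_on UNIV d" "continuous_on {0..t} X" "continuous_on {0..t} Y" for c d :: "real \<Rightarrow> real" and X Y :: "real \<Rightarrow> complex"
    by (rule set_integral_add(2); intro set_integrable_Icc continuous_intros that continuous_on_subset[OF that(1)] continuous_on_subset[OF that(2)]; simp)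
  have ica: "set_integrable lborel {0..t} (\<lambda>\<sigma>. of_real (c \<sigma>) * f \<sigma>)"
    if c: "continuous_on UNIV c" "\<And>s. \<bar>c s\<bar> \<le> 1" and f: "integrable lborel (\<lambda>\<sigma>. indicator {0..t} \<sigma> *\<^sub>R f \<sigma>)" for c :: "real \<Rightarrow> real" and f :: "real \<Rightarrow> complex"
    unfolding set_integrable_def
  proof (rule Bochner_Integration.integrable_bound[OF f])
    have [measurable]: "c \<in> borel_measurable borel" "(\<lambda>\<sigma>. indicator {0..t} \<sigma> *\<^sub>R f \<sigma>) \<in> borel_measurable borel" 
      using c(1) f by (auto intro: borel_measurable_continuous_onI)
    have "(\<lambda>\<sigma>. of_real (c \<sigma>) * (indicator {0..t} \<sigma> *\<^sub>R f \<sigma>)) \<in> borel_measurable lborel" by measurable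
    then show "(\<lambda>\<sigma>. indicator {0..t} \<sigma> *\<^sub>R (of_real (c \<sigma>) * f \<sigma>)) \<in> borel_measurable lborel" by simp
    show "AE \<sigma> in lborel. norm (indicator {0..t} \<sigma> *\<^sub>R (of_real (c \<sigma>) * f \<sigma>)) \<le> norm (indicator {0..t} \<sigma> *\<^sub>R f \<sigma>)"
      using c(2) by (intro always_eventually) (auto simp: indicator_def norm_mult mult_left_le_one_le)
  qed
  have ct: "continuous_on UNIV (\<lambda>s. cos (?w * s))" "continuous_on UNIV (\<lambda>s. sin (?w * s))" by (intro continuous_intros)+
  \<comment> \<open>The contributions \<open>- cos sin\<close> and \<open>sin cos\<close> cancel:
    the input does not act on the elevation directly.\<close>
  have "(LINT \<sigma>:{0..t}|lborel. of_real (cos (?w * \<sigma>)) * a \<sigma>) + (LINT \<sigma>:{0..t}|lborel. of_real (sin (?w * \<sigma>)) * b \<sigma>)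
    = (LINT \<sigma>:{0..t}|lborel. of_real (cos (?w * \<sigma>)) * a \<sigma> + of_real (sin (?w * \<sigma>)) * b \<sigma>)"
    by (rule set_integral_add(2)[symmetric]; intro ica ct ia ib; simp)
  also have "\<dots> = (LINT \<sigma>:{0..t}|lborel. 0)"
    by (intro set_lebesgue_integral_cong) (auto simp: a_def b_def z_orbit algebra_simps)
  finally have Z1: "(LINT \<sigma>:{0..t}|lborel. of_real (cos (?w * \<sigma>)) * a \<sigma>) + (LINT \<sigma>:{0..t}|lborel. of_real (sin (?w * \<sigma>)) * b \<sigma>) = 0"
    by simp
  \<comment> \<open>Here the squares of cos and sin add up to 1, and the full input acts on the
    velocity.\<close>
  have "(LINT \<sigma>:{0..t}|lborel. of_real (cos (?w * \<sigma>)) * b \<sigma>) - (LINT \<sigma>:{0..t}|lborel. of_real (sin (?w * \<sigma>)) * a \<sigma>)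
    = (LINT \<sigma>:{0..t}|lborel. of_real (cos (?w * \<sigma>)) * b \<sigma> - of_real (sin (?w * \<sigma>)) * a \<sigma>)"
    by (rule set_integral_diff(2)[symmetric]; intro ica ct ia ib; simp)
  also have "\<dots> = (LINT \<sigma>:{0..t}|lborel. ?b * u \<sigma>)"
  proof (intro set_lebesgue_integral_cong allI impI)
    fix \<sigma>
    have "complex_of_real (cos (?w * \<sigma>)) * of_real (cos (?w * \<sigma>)) + of_real (sin (?w * \<sigma>)) * of_real (sin (?w * \<sigma>)) = 1"
      by (metis of_real_add of_real_mult of_real_1 sin_cos_squared_add3)
    moreover have "of_real (cos (?w * \<sigma>)) * b \<sigma> - of_real (sin (?w * \<sigma>)) * a \<sigma> = 
       (complex_of_real (cos (?w * \<sigma>)) * of_real (cos (?w * \<sigma>)) + of_real (sin (?w * \<sigma>)) * of_real (sin (?w * \<sigma>))) * (?b * u \<sigma>)"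
      unfolding a_def b_def z_orbit by (simp add: algebra_simps)
    ultimately show "of_real (cos (?w * \<sigma>)) * b \<sigma> - of_real (sin (?w * \<sigma>)) * a \<sigma> = ?b * u \<sigma>" by simp
  qed simp
  also have "\<dots> = ?b * (LINT s:{0..t}|lborel. u s)" by simp
  finally have Z2: "(LINT \<sigma>:{0..t}|lborel. of_real (cos (?w * \<sigma>)) * b \<sigma>) - (LINT \<sigma>:{0..t}|lborel. of_real (sin (?w * \<sigma>)) * a \<sigma>) = ?b * (LINT s:{0..t}|lborel. u s)" .
  have "(LINT s:{0..t}|lborel. of_real ?w * zq (trajectory h u z s) k) 
    = (LINT s:{0..t}|lborel. of_real (- ?w * sin (?w * s)) * A s + of_real (?w * cos (?w * s)) * B s)"
    unfolding zt by (intro set_lebesgue_integral_cong) (auto simp: algebra_simps)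
  also have "\<dots> = zp (trajectory h u z t) k - zp z k"
    unfolding isum[OF cc cA cB] I1 I2 zt using Z1 by (simp add: algebra_simps)
  finally show "zp (trajectory h u z t) k - zp z k = (LINT s:{0..t}|lborel. of_real ?w * zq (trajectory h u z s) k)" by simp
  have "(LINT s:{0..t}|lborel. of_real ?w * zp (trajectory h u z s) k) 
    = (LINT s:{0..t}|lborel. of_real (?w * cos (?w * s)) * A s - of_real (- ?w * sin (?w * s)) * B s)"
    unfolding zt by (intro set_lebesgue_integral_cong) (auto simp: algebra_simps)
  also have "\<dots> = (LINT s:{0..t}|lborel. of_real (?w * cos (?w * s)) * A s) - (LINT s:{0..t}|lborel. of_real (- ?w * sin (?w * s)) * B s)"
    by (rule set_integral_diff(2); intro set_integrable_Icc continuous_intros cA cB)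
  also have "\<dots> = zq z k - zq (trajectory h u z t) k + ?b * (LINT s:{0..t}|lborel. u s)"
    unfolding I3 I4 zt Z2[symmetric] by (simp add: algebra_simps)
  finally show "zq (trajectory h u z t) k - zq z k = - (LINT s:{0..t}|lborel. of_real ?w * zp (trajectory h u z s) k)
       + ?b * (LINT s:{0..t}|lborel. u s)" by simp
qed

section \<open>Solutions of the water wave system\<close>

lemma set_borel_measurable_L2_loc_H1:
  assumes "\<phi> \<in> L2_loc_H1"
  shows "(\<lambda>\<sigma>. indicator {0..T} \<sigma> *\<^sub>R H1_graph (\<phi> \<sigma>)) \<in> borel_measurable borel"
    "integrable lborel (\<lambda>\<sigma>. indicator {0..T} \<sigma> *\<^sub>R (norm (H1_graph (\<phi> \<sigma>)))\<^sup>2)"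
  using assms by (auto simp: L2_loc_H1_def L2_loc_def sqint_def set_borel_measurable_def set_integrable_def)

lemma grad_form_sqint:
  assumes \<phi>: "\<phi> \<in> L2_loc_H1"
  shows "(\<lambda>\<sigma>. cinner (grad (\<phi> \<sigma>)) g) \<in> sqint {0..T}"
proof -
  note m = set_borel_measurable_L2_loc_H1[OF \<phi>, of T]
  have "continuous_on UNIV (\<lambda>x. cinner (snd x) g :: complex)" for g :: "(real \<times> real) L2 \<times> (real \<times> real) L2"
    by (intro cinner.continuous_on continuous_intros)
  from measurable_compose[OF m(1) borel_measurable_continuous_onI[OF this]]
  have m2: "(\<lambda>\<sigma>. indicator {0..T} \<sigma> *\<^sub>R cinner (grad (\<phi> \<sigma>)) g) \<in> borel_measurable borel"
    by (simp add: grad_graph cinner.scaleR_left)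
  have "integrable lborel (\<lambda>\<sigma>. indicator {0..T} \<sigma> *\<^sub>R (cmod (cinner (grad (\<phi> \<sigma>)) g))\<^sup>2)"
  proof (rule Bochner_Integration.integrable_bound)
    show "integrable lborel (\<lambda>\<sigma>. (norm g)\<^sup>2 * (indicator {0..T} \<sigma> *\<^sub>R (norm (H1_graph (\<phi> \<sigma>)))\<^sup>2))"
      by (rule integrable_mult_right[OF m(2)])
    have e: "(cmod (indicator {0..T} \<sigma> *\<^sub>R cinner (grad (\<phi> \<sigma>)) g))\<^sup>2 = indicator {0..T} \<sigma> *\<^sub>R (cmod (cinner (grad (\<phi> \<sigma>)) g))\<^sup>2" for \<sigma>
      by (simp add: indicator_def)
    have "(\<lambda>\<sigma>. (cmod (indicator {0..T} \<sigma> *\<^sub>R cinner (grad (\<phi> \<sigma>)) g))\<^sup>2) \<in> borel_measurable lborel" using m2 by measurable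
    then show "(\<lambda>\<sigma>. indicator {0..T} \<sigma> *\<^sub>R (cmod (cinner (grad (\<phi> \<sigma>)) g))\<^sup>2) \<in> borel_measurable lborel" unfolding e .
    have "(cmod (cinner (grad v) g))\<^sup>2 \<le> (norm g)\<^sup>2 * (norm (H1_graph v))\<^sup>2" for v
    proof -
      have "norm (grad v) \<le> norm (H1_graph v)" using norm_snd_le[of "grad v" v] by (simp add: H1_graph_def grad_def)
      then have "cmod (cinner (grad v) g) \<le> norm g * norm (H1_graph v)"
        using norm_cinner_le[of "grad v" g] mult_right_mono[of "norm (grad v)" "norm (H1_graph v)" "norm g"]
        by (simp add: mult.commute)
      then have "(cmod (cinner (grad v) g))\<^sup>2 \<le> (norm g * norm (H1_graph v))\<^sup>2" by (rule power_mono) simp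
      then show ?thesis by (simp add: power_mult_distrib)
    qed
    then show "AE \<sigma> in lborel. norm (indicator {0..T} \<sigma> *\<^sub>R (cmod (cinner (grad (\<phi> \<sigma>)) g))\<^sup>2) \<le> 
        norm ((norm g)\<^sup>2 * (indicator {0..T} \<sigma> *\<^sub>R (norm (H1_graph (\<phi> \<sigma>)))\<^sup>2))"
      by (intro always_eventually) (auto simp: indicator_def)
  qed
  then show ?thesis using m2 by (simp add: sqint_def set_borel_measurable_def set_integrable_def)
qed

lemma at_within_Ici_nonbot: "t \<ge> 0 \<Longrightarrow> at t within {0::real..} \<noteq> bot"
proof
  assume t: "t \<ge> 0" "at t within {0..} = bot"
  then have "{t<..} \<subseteq> {0..}" by auto
  then have "at_right t \<le> at t within {0..}" by (rule at_le)
  then show False using t(2) by (simp add: bot_unique)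
qed

lemma at_within_Ici: "0 \<le> t \<Longrightarrow> t < T \<Longrightarrow> at t within {0::real..T} = at t within {0..}"
  by (rule at_within_nhd[of _ "{..<T}"]) auto

lemma LINT_eq_integral:
  fixes f :: "real \<Rightarrow> complex"
  shows "continuous_on {a..b} f \<Longrightarrow> (LINT s:{a..b}|lborel. f s) = integral {a..b} f"
  by (rule set_borel_integral_eq_integral(2)[OF set_integrable_Icc])

text \<open>The derivative exists in the weaker space \<open>H0\<close> only. There the elevation
  equals its initial value plus the integral of the velocity, as its coefficients show; the velocity
  is continuous, so the fundamental theorem applies.\<close>

lemma trajectory_derivative:
  assumes u: "u \<in> L2_loc" and t: "t \<ge> 0"
  shows "((\<lambda>s. H0_of_Hhalf (fst (trajectory h u z s))) has_vector_derivative snd (trajectory h u z t)) (at t within {0..})"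
proof -
  let ?w = "\<lambda>s. snd (trajectory h u z s)"
  have cw: "continuous_on {0..T} ?w" for T
    by (intro continuous_on_snd continuous_on_subset[OF trajectory_continuous[OF u]]) auto
  have "H0_of_Hhalf (fst (trajectory h u z s)) = H0_of_Hhalf (fst z) + integral {0..s} ?w" if s: "s \<ge> 0" for s
  proof (rule e_H0_ext)
    fix k
    have c: "continuous_on {0..s} (\<lambda>r. zq (trajectory h u z r) k)"
      unfolding zq_def by (intro cinner.continuous_on cw continuous_intros)
    have "cinner (integral {0..s} ?w) (e_H0 k) = integral {0..s} (\<lambda>r. zq (trajectory h u z r) k)"
      using integral_linear[OF integrable_continuous_real[OF cw] cinner.bounded_linear_left[of "e_H0 k"], of s]
      by (simp add: o_def zq_def)
    also have "\<dots> = (LINT r:{0..s}|lborel. zq (trajectory h u z r) k)" by (rule LINT_eq_integral[OF c, symmetric])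
    finally have i: "cinner (integral {0..s} ?w) (e_H0 k) = (LINT r:{0..s}|lborel. zq (trajectory h u z r) k)" .
    have "of_real (omega k) * (hcoef (fst (trajectory h u z s)) k - hcoef (fst z) k) = of_real (omega k) * cinner (integral {0..s} ?w) (e_H0 k)"
      using trajectory_ode(1)[OF u s, of h z k] unfolding zp_hcoef i by (simp add: right_diff_distrib)
    then have "hcoef (fst (trajectory h u z s)) k - hcoef (fst z) k = cinner (integral {0..s} ?w) (e_H0 k)"
      using omega(2)[of k] by simp
    then show "cinner (H0_of_Hhalf (fst (trajectory h u z s))) (e_H0 k) = cinner (H0_of_Hhalf (fst z) + integral {0..s} ?w) (e_H0 k)"
      by (simp add: hcoef_def cinner.add_left algebra_simps)
  qed
  note eq = this
  \<comment> \<open>The interval is extended beyond t so that the derivative within it is the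
    derivative within \<open>{0..}\<close>, one-sided only at 0.\<close>
  have "((\<lambda>s. integral {0..s} ?w) has_vector_derivative ?w t) (at t within {0..t + 1})"
    by (rule integral_has_vector_derivative[OF cw]) (use t in auto)
  then have "((\<lambda>s. H0_of_Hhalf (fst z) + integral {0..s} ?w) has_vector_derivative ?w t) (at t within {0..})"
    using t at_within_Ici[of t "t + 1"] by (auto intro!: derivative_eq_intros)
  then show ?thesis
    by (rule has_vector_derivative_transform[rotated 2]) (use t eq in auto)
qed

lemma zeta_dot_eqI:
  assumes "t \<ge> 0" "((\<lambda>s. H0_of_Hhalf (\<zeta> s)) has_vector_derivative w) (at t within {0..})"
  shows "zeta_dot \<zeta> t = w"
  unfolding zeta_dot_def by (rule vector_derivative_within[OF at_within_Ici_nonbot[OF assms(1)] assms(2)])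

lemma trajectory_solution:
  assumes h_mean: "(LINT y:{-1..0}|lborel. rep_L2 h y) = 0" and u: "u \<in> L2_loc"
  shows "\<exists>\<phi>. WW_solution h u \<phi> (\<lambda>t. fst (trajectory h u z t))"
    and "t \<ge> 0 \<Longrightarrow> zeta_dot (\<lambda>t. fst (trajectory h u z t)) t = snd (trajectory h u z t)"
proof -
  let ?z = "trajectory h u z" and ?\<zeta> = "\<lambda>t. fst (trajectory h u z t)"
  show zd: "t \<ge> 0 \<Longrightarrow> zeta_dot ?\<zeta> t = snd (?z t)" for t
    by (rule zeta_dot_eqI[OF _ trajectory_derivative[OF u]])
  have us: "u \<in> sqint {0..T}" for T using u by (auto simp: L2_loc_def)
  obtain n where n: "n \<in> sobolev_H1" "trace_top n = 0"
    "\<And>\<Psi>. \<Psi> \<in> sobolev_H1 \<Longrightarrow> cinner (grad n) (grad \<Psi>) = cinner h (trace_left \<Psi>) + cinner (L2_of_H0 (control_vec h)) (trace_top \<Psi>)"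
    using neumann_exists[OF h_mean] by blast
  define \<phi> where "\<phi> t = u t *\<^sub>C n - extension (?\<zeta> t)" for t
  have un: "u t *\<^sub>C n \<in> sobolev_H1" for t by (rule H1_scaleC(1)[OF n(1)])
  have pH: "\<phi> t \<in> sobolev_H1" for t unfolding \<phi>_def by (rule H1_diff(1)[OF un extension_H1])
  have pg: "H1_graph (\<phi> t) = u t *\<^sub>C H1_graph n - H1_graph (extension (?\<zeta> t))" for t
    unfolding \<phi>_def by (simp add: H1_diff(4)[OF un extension_H1] H1_scaleC(4)[OF n(1)])
  have cz: "continuous_on {0..} ?z" by (rule trajectory_continuous[OF u])
  have czT: "continuous_on {0..T} ?\<zeta>" for T by (intro continuous_on_fst continuous_on_subset[OF cz]) auto
  have cE: "continuous_on {0..T} (\<lambda>t. H1_graph (extension (?\<zeta> t)))" for T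
    by (rule bounded_linear.continuous_on[OF bounded_linear_extension czT])
  have "\<phi> \<in> L2_loc_H1" unfolding L2_loc_H1_def L2_loc_def sqint_def mem_Collect_eq
  proof (intro conjI allI impI)
    fix T :: real
    have "(\<lambda>t. (indicator {0..T} t *\<^sub>R u t) *\<^sub>C H1_graph n) \<in> borel_measurable lborel"
      by (rule scaleC_measurable) (use us[of T] in \<open>simp_all add: sqint_def set_borel_measurable_def\<close>)
    moreover have "(\<lambda>t. indicator {0..T} t *\<^sub>R H1_graph (extension (?\<zeta> t))) \<in> borel_measurable lborel"
      using borel_measurable_continuous_on_indicator[OF _ cE, of T] by simp
    ultimately have "(\<lambda>t. (indicator {0..T} t *\<^sub>R u t) *\<^sub>C H1_graph n - indicator {0..T} t *\<^sub>R H1_graph (extension (?\<zeta> t))) \<in> borel_measurable lborel"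
      by (rule borel_measurable_diff)
    then have m: "(\<lambda>t. indicator {0..T} t *\<^sub>R H1_graph (\<phi> t)) \<in> borel_measurable lborel"
      unfolding pg scaleR_diff_right by (simp only: scaleC.scaleR_left)
    then show "set_borel_measurable lborel {0..T} (\<lambda>t. H1_graph (\<phi> t))" by (simp add: set_borel_measurable_def)
    have "bounded ((\<lambda>t. H1_graph (extension (?\<zeta> t))) ` {0..T})"
      by (intro compact_imp_bounded compact_continuous_image cE) simp
    then obtain M where "\<forall>x\<in>(\<lambda>t. H1_graph (extension (?\<zeta> t))) ` {0..T}. norm x \<le> M" unfolding bounded_iff by blast
    then have M: "\<And>t. t \<in> {0..T} \<Longrightarrow> norm (H1_graph (extension (?\<zeta> t))) \<le> M" by simp
    show "set_integrable lborel {0..T} (\<lambda>t. (norm (H1_graph (\<phi> t)))\<^sup>2)"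
      unfolding set_integrable_def
    proof (rule Bochner_Integration.integrable_bound)
      have "integrable lborel (\<lambda>t. indicator {0..T} t *\<^sub>R (cmod (u t))\<^sup>2)" using us[of T] by (simp add: sqint_def set_integrable_def)
      moreover have "integrable lborel (indicat_real {0..T})"
        by (rule integrable_real_indicator) (simp_all add: emeasure_lborel_Icc_eq)
      ultimately show "integrable lborel (\<lambda>t. (2 * (norm (H1_graph n))\<^sup>2) * (indicator {0..T} t *\<^sub>R (cmod (u t))\<^sup>2) + (2 * M\<^sup>2) * indicator {0..T} t)"
        by (intro Bochner_Integration.integrable_add integrable_mult_right)
      have e: "(norm (indicator {0..T} t *\<^sub>R H1_graph (\<phi> t)))\<^sup>2 = indicator {0..T} t *\<^sub>R (norm (H1_graph (\<phi> t)))\<^sup>2" for t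
        by (simp add: indicator_def)
      have "(\<lambda>t. (norm (indicator {0..T} t *\<^sub>R H1_graph (\<phi> t)))\<^sup>2) \<in> borel_measurable lborel" using m by measurable
      then show "(\<lambda>t. indicator {0..T} t *\<^sub>R (norm (H1_graph (\<phi> t)))\<^sup>2) \<in> borel_measurable lborel" unfolding e .
      have "(norm (H1_graph (\<phi> t)))\<^sup>2 \<le> 2 * (norm (H1_graph n))\<^sup>2 * (cmod (u t))\<^sup>2 + 2 * M\<^sup>2" if t: "t \<in> {0..T}" for t
      proof -
        let ?a = "cmod (u t) * norm (H1_graph n)"
        have "norm (H1_graph (\<phi> t)) \<le> ?a + M"
          unfolding pg using norm_triangle_ineq4[of "u t *\<^sub>C H1_graph n" "H1_graph (extension (?\<zeta> t))"] M[OF t] by (simp add: norm_scaleC)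
        then have "(norm (H1_graph (\<phi> t)))\<^sup>2 \<le> (?a + M)\<^sup>2" by (rule power_mono) simp
        also have "\<dots> \<le> 2 * ?a\<^sup>2 + 2 * M\<^sup>2" using sum_squares_bound[of ?a M] by (simp add: power2_sum)
        finally show ?thesis by (simp add: power_mult_distrib mult_ac)
      qed
      then show "AE t in lborel. norm (indicator {0..T} t *\<^sub>R (norm (H1_graph (\<phi> t)))\<^sup>2) \<le> 
         norm ((2 * (norm (H1_graph n))\<^sup>2) * (indicator {0..T} t *\<^sub>R (cmod (u t))\<^sup>2) + (2 * M\<^sup>2) * indicator {0..T} t)"
        by (intro always_eventually) (auto simp: indicator_def)
    qed
  qed (rule pH)
  moreover have "continuous_on {0..} ?\<zeta>" by (intro continuous_on_fst cz)
  moreover have "(\<lambda>s. H0_of_Hhalf (?\<zeta> s)) differentiable_on {0..}"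
    unfolding differentiable_on_def using differentiableI_vector[OF trajectory_derivative[OF u]] by auto
  moreover have "continuous_on {0..} (zeta_dot ?\<zeta>)"
    using continuous_on_snd[OF cz] zd by (subst continuous_on_cong[OF refl, of _ _ "\<lambda>t. snd (?z t)"]) auto
  moreover have "trace_top (\<phi> t) + L2_of_H0 (H0_of_Hhalf (?\<zeta> t)) = 0" for t
    unfolding \<phi>_def top.tr_diff[OF un extension_H1] top.tr_scaleC[OF n(1)] n(2) trace_extension by (simp add: scaleC.zero_right)
  moreover have "cinner (L2_of_H0 (zeta_dot ?\<zeta> t)) (trace_top \<Psi>) - cinner (L2_of_H0 (zeta_dot ?\<zeta> 0)) (trace_top \<Psi>) =
      (LINT \<sigma>:{0..t}|lborel. cinner (weak_dx (\<phi> \<sigma>)) (weak_dx \<Psi>) + cinner (weak_dy (\<phi> \<sigma>)) (weak_dy \<Psi>)) -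
      (LINT \<sigma>:{0..t}|lborel. u \<sigma> * cinner h (trace_left \<Psi>))" if P: "\<Psi> \<in> sobolev_H1" and t: "t > 0" for \<Psi> t
  proof -
    define q where "q = trace_half \<Psi>"
    define U where "U = (LINT \<sigma>:{0..t}|lborel. u \<sigma>)"
    \<comment> \<open>The elevation is integrated over time as an element of \<open>Hhalf\<close>.
      Pairing Z with the trace q is then a single series in k, which avoids exchanging a time
      integral with an infinite sum.\<close>
    define Z where "Z = integral {0..t} ?\<zeta>"
    let ?b = "cinner (control_vec h) (H0_of_Hhalf q)"
    have iu': "set_integrable lborel {0..t} (\<lambda>\<sigma>. u \<sigma> * c)" for c
      using integrable_mult_left[OF sqint_set_integrable[OF us[of t]], of c] by (simp add: set_integrable_def)
    have cq: "continuous_on {0..t} (\<lambda>\<sigma>. cinner (?\<zeta> \<sigma>) q)" by (intro cinner.continuous_on czT continuous_intros)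
    \<comment> \<open>The left-trace term of the Neumann map is exactly the input term of the weak
      formulation, so the two cancel and only surface quantities remain.\<close>
    have form: "cinner (weak_dx (\<phi> \<sigma>)) (weak_dx \<Psi>) + cinner (weak_dy (\<phi> \<sigma>)) (weak_dy \<Psi>) 
        = u \<sigma> * cinner h (trace_left \<Psi>) + (u \<sigma> * ?b - cinner (?\<zeta> \<sigma>) q)" for \<sigma>
    proof -
      have "cinner (weak_dx (\<phi> \<sigma>)) (weak_dx \<Psi>) + cinner (weak_dy (\<phi> \<sigma>)) (weak_dy \<Psi>) = cinner (grad (\<phi> \<sigma>)) (grad \<Psi>)"
        by (simp add: cinner_grad)
      also have "\<dots> = u \<sigma> * cinner (grad n) (grad \<Psi>) - cinner (?\<zeta> \<sigma>) q"
        unfolding \<phi>_def grad_linear(2)[OF un extension_H1] grad_linear(3)[OF n(1)] q_def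
        by (simp add: cinner.diff_left cinner_scaleC_left grad_extension[OF P])
      finally show ?thesis unfolding n(3)[OF P] cinner_H0_trace[OF P] q_def by (simp add: algebra_simps)
    qed
    have "(LINT \<sigma>:{0..t}|lborel. cinner (weak_dx (\<phi> \<sigma>)) (weak_dx \<Psi>) + cinner (weak_dy (\<phi> \<sigma>)) (weak_dy \<Psi>)) -
      (LINT \<sigma>:{0..t}|lborel. u \<sigma> * cinner h (trace_left \<Psi>)) = (LINT \<sigma>:{0..t}|lborel. u \<sigma> * ?b - cinner (?\<zeta> \<sigma>) q)"
      unfolding form
      by (subst set_integral_add(2)[OF iu' set_integral_diff(1)[OF iu' set_integrable_Icc[OF cq]]]) simp
    also have "\<dots> = (LINT \<sigma>:{0..t}|lborel. u \<sigma> * ?b) - (LINT \<sigma>:{0..t}|lborel. cinner (?\<zeta> \<sigma>) q)"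
      by (rule set_integral_diff(2)[OF iu' set_integrable_Icc[OF cq]])
    also have "(LINT \<sigma>:{0..t}|lborel. u \<sigma> * ?b) = U * ?b" by (simp add: U_def)
    also have "(LINT \<sigma>:{0..t}|lborel. cinner (?\<zeta> \<sigma>) q) = cinner Z q"
      using integral_linear[OF integrable_continuous_real[OF czT] cinner.bounded_linear_left[of q], of t]
      unfolding LINT_eq_integral[OF cq] Z_def by (simp add: o_def)
    finally have R: "(LINT \<sigma>:{0..t}|lborel. cinner (weak_dx (\<phi> \<sigma>)) (weak_dx \<Psi>) + cinner (weak_dy (\<phi> \<sigma>)) (weak_dy \<Psi>)) -
      (LINT \<sigma>:{0..t}|lborel. u \<sigma> * cinner h (trace_left \<Psi>)) = U * ?b - cinner Z q" .
    \<comment> \<open>The weak formulation for a general test function is this identity for single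
      coefficients, summed against the coefficients of its trace.\<close>
    have co: "cinner (snd (?z t) - snd (?z 0)) (e_H0 k) = U * cinner (control_vec h) (e_H0 k) - of_real (w_half k) * hcoef Z k" for k
    proof -
      have bl: "bounded_linear (\<lambda>x. hcoef x k)" unfolding hcoef_def
        by (rule bounded_linear_compose[OF cinner.bounded_linear_left bounded_linear_H0_of_Hhalf])
      have ck: "continuous_on {0..t} (\<lambda>s. hcoef (?\<zeta> s) k)" by (rule bounded_linear.continuous_on[OF bl czT])
      have "(LINT s:{0..t}|lborel. of_real (omega k) * zp (?z s) k) = (LINT s:{0..t}|lborel. of_real (w_half k) * hcoef (?\<zeta> s) k)"
        unfolding zp_hcoef mult.assoc[symmetric] of_real_mult[symmetric] omega(3) ..
      also have "\<dots> = of_real (w_half k) * hcoef Z k"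
        using integral_linear[OF integrable_continuous_real[OF czT] bl, of t]
        by (simp add: LINT_eq_integral[OF ck] Z_def o_def)
      finally show ?thesis
        using trajectory_ode(2)[OF u less_imp_le[OF t], of h z k]
        by (simp add: zq_def cinner.diff_left trajectory_0 U_def algebra_simps)
    qed
    have "(\<lambda>k. cinner (snd (?z t) - snd (?z 0)) (e_H0 k) * cnj (cinner (H0_of_Hhalf q) (e_H0 k))) sums cinner (snd (?z t) - snd (?z 0)) (H0_of_Hhalf q)"
      by (rule H0_sums)
    moreover have "(\<lambda>k. U * (cinner (control_vec h) (e_H0 k) * cnj (cinner (H0_of_Hhalf q) (e_H0 k))) - of_real (w_half k) * hcoef Z k * cnj (hcoef q k)) sums (U * ?b - cinner Z q)"
      by (intro sums_diff sums_mult H0_sums Hhalf_sums)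
    moreover have "cinner (snd (?z t) - snd (?z 0)) (e_H0 k) * cnj (cinner (H0_of_Hhalf q) (e_H0 k)) = 
        U * (cinner (control_vec h) (e_H0 k) * cnj (cinner (H0_of_Hhalf q) (e_H0 k))) - of_real (w_half k) * hcoef Z k * cnj (hcoef q k)" for k
      unfolding co by (simp add: hcoef_def algebra_simps)
    ultimately have "cinner (snd (?z t) - snd (?z 0)) (H0_of_Hhalf q) = U * ?b - cinner Z q"
      using sums_unique2 by (simp only:) blast
    then show ?thesis unfolding R cinner_H0_trace[OF P] using t zd[of t] zd[of 0] by (simp add: cinner.diff_left q_def)
  qed
  ultimately have "WW_solution h u \<phi> ?\<zeta>"
    unfolding WW_solution_def by blast
  then show "\<exists>\<phi>. WW_solution h u \<phi> ?\<zeta>" by blast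
qed

section \<open>Uniqueness of elevation and potential\<close>

lemma oscillator_unique:
  fixes d e :: "real \<Rightarrow> complex"
  assumes w: "w > 0" and d: "\<And>t. t \<ge> 0 \<Longrightarrow> (d has_vector_derivative e t) (at t within {0..})"
    and e: "\<And>t. t \<ge> 0 \<Longrightarrow> (e has_vector_derivative (- w) *\<^sub>R d t) (at t within {0..})"
    and 0: "d 0 = 0" "e 0 = 0" and t: "t \<ge> 0"
  shows "d t = 0" "e t = 0"
proof -
  define E where "E s = w * (d s \<bullet> d s) + e s \<bullet> e s" for s
  have "(E has_vector_derivative 0) (at s within {0..})" if s: "s \<in> {0..}" for s
  proof -
    have "(E has_vector_derivative (w * (d s \<bullet> e s + e s \<bullet> d s) + (e s \<bullet> ((- w) *\<^sub>R d s) + ((- w) *\<^sub>R d s) \<bullet> e s))) (at s within {0..})"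
      unfolding E_def using s
      by (intro has_vector_derivative_add has_vector_derivative_mult_right 
          bounded_bilinear.has_vector_derivative[OF bounded_bilinear_inner] d e) auto
    then show ?thesis by (simp add: inner_commute algebra_simps)
  qed
  then obtain c where "\<And>s. s \<in> {0..} \<Longrightarrow> E s = c"
    using has_vector_derivative_zero_constant[of "{0..}" E] by auto
  then have "E t = 0" using t 0 by (simp add: E_def) (metis E_def add.right_neutral atLeast_iff inner_zero_left mult_zero_right order_refl)
  moreover have "0 \<le> w * (d t \<bullet> d t)" "0 \<le> e t \<bullet> e t" using w by auto
  ultimately have "w * (d t \<bullet> d t) = 0" "e t \<bullet> e t = 0" unfolding E_def by linarith+
  then show "d t = 0" "e t = 0" using w by auto
qed

text \<open>Testing with \<open>dirichlet k\<close> and inserting the surface condition turns the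
  gradient term into \<open>- w_half k\<close> times the elevation coefficient. A velocity
  coefficient alone need not be differentiable, as u is rough; but the trajectory obeys the same
  integrated equation, so in the difference the input drops out and an unforced oscillator starting
  at rest remains.\<close>

lemma WW_solution_trajectory:
  assumes sol: "WW_solution h u \<phi> \<zeta>" and h_mean: "(LINT y:{-1..0}|lborel. rep_L2 h y) = 0" and u: "u \<in> L2_loc" and t: "t \<ge> 0"
  shows "(\<zeta> t, zeta_dot \<zeta> t) = trajectory h u (\<zeta> 0, zeta_dot \<zeta> 0) t"
proof -
  define z where "z = trajectory h u (\<zeta> 0, zeta_dot \<zeta> 0)"
  have p: "\<phi> \<in> L2_loc_H1" and cz: "continuous_on {0..} \<zeta>" 
    and diff: "(\<lambda>s. H0_of_Hhalf (\<zeta> s)) differentiable_on {0..}" and czd: "continuous_on {0..} (zeta_dot \<zeta>)"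
    and tr: "AE t in lborel. t \<ge> 0 \<longrightarrow> trace_top (\<phi> t) + L2_of_H0 (H0_of_Hhalf (\<zeta> t)) = 0"
    and eq: "\<And>\<Psi> t. \<Psi> \<in> sobolev_H1 \<Longrightarrow> t > 0 \<Longrightarrow>
        cinner (L2_of_H0 (zeta_dot \<zeta> t)) (trace_top \<Psi>) - cinner (L2_of_H0 (zeta_dot \<zeta> 0)) (trace_top \<Psi>) =
        (LINT \<sigma>:{0..t}|lborel. cinner (weak_dx (\<phi> \<sigma>)) (weak_dx \<Psi>) + cinner (weak_dy (\<phi> \<sigma>)) (weak_dy \<Psi>)) -
        (LINT \<sigma>:{0..t}|lborel. u \<sigma> * cinner h (trace_left \<Psi>))"
    using sol by (auto simp: WW_solution_def)
  have pH: "\<phi> s \<in> sobolev_H1" if "s \<ge> 0" for s using p that by (auto simp: L2_loc_H1_def)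
  have zd: "((\<lambda>s. H0_of_Hhalf (\<zeta> s)) has_vector_derivative zeta_dot \<zeta> s) (at s within {0..})" if "s \<ge> 0" for s
    using diff that unfolding differentiable_on_def zeta_dot_def by (simp add: vector_derivative_works[symmetric])
  have ct: "continuous_on {0..} z" unfolding z_def by (rule trajectory_continuous[OF u])
  have z0: "z 0 = (\<zeta> 0, zeta_dot \<zeta> 0)" by (simp add: z_def trajectory_0)
  have "hcoef (\<zeta> t) k = hcoef (fst (z t)) k \<and> cinner (zeta_dot \<zeta> t) (e_H0 k) = zq (z t) k" for k
  proof -
    define d where "d s = hcoef (\<zeta> s) k - hcoef (fst (z s)) k" for s
    define e where "e s = cinner (zeta_dot \<zeta> s) (e_H0 k) - zq (z s) k" for s
    let ?w = "w_half k" and ?b = "cinner (control_vec h) (e_H0 k)"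
    have bl: "bounded_linear (\<lambda>x. hcoef x k)" unfolding hcoef_def
      by (rule bounded_linear_compose[OF cinner.bounded_linear_left bounded_linear_H0_of_Hhalf])
    have c1: "continuous_on {0..} (\<lambda>s. hcoef (\<zeta> s) k)" by (rule bounded_linear.continuous_on[OF bl cz])
    have c2: "continuous_on {0..} (\<lambda>s. hcoef (fst (z s)) k)" by (rule bounded_linear.continuous_on[OF bl continuous_on_fst[OF ct]])
    have cd: "continuous_on {0..} d" unfolding d_def by (intro continuous_on_diff c1 c2)
    have sub: "continuous_on {0..s} f" if "continuous_on {0..} f" for f :: "real \<Rightarrow> complex" and s
      by (rule continuous_on_subset[OF that]) auto
    have dd: "(d has_vector_derivative e s) (at s within {0..})" if s: "s \<ge> 0" for s
      unfolding d_def e_def hcoef_def zq_def z_def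
      by (intro has_vector_derivative_diff bounded_linear.has_vector_derivative[OF cinner.bounded_linear_left] zd s trajectory_derivative[OF u])
    have es: "e s = - of_real ?w * integral {0..s} d" if s: "s \<ge> 0" for s
    proof (cases "s = 0")
      case True
      then show ?thesis by (simp add: e_def z0 zq_def)
    next
      case False
      then have s0: "s > 0" using s by simp
      note D = dirichlet_H1[of k]
      have m: "(\<lambda>\<sigma>. indicator {0..s} \<sigma> *\<^sub>R cinner (grad (\<phi> \<sigma>)) (grad (dirichlet k))) \<in> borel_measurable lborel"
        using grad_form_sqint[OF p] by (simp add: sqint_def set_borel_measurable_def)
      have "(LINT \<sigma>|lborel. indicator {0..s} \<sigma> *\<^sub>R cinner (grad (\<phi> \<sigma>)) (grad (dirichlet k))) = (LINT \<sigma>|lborel. indicator {0..s} \<sigma> *\<^sub>R (- of_real ?w * hcoef (\<zeta> \<sigma>) k))"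
      proof (rule integral_cong_AE[OF m])
        have "set_integrable lborel {0..s} (\<lambda>\<sigma>. - of_real ?w * hcoef (\<zeta> \<sigma>) k)"
          by (intro set_integrable_Icc continuous_intros sub[OF c1])
        then show "(\<lambda>\<sigma>. indicator {0..s} \<sigma> *\<^sub>R (- of_real ?w * hcoef (\<zeta> \<sigma>) k)) \<in> borel_measurable lborel" 
          unfolding set_integrable_def by (rule borel_measurable_integrable)
        show "AE \<sigma> in lborel. indicator {0..s} \<sigma> *\<^sub>R cinner (grad (\<phi> \<sigma>)) (grad (dirichlet k)) = indicator {0..s} \<sigma> *\<^sub>R (- of_real ?w * hcoef (\<zeta> \<sigma>) k)"
          \<comment> \<open>The surface condition holds only for almost every time, which is enough
            under the time integral.\<close>
          using tr
        proof eventually_elim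
          case (elim \<sigma>)
          show ?case
          proof (cases "\<sigma> \<in> {0..s}")
            case True
            then have "trace_top (\<phi> \<sigma>) = - L2_of_H0 (H0_of_Hhalf (\<zeta> \<sigma>))" using elim by (simp add: eq_neg_iff_add_eq_0)
            then show ?thesis using True by (simp add: grad_dirichlet[OF pH] cinner.minus_left hcoef_def cinner_H0_def L2_of_e_H0)
          qed simp
        qed
      qed
      then have I: "(LINT \<sigma>:{0..s}|lborel. cinner (grad (\<phi> \<sigma>)) (grad (dirichlet k))) = - of_real ?w * (LINT \<sigma>:{0..s}|lborel. hcoef (\<zeta> \<sigma>) k)"
        by (simp only: set_lebesgue_integral_def[symmetric] set_integral_mult_right)
      have 1: "cinner (zeta_dot \<zeta> s) (e_H0 k) - cinner (zeta_dot \<zeta> 0) (e_H0 k) = - of_real ?w * (LINT \<sigma>:{0..s}|lborel. hcoef (\<zeta> \<sigma>) k) + ?b * (LINT \<sigma>:{0..s}|lborel. u \<sigma>)"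
        using eq[OF D s0] unfolding cinner_grad[symmetric] I trace_dirichlet control_vec
        by (simp add: cinner_H0_def L2_of_e_H0 mult.commute)
      have "(LINT r:{0..s}|lborel. of_real (omega k) * zp (z r) k) = of_real ?w * (LINT r:{0..s}|lborel. hcoef (fst (z r)) k)"
        unfolding zp_hcoef mult.assoc[symmetric] of_real_mult[symmetric] omega(3) by simp
      then have 2: "zq (z s) k - cinner (zeta_dot \<zeta> 0) (e_H0 k) = - of_real ?w * (LINT r:{0..s}|lborel. hcoef (fst (z r)) k) + ?b * (LINT \<sigma>:{0..s}|lborel. u \<sigma>)"
        using trajectory_ode(2)[OF u s, of h "(\<zeta> 0, zeta_dot \<zeta> 0)" k] by (simp add: z_def zq_def[of "(_, _)"])
      have "e s = - of_real ?w * ((LINT \<sigma>:{0..s}|lborel. hcoef (\<zeta> \<sigma>) k) - (LINT r:{0..s}|lborel. hcoef (fst (z r)) k))"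
        using 1 2 unfolding e_def by (simp add: algebra_simps)
      also have "(LINT \<sigma>:{0..s}|lborel. hcoef (\<zeta> \<sigma>) k) - (LINT r:{0..s}|lborel. hcoef (fst (z r)) k) = (LINT r:{0..s}|lborel. d r)"
        unfolding d_def by (rule set_integral_diff(2)[symmetric]; intro set_integrable_Icc sub c1 c2)
      finally show ?thesis using LINT_eq_integral[OF sub[OF cd]] by simp
    qed
    \<comment> \<open>The difference of velocities is a multiple of the integral of the continuous
      function d, hence differentiable.\<close>
    have de: "(e has_vector_derivative (- ?w) *\<^sub>R d s) (at s within {0..})" if s: "s \<ge> 0" for s
    proof -
      have "((\<lambda>r. integral {0..r} d) has_vector_derivative d s) (at s within {0..s + 1})"
        by (rule integral_has_vector_derivative[OF sub[OF cd]]) (use s in auto)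
      then have "((\<lambda>r. - of_real ?w * integral {0..r} d) has_vector_derivative - of_real ?w * d s) (at s within {0..})"
        using s at_within_Ici[of s "s + 1"] by (intro has_vector_derivative_mult_right) simp
      then have "(e has_vector_derivative - of_real ?w * d s) (at s within {0..})"
        by (rule has_vector_derivative_transform[rotated 2]) (use s es in auto)
      then show ?thesis by (simp add: scaleR_conv_of_real)
    qed
    have "d 0 = 0" "e 0 = 0" by (simp_all add: d_def e_def z0 zq_def)
    from oscillator_unique[OF w_half_bounds(1)[of k] dd de this t] 
    show ?thesis by (simp add: d_def e_def)
  qed
  then show ?thesis unfolding z_def[symmetric]
    by (intro z_ext) (simp_all add: zp_hcoef, simp add: zq_def)
qed

text \<open>On \<open>{0..N}\<close> the function is orthogonal to the indicators of bounded
  intervals. Half-lines are an intersection-stable generator of the Borel sets, so it is orthogonal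
  to every square integrable function, itself included.\<close>

lemma AE_zero_of_integrals_zero:
  fixes f :: "real \<Rightarrow> complex"
  assumes f: "\<And>T. f \<in> sqint {0..T}" and z: "\<And>t. t > 0 \<Longrightarrow> (LINT x:{0..t}|lborel. f x) = 0"
  shows "AE x in lborel. x \<ge> 0 \<longrightarrow> f x = 0"
proof -
  have z': "(LINT x:{0..t}|lborel. f x) = 0" for t
  proof (cases "t > 0")
    case False
    have "AE x in lborel. indicator {0..t} x *\<^sub>R f x = 0"
      using AE_lborel_singleton[of "0::real"] by eventually_elim (use False in \<open>auto simp: indicator_def\<close>)
    then show ?thesis unfolding set_lebesgue_integral_def by (rule integral_eq_zero_AE)
  qed (rule z)
  have "AE x in lborel. indicator {0..real N} x *\<^sub>R f x = 0" for N
  proof -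
    define F where "F = to_L2 {0..real N} f"
    define V where "V = {g. cinner F g = 0}"
    \<comment> \<open>A half-line cut by a ball around 0 is such an interval, and only its part in
      \<open>{0..N}\<close> meets the support. Negative m occur, which is why \<open>z'\<close>
      covers all real endpoints.\<close>
    have mem: "to_L2 {- real n..m} (\<lambda>_. 1) \<in> V" for n m
    proof -
      have "cinner F (to_L2 {- real n..m} (\<lambda>_. 1)) = (LINT x|lborel. (indicator {0..real N} x *\<^sub>R f x) * cnj (indicator {- real n..m} x *\<^sub>R 1))"
        unfolding F_def cinner_L2_def
        by (rule L2_cinner_AE[OF _ _ rep_to_L2[OF f] rep_to_L2[OF sqint_Icc_one]])
          (use f[of "real N"] in \<open>simp_all add: sqint_def set_borel_measurable_def\<close>)
      also have "\<dots> = (LINT x:{0..min (real N) m}|lborel. f x)"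
        unfolding set_lebesgue_integral_def by (intro Bochner_Integration.integral_cong) (auto simp: indicator_def)
      finally show ?thesis by (simp add: V_def z')
    qed
    have "V = UNIV"
    proof (rule L2_closed_subspace_UNIV[where G = "insert UNIV (range atMost)"])
      have "V = (\<lambda>g. cinner F g) -` {0}" by (auto simp: V_def)
      then show "closed V" 
        by (simp add: closed_vimage linear_continuous_on[OF cinner.bounded_linear_right])
      show "0 \<in> V" by (simp add: V_def cinner.zero_right)
      show "g + k \<in> V" if "g \<in> V" "k \<in> V" for g k using that by (simp add: V_def cinner.add_right)
      show "c *\<^sub>C g \<in> V" if "g \<in> V" for c g using that by (simp add: V_def cinner_scaleC_right)
      show "Int_stable (insert UNIV (range atMost :: real set set))"
        by (auto simp: Int_stable_def intro: image_eqI[of _ _ "min _ _"])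
      have "sigma_sets UNIV (insert UNIV (range atMost)) = sigma_sets UNIV (range (\<lambda>a::real. {..a}))"
        by (rule sigma_sets_eqI) (auto intro: sigma_sets_top sigma_sets.Basic)
      also have "\<dots> = sets borel" by (subst borel_eq_atMost) (simp add: sets_measure_of)
      finally show "sigma_sets UNIV (insert UNIV (range atMost)) = sets (borel :: real measure)" .
      fix A :: "real set" and n :: nat assume "A \<in> insert UNIV (range atMost)"
      then obtain m where "A \<inter> cball 0 (real n) = {- real n..m}"
      proof (elim insertE rangeE)
        assume "A = UNIV" then show ?thesis by (intro that[of "real n"]) (auto simp: dist_real_def)
      next
        fix a assume "A = {..a}" then show ?thesis by (intro that[of "min a (real n)"]) (auto simp: dist_real_def)
      qed
      then show "to_L2 (A \<inter> cball 0 (real n)) (\<lambda>_. 1) \<in> V" using mem by simp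
    qed simp
    then have "cinner F F = 0" by (auto simp: V_def)
    then have "F = 0" using cinner_self[of F] by simp
    then show ?thesis using rep_to_L2[OF f, of "real N"] rep_zero_L2[where 'a=real] unfolding F_def[symmetric]
      by (auto elim!: eventually_elim2)
  qed
  then have "AE x in lborel. \<forall>N. indicator {0..real N} x *\<^sub>R f x = 0" by (subst AE_all_countable) blast
  then show ?thesis
  proof eventually_elim
    case (elim x)
    show ?case
    proof
      assume "x \<ge> 0"
      obtain N where "x \<le> real N" using real_arch_simple by blast
      then show "f x = 0" using elim[rule_format, of N] \<open>x \<ge> 0\<close> by (simp add: indicator_def)
    qed
  qed
qed

text \<open>Subtracting the two weak formulations shows that, for each test function, the gradient
  of the difference is orthogonal to its gradient at almost every time. The exceptional set depends
  on the test function; a countable dense set of graphs yields one common null set. Outside it the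
  difference itself may be approximated by test functions, so its gradient vanishes, and having zero
  surface trace it vanishes by the Poincare inequality.\<close>

lemma WW_potential_unique:
  assumes s1: "WW_solution h u \<phi> \<zeta>" and s2: "WW_solution h u \<phi>' \<zeta>'"
    and \<zeta>: "\<And>t. t \<ge> 0 \<Longrightarrow> \<zeta>' t = \<zeta> t" and zd: "\<And>t. t \<ge> 0 \<Longrightarrow> zeta_dot \<zeta>' t = zeta_dot \<zeta> t"
  shows "AE t in lborel. t \<ge> 0 \<longrightarrow> \<phi>' t = \<phi> t"
proof -
  have p: "\<phi> \<in> L2_loc_H1" "\<phi>' \<in> L2_loc_H1" using s1 s2 by (auto simp: WW_solution_def)
  have pH: "\<phi> t \<in> sobolev_H1" "\<phi>' t \<in> sobolev_H1" if "t \<ge> 0" for t using p that by (auto simp: L2_loc_H1_def)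
  obtain S where S: "countable S" "S \<subseteq> H1_graph ` sobolev_H1" "H1_graph ` sobolev_H1 \<subseteq> closure S"
    using separable[of "H1_graph ` sobolev_H1"] by blast
  have ortho: "AE t in lborel. t \<ge> 0 \<longrightarrow> cinner (grad (\<phi>' t) - grad (\<phi> t)) (snd g) = 0" if gS: "g \<in> S" for g
  proof -
    obtain \<Psi> where P: "\<Psi> \<in> sobolev_H1" "g = H1_graph \<Psi>" using gS S(2) by blast
    let ?f = "\<lambda>t. cinner (grad (\<phi> t)) (snd g)" and ?f' = "\<lambda>t. cinner (grad (\<phi>' t)) (snd g)"
    have sq: "?f \<in> sqint {0..T}" "?f' \<in> sqint {0..T}" for T by (rule grad_form_sqint[OF p(1)] grad_form_sqint[OF p(2)])+
    have "(LINT x:{0..t}|lborel. ?f' x - ?f x) = 0" if t: "t > 0" for t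
    proof -
      have "(LINT x:{0..t}|lborel. ?f' x - ?f x) = (LINT x:{0..t}|lborel. ?f' x) - (LINT x:{0..t}|lborel. ?f x)"
        by (rule set_integral_diff(2)) (unfold set_integrable_def, rule sqint_set_integrable[OF sq(2)], rule sqint_set_integrable[OF sq(1)])
      moreover have "cinner (L2_of_H0 (zeta_dot \<zeta> t)) (trace_top \<Psi>) - cinner (L2_of_H0 (zeta_dot \<zeta> 0)) (trace_top \<Psi>) =
          (LINT x:{0..t}|lborel. cinner (grad (\<phi> x)) (grad \<Psi>)) - (LINT x:{0..t}|lborel. u x * cinner h (trace_left \<Psi>))"
        using s1 P(1) t unfolding WW_solution_def cinner_grad by blast
      moreover have "cinner (L2_of_H0 (zeta_dot \<zeta>' t)) (trace_top \<Psi>) - cinner (L2_of_H0 (zeta_dot \<zeta>' 0)) (trace_top \<Psi>) =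
          (LINT x:{0..t}|lborel. cinner (grad (\<phi>' x)) (grad \<Psi>)) - (LINT x:{0..t}|lborel. u x * cinner h (trace_left \<Psi>))"
        using s2 P(1) t unfolding WW_solution_def cinner_grad by blast
      ultimately show ?thesis using zd[of t] zd[of 0] t by (simp add: P(2) grad_graph[symmetric])
    qed
    moreover have "(\<lambda>x. ?f' x - ?f x) \<in> sqint {0..T}" for T
    proof -
      have "(\<lambda>x. indicator {0..T} x *\<^sub>R ?f' x + (-1) * (indicator {0..T} x *\<^sub>R ?f x)) \<in> sqint UNIV"
        by (intro sqint_add sqint_scale) (simp_all only: indicator_in_sqint sq)
      moreover have "indicator {0..T} x *\<^sub>R ?f' x + (-1) * (indicator {0..T} x *\<^sub>R ?f x) = indicator {0..T} x *\<^sub>R (?f' x - ?f x)" for x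
        by (simp add: scaleR_diff_right)
      ultimately show ?thesis by (simp only: indicator_in_sqint)
    qed
    ultimately have "AE t in lborel. t \<ge> 0 \<longrightarrow> ?f' t - ?f t = 0" by (intro AE_zero_of_integrals_zero)
    then show ?thesis by (simp add: cinner.diff_left)
  qed
  have "AE t in lborel. \<forall>g\<in>S. t \<ge> 0 \<longrightarrow> cinner (grad (\<phi>' t) - grad (\<phi> t)) (snd g) = 0"
    by (subst AE_ball_countable[OF S(1)]) (use ortho in blast)
  moreover have "AE t in lborel. t \<ge> 0 \<longrightarrow> trace_top (\<phi> t) + L2_of_H0 (H0_of_Hhalf (\<zeta> t)) = 0"
    "AE t in lborel. t \<ge> 0 \<longrightarrow> trace_top (\<phi>' t) + L2_of_H0 (H0_of_Hhalf (\<zeta>' t)) = 0"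
    using s1 s2 by (auto simp: WW_solution_def)
  ultimately show ?thesis
  proof eventually_elim
    case (elim t)
    show ?case
    proof
      assume t: "t \<ge> 0"
      let ?d = "\<phi>' t - \<phi> t"
      have d: "?d \<in> sobolev_H1" by (rule H1_diff(1)[OF pH(2)[OF t] pH(1)[OF t]])
      have "trace_top (\<phi>' t) + L2_of_H0 (H0_of_Hhalf (\<zeta> t)) = trace_top (\<phi> t) + L2_of_H0 (H0_of_Hhalf (\<zeta> t))"
        using elim(2,3) t \<zeta>[OF t] by simp
      then have "trace_top (\<phi>' t) = trace_top (\<phi> t)" by (rule add_right_imp_eq)
      then have tr0: "trace_top ?d = 0" using pH[OF t] by (simp add: top.tr_diff)
      have gd: "grad ?d = grad (\<phi>' t) - grad (\<phi> t)" using pH[OF t] by (simp add: grad_linear(2))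
      have "H1_graph ?d \<in> closure S" using S(3) d by blast
      then obtain X where X: "\<And>n. X n \<in> S" "X \<longlonglongrightarrow> H1_graph ?d" unfolding closure_sequential by metis
      have "(\<lambda>n. cinner (grad ?d) (snd (X n))) \<longlonglongrightarrow> cinner (grad ?d) (snd (H1_graph ?d))"
        by (intro cinner.tendsto tendsto_const tendsto_snd X(2))
      moreover have "cinner (grad ?d) (snd (X n)) = 0" for n using elim(1) X(1) t unfolding gd by blast
      ultimately have "cinner (grad ?d) (grad ?d) = 0" by (simp add: LIMSEQ_const_iff grad_graph)
      then have "grad ?d = 0" using cinner_self[of "grad ?d"] by simp
      then have "H1_graph ?d = 0" using zero_trace_bound[OF d tr0] by simp
      then show "\<phi>' t = \<phi> t" by (simp add: H1_graph_def zero_prod_def)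
    qed
  qed
qed

theorem theorem2p4:
  fixes h :: "real L2"
  assumes h: "h \<in> L2_on {-1..0}" and h_mean: "(LINT y:{-1..0}|lborel. rep_L2 h y) = 0"
  shows "(\<forall>u\<in>L2_loc. \<forall>(\<zeta>0::Hhalf) (w0::H0).
            \<exists>\<phi> \<zeta>. WW_solution h u \<phi> \<zeta> \<and> \<zeta> 0 = \<zeta>0 \<and> zeta_dot \<zeta> 0 = w0 \<and>
              (\<forall>\<phi>' \<zeta>'. WW_solution h u \<phi>' \<zeta>' \<and> \<zeta>' 0 = \<zeta>0 \<and> zeta_dot \<zeta>' 0 = w0 \<longrightarrow>
                 (AE t in lborel. t \<ge> 0 \<longrightarrow> \<phi>' t = \<phi> t) \<and> (\<forall>t\<ge>0. \<zeta>' t = \<zeta> t)))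
    \<and> (\<exists>(T :: real \<Rightarrow> Hhalf \<times> H0 \<Rightarrow> Hhalf \<times> H0) (\<Phi> :: real \<Rightarrow> (real \<Rightarrow> complex) \<Rightarrow> Hhalf \<times> H0).
          well_posed_system T \<Phi> \<and>
          (\<forall>u\<in>L2_loc. \<forall>\<zeta>0 w0 \<phi> \<zeta>.
             WW_solution h u \<phi> \<zeta> \<and> \<zeta> 0 = \<zeta>0 \<and> zeta_dot \<zeta> 0 = w0 \<longrightarrow>
             (\<forall>\<tau>\<ge>0. (\<zeta> \<tau>, zeta_dot \<zeta> \<tau>) = T \<tau> (\<zeta>0, w0) + input_ext \<Phi> \<tau> u)) \<and>
          skew_adjoint (generator T) \<and>
          Domain (generator T) = {(\<zeta>, w). H0_of_Hhalf \<zeta> \<in> H_alpha 1 \<and> w \<in> H_alpha (1/2)} \<and>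
          (\<exists>B :: complex \<Rightarrow> Hhalf \<times> H0. bounded_clinear B \<and>
             (\<forall>\<tau>\<ge>0. \<forall>u\<in>L2_loc.
                has_bochner_integral lborel
                  (\<lambda>\<sigma>. indicator {0..\<tau>} \<sigma> *\<^sub>R T (\<tau> - \<sigma>) (B (u \<sigma>))) (input_ext \<Phi> \<tau> u))))"
proof (intro conjI ballI allI)
  fix u :: "real \<Rightarrow> complex" and \<zeta>0 :: Hhalf and w0 :: H0
  assume u: "u \<in> L2_loc"
  let ?\<zeta> = "\<lambda>t. fst (trajectory h u (\<zeta>0, w0) t)"
  obtain \<phi> where \<phi>: "WW_solution h u \<phi> ?\<zeta>" using trajectory_solution(1)[OF h_mean u] by blast
  have zd: "zeta_dot ?\<zeta> t = snd (trajectory h u (\<zeta>0, w0) t)" if "t \<ge> 0" for t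
    by (rule trajectory_solution(2)[OF h_mean u that])
  show "\<exists>\<phi> \<zeta>. WW_solution h u \<phi> \<zeta> \<and> \<zeta> 0 = \<zeta>0 \<and> zeta_dot \<zeta> 0 = w0 \<and>
      (\<forall>\<phi>' \<zeta>'. WW_solution h u \<phi>' \<zeta>' \<and> \<zeta>' 0 = \<zeta>0 \<and> zeta_dot \<zeta>' 0 = w0 \<longrightarrow>
         (AE t in lborel. t \<ge> 0 \<longrightarrow> \<phi>' t = \<phi> t) \<and> (\<forall>t\<ge>0. \<zeta>' t = \<zeta> t))"
  proof (intro exI[of _ \<phi>] exI[of _ ?\<zeta>] conjI allI impI \<phi>)
    show "?\<zeta> 0 = \<zeta>0" "zeta_dot ?\<zeta> 0 = w0" using zd[of 0] by (simp_all add: trajectory_0)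
    fix \<phi>' \<zeta>' assume s: "WW_solution h u \<phi>' \<zeta>' \<and> \<zeta>' 0 = \<zeta>0 \<and> zeta_dot \<zeta>' 0 = w0"
    have t: "(\<zeta>' t, zeta_dot \<zeta>' t) = trajectory h u (\<zeta>0, w0) t" if "t \<ge> 0" for t
      using WW_solution_trajectory[OF _ h_mean u that, of \<phi>' \<zeta>'] s by simp
    have z1: "\<zeta>' t = ?\<zeta> t" if "t \<ge> 0" for t using t[OF that] by (metis fst_conv)
    then show "\<zeta>' t = ?\<zeta> t" if "t \<ge> 0" for t using that .
    have z2: "zeta_dot \<zeta>' t = zeta_dot ?\<zeta> t" if "t \<ge> 0" for t using t[OF that] zd[OF that] by (metis snd_conv)
    show "AE t in lborel. t \<ge> 0 \<longrightarrow> \<phi>' t = \<phi> t"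
      by (rule WW_potential_unique[OF \<phi> conjunct1[OF s] z1 z2])
  qed
next
  show "\<exists>T \<Phi>. well_posed_system T \<Phi> \<and>
      (\<forall>u\<in>L2_loc. \<forall>\<zeta>0 w0 \<phi> \<zeta>. WW_solution h u \<phi> \<zeta> \<and> \<zeta> 0 = \<zeta>0 \<and> zeta_dot \<zeta> 0 = w0 \<longrightarrow>
         (\<forall>\<tau>\<ge>0. (\<zeta> \<tau>, zeta_dot \<zeta> \<tau>) = T \<tau> (\<zeta>0, w0) + input_ext \<Phi> \<tau> u)) \<and>
      skew_adjoint (generator T) \<and>
      Domain (generator T) = {(\<zeta>, w). H0_of_Hhalf \<zeta> \<in> H_alpha 1 \<and> w \<in> H_alpha (1/2)} \<and>
      (\<exists>B :: complex \<Rightarrow> Hhalf \<times> H0. bounded_clinear B \<and>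
         (\<forall>\<tau>\<ge>0. \<forall>u\<in>L2_loc. has_bochner_integral lborel
              (\<lambda>\<sigma>. indicator {0..\<tau>} \<sigma> *\<^sub>R T (\<tau> - \<sigma>) (B (u \<sigma>))) (input_ext \<Phi> \<tau> u)))"
  proof (intro exI[of _ grp] exI[of _ "input_map h"] conjI ballI allI impI input_map_well_posed)
    fix u :: "real \<Rightarrow> complex" and \<zeta>0 w0 \<phi> \<zeta> and \<tau> :: real
    assume "u \<in> L2_loc" "WW_solution h u \<phi> \<zeta> \<and> \<zeta> 0 = \<zeta>0 \<and> zeta_dot \<zeta> 0 = w0" "\<tau> \<ge> 0"
    then show "(\<zeta> \<tau>, zeta_dot \<zeta> \<tau>) = grp \<tau> (\<zeta>0, w0) + input_ext (input_map h) \<tau> u"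
      using WW_solution_trajectory[OF _ h_mean, of u \<phi> \<zeta> \<tau>] by (simp add: trajectory_eq input_ext_input_map)
  next
    show "skew_adjoint (generator grp)" unfolding generator_grp by (rule gen_rel_skew_adjoint)
    show "Domain (generator grp) = {(\<zeta>, w). H0_of_Hhalf \<zeta> \<in> H_alpha 1 \<and> w \<in> H_alpha (1/2)}"
      unfolding generator_grp by (rule gen_rel_domain)
    \<comment> \<open>The input forces the velocity component only; boundedness of B amounts to
      \<open>control_vec h\<close> being an element of \<open>H0\<close>.\<close>
    let ?B = "\<lambda>c::complex. c *\<^sub>C (0 :: Hhalf, control_vec h)"
    show "\<exists>B :: complex \<Rightarrow> Hhalf \<times> H0. bounded_clinear B \<and>
         (\<forall>\<tau>\<ge>0. \<forall>u\<in>L2_loc. has_bochner_integral lborel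
              (\<lambda>\<sigma>. indicator {0..\<tau>} \<sigma> *\<^sub>R grp (\<tau> - \<sigma>) (B (u \<sigma>))) (input_ext (input_map h) \<tau> u))"
    proof (intro exI[of _ ?B] conjI allI impI ballI)
      show "bounded_clinear ?B"
        unfolding bounded_clinear_def by (auto simp: scaleC.bounded_linear_left scaleC_scaleC scaleC_complex_def)
      fix \<tau> :: real and u :: "real \<Rightarrow> complex" assume "u \<in> L2_loc"
      then have "u \<in> sqint {0..\<tau>}" by (simp add: L2_loc_def)
      then show "has_bochner_integral lborel (\<lambda>\<sigma>. indicator {0..\<tau>} \<sigma> *\<^sub>R grp (\<tau> - \<sigma>) (?B (u \<sigma>))) (input_ext (input_map h) \<tau> u)"
        unfolding input_ext_input_map by (rule input_map_integral)
    qed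
  qed
qed

end
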